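(* Let $\mathcal{A}$ be an abelian category with enough projectives. For the defect recollement, i.e. the recollement of abelian categories given by $\mathcal{C}'=\mathrm{fp}_0(\mathcal{A}^{\mathrm{op}},\mathrm{Ab})$, $\mathcal{C}=\mathrm{fp}(\mathcal{A}^{\mathrm{op}},\mathrm{Ab})$, $\mathcal{C}''=\mathcal{A}$, with $i_*$ the inclusion, $i^*=(-)^0$, $i^!=(-)_0$, $j^*=w$, $j_*=Y$ and $j_!=\mathrm{L}_0(Y)$, the following are equivalent. 1. It is pre-hereditary. 2. It is an instance of the MacPherson-Vilonen construction. 3. $\mathcal{A}$ is hereditary. Moreover, when the defect recollement is an instance of the MacPherson-Vilonen construction, it is the MacPherson-Vilonen construction for the natural transformation $0\to\underline{Y}$, where $\underline{Y}:\mathcal{A}\to\mathrm{fp}_0(\mathcal{A}^{\mathrm{op}},\mathrm{Ab})$ is defined by $\underline{Y}A=\underline{\mathrm{Hom}}_{\mathcal{A}}(-,A)$ for any $A\in\mathcal{A}$.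
   Context: A functor $F:\mathcal{A}^{\mathrm{op}}\to\mathrm{Ab}$ is finitely presented if there is an exact sequence $\mathrm{Hom}_{\mathcal{A}}(-,B)\to\mathrm{Hom}_{\mathcal{A}}(-,C)\to F\to 0$ with $B,C\in\mathcal{A}$; $\mathrm{fp}(\mathcal{A}^{\mathrm{op}},\mathrm{Ab})$ is the category of such functors (it is abelian, with kernels and cokernels computed objectwise, and its projectives are the representables). $Y:\mathcal{A}\to\mathrm{fp}(\mathcal{A}^{\mathrm{op}},\mathrm{Ab})$, $A\mapsto\mathrm{Hom}_{\mathcal{A}}(-,A)$, is the Yoneda embedding; the defect $w:\mathrm{fp}(\mathcal{A}^{\mathrm{op}},\mathrm{Ab})\to\mathcal{A}$ is its (exact) left adjoint. $\mathrm{fp}_0(\mathcal{A}^{\mathrm{op}},\mathrm{Ab})=\mathrm{Ker}(w)$, equivalently the finitely presented functors vanishing on all projectives of $\mathcal{A}$. $(-)^0$ and $(-)_0$ are the left and right adjoints of the inclusion $\mathrm{fp}_0(\mathcal{A}^{\mathrm{op}},\mathrm{Ab})\subseteq\mathrm{fp}(\mathcal{A}^{\mathrm{op}},\mathrm{Ab})$. $\mathrm{L}_0(Y)$ is the unique right exact functor $\mathcal{A}\to\mathrm{fp}(\mathcal{A}^{\mathrm{op}},\mathrm{Ab})$ agreeing with $Y$ on projectives; it is left adjoint to $w$. $\underline{\mathrm{Hom}}_{\mathcal{A}}(B,A)=\mathrm{Hom}_{\mathcal{A}}(B,A)/\mathcal{P}(B,A)$, where $\mathcal{P}(B,A)$ is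 the subgroup of morphisms factoring through a projective object. $\mathcal{A}$ is hereditary if each of its objects has projective dimension at most one. A recollement of abelian categories consists of additive functors $i_*:\mathcal{C}'\to\mathcal{C}$, $i^*,i^!:\mathcal{C}\to\mathcal{C}'$, $j^*:\mathcal{C}\to\mathcal{C}''$, $j_!,j_*:\mathcal{C}''\to\mathcal{C}$ between abelian categories such that $\mathrm{Im}(i_* )=\mathrm{Ker}(j^* )$ (essential image), $i_*$ is fully faithful, $i^*\dashv i_*\dashv i^!$, $j_!\dashv j^*\dashv j_*$, and $j_!$, $j_*$ are fully faithful. If $\mathcal{C}',\mathcal{C},\mathcal{C}''$ have enough projectives (as is the case for the defect recollement), it is pre-hereditary if $\mathrm{L}_2(i^* )(i_*P)=0$ for each projective $P\in\mathcal{C}'$. MacPherson-Vilonen construction: given abelian categories $\mathcal{C}',\mathcal{C}''$, a right exact functor $F:\mathcal{C}''\to\mathcal{C}'$, a left exact functor $G:\mathcal{C}''\to\mathcal{C}'$ and a natural transformation $\alpha:F\to G$, let $\mathcal{C}(\alpha)$ be the category whose objects are $(X,V,g,f)$ with $X\in\mathcal{C}''$, $V\in\mathcal{C}'$ and morphisms $f:FX\to V$, $g:V\to GX$ such that $gf=\alpha_X$; a morphism $(X,V,g,f)\to(X',V',g',f')$ is a pair $(x:X\to X',v:V\to V')$ with $vf=f'F(x)$ and $G(x)g=g'v$. The recollement for $\alpha$ has middle category $\mathcal{C}(\alpha)$ and $j^*(X,V,g,f)=X$, $i^*(X,V,g,f)=\mathrm{Coker} f$, $i^!(X,V,g,f)=\mathrm{Ker}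 g$, $i_*V=(0,V,0,0)$, $j_!X=(X,FX,\alpha_X,1_{FX})$, $j_*X=(X,GX,1_{GX},\alpha_X)$. A recollement is an instance of the construction if it is equivalent, as a recollement (compatibly with the recollement functors, up to natural isomorphism), to the recollement for some such $\alpha$. *)

theory Defs
  imports "HOL-Algebra.Coset"
begin

section \<open>Preadditive and abelian categories\<close>

text \<open>A category enriched in abelian groups, given by its sets of objects and arrows. Arrows know
  their source and target, so distinct hom-sets are disjoint. \<open>Cmp C g f\<close> is \<open>g\<close> after \<open>f\<close>;
  \<open>Pls\<close> adds parallel arrows and \<open>Nul C X Y\<close> is the zero arrow from \<open>X\<close> to \<open>Y\<close>.\<close>

record ('o, 'm) cat =
  Obj :: "'o set"
  Arr :: "'m set"
  Dom :: "'m \<Rightarrow> 'o"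
  Cod :: "'m \<Rightarrow> 'o"
  Idn :: "'o \<Rightarrow> 'm"
  Cmp :: "'m \<Rightarrow> 'm \<Rightarrow> 'm"
  Pls :: "'m \<Rightarrow> 'm \<Rightarrow> 'm"
  Nul :: "'o \<Rightarrow> 'o \<Rightarrow> 'm"

definition Hom :: "('o, 'm) cat \<Rightarrow> 'o \<Rightarrow> 'o \<Rightarrow> 'm set" where
  "Hom C X Y = {f \<in> Arr C. Dom C f = X \<and> Cod C f = Y}"

definition hom_group :: "('o, 'm) cat \<Rightarrow> 'o \<Rightarrow> 'o \<Rightarrow> 'm monoid" where
  "hom_group C X Y = \<lparr>carrier = Hom C X Y, mult = Pls C, one = Nul C X Y\<rparr>"

locale category =
  fixes C :: "('o, 'm) cat"
  assumes Dom_Obj: "f \<in> Arr C \<Longrightarrow> Dom C f \<in> Obj C"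
    and Cod_Obj: "f \<in> Arr C \<Longrightarrow> Cod C f \<in> Obj C"
    and Idn_Hom: "X \<in> Obj C \<Longrightarrow> Idn C X \<in> Hom C X X"
    and Cmp_Hom: "f \<in> Hom C X Y \<Longrightarrow> g \<in> Hom C Y Z \<Longrightarrow> Cmp C g f \<in> Hom C X Z"
    and Cmp_Idn: "f \<in> Hom C X Y \<Longrightarrow> Cmp C f (Idn C X) = f"
    and Idn_Cmp: "f \<in> Hom C X Y \<Longrightarrow> Cmp C (Idn C Y) f = f"
    and Cmp_assoc: "f \<in> Hom C W X \<Longrightarrow> g \<in> Hom C X Y \<Longrightarrow> h \<in> Hom C Y Z \<Longrightarrow>
      Cmp C (Cmp C h g) f = Cmp C h (Cmp C g f)"

locale preadditive = category +
  assumes hom_comm_group: "X \<in> Obj C \<Longrightarrow> Y \<in> Obj C \<Longrightarrow> comm_group (hom_group C X Y)"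
    and Cmp_Pls_left: "f \<in> Hom C X Y \<Longrightarrow> g \<in> Hom C Y Z \<Longrightarrow> h \<in> Hom C Y Z \<Longrightarrow>
      Cmp C (Pls C g h) f = Pls C (Cmp C g f) (Cmp C h f)"
    and Cmp_Pls_right: "f \<in> Hom C X Y \<Longrightarrow> g \<in> Hom C X Y \<Longrightarrow> h \<in> Hom C Y Z \<Longrightarrow>
      Cmp C h (Pls C f g) = Pls C (Cmp C h f) (Cmp C h g)"

definition is_zero :: "('o, 'm) cat \<Rightarrow> 'o \<Rightarrow> bool" where
  "is_zero C Z \<longleftrightarrow> Z \<in> Obj C \<and>
     (\<forall>X \<in> Obj C. (\<exists>!f. f \<in> Hom C X Z) \<and> (\<exists>!f. f \<in> Hom C Z X))"

definition is_iso :: "('o, 'm) cat \<Rightarrow> 'o \<Rightarrow> 'o \<Rightarrow> 'm \<Rightarrow> bool" where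
  "is_iso C X Y f \<longleftrightarrow> f \<in> Hom C X Y \<and>
     (\<exists>g \<in> Hom C Y X. Cmp C g f = Idn C X \<and> Cmp C f g = Idn C Y)"

definition mono_arr :: "('o, 'm) cat \<Rightarrow> 'm \<Rightarrow> bool" where
  "mono_arr C f \<longleftrightarrow> f \<in> Arr C \<and>
     (\<forall>W \<in> Obj C. \<forall>a \<in> Hom C W (Dom C f). \<forall>b \<in> Hom C W (Dom C f).
        Cmp C f a = Cmp C f b \<longrightarrow> a = b)"

definition epi_arr :: "('o, 'm) cat \<Rightarrow> 'm \<Rightarrow> bool" where
  "epi_arr C f \<longleftrightarrow> f \<in> Arr C \<and>
     (\<forall>W \<in> Obj C. \<forall>a \<in> Hom C (Cod C f) W. \<forall>b \<in> Hom C (Cod C f) W.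
        Cmp C a f = Cmp C b f \<longrightarrow> a = b)"

definition is_kernel :: "('o, 'm) cat \<Rightarrow> 'm \<Rightarrow> 'o \<Rightarrow> 'm \<Rightarrow> bool" where
  "is_kernel C f K k \<longleftrightarrow> f \<in> Arr C \<and> K \<in> Obj C \<and> k \<in> Hom C K (Dom C f) \<and>
     Cmp C f k = Nul C K (Cod C f) \<and>
     (\<forall>W \<in> Obj C. \<forall>a \<in> Hom C W (Dom C f). Cmp C f a = Nul C W (Cod C f) \<longrightarrow>
        (\<exists>!u. u \<in> Hom C W K \<and> Cmp C k u = a))"

definition is_cokernel :: "('o, 'm) cat \<Rightarrow> 'm \<Rightarrow> 'o \<Rightarrow> 'm \<Rightarrow> bool" where
  "is_cokernel C f Q q \<longleftrightarrow> f \<in> Arr C \<and> Q \<in> Obj C \<and> q \<in> Hom C (Cod C f) Q \<and>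
     Cmp C q f = Nul C (Dom C f) Q \<and>
     (\<forall>W \<in> Obj C. \<forall>a \<in> Hom C (Cod C f) W. Cmp C a f = Nul C (Dom C f) W \<longrightarrow>
        (\<exists>!u. u \<in> Hom C Q W \<and> Cmp C u q = a))"

definition is_biproduct ::
  "('o, 'm) cat \<Rightarrow> 'o \<Rightarrow> 'o \<Rightarrow> 'o \<Rightarrow> 'm \<Rightarrow> 'm \<Rightarrow> 'm \<Rightarrow> 'm \<Rightarrow> bool" where
  "is_biproduct C X Y S i1 i2 p1 p2 \<longleftrightarrow> S \<in> Obj C \<and>
     i1 \<in> Hom C X S \<and> i2 \<in> Hom C Y S \<and> p1 \<in> Hom C S X \<and> p2 \<in> Hom C S Y \<and>
     Cmp C p1 i1 = Idn C X \<and> Cmp C p2 i2 = Idn C Y \<and>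
     Cmp C p1 i2 = Nul C Y X \<and> Cmp C p2 i1 = Nul C X Y \<and>
     Pls C (Cmp C i1 p1) (Cmp C i2 p2) = Idn C S"

locale abelian = preadditive +
  assumes has_zero: "\<exists>Z. is_zero C Z"
    and has_biproducts: "X \<in> Obj C \<Longrightarrow> Y \<in> Obj C \<Longrightarrow>
      \<exists>S i1 i2 p1 p2. is_biproduct C X Y S i1 i2 p1 p2"
    and has_kernels: "f \<in> Arr C \<Longrightarrow> \<exists>K k. is_kernel C f K k"
    and has_cokernels: "f \<in> Arr C \<Longrightarrow> \<exists>Q q. is_cokernel C f Q q"
    and mono_normal: "mono_arr C f \<Longrightarrow> \<exists>g. is_kernel C g (Dom C f) f"
    and epi_normal: "epi_arr C f \<Longrightarrow> \<exists>g. is_cokernel C g (Cod C f) f"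

definition zero_obj :: "('o, 'm) cat \<Rightarrow> 'o" where
  "zero_obj C = (SOME Z. is_zero C Z)"

definition ker_obj :: "('o, 'm) cat \<Rightarrow> 'm \<Rightarrow> 'o" where
  "ker_obj C f = fst (SOME (K, k). is_kernel C f K k)"

definition ker_arr :: "('o, 'm) cat \<Rightarrow> 'm \<Rightarrow> 'm" where
  "ker_arr C f = snd (SOME (K, k). is_kernel C f K k)"

definition coker_obj :: "('o, 'm) cat \<Rightarrow> 'm \<Rightarrow> 'o" where
  "coker_obj C f = fst (SOME (Q, q). is_cokernel C f Q q)"

definition coker_arr :: "('o, 'm) cat \<Rightarrow> 'm \<Rightarrow> 'm" where
  "coker_arr C f = snd (SOME (Q, q). is_cokernel C f Q q)"

definition op_cat :: "('o, 'm) cat \<Rightarrow> ('o, 'm) cat" where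
  "op_cat C = \<lparr>Obj = Obj C, Arr = Arr C, Dom = Cod C, Cod = Dom C, Idn = Idn C,
     Cmp = (\<lambda>g f. Cmp C f g), Pls = Pls C, Nul = (\<lambda>X Y. Nul C Y X)\<rparr>"

definition full_sub :: "('o, 'm) cat \<Rightarrow> 'o set \<Rightarrow> ('o, 'm) cat" where
  "full_sub C S = C\<lparr>Obj := Obj C \<inter> S, Arr := {f \<in> Arr C. Dom C f \<in> S \<and> Cod C f \<in> S}\<rparr>"

section \<open>Functors, natural transformations, adjunctions\<close>

record ('o, 'm, 'p, 'n) fctr =
  FO :: "'o \<Rightarrow> 'p"
  FA :: "'m \<Rightarrow> 'n"

definition is_functor :: "('o, 'm) cat \<Rightarrow> ('p, 'n) cat \<Rightarrow> ('o, 'm, 'p, 'n) fctr \<Rightarrow> bool" where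
  "is_functor C D F \<longleftrightarrow>
     (\<forall>X \<in> Obj C. FO F X \<in> Obj D \<and> FA F (Idn C X) = Idn D (FO F X)) \<and>
     (\<forall>f \<in> Arr C. FA F f \<in> Hom D (FO F (Dom C f)) (FO F (Cod C f))) \<and>
     (\<forall>f \<in> Arr C. \<forall>g \<in> Arr C. Dom C g = Cod C f \<longrightarrow>
        FA F (Cmp C g f) = Cmp D (FA F g) (FA F f))"

definition additive_functor ::
  "('o, 'm) cat \<Rightarrow> ('p, 'n) cat \<Rightarrow> ('o, 'm, 'p, 'n) fctr \<Rightarrow> bool" where
  "additive_functor C D F \<longleftrightarrow> is_functor C D F \<and>
     (\<forall>X \<in> Obj C. \<forall>Y \<in> Obj C. \<forall>f \<in> Hom C X Y. \<forall>g \<in> Hom C X Y.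
        FA F (Pls C f g) = Pls D (FA F f) (FA F g))"

definition id_functor :: "('o, 'm, 'o, 'm) fctr" where
  "id_functor = \<lparr>FO = (\<lambda>X. X), FA = (\<lambda>f. f)\<rparr>"

definition comp_functor ::
  "('p, 'n, 'q, 'l) fctr \<Rightarrow> ('o, 'm, 'p, 'n) fctr \<Rightarrow> ('o, 'm, 'q, 'l) fctr" (infixl "\<circ>\<^sub>F" 70) where
  "G \<circ>\<^sub>F F = \<lparr>FO = (\<lambda>X. FO G (FO F X)), FA = (\<lambda>f. FA G (FA F f))\<rparr>"

definition nat_trans :: "('o, 'm) cat \<Rightarrow> ('p, 'n) cat \<Rightarrow>
    ('o, 'm, 'p, 'n) fctr \<Rightarrow> ('o, 'm, 'p, 'n) fctr \<Rightarrow> ('o \<Rightarrow> 'n) \<Rightarrow> bool" where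
  "nat_trans C D F G \<eta> \<longleftrightarrow>
     (\<forall>X \<in> Obj C. \<eta> X \<in> Hom D (FO F X) (FO G X)) \<and>
     (\<forall>f \<in> Arr C. Cmp D (\<eta> (Cod C f)) (FA F f) = Cmp D (FA G f) (\<eta> (Dom C f)))"

definition nat_isomorphic :: "('o, 'm) cat \<Rightarrow> ('p, 'n) cat \<Rightarrow>
    ('o, 'm, 'p, 'n) fctr \<Rightarrow> ('o, 'm, 'p, 'n) fctr \<Rightarrow> bool" where
  "nat_isomorphic C D F G \<longleftrightarrow>
     (\<exists>\<eta>. nat_trans C D F G \<eta> \<and> (\<forall>X \<in> Obj C. is_iso D (FO F X) (FO G X) (\<eta> X)))"

definition fully_faithful ::
  "('o, 'm) cat \<Rightarrow> ('p, 'n) cat \<Rightarrow> ('o, 'm, 'p, 'n) fctr \<Rightarrow> bool" where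
  "fully_faithful C D F \<longleftrightarrow> is_functor C D F \<and>
     (\<forall>X \<in> Obj C. \<forall>Y \<in> Obj C. bij_betw (FA F) (Hom C X Y) (Hom D (FO F X) (FO F Y)))"

definition equivalence ::
  "('o, 'm) cat \<Rightarrow> ('p, 'n) cat \<Rightarrow> ('o, 'm, 'p, 'n) fctr \<Rightarrow> bool" where
  "equivalence C D F \<longleftrightarrow> is_functor C D F \<and>
     (\<exists>G. is_functor D C G \<and> nat_isomorphic C C (G \<circ>\<^sub>F F) id_functor \<and>
          nat_isomorphic D D (F \<circ>\<^sub>F G) id_functor)"

definition left_adjoint :: "('o, 'm) cat \<Rightarrow> ('p, 'n) cat \<Rightarrow>
    ('o, 'm, 'p, 'n) fctr \<Rightarrow> ('p, 'n, 'o, 'm) fctr \<Rightarrow> bool" where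
  "left_adjoint C D F G \<longleftrightarrow> is_functor C D F \<and> is_functor D C G \<and>
     (\<exists>\<phi>. (\<forall>X \<in> Obj C. \<forall>Y \<in> Obj D.
              bij_betw (\<phi> X Y) (Hom D (FO F X) Y) (Hom C X (FO G Y))) \<and>
          (\<forall>u \<in> Arr C. \<forall>v \<in> Arr D. \<forall>f \<in> Hom D (FO F (Cod C u)) (Dom D v).
              \<phi> (Dom C u) (Cod D v) (Cmp D v (Cmp D f (FA F u))) =
              Cmp C (FA G v) (Cmp C (\<phi> (Cod C u) (Dom D v) f) u)))"

definition right_exact :: "('o, 'm) cat \<Rightarrow> ('p, 'n) cat \<Rightarrow> ('o, 'm, 'p, 'n) fctr \<Rightarrow> bool" where
  "right_exact C D F \<longleftrightarrow> additive_functor C D F \<and>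
     (\<forall>f Q q. is_cokernel C f Q q \<longrightarrow> is_cokernel D (FA F f) (FO F Q) (FA F q))"

definition left_exact :: "('o, 'm) cat \<Rightarrow> ('p, 'n) cat \<Rightarrow> ('o, 'm, 'p, 'n) fctr \<Rightarrow> bool" where
  "left_exact C D F \<longleftrightarrow> additive_functor C D F \<and>
     (\<forall>f K k. is_kernel C f K k \<longrightarrow> is_kernel D (FA F f) (FO F K) (FA F k))"

text \<open>Arrows of the category of functors from \<open>C\<close> to \<open>D\<close> are triples (source, components, target).
  Extensionality makes equality of functors and of natural transformations literal equality.\<close>

type_synonym ('o, 'm, 'p, 'n) trans =
  "('o, 'm, 'p, 'n) fctr \<times> ('o \<Rightarrow> 'n) \<times> ('o, 'm, 'p, 'n) fctr"

definition functor_cat ::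
  "('o, 'm) cat \<Rightarrow> ('p, 'n) cat \<Rightarrow> (('o, 'm, 'p, 'n) fctr, ('o, 'm, 'p, 'n) trans) cat" where
  "functor_cat C D =
     (let Ob = {F. is_functor C D F \<and> FO F \<in> extensional (Obj C) \<and> FA F \<in> extensional (Arr C)}
      in \<lparr>Obj = Ob,
          Arr = {(F, \<eta>, G). F \<in> Ob \<and> G \<in> Ob \<and> nat_trans C D F G \<eta> \<and> \<eta> \<in> extensional (Obj C)},
          Dom = (\<lambda>(F, \<eta>, G). F),
          Cod = (\<lambda>(F, \<eta>, G). G),
          Idn = (\<lambda>F. (F, \<lambda>X \<in> Obj C. Idn D (FO F X), F)),
          Cmp = (\<lambda>(G', \<theta>, H) (F, \<eta>, G). (F, \<lambda>X \<in> Obj C. Cmp D (\<theta> X) (\<eta> X), H)),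
          Pls = (\<lambda>(F, \<eta>, G) (F', \<theta>, G'). (F, \<lambda>X \<in> Obj C. Pls D (\<eta> X) (\<theta> X), G)),
          Nul = (\<lambda>F G. (F, \<lambda>X \<in> Obj C. Nul D (FO F X) (FO G X), G))\<rparr>)"

section \<open>Exactness, projectives and derived functors\<close>

text \<open>Exactness of \<open>f\<close>, \<open>g\<close> at the middle object of an abelian category: \<open>f\<close> maps onto the
  kernel of \<open>g\<close>.\<close>

definition exact_at :: "('o, 'm) cat \<Rightarrow> 'm \<Rightarrow> 'm \<Rightarrow> bool" where
  "exact_at C f g \<longleftrightarrow> f \<in> Arr C \<and> g \<in> Arr C \<and> Cod C f = Dom C g \<and>
     (\<exists>K k e. is_kernel C g K k \<and> e \<in> Hom C (Dom C f) K \<and> Cmp C k e = f \<and> epi_arr C e)"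

text \<open>\<open>H\<close> is a homology object at the middle of \<open>f\<close>, \<open>g\<close> (where \<open>g f = 0\<close>): the cokernel of
  the arrow from the source of \<open>f\<close> to the kernel of \<open>g\<close>.\<close>

definition is_homology :: "('o, 'm) cat \<Rightarrow> 'm \<Rightarrow> 'm \<Rightarrow> 'o \<Rightarrow> bool" where
  "is_homology C f g H \<longleftrightarrow> f \<in> Arr C \<and> g \<in> Arr C \<and> Cod C f = Dom C g \<and>
     (\<exists>K k e q. is_kernel C g K k \<and> e \<in> Hom C (Dom C f) K \<and> Cmp C k e = f \<and>
        is_cokernel C e H q)"

definition projective :: "('o, 'm) cat \<Rightarrow> 'o \<Rightarrow> bool" where
  "projective C P \<longleftrightarrow> P \<in> Obj C \<and>
     (\<forall>e. epi_arr C e \<longrightarrow> (\<forall>f \<in> Hom C P (Cod C e). \<exists>u \<in> Hom C P (Dom C e). Cmp C e u = f))"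

definition enough_projectives :: "('o, 'm) cat \<Rightarrow> bool" where
  "enough_projectives C \<longleftrightarrow>
     (\<forall>X \<in> Obj C. \<exists>P e. projective C P \<and> e \<in> Hom C P X \<and> epi_arr C e)"

text \<open>The differential \<open>d n\<close> goes from degree \<open>n + 1\<close> to degree \<open>n\<close>.\<close>

definition projective_resolution ::
  "('o, 'm) cat \<Rightarrow> 'o \<Rightarrow> (nat \<Rightarrow> 'o) \<Rightarrow> (nat \<Rightarrow> 'm) \<Rightarrow> 'm \<Rightarrow> bool" where
  "projective_resolution C X P d \<epsilon> \<longleftrightarrow>
     (\<forall>n. projective C (P n)) \<and> (\<forall>n. d n \<in> Hom C (P (Suc n)) (P n)) \<and>
     \<epsilon> \<in> Hom C (P 0) X \<and> epi_arr C \<epsilon> \<and> exact_at C (d 0) \<epsilon> \<and>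
     (\<forall>n. exact_at C (d (Suc n)) (d n))"

definition proj_dim_le :: "('o, 'm) cat \<Rightarrow> nat \<Rightarrow> 'o \<Rightarrow> bool" where
  "proj_dim_le C n X \<longleftrightarrow>
     (\<exists>P d \<epsilon>. projective_resolution C X P d \<epsilon> \<and> (\<forall>k > n. is_zero C (P k)))"

definition hereditary :: "('o, 'm) cat \<Rightarrow> bool" where
  "hereditary C \<longleftrightarrow> (\<forall>X \<in> Obj C. proj_dim_le C 1 X)"

text \<open>\<open>H\<close> is a value at \<open>X\<close> of the \<open>n\<close>-th left derived functor of \<open>F\<close>. Such an \<open>H\<close> is determined
  up to isomorphism.\<close>

definition left_derived_value :: "('o, 'm) cat \<Rightarrow> ('p, 'n) cat \<Rightarrow>
    ('o, 'm, 'p, 'n) fctr \<Rightarrow> nat \<Rightarrow> 'o \<Rightarrow> 'p \<Rightarrow> bool" where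
  "left_derived_value C D F n X H \<longleftrightarrow>
     (\<exists>P d \<epsilon>. projective_resolution C X P d \<epsilon> \<and>
        (case n of
           0 \<Rightarrow> \<exists>q. is_cokernel D (FA F (d 0)) H q
         | Suc m \<Rightarrow> is_homology D (FA F (d (Suc m))) (FA F (d m)) H))"

section \<open>Recollements\<close>

text \<open>\<open>i_lower\<close>, \<open>i_upper\<close>, \<open>i_ushriek\<close>, \<open>j_upper\<close>, \<open>j_lshriek\<close>, \<open>j_lower\<close> stand for
  \<open>i_*\<close>, \<open>i^*\<close>, \<open>i^!\<close>, \<open>j^*\<close>, \<open>j_!\<close>, \<open>j_*\<close>, and \<open>sub\<close>, \<open>mid\<close>, \<open>quo\<close> for
  \<open>C'\<close>, \<open>C\<close>, \<open>C''\<close>.\<close>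

record ('o1, 'm1, 'o, 'm, 'o2, 'm2) recoll =
  sub :: "('o1, 'm1) cat"
  mid :: "('o, 'm) cat"
  quo :: "('o2, 'm2) cat"
  i_lower :: "('o1, 'm1, 'o, 'm) fctr"
  i_upper :: "('o, 'm, 'o1, 'm1) fctr"
  i_ushriek :: "('o, 'm, 'o1, 'm1) fctr"
  j_upper :: "('o, 'm, 'o2, 'm2) fctr"
  j_lshriek :: "('o2, 'm2, 'o, 'm) fctr"
  j_lower :: "('o2, 'm2, 'o, 'm) fctr"

definition recollement :: "('o1, 'm1, 'o, 'm, 'o2, 'm2) recoll \<Rightarrow> bool" where
  "recollement R \<longleftrightarrow>
     abelian (sub R) \<and> abelian (mid R) \<and> abelian (quo R) \<and>
     additive_functor (sub R) (mid R) (i_lower R) \<and>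
     additive_functor (mid R) (sub R) (i_upper R) \<and>
     additive_functor (mid R) (sub R) (i_ushriek R) \<and>
     additive_functor (mid R) (quo R) (j_upper R) \<and>
     additive_functor (quo R) (mid R) (j_lshriek R) \<and>
     additive_functor (quo R) (mid R) (j_lower R) \<and>
     (\<forall>X \<in> Obj (mid R). is_zero (quo R) (FO (j_upper R) X) \<longleftrightarrow>
        (\<exists>V \<in> Obj (sub R). \<exists>f. is_iso (mid R) (FO (i_lower R) V) X f)) \<and>
     fully_faithful (sub R) (mid R) (i_lower R) \<and>
     left_adjoint (mid R) (sub R) (i_upper R) (i_lower R) \<and>
     left_adjoint (sub R) (mid R) (i_lower R) (i_ushriek R) \<and>
     left_adjoint (quo R) (mid R) (j_lshriek R) (j_upper R) \<and>
     left_adjoint (mid R) (quo R) (j_upper R) (j_lower R) \<and>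
     fully_faithful (quo R) (mid R) (j_lshriek R) \<and>
     fully_faithful (quo R) (mid R) (j_lower R)"

definition pre_hereditary :: "('o1, 'm1, 'o, 'm, 'o2, 'm2) recoll \<Rightarrow> bool" where
  "pre_hereditary R \<longleftrightarrow>
     enough_projectives (sub R) \<and> enough_projectives (mid R) \<and> enough_projectives (quo R) \<and>
     (\<forall>P. projective (sub R) P \<longrightarrow>
        (\<forall>H. left_derived_value (mid R) (sub R) (i_upper R) 2 (FO (i_lower R) P) H \<longrightarrow>
           is_zero (sub R) H))"

definition recoll_equiv :: "('o1, 'm1, 'o, 'm, 'o2, 'm2) recoll \<Rightarrow>
    ('p1, 'n1, 'p, 'n, 'p2, 'n2) recoll \<Rightarrow> bool" where
  "recoll_equiv R S \<longleftrightarrow> (\<exists>E' E E''.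
     equivalence (sub R) (sub S) E' \<and> equivalence (mid R) (mid S) E \<and>
     equivalence (quo R) (quo S) E'' \<and>
     nat_isomorphic (sub R) (mid S) (E \<circ>\<^sub>F i_lower R) (i_lower S \<circ>\<^sub>F E') \<and>
     nat_isomorphic (mid R) (sub S) (E' \<circ>\<^sub>F i_upper R) (i_upper S \<circ>\<^sub>F E) \<and>
     nat_isomorphic (mid R) (sub S) (E' \<circ>\<^sub>F i_ushriek R) (i_ushriek S \<circ>\<^sub>F E) \<and>
     nat_isomorphic (mid R) (quo S) (E'' \<circ>\<^sub>F j_upper R) (j_upper S \<circ>\<^sub>F E) \<and>
     nat_isomorphic (quo R) (mid S) (E \<circ>\<^sub>F j_lshriek R) (j_lshriek S \<circ>\<^sub>F E'') \<and>
     nat_isomorphic (quo R) (mid S) (E \<circ>\<^sub>F j_lower R) (j_lower S \<circ>\<^sub>F E''))"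

section \<open>The MacPherson-Vilonen construction\<close>

text \<open>Here \<open>D'\<close>, \<open>D''\<close> are the outer categories, \<open>F\<close> and \<open>G\<close> are functors from \<open>D''\<close> to \<open>D'\<close> and
  \<open>\<alpha>\<close> is a transformation from \<open>F\<close> to \<open>G\<close>. Objects are \<open>(X, V, g, f)\<close>; an arrow is a triple of
  source, pair \<open>(x, v)\<close> and target.\<close>

type_synonym ('p1, 'n1, 'p2) mv_obj = "'p2 \<times> 'p1 \<times> 'n1 \<times> 'n1"

type_synonym ('p1, 'n1, 'p2, 'n2) mv_arr =
  "('p1, 'n1, 'p2) mv_obj \<times> ('n2 \<times> 'n1) \<times> ('p1, 'n1, 'p2) mv_obj"

definition mv_data :: "('p1, 'n1) cat \<Rightarrow> ('p2, 'n2) cat \<Rightarrow> ('p2, 'n2, 'p1, 'n1) fctr \<Rightarrow>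
    ('p2, 'n2, 'p1, 'n1) fctr \<Rightarrow> ('p2 \<Rightarrow> 'n1) \<Rightarrow> bool" where
  "mv_data D' D'' F G \<alpha> \<longleftrightarrow> abelian D' \<and> abelian D'' \<and>
     right_exact D'' D' F \<and> left_exact D'' D' G \<and> nat_trans D'' D' F G \<alpha>"

definition mv_cat :: "('p1, 'n1) cat \<Rightarrow> ('p2, 'n2) cat \<Rightarrow> ('p2, 'n2, 'p1, 'n1) fctr \<Rightarrow>
    ('p2, 'n2, 'p1, 'n1) fctr \<Rightarrow> ('p2 \<Rightarrow> 'n1) \<Rightarrow>
    (('p1, 'n1, 'p2) mv_obj, ('p1, 'n1, 'p2, 'n2) mv_arr) cat" where
  "mv_cat D' D'' F G \<alpha> =
     (let Ob = {(X, V, g, f). X \<in> Obj D'' \<and> V \<in> Obj D' \<and> f \<in> Hom D' (FO F X) V \<and>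
                  g \<in> Hom D' V (FO G X) \<and> Cmp D' g f = \<alpha> X}
      in \<lparr>Obj = Ob,
          Arr = {((X, V, g, f), (x, v), (X', V', g', f')) | X V g f x v X' V' g' f'.
                   (X, V, g, f) \<in> Ob \<and> (X', V', g', f') \<in> Ob \<and>
                   x \<in> Hom D'' X X' \<and> v \<in> Hom D' V V' \<and>
                   Cmp D' v f = Cmp D' f' (FA F x) \<and> Cmp D' (FA G x) g = Cmp D' g' v},
          Dom = (\<lambda>(S, a, T). S),
          Cod = (\<lambda>(S, a, T). T),
          Idn = (\<lambda>(X, V, g, f). ((X, V, g, f), (Idn D'' X, Idn D' V), (X, V, g, f))),
          Cmp = (\<lambda>(T', (x', v'), U) (S, (x, v), T). (S, (Cmp D'' x' x, Cmp D' v' v), U)),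
          Pls = (\<lambda>(S, (x, v), T) (S', (x', v'), T'). (S, (Pls D'' x x', Pls D' v v'), T)),
          Nul = (\<lambda>(X, V, g, f) (X', V', g', f').
                   ((X, V, g, f), (Nul D'' X X', Nul D' V V'), (X', V', g', f')))\<rparr>)"

definition mv_recoll :: "('p1, 'n1) cat \<Rightarrow> ('p2, 'n2) cat \<Rightarrow> ('p2, 'n2, 'p1, 'n1) fctr \<Rightarrow>
    ('p2, 'n2, 'p1, 'n1) fctr \<Rightarrow> ('p2 \<Rightarrow> 'n1) \<Rightarrow>
    ('p1, 'n1, ('p1, 'n1, 'p2) mv_obj, ('p1, 'n1, 'p2, 'n2) mv_arr, 'p2, 'n2) recoll" where
  "mv_recoll D' D'' F G \<alpha> =
     (let Z = zero_obj D'';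
          iO = (\<lambda>V. (Z, V, Nul D' V (FO G Z), Nul D' (FO F Z) V));
          lO = (\<lambda>X. (X, FO F X, \<alpha> X, Idn D' (FO F X)));
          rO = (\<lambda>X. (X, FO G X, Idn D' (FO G X), \<alpha> X))
      in \<lparr>sub = D', mid = mv_cat D' D'' F G \<alpha>, quo = D'',
          i_lower = \<lparr>FO = iO, FA = (\<lambda>v. (iO (Dom D' v), (Idn D'' Z, v), iO (Cod D' v)))\<rparr>,
          i_upper = \<lparr>FO = (\<lambda>(X, V, g, f). coker_obj D' f),
            FA = (\<lambda>((X, V, g, f), (x, v), (X', V', g', f')).
                    THE u. u \<in> Hom D' (coker_obj D' f) (coker_obj D' f') \<and>
                           Cmp D' u (coker_arr D' f) = Cmp D' (coker_arr D' f') v)\<rparr>,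
          i_ushriek = \<lparr>FO = (\<lambda>(X, V, g, f). ker_obj D' g),
            FA = (\<lambda>((X, V, g, f), (x, v), (X', V', g', f')).
                    THE u. u \<in> Hom D' (ker_obj D' g) (ker_obj D' g') \<and>
                           Cmp D' (ker_arr D' g') u = Cmp D' v (ker_arr D' g))\<rparr>,
          j_upper = \<lparr>FO = (\<lambda>(X, V, g, f). X), FA = (\<lambda>(S, (x, v), T). x)\<rparr>,
          j_lshriek = \<lparr>FO = lO,
            FA = (\<lambda>x. (lO (Dom D'' x), (x, FA F x), lO (Cod D'' x)))\<rparr>,
          j_lower = \<lparr>FO = rO,
            FA = (\<lambda>x. (rO (Dom D'' x), (x, FA G x), rO (Cod D'' x)))\<rparr>\<rparr>)"

definition is_mv_for :: "('o1, 'm1, 'o, 'm, 'o2, 'm2) recoll \<Rightarrow>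
    ('p1, 'n1) cat \<Rightarrow> ('p2, 'n2) cat \<Rightarrow> ('p2, 'n2, 'p1, 'n1) fctr \<Rightarrow>
    ('p2, 'n2, 'p1, 'n1) fctr \<Rightarrow> ('p2 \<Rightarrow> 'n1) \<Rightarrow> bool" where
  "is_mv_for R D' D'' F G \<alpha> \<longleftrightarrow>
     mv_data D' D'' F G \<alpha> \<and> recoll_equiv R (mv_recoll D' D'' F G \<alpha>)"

text \<open>HOL cannot quantify existentially over types, so the types in which the outer categories
  \<open>D'\<close>, \<open>D''\<close> of the construction live are a parameter. \<open>mv_instance\<close> uses the types of the outer
  categories of \<open>R\<close>; this loses nothing, because \<open>D'\<close> and \<open>D''\<close> are equivalent to these, so
  \<open>F\<close>, \<open>G\<close>, \<open>\<alpha>\<close> can be transported along the equivalences.\<close>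

definition mv_instance_over :: "('p1, 'n1) cat itself \<Rightarrow> ('p2, 'n2) cat itself \<Rightarrow>
    ('o1, 'm1, 'o, 'm, 'o2, 'm2) recoll \<Rightarrow> bool" where
  "mv_instance_over T' T'' R \<longleftrightarrow>
     (\<exists>(D' :: ('p1, 'n1) cat) (D'' :: ('p2, 'n2) cat) F G \<alpha>. is_mv_for R D' D'' F G \<alpha>)"

definition mv_instance :: "('o1, 'm1, 'o, 'm, 'o2, 'm2) recoll \<Rightarrow> bool" where
  "mv_instance R \<longleftrightarrow>
     mv_instance_over TYPE(('o1, 'm1) cat) TYPE(('o2, 'm2) cat) R"

section \<open>Abelian groups and finitely presented functors\<close>

text \<open>Abelian groups whose elements come from the type \<open>'u\<close>, which plays the role of the universe.
  An arrow is a triple (source, homomorphism, target).\<close>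

type_synonym 'u ab_arr = "'u monoid \<times> ('u \<Rightarrow> 'u) \<times> 'u monoid"

definition Ab :: "('u monoid, 'u ab_arr) cat" where
  "Ab = \<lparr>Obj = {G. comm_group G},
     Arr = {(G, h, H). comm_group G \<and> comm_group H \<and> h \<in> hom G H \<and> h \<in> extensional (carrier G)},
     Dom = (\<lambda>(G, h, H). G),
     Cod = (\<lambda>(G, h, H). H),
     Idn = (\<lambda>G. (G, \<lambda>x \<in> carrier G. x, G)),
     Cmp = (\<lambda>(H', k, K) (G, h, H). (G, \<lambda>x \<in> carrier G. k (h x), K)),
     Pls = (\<lambda>(G, h, H) (G', k, H'). (G, \<lambda>x \<in> carrier G. h x \<otimes>\<^bsub>H\<^esub> k x, H)),
     Nul = (\<lambda>G H. (G, \<lambda>x \<in> carrier G. \<one>\<^bsub>H\<^esub>, H))\<rparr>"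

definition ab_fun :: "'u ab_arr \<Rightarrow> 'u \<Rightarrow> 'u" where
  "ab_fun a = fst (snd a)"

text \<open>For a category with arrows of type \<open>'m\<close>, abelian groups have elements of type \<open>'m set\<close>, so
  that quotients of hom-groups are groups of cosets and hom-groups are groups of singletons. Every
  pointwise quotient of a representable functor is isomorphic to one with values in these groups.
  Since \<open>'m\<close> may be any type containing the arrows, a larger universe is obtained by enlarging
  \<open>'m\<close>.\<close>

type_synonym ('o, 'm) psh = "('o, 'm, 'm set monoid, 'm set ab_arr) fctr"

type_synonym ('o, 'm) psh_arr = "('o, 'm, 'm set monoid, 'm set ab_arr) trans"

type_synonym ('o, 'm) psh_cat = "(('o, 'm) psh, ('o, 'm) psh_arr) cat"

definition psh_cat :: "('o, 'm) cat \<Rightarrow> ('o, 'm) psh_cat" where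
  "psh_cat A = functor_cat (op_cat A) Ab"

text \<open>Let \<open>N\<close> be a two-sided ideal of \<open>A\<close>, given by subgroups \<open>N X Y\<close> of the hom-groups.
  \<open>quot_rep A N Y\<close> is the contravariant functor sending \<open>X\<close> to \<open>Hom(X, Y) / N(X, Y)\<close>. It sends an
  arrow \<open>u\<close> to precomposition of a coset \<open>S\<close> with \<open>u\<close>; the cosets in the union all coincide.
  \<open>quot_yoneda A N\<close> sends \<open>Y\<close> to \<open>quot_rep A N Y\<close> and an arrow to postcomposition with it.\<close>

definition quot_rep :: "('o, 'm) cat \<Rightarrow> ('o \<Rightarrow> 'o \<Rightarrow> 'm set) \<Rightarrow> 'o \<Rightarrow> ('o, 'm) psh" where
  "quot_rep A N Y =
     (let Q = (\<lambda>X. hom_group A X Y Mod N X Y)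
      in \<lparr>FO = (\<lambda>X \<in> Obj A. Q X),
          FA = (\<lambda>u \<in> Arr A.
            (Q (Cod A u),
             \<lambda>S \<in> carrier (Q (Cod A u)).
               \<Union>g \<in> S. N (Dom A u) Y #>\<^bsub>hom_group A (Dom A u) Y\<^esub> Cmp A g u,
             Q (Dom A u)))\<rparr>)"

definition quot_yoneda ::
  "('o, 'm) cat \<Rightarrow> ('o \<Rightarrow> 'o \<Rightarrow> 'm set) \<Rightarrow> ('o, 'm, ('o, 'm) psh, ('o, 'm) psh_arr) fctr" where
  "quot_yoneda A N =
     \<lparr>FO = quot_rep A N,
      FA = (\<lambda>a.
        (quot_rep A N (Dom A a),
         \<lambda>X \<in> Obj A.
           (FO (quot_rep A N (Dom A a)) X,
            \<lambda>S \<in> carrier (FO (quot_rep A N (Dom A a)) X).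
              \<Union>g \<in> S. N X (Cod A a) #>\<^bsub>hom_group A X (Cod A a)\<^esub> Cmp A a g,
            FO (quot_rep A N (Cod A a)) X),
         quot_rep A N (Cod A a)))\<rparr>"

definition yoneda :: "('o, 'm) cat \<Rightarrow> ('o, 'm, ('o, 'm) psh, ('o, 'm) psh_arr) fctr" where
  "yoneda A = quot_yoneda A (\<lambda>X Y. {Nul A X Y})"

definition proj_factoring :: "('o, 'm) cat \<Rightarrow> 'o \<Rightarrow> 'o \<Rightarrow> 'm set" where
  "proj_factoring A X Y =
     {Cmp A h g | P g h. projective A P \<and> g \<in> Hom A X P \<and> h \<in> Hom A P Y}"

definition stable_yoneda :: "('o, 'm) cat \<Rightarrow> ('o, 'm, ('o, 'm) psh, ('o, 'm) psh_arr) fctr" where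
  "stable_yoneda A = quot_yoneda A (proj_factoring A)"

definition finitely_presented :: "('o, 'm) cat \<Rightarrow> ('o, 'm) psh \<Rightarrow> bool" where
  "finitely_presented A F \<longleftrightarrow> F \<in> Obj (psh_cat A) \<and>
     (\<exists>B \<in> Obj A. \<exists>C \<in> Obj A. \<exists>\<phi> \<psi>.
        (FO (yoneda A) B, \<phi>, FO (yoneda A) C) \<in> Arr (psh_cat A) \<and>
        (FO (yoneda A) C, \<psi>, F) \<in> Arr (psh_cat A) \<and>
        (\<forall>X \<in> Obj A.
           ab_fun (\<phi> X) ` carrier (FO (FO (yoneda A) B) X) =
             kernel (FO (FO (yoneda A) C) X) (FO F X) (ab_fun (\<psi> X)) \<and>
           ab_fun (\<psi> X) ` carrier (FO (FO (yoneda A) C) X) = carrier (FO F X)))"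

definition fp_cat :: "('o, 'm) cat \<Rightarrow> ('o, 'm) psh_cat" where
  "fp_cat A = full_sub (psh_cat A) {F. finitely_presented A F}"

section \<open>The defect recollement\<close>

text \<open>The adjoints are determined only up to isomorphism, so this is a predicate allowing any choice
  of them. The defect \<open>w\<close> is \<open>j_upper R\<close>, the left adjoint of \<open>yoneda A\<close>, and \<open>sub R\<close> is its
  kernel.\<close>

definition defect_recollement ::
  "('o, 'm) cat \<Rightarrow> (('o, 'm) psh, ('o, 'm) psh_arr, ('o, 'm) psh, ('o, 'm) psh_arr, 'o, 'm) recoll
   \<Rightarrow> bool" where
  "defect_recollement A R \<longleftrightarrow> recollement R \<and>
     quo R = A \<and>
     mid R = fp_cat A \<and>
     sub R = full_sub (fp_cat A) {F. is_zero A (FO (j_upper R) F)} \<and>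
     i_lower R = id_functor \<and>
     left_adjoint (mid R) (sub R) (i_upper R) (i_lower R) \<and>
     left_adjoint (sub R) (mid R) (i_lower R) (i_ushriek R) \<and>
     j_lower R = yoneda A \<and>
     left_adjoint (mid R) (quo R) (j_upper R) (yoneda A) \<and>
     right_exact (quo R) (mid R) (j_lshriek R) \<and>
     nat_isomorphic (full_sub A {P. projective A P}) (mid R) (j_lshriek R) (yoneda A)"

definition zero_functor :: "('p, 'n) cat \<Rightarrow> ('o, 'm, 'p, 'n) fctr" where
  "zero_functor D = \<lparr>FO = (\<lambda>_. zero_obj D), FA = (\<lambda>_. Idn D (zero_obj D))\<rparr>"

definition zero_trans :: "('p, 'n) cat \<Rightarrow> ('o, 'm, 'p, 'n) fctr \<Rightarrow> 'o \<Rightarrow> 'n" where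
  "zero_trans D G X = Nul D (zero_obj D) (FO G X)"

end

theory Submission
  imports Defs
begin

text \<open>
  Let \<open>C\<close> be the category of finitely presented functors on \<open>A\<close>, \<open>Y\<close> the Yoneda embedding, \<open>w\<close> the defect, \<open>l\<close> its left
  adjoint, \<open>D\<close> the kernel of \<open>w\<close>, \<open>R\<close> and \<open>S\<close> the reflection and the coreflection of \<open>C\<close> in \<open>D\<close>, and \<open>T\<close> the stable Yoneda
  functor. Concretely, if \<open>f: B \<rightarrow> X\<close> presents \<open>F\<close> and \<open>P \<rightarrow> X\<close> is an epimorphism from a projective, then \<open>w F\<close> is the cokernel
  of \<open>f\<close> and \<open>R F\<close> is the quotient of \<open>F\<close> by the image of \<open>Y P\<close>. In particular \<open>R (Y X) = T X\<close>, which is \<open>Y X\<close> modulo the arrows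
  that factor through a projective, and \<open>T X = 0\<close> exactly if \<open>X\<close> is projective.

  Why is \<open>A\<close> hereditary if the recollement is pre-hereditary? A syzygy \<open>0 \<rightarrow> K \<rightarrow> P \<rightarrow> X \<rightarrow> 0\<close> gives a projective resolution
  \<open>0 \<rightarrow> Y K \<rightarrow> Y P \<rightarrow> Y X \<rightarrow> T X \<rightarrow> 0\<close> of the projective object \<open>T X\<close> of \<open>D\<close>. Because \<open>R (Y P) = 0\<close>, the second derived functor of
  \<open>R\<close> at \<open>T X\<close> is \<open>R (Y K) = T K\<close>. So if it always vanishes, every syzygy is projective
  (\<open>hereditary_of_derived_vanish\<close>). Conversely, if \<open>A\<close> is hereditary then \<open>R\<close> is exact (\<open>r_mono\<close>, \<open>derived_vanish\<close>).

  Why is \<open>A\<close> hereditary if the recollement is a MacPherson-Vilonen construction? In the construction for \<open>\<alpha>: F \<rightarrow> G\<close> the object \<open>(X, F X \<oplus> G X)\<close> maps onto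
  \<open>j_lower X = (X, G X)\<close>. All objects \<open>Y X\<close> are projective in \<open>C\<close>, so in the case at hand this epimorphism splits, and the
  section makes \<open>\<alpha>\<close> a split monomorphism (\<open>mv_projective_split\<close>). The kernel of \<open>\<alpha>\<close> is \<open>S l\<close>, so \<open>l X\<close> has no nonzero
  subobject in \<open>D\<close>. For an epimorphism \<open>P1 \<rightarrow> K\<close> from a projective onto a syzygy, \<open>l X\<close> is the cokernel of \<open>Y P1 \<rightarrow> Y P\<close>. The arrow
  \<open>Y K \<rightarrow> Y P \<rightarrow> l X\<close> factors through \<open>T K\<close>, which is in \<open>D\<close>, so it vanishes. Therefore \<open>Y K \<rightarrow> Y P\<close> lifts to \<open>Y P1\<close>, and \<open>K\<close> is a
  direct summand of \<open>P1\<close> (\<open>hereditary_of_torsion_free\<close>).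

  Finally, if \<open>A\<close> is hereditary then the recollement is glued along \<open>0 \<rightarrow> T\<close>. The units \<open>F \<rightarrow> R F\<close> and \<open>F \<rightarrow> Y (w F)\<close> exhibit every \<open>F\<close> as the
  pullback of \<open>R F\<close> and \<open>Y (w F)\<close> over \<open>T (w F)\<close> (\<open>joint_mono\<close>, \<open>gluing\<close>). Heredity is needed for the joint monicity: the
  part of a projective that dies in \<open>w F\<close> is again projective. Consequently \<open>F\<close> is determined by \<open>w F\<close>, \<open>R F\<close> and the arrow
  \<open>R F \<rightarrow> T (w F)\<close>, which form an object of the MacPherson-Vilonen category for \<open>0 \<rightarrow> T\<close>. Every object of that category arises
  from a pullback, and the resulting equivalence \<open>glue\<close> respects the six functors.

  These arguments are carried out in the locale \<open>defect\<close>, where arrows from \<open>Y U\<close> to \<open>F\<close> serve as elements of \<open>F\<close>. Its assumptions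
  on \<open>C\<close> are that \<open>Y\<close> is additive and fully faithful, that representables are projective, that every object is a cokernel
  of an arrow between representables, and that \<open>T X\<close> is the cokernel of \<open>Y P \<rightarrow> Y X\<close>. The sections on presheaves verify them
  by computing with cosets of arrows.
\<close>

section \<open>Calculus in preadditive categories\<close>

context category
begin

lemma Hom_iff:
  "f \<in> Hom C X Y \<longleftrightarrow> f \<in> Arr C \<and> Dom C f = X \<and> Cod C f = Y \<and> X \<in> Obj C \<and> Y \<in> Obj C"
  using Dom_Obj Cod_Obj by (auto simp: Hom_def)

lemma HomD:
  assumes "f \<in> Hom C X Y"
  shows "f \<in> Arr C" "Dom C f = X" "Cod C f = Y" "X \<in> Obj C" "Y \<in> Obj C"
  using assms by (auto simp: Hom_iff)

lemma Arr_Hom: "f \<in> Arr C \<Longrightarrow> f \<in> Hom C (Dom C f) (Cod C f)"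
  by (simp add: Hom_def)

lemma Arr_Cmp [simp]: "f \<in> Arr C \<Longrightarrow> g \<in> Arr C \<Longrightarrow> Dom C g = Cod C f \<Longrightarrow> Cmp C g f \<in> Arr C"
  and Dom_Cmp [simp]: "f \<in> Arr C \<Longrightarrow> g \<in> Arr C \<Longrightarrow> Dom C g = Cod C f \<Longrightarrow> Dom C (Cmp C g f) = Dom C f"
  and Cod_Cmp [simp]: "f \<in> Arr C \<Longrightarrow> g \<in> Arr C \<Longrightarrow> Dom C g = Cod C f \<Longrightarrow> Cod C (Cmp C g f) = Cod C g"
  using Cmp_Hom[of f "Dom C f" "Cod C f" g "Cod C g"] by (auto simp: Hom_def)

lemma Arr_Idn [simp]: "X \<in> Obj C \<Longrightarrow> Idn C X \<in> Arr C"
  and Dom_Idn [simp]: "X \<in> Obj C \<Longrightarrow> Dom C (Idn C X) = X"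
  and Cod_Idn [simp]: "X \<in> Obj C \<Longrightarrow> Cod C (Idn C X) = X"
  using Idn_Hom[of X] by (auto simp: Hom_def)

lemma Cmp_Idn_right [simp]: "f \<in> Arr C \<Longrightarrow> Dom C f = X \<Longrightarrow> Cmp C f (Idn C X) = f"
  and Cmp_Idn_left [simp]: "f \<in> Arr C \<Longrightarrow> Cod C f = X \<Longrightarrow> Cmp C (Idn C X) f = f"
  using Cmp_Idn Idn_Cmp by (auto simp: Hom_def)

lemma Cmp_Cmp [simp]:
  "f \<in> Arr C \<Longrightarrow> g \<in> Arr C \<Longrightarrow> h \<in> Arr C \<Longrightarrow> Dom C g = Cod C f \<Longrightarrow> Dom C h = Cod C g \<Longrightarrow>
    Cmp C (Cmp C h g) f = Cmp C h (Cmp C g f)"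
  using Cmp_assoc[of f "Dom C f" "Cod C f" g "Cod C g" h "Cod C h"] by (simp add: Hom_def)

lemma Cmp_push:
  assumes "Cmp C g f = h" "f \<in> Hom C X Y" "g \<in> Hom C Y Z" "t \<in> Hom C W X"
  shows "Cmp C g (Cmp C f t) = Cmp C h t"
  using Cmp_assoc[of t W X f Y g Z] assms by simp

lemma Cmp_swap:
  assumes "Cmp C g f = Cmp C g' f'" "f \<in> Hom C X Y" "g \<in> Hom C Y Z"
    "f' \<in> Hom C X Y'" "g' \<in> Hom C Y' Z" "t \<in> Hom C W X"
  shows "Cmp C g (Cmp C f t) = Cmp C g' (Cmp C f' t)"
  using Cmp_assoc[OF assms(6,2,3)] Cmp_assoc[OF assms(6,4,5)] assms(1) by simp

lemma mono_arrD:
  assumes "mono_arr C m" "m \<in> Hom C X Y" "a \<in> Hom C W X" "b \<in> Hom C W X" "Cmp C m a = Cmp C m b"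
  shows "a = b"
  using assms by (auto simp: mono_arr_def Hom_iff)

lemma epi_arrD:
  assumes "epi_arr C e" "e \<in> Hom C X Y" "a \<in> Hom C Y W" "b \<in> Hom C Y W" "Cmp C a e = Cmp C b e"
  shows "a = b"
  using assms by (auto simp: epi_arr_def Hom_iff)

lemma projectiveD:
  assumes "projective C P" "epi_arr C e" "e \<in> Hom C X Y" "f \<in> Hom C P Y"
  obtains u where "u \<in> Hom C P X" "Cmp C e u = f"
  using assms HomD[OF assms(3)] unfolding projective_def by blast

lemma projective_Obj: "projective C P \<Longrightarrow> P \<in> Obj C"
  by (simp add: projective_def)

lemma projective_retract:
  assumes P: "projective C P" and s: "s \<in> Hom C K P" "t \<in> Hom C P K" "Cmp C t s = Idn C K"
  shows "projective C K"
  unfolding projective_def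
proof (intro conjI allI impI ballI)
  show "K \<in> Obj C" using s(1) by (simp add: Hom_iff)
  fix e f assume e: "epi_arr C e" and f: "f \<in> Hom C K (Cod C e)"
  have e': "e \<in> Hom C (Dom C e) (Cod C e)" using e by (simp add: Hom_def epi_arr_def)
  obtain u where u: "u \<in> Hom C P (Dom C e)" "Cmp C e u = Cmp C f t"
    using projectiveD[OF P e e' Cmp_Hom[OF s(2) f]] by blast
  have "Cmp C e (Cmp C u s) = Cmp C (Cmp C f t) s" using Cmp_push[OF u(2,1) e' s(1)] .
  also have "\<dots> = f" using s f by (simp add: Hom_iff)
  finally show "\<exists>u\<in>Hom C K (Dom C e). Cmp C e u = f" using Cmp_Hom[OF s(1) u(1)] by blast
qed

lemma epi_Cmp:
  assumes "epi_arr C e" "epi_arr C e'" "e \<in> Hom C X Y" "e' \<in> Hom C Y Z"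
  shows "epi_arr C (Cmp C e' e)"
  unfolding epi_arr_def
proof (intro conjI ballI impI)
  show "Cmp C e' e \<in> Arr C" using assms by (simp add: Hom_iff)
  fix W a b
  assume "W \<in> Obj C" and a: "a \<in> Hom C (Cod C (Cmp C e' e)) W" and b: "b \<in> Hom C (Cod C (Cmp C e' e)) W"
    and eq: "Cmp C a (Cmp C e' e) = Cmp C b (Cmp C e' e)"
  have a': "a \<in> Hom C Z W" and b': "b \<in> Hom C Z W" using a b assms by (simp_all add: Hom_iff)
  have "Cmp C (Cmp C a e') e = Cmp C (Cmp C b e') e"
    using a' b' assms(3,4) eq by (simp add: Hom_iff)
  then have "Cmp C a e' = Cmp C b e'"
    using epi_arrD[OF assms(1,3)] Cmp_Hom[OF assms(4) a'] Cmp_Hom[OF assms(4) b'] by blast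
  then show "a = b" using epi_arrD[OF assms(2,4) a' b'] by blast
qed

lemma epi_of_epi_Cmp:
  assumes "epi_arr C (Cmp C e' e)" "e \<in> Hom C X Y" "e' \<in> Hom C Y Z"
  shows "epi_arr C e'"
  unfolding epi_arr_def
proof (intro conjI ballI impI)
  show "e' \<in> Arr C" using assms by (simp add: Hom_iff)
  fix W a b
  assume a: "a \<in> Hom C (Cod C e') W" and b: "b \<in> Hom C (Cod C e') W"
    and eq: "Cmp C a e' = Cmp C b e'"
  have "Cmp C a (Cmp C e' e) = Cmp C b (Cmp C e' e)"
    using assms(2,3) a b eq by (simp add: Hom_iff flip: Cmp_Cmp)
  then show "a = b" using epi_arrD[OF assms(1)] a b assms by (simp add: Hom_iff)
qed

lemma is_isoD:
  assumes "is_iso C X Y f"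
  obtains g where "f \<in> Hom C X Y" "g \<in> Hom C Y X" "Cmp C g f = Idn C X" "Cmp C f g = Idn C Y"
  using assms by (auto simp: is_iso_def)

lemma is_iso_Idn: "X \<in> Obj C \<Longrightarrow> is_iso C X X (Idn C X)"
  by (auto simp: is_iso_def Hom_iff intro!: bexI[of _ "Idn C X"])

lemma iso_epi: assumes "is_iso C X Y f" shows "epi_arr C f"
proof -
  obtain g where g: "f \<in> Hom C X Y" "g \<in> Hom C Y X" "Cmp C f g = Idn C Y"
    using assms by (auto simp: is_iso_def)
  have "a = b" if "a \<in> Hom C Y W" "b \<in> Hom C Y W" "Cmp C a f = Cmp C b f" for a b W
  proof -
    have "Cmp C (Cmp C a f) g = a" "Cmp C (Cmp C b f) g = b"
      using g that(1,2) by (simp_all add: Hom_iff)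
    then show ?thesis using that(3) by metis
  qed
  then show ?thesis using g by (auto simp: epi_arr_def Hom_iff)
qed

end

context preadditive
begin

lemma Nul_Hom [simp]: "X \<in> Obj C \<Longrightarrow> Y \<in> Obj C \<Longrightarrow> Nul C X Y \<in> Hom C X Y"
  using comm_group.axioms(1)[OF hom_comm_group[of X Y]]
  by (metis comm_monoid.axioms(1) hom_group_def monoid.one_closed partial_object.simps(1) monoid.simps(2))

lemma Arr_Nul [simp]: "X \<in> Obj C \<Longrightarrow> Y \<in> Obj C \<Longrightarrow> Nul C X Y \<in> Arr C"
  and Dom_Nul [simp]: "X \<in> Obj C \<Longrightarrow> Y \<in> Obj C \<Longrightarrow> Dom C (Nul C X Y) = X"
  and Cod_Nul [simp]: "X \<in> Obj C \<Longrightarrow> Y \<in> Obj C \<Longrightarrow> Cod C (Nul C X Y) = Y"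
  using Nul_Hom[of X Y] by (auto simp: Hom_def)

lemma Pls_Hom:
  assumes "f \<in> Hom C X Y" "g \<in> Hom C X Y" shows "Pls C f g \<in> Hom C X Y"
proof -
  interpret G: comm_group "hom_group C X Y" using assms hom_comm_group by (simp add: Hom_iff)
  show ?thesis using G.m_closed[of f g] assms by (simp add: hom_group_def)
qed

lemma Arr_Pls [simp]: "f \<in> Arr C \<Longrightarrow> g \<in> Arr C \<Longrightarrow> Dom C g = Dom C f \<Longrightarrow> Cod C g = Cod C f \<Longrightarrow> Pls C f g \<in> Arr C"
  and Dom_Pls [simp]: "f \<in> Arr C \<Longrightarrow> g \<in> Arr C \<Longrightarrow> Dom C g = Dom C f \<Longrightarrow> Cod C g = Cod C f \<Longrightarrow> Dom C (Pls C f g) = Dom C f"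
  and Cod_Pls [simp]: "f \<in> Arr C \<Longrightarrow> g \<in> Arr C \<Longrightarrow> Dom C g = Dom C f \<Longrightarrow> Cod C g = Cod C f \<Longrightarrow> Cod C (Pls C f g) = Cod C f"
  using Pls_Hom[of f "Dom C f" "Cod C f" g] by (auto simp: Hom_def)

lemma Pls_Nul [simp]:
  assumes "f \<in> Arr C" "Dom C f = X" "Cod C f = Y"
  shows "Pls C f (Nul C X Y) = f" "Pls C (Nul C X Y) f = f"
proof -
  interpret G: comm_group "hom_group C X Y" using assms hom_comm_group Dom_Obj Cod_Obj by blast
  show "Pls C f (Nul C X Y) = f" "Pls C (Nul C X Y) f = f"
    using G.r_one[of f] G.l_one[of f] assms by (auto simp: hom_group_def Hom_def)
qed

text \<open>Differences of parallel arrows occur only through this lemma and the next: to show that two arrows agree,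
  write the first as \<open>d\<close> plus the second and show that \<open>d\<close> vanishes.\<close>

lemma ex_diff:
  assumes "f \<in> Hom C X Y" "g \<in> Hom C X Y"
  obtains d where "d \<in> Hom C X Y" "f = Pls C d g"
proof -
  interpret G: comm_group "hom_group C X Y" using assms hom_comm_group by (simp add: Hom_iff)
  let ?d = "f \<otimes>\<^bsub>hom_group C X Y\<^esub> inv\<^bsub>hom_group C X Y\<^esub> g"
  have c: "f \<in> carrier (hom_group C X Y)" "g \<in> carrier (hom_group C X Y)"
    using assms by (auto simp: hom_group_def)
  have "?d \<in> carrier (hom_group C X Y)" "?d \<otimes>\<^bsub>hom_group C X Y\<^esub> g = f"
    using c by (simp_all add: G.m_assoc)
  then show ?thesis using that[of ?d] by (simp add: hom_group_def)
qed

lemma Pls_eq_right_iff: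
  assumes "d \<in> Hom C X Y" "g \<in> Hom C X Y"
  shows "Pls C d g = g \<longleftrightarrow> d = Nul C X Y"
proof -
  interpret G: comm_group "hom_group C X Y" using assms hom_comm_group by (simp add: Hom_iff)
  show ?thesis using G.r_cancel_one[of g d] assms by (simp add: hom_group_def)
qed

lemma Cmp_Nul_right [simp]:
  assumes "f \<in> Arr C" "Dom C f = Y" "X \<in> Obj C"
  shows "Cmp C f (Nul C X Y) = Nul C X (Cod C f)"
proof -
  have o: "Y \<in> Obj C" "Cod C f \<in> Obj C" using assms Dom_Obj Cod_Obj by auto
  have "Pls C (Cmp C f (Nul C X Y)) (Cmp C f (Nul C X Y)) = Cmp C f (Pls C (Nul C X Y) (Nul C X Y))"
    using Cmp_Pls_right[of "Nul C X Y" X Y "Nul C X Y" f "Cod C f"] assms o by (simp add: Hom_iff)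
  also have "\<dots> = Cmp C f (Nul C X Y)" using assms o by simp
  finally show ?thesis
    using Pls_eq_right_iff[of "Cmp C f (Nul C X Y)" X "Cod C f"] assms o by (simp add: Hom_iff)
qed

lemma Cmp_Nul_left [simp]:
  assumes "f \<in> Arr C" "Cod C f = Y" "Z \<in> Obj C"
  shows "Cmp C (Nul C Y Z) f = Nul C (Dom C f) Z"
proof -
  have o: "Y \<in> Obj C" "Dom C f \<in> Obj C" using assms Dom_Obj Cod_Obj by auto
  have "Pls C (Cmp C (Nul C Y Z) f) (Cmp C (Nul C Y Z) f) = Cmp C (Pls C (Nul C Y Z) (Nul C Y Z)) f"
    using Cmp_Pls_left[of f "Dom C f" Y "Nul C Y Z" Z "Nul C Y Z"] assms o by (simp add: Hom_iff)
  also have "\<dots> = Cmp C (Nul C Y Z) f" using assms o by simp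
  finally show ?thesis
    using Pls_eq_right_iff[of "Cmp C (Nul C Y Z) f" "Dom C f" Z] assms o by (simp add: Hom_iff)
qed

lemma mono_arrI:
  assumes m: "m \<in> Hom C X Y"
    and z: "\<And>W a. a \<in> Hom C W X \<Longrightarrow> Cmp C m a = Nul C W Y \<Longrightarrow> a = Nul C W X"
  shows "mono_arr C m"
proof -
  have "a = b" if a: "a \<in> Hom C W X" and b: "b \<in> Hom C W X" and eq: "Cmp C m a = Cmp C m b" for W a b
  proof -
    obtain d where d: "d \<in> Hom C W X" "a = Pls C d b" using ex_diff[OF a b] .
    have "Pls C (Cmp C m d) (Cmp C m b) = Cmp C m b" using Cmp_Pls_right[OF d(1) b m] d(2) eq by simp
    then have "Cmp C m d = Nul C W Y"
      using Pls_eq_right_iff[OF Cmp_Hom[OF d(1) m] Cmp_Hom[OF b m]] by simp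
    then have "d = Nul C W X" using z[OF d(1)] by simp
    then show ?thesis using d(2) b by (simp add: Hom_iff)
  qed
  then show ?thesis using m by (auto simp: mono_arr_def Hom_iff)
qed

lemma epi_arrI:
  assumes m: "m \<in> Hom C X Y"
    and z: "\<And>W a. a \<in> Hom C Y W \<Longrightarrow> Cmp C a m = Nul C X W \<Longrightarrow> a = Nul C Y W"
  shows "epi_arr C m"
proof -
  have "a = b" if a: "a \<in> Hom C Y W" and b: "b \<in> Hom C Y W" and eq: "Cmp C a m = Cmp C b m" for W a b
  proof -
    obtain d where d: "d \<in> Hom C Y W" "a = Pls C d b" using ex_diff[OF a b] .
    have "Pls C (Cmp C d m) (Cmp C b m) = Cmp C b m" using Cmp_Pls_left[OF m d(1) b] d(2) eq by simp
    then have "Cmp C d m = Nul C X W"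
      using Pls_eq_right_iff[OF Cmp_Hom[OF m d(1)] Cmp_Hom[OF m b]] by simp
    then have "d = Nul C Y W" using z[OF d(1)] by simp
    then show ?thesis using d(2) b by (simp add: Hom_iff)
  qed
  then show ?thesis using m by (auto simp: epi_arr_def Hom_iff)
qed

lemma mono_Nul:
  assumes "mono_arr C m" "m \<in> Hom C X Y" "a \<in> Hom C W X" "Cmp C m a = Nul C W Y"
  shows "a = Nul C W X"
  using mono_arrD[OF assms(1-3), of "Nul C W X"] assms(2-4) by (simp add: Hom_iff)

lemma epi_Nul:
  assumes "epi_arr C m" "m \<in> Hom C X Y" "a \<in> Hom C Y W" "Cmp C a m = Nul C X W"
  shows "a = Nul C Y W"
  using epi_arrD[OF assms(1-3), of "Nul C Y W"] assms(2-4) by (simp add: Hom_iff)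

lemma is_zeroI:
  assumes "Z \<in> Obj C" "Idn C Z = Nul C Z Z"
  shows "is_zero C Z"
proof -
  have "f = Nul C X Z" if "f \<in> Hom C X Z" for f X
  proof -
    have "Cmp C (Idn C Z) f = Nul C X Z" using that assms by (simp add: Hom_iff)
    then show ?thesis using that by (simp add: Hom_iff)
  qed
  moreover have "f = Nul C Z X" if "f \<in> Hom C Z X" for f X
  proof -
    have "Cmp C f (Idn C Z) = Nul C Z X" using that assms(1) by (subst assms(2)) (simp add: Hom_iff)
    then show ?thesis using that by (simp add: Hom_iff)
  qed
  ultimately show ?thesis unfolding is_zero_def
    using assms(1) Nul_Hom by blast
qed

lemma is_zero_Obj: "is_zero C Z \<Longrightarrow> Z \<in> Obj C"
  by (simp add: is_zero_def)

lemma to_zero: "is_zero C Z \<Longrightarrow> f \<in> Hom C X Z \<Longrightarrow> f = Nul C X Z"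
  unfolding is_zero_def by (metis Hom_iff Nul_Hom)

lemma from_zero: "is_zero C Z \<Longrightarrow> f \<in> Hom C Z X \<Longrightarrow> f = Nul C Z X"
  unfolding is_zero_def by (metis Hom_iff Nul_Hom)

lemma zero_Idn: "is_zero C Z \<Longrightarrow> Idn C Z = Nul C Z Z"
  using to_zero Idn_Hom is_zero_Obj by blast

lemma zero_obj_zero: "\<exists>Z. is_zero C Z \<Longrightarrow> is_zero C (zero_obj C)"
  unfolding zero_obj_def by (rule someI_ex)

lemma factor_through_zero:
  assumes "is_zero C Z" "a \<in> Hom C X Z" "b \<in> Hom C Z Y" shows "Cmp C b a = Nul C X Y"
  using to_zero[OF assms(1,2)] assms by (simp add: Hom_iff)

lemma is_iso_zero:
  assumes "is_zero C X" "is_zero C Y" "f \<in> Hom C X Y" shows "is_iso C X Y f"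
proof -
  have o: "X \<in> Obj C" "Y \<in> Obj C" using assms is_zero_Obj by auto
  have "Cmp C (Nul C Y X) f = Idn C X" "Cmp C f (Nul C Y X) = Idn C Y"
    using to_zero[OF assms(1) Idn_Hom[OF o(1)]] to_zero[OF assms(2) Idn_Hom[OF o(2)]] assms(3) o
    by (simp_all add: Hom_iff)
  then show ?thesis using assms(3) o by (auto simp: is_iso_def intro!: bexI[of _ "Nul C Y X"])
qed

lemma is_kernelD:
  assumes "is_kernel C f K k" "f \<in> Hom C X Y"
  shows "k \<in> Hom C K X" "Cmp C f k = Nul C K Y" "mono_arr C k"
proof -
  show k: "k \<in> Hom C K X" and z: "Cmp C f k = Nul C K Y"
    using assms by (auto simp: is_kernel_def Hom_iff)
  show "mono_arr C k"
  proof (rule mono_arrI[OF k])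
    fix W a assume a: "a \<in> Hom C W K" "Cmp C k a = Nul C W X"
    have "Nul C W X \<in> Hom C W (Dom C f)" "Cmp C f (Nul C W X) = Nul C W (Cod C f)" "W \<in> Obj C"
      using assms(2) a(1) by (simp_all add: Hom_iff)
    then have "\<exists>!u. u \<in> Hom C W K \<and> Cmp C k u = Nul C W X"
      using assms(1) unfolding is_kernel_def by blast
    moreover have "Cmp C k (Nul C W K) = Nul C W X" "Nul C W K \<in> Hom C W K"
      using k a(1) by (simp_all add: Hom_iff)
    ultimately show "a = Nul C W K" using a by blast
  qed
qed

lemma is_kernel_lift:
  assumes "is_kernel C f K k" "f \<in> Hom C X Y" "a \<in> Hom C W X" "Cmp C f a = Nul C W Y"
  obtains u where "u \<in> Hom C W K" "Cmp C k u = a"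
proof -
  have "\<exists>!u. u \<in> Hom C W K \<and> Cmp C k u = a"
    using assms HomD[OF assms(2)] HomD[OF assms(3)] unfolding is_kernel_def by auto
  then show ?thesis using that by blast
qed

lemma is_kernelI:
  assumes f: "f \<in> Hom C X Y" and k: "k \<in> Hom C K X" and z: "Cmp C f k = Nul C K Y" and m: "mono_arr C k"
    and l: "\<And>W a. a \<in> Hom C W X \<Longrightarrow> Cmp C f a = Nul C W Y \<Longrightarrow> \<exists>u \<in> Hom C W K. Cmp C k u = a"
  shows "is_kernel C f K k"
proof -
  have "\<exists>!u. u \<in> Hom C W K \<and> Cmp C k u = a" if "a \<in> Hom C W X" "Cmp C f a = Nul C W Y" for W a
    using l[OF that] mono_arrD[OF m k] by blast
  then show ?thesis using HomD[OF f] HomD[OF k] k z unfolding is_kernel_def by simp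
qed

lemma is_cokernelD:
  assumes "is_cokernel C f Q q" "f \<in> Hom C X Y"
  shows "q \<in> Hom C Y Q" "Cmp C q f = Nul C X Q" "epi_arr C q"
proof -
  show q: "q \<in> Hom C Y Q" and z: "Cmp C q f = Nul C X Q"
    using assms by (auto simp: is_cokernel_def Hom_iff)
  show "epi_arr C q"
  proof (rule epi_arrI[OF q])
    fix W a assume a: "a \<in> Hom C Q W" "Cmp C a q = Nul C Y W"
    have "Nul C Y W \<in> Hom C (Cod C f) W" "Cmp C (Nul C Y W) f = Nul C (Dom C f) W" "W \<in> Obj C"
      using assms(2) a(1) by (simp_all add: Hom_iff)
    then have "\<exists>!u. u \<in> Hom C Q W \<and> Cmp C u q = Nul C Y W"
      using assms(1) unfolding is_cokernel_def by blast
    moreover have "Cmp C (Nul C Q W) q = Nul C Y W" "Nul C Q W \<in> Hom C Q W"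
      using q a(1) by (simp_all add: Hom_iff)
    ultimately show "a = Nul C Q W" using a by blast
  qed
qed

lemma is_cokernel_desc:
  assumes "is_cokernel C f Q q" "f \<in> Hom C X Y" "a \<in> Hom C Y W" "Cmp C a f = Nul C X W"
  obtains u where "u \<in> Hom C Q W" "Cmp C u q = a"
proof -
  have "\<exists>!u. u \<in> Hom C Q W \<and> Cmp C u q = a"
    using assms HomD[OF assms(2)] HomD[OF assms(3)] unfolding is_cokernel_def by auto
  then show ?thesis using that by blast
qed

lemma is_cokernelI:
  assumes f: "f \<in> Hom C X Y" and q: "q \<in> Hom C Y Q" and z: "Cmp C q f = Nul C X Q" and e: "epi_arr C q"
    and l: "\<And>W a. a \<in> Hom C Y W \<Longrightarrow> Cmp C a f = Nul C X W \<Longrightarrow> \<exists>u \<in> Hom C Q W. Cmp C u q = a"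
  shows "is_cokernel C f Q q"
proof -
  have "\<exists>!u. u \<in> Hom C Q W \<and> Cmp C u q = a" if "a \<in> Hom C Y W" "Cmp C a f = Nul C X W" for W a
    using l[OF that] epi_arrD[OF e q] by blast
  then show ?thesis using HomD[OF f] HomD[OF q] q z unfolding is_cokernel_def by simp
qed

lemma is_kernel_ker: "\<exists>K k. is_kernel C f K k \<Longrightarrow> is_kernel C f (ker_obj C f) (ker_arr C f)"
  unfolding ker_obj_def ker_arr_def
  using someI_ex[of "\<lambda>(K, k). is_kernel C f K k"] by (simp add: case_prod_unfold)

lemma is_cokernel_coker: "\<exists>K k. is_cokernel C f K k \<Longrightarrow> is_cokernel C f (coker_obj C f) (coker_arr C f)"
  unfolding coker_obj_def coker_arr_def
  using someI_ex[of "\<lambda>(K, k). is_cokernel C f K k"] by (simp add: case_prod_unfold)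

lemma is_cokernel_Cmp_epi:
  assumes q: "is_cokernel C f Q q" and f: "f \<in> Hom C X Y" and e: "epi_arr C e" "e \<in> Hom C W X"
  shows "is_cokernel C (Cmp C f e) Q q"
proof (rule is_cokernelI[OF Cmp_Hom[OF e(2) f]])
  note qD = is_cokernelD[OF q f]
  show "q \<in> Hom C Y Q" "epi_arr C q" by fact+
  show "Cmp C q (Cmp C f e) = Nul C W Q" using Cmp_push[OF qD(2) f qD(1) e(2)] e(2) qD(1)
    by (simp add: Hom_iff)
  fix V a assume a: "a \<in> Hom C Y V" "Cmp C a (Cmp C f e) = Nul C W V"
  have "Cmp C (Cmp C a f) e = Nul C W V" using a e(2) f by (simp add: Hom_iff)
  then have "Cmp C a f = Nul C X V" using epi_Nul[OF e Cmp_Hom[OF f a(1)]] by simp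
  then show "\<exists>u\<in>Hom C Q V. Cmp C u q = a" using is_cokernel_desc[OF q f a(1)] by blast
qed

lemma is_kernel_Nul:
  assumes "X \<in> Obj C" "Y \<in> Obj C" shows "is_kernel C (Nul C X Y) X (Idn C X)"
proof (rule is_kernelI[of _ X Y])
  show "mono_arr C (Idn C X)" by (rule mono_arrI[of _ X X]) (use assms in \<open>auto simp: Hom_iff\<close>)
  show "\<exists>u\<in>Hom C W X. Cmp C (Idn C X) u = a" if "a \<in> Hom C W X" for W a
    using that by (intro bexI[of _ a]) (auto simp: Hom_iff)
qed (use assms in \<open>auto simp: Hom_iff\<close>)

lemma is_cokernel_Nul:
  assumes "X \<in> Obj C" "Y \<in> Obj C" shows "is_cokernel C (Nul C X Y) Y (Idn C Y)"
proof (rule is_cokernelI[of _ X Y])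
  show "epi_arr C (Idn C Y)" by (rule epi_arrI[of _ Y Y]) (use assms in \<open>auto simp: Hom_iff\<close>)
  show "\<exists>u\<in>Hom C Y W. Cmp C u (Idn C Y) = a" if "a \<in> Hom C Y W" for W a
    using that by (intro bexI[of _ a]) (auto simp: Hom_iff)
qed (use assms in \<open>auto simp: Hom_iff\<close>)

lemma is_homology_Nul:
  assumes "X \<in> Obj C" "Y \<in> Obj C" "Z \<in> Obj C"
  shows "is_homology C (Nul C X Y) (Nul C Y Z) Y"
  unfolding is_homology_def
  using assms is_kernel_Nul[of Y Z] is_cokernel_Nul[of X Y]
  by (intro conjI exI[of _ Y] exI[of _ "Idn C Y"] exI[of _ "Nul C X Y"]) (auto simp: Hom_iff)

lemma projective_zero:
  assumes Z: "is_zero C Z" shows "projective C Z"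
  unfolding projective_def
proof (intro conjI allI impI ballI)
  show o: "Z \<in> Obj C" using is_zero_Obj[OF Z] .
  fix e f assume e: "epi_arr C e" and f: "f \<in> Hom C Z (Cod C e)"
  have "Cmp C e (Nul C Z (Dom C e)) = f"
    using e from_zero[OF Z f] o by (simp add: epi_arr_def)
  then show "\<exists>u\<in>Hom C Z (Dom C e). Cmp C e u = f"
    using e o by (intro bexI[of _ "Nul C Z (Dom C e)"]) (simp_all add: epi_arr_def Dom_Obj)
qed

lemma kernel_of_mono:
  assumes m: "mono_arr C m" "m \<in> Hom C X Y" and Z: "is_zero C Z"
  shows "is_kernel C m Z (Nul C Z X)"
proof (rule is_kernelI[OF m(2)])
  have o: "X \<in> Obj C" "Y \<in> Obj C" "Z \<in> Obj C" using m(2) is_zero_Obj[OF Z] by (auto simp: Hom_iff)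
  show "Nul C Z X \<in> Hom C Z X" using o by simp
  show "Cmp C m (Nul C Z X) = Nul C Z Y" using m(2) o by (simp add: Hom_iff)
  show "mono_arr C (Nul C Z X)"
    by (rule mono_arrI[of _ Z X]) (use o to_zero[OF Z] in auto)
  fix W a assume a: "a \<in> Hom C W X" "Cmp C m a = Nul C W Y"
  have "a = Nul C W X" using mono_Nul[OF m a] .
  then show "\<exists>u\<in>Hom C W Z. Cmp C (Nul C Z X) u = a"
    using a(1) o by (intro bexI[of _ "Nul C W Z"]) (auto simp: Hom_iff)
qed

end

section \<open>Exactness in abelian categories\<close>

context abelian
begin

lemma obtain_kernel:
  assumes "f \<in> Hom C X Y" obtains K k where "is_kernel C f K k"
  using has_kernels[of f] assms by (auto simp: Hom_iff)

lemma obtain_cokernel: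
  assumes "f \<in> Hom C X Y" obtains Q q where "is_cokernel C f Q q"
  using has_cokernels[of f] assms by (auto simp: Hom_iff)

text \<open>Suppose \<open>b\<close> kills \<open>e\<close>, and let \<open>j\<close> be the kernel of \<open>b\<close>. Then \<open>f\<close> factors through the monomorphism \<open>k j\<close>, which is
  the kernel of some \<open>z\<close>. Since \<open>z f = 0\<close>, the arrow \<open>z\<close> factors through the cokernel \<open>q\<close> of \<open>f\<close>, so \<open>z\<close> kills \<open>k\<close>. Hence
  \<open>k\<close> factors through \<open>k j\<close>, so \<open>j\<close> splits and \<open>b = 0\<close>.\<close>

lemma epi_onto_kernel_of_cokernel:
  assumes q: "is_cokernel C f Q q" and f: "f \<in> Hom C X Y" and k: "is_kernel C q K k"
    and e: "e \<in> Hom C X K" "Cmp C k e = f"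
  shows "epi_arr C e"
proof (rule epi_arrI[OF e(1)])
  note qD = is_cokernelD[OF q f]
  note kD = is_kernelD[OF k qD(1)]
  fix W b assume b: "b \<in> Hom C K W" "Cmp C b e = Nul C X W"
  obtain J j where j: "is_kernel C b J j" using obtain_kernel[OF b(1)] .
  note jD = is_kernelD[OF j b(1)]
  have kj: "Cmp C k j \<in> Hom C J Y" using kD jD by (blast intro: Cmp_Hom)
  have "mono_arr C (Cmp C k j)"
  proof (rule mono_arrI[OF kj])
    fix V a assume a: "a \<in> Hom C V J" "Cmp C (Cmp C k j) a = Nul C V Y"
    have "Cmp C k (Cmp C j a) = Nul C V Y" using a kD(1) jD(1) by (simp add: Hom_iff)
    then have "Cmp C j a = Nul C V K" using mono_Nul[OF kD(3,1) Cmp_Hom[OF a(1) jD(1)]] by blast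
    then show "a = Nul C V J" using mono_Nul[OF jD(3,1) a(1)] by blast
  qed
  then obtain z where z: "is_kernel C z J (Cmp C k j)" using mono_normal[of "Cmp C k j"] kj by (auto simp: Hom_iff)
  have zH: "z \<in> Hom C Y (Cod C z)" using z HomD[OF kj] by (auto simp: is_kernel_def Hom_def)
  obtain e' where e': "e' \<in> Hom C X J" "Cmp C j e' = e" using is_kernel_lift[OF j b(1) e(1) b(2)] .
  have "Cmp C z f = Cmp C z (Cmp C (Cmp C k j) e')" using e' e(2) kD(1) jD(1) by (simp add: Hom_iff)
  also have "\<dots> = Nul C X (Cod C z)"
    using Cmp_push[OF is_kernelD(2)[OF z zH] kj zH e'(1)] e'(1) zH by (simp add: Hom_iff)
  finally obtain z' where z': "z' \<in> Hom C Q (Cod C z)" "Cmp C z' q = z"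
    using is_cokernel_desc[OF q f zH] by blast
  have "Cmp C z k = Cmp C z' (Cmp C q k)" using z' kD(1) qD(1) by (auto simp: Hom_iff)
  also have "\<dots> = Nul C K (Cod C z)" using kD z'(1) by (simp add: Hom_iff)
  finally obtain y where y: "y \<in> Hom C K J" "Cmp C (Cmp C k j) y = k"
    using is_kernel_lift[OF z zH kD(1)] by blast
  have "Cmp C k (Cmp C j y) = Cmp C k (Idn C K)" using y kD(1) jD(1) by (simp add: Hom_iff)
  then have jy: "Cmp C j y = Idn C K"
    using mono_arrD[OF kD(3,1) Cmp_Hom[OF y(1) jD(1)]] kD(1) Idn_Hom by (simp add: Hom_iff)
  have "b = Cmp C b (Cmp C j y)" using jy b(1) by (simp add: Hom_iff)
  also have "\<dots> = Nul C K W" using Cmp_push[OF jD(2) jD(1) b(1) y(1)] y(1) b(1) by (simp add: Hom_iff)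
  finally show "b = Nul C K W" .
qed

text \<open>Arrows from a projective object behave like elements: those killed by the cokernel of \<open>f\<close> lie in the image
  of \<open>f\<close>. Most exactness arguments below are carried out on such elements.\<close>

lemma projective_lift_cokernel:
  assumes q: "is_cokernel C f Q q" and f: "f \<in> Hom C X Y" and P: "projective C P"
    and t: "t \<in> Hom C P Y" "Cmp C q t = Nul C P Q"
  obtains s where "s \<in> Hom C P X" "Cmp C f s = t"
proof -
  note qD = is_cokernelD[OF q f]
  obtain K k where k: "is_kernel C q K k" using obtain_kernel[OF qD(1)] .
  note kD = is_kernelD[OF k qD(1)]
  obtain e where e: "e \<in> Hom C X K" "Cmp C k e = f" using is_kernel_lift[OF k qD(1) f qD(2)] .
  obtain t' where t': "t' \<in> Hom C P K" "Cmp C k t' = t" using is_kernel_lift[OF k qD(1) t] .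
  obtain s where s: "s \<in> Hom C P X" "Cmp C e s = t'"
    using projectiveD[OF P epi_onto_kernel_of_cokernel[OF q f k e] e(1) t'(1)] .
  have "Cmp C f s = t" using Cmp_push[OF e(2,1) kD(1) s(1)] s(2) t'(2) by simp
  then show ?thesis using that s by blast
qed

lemma epi_is_cokernel_of_kernel:
  assumes e: "epi_arr C e" "e \<in> Hom C X Y" and k: "is_kernel C e K k"
  shows "is_cokernel C k Y e"
proof -
  note kD = is_kernelD[OF k e(2)]
  obtain g where g: "is_cokernel C g Y e" using epi_normal[OF e(1)] e(2) by (auto simp: Hom_iff)
  have gH: "g \<in> Hom C (Dom C g) X" using g HomD[OF e(2)] by (auto simp: is_cokernel_def Hom_def)
  obtain g' where g': "g' \<in> Hom C (Dom C g) K" "Cmp C k g' = g"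
    using is_kernel_lift[OF k e(2) gH is_cokernelD(2)[OF g gH]] .
  show ?thesis
  proof (rule is_cokernelI[OF kD(1) e(2) kD(2) e(1)])
    fix W a assume a: "a \<in> Hom C X W" "Cmp C a k = Nul C K W"
    have "Cmp C a g = Cmp C a (Cmp C k g')" using g' by simp
    also have "\<dots> = Nul C (Dom C g) W"
      using Cmp_push[OF a(2) kD(1) a(1) g'(1)] g'(1) a(1) by (simp add: Hom_iff)
    finally show "\<exists>u\<in>Hom C Y W. Cmp C u e = a" using is_cokernel_desc[OF g gH a(1)] by blast
  qed
qed

lemma mono_is_kernel_of_cokernel:
  assumes m: "mono_arr C m" "m \<in> Hom C X Y" and q: "is_cokernel C m Q q"
  shows "is_kernel C q X m"
proof -
  note qD = is_cokernelD[OF q m(2)]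
  obtain g where g: "is_kernel C g X m" using mono_normal[OF m(1)] m(2) by (auto simp: Hom_iff)
  have gH: "g \<in> Hom C Y (Cod C g)" using g HomD[OF m(2)] by (auto simp: is_kernel_def Hom_def)
  obtain g' where g': "g' \<in> Hom C Q (Cod C g)" "Cmp C g' q = g"
    using is_cokernel_desc[OF q m(2) gH is_kernelD(2)[OF g gH]] .
  show ?thesis
  proof (rule is_kernelI[OF qD(1) m(2) qD(2) m(1)])
    fix W a assume a: "a \<in> Hom C W Y" "Cmp C q a = Nul C W Q"
    have "Cmp C g a = Cmp C g' (Cmp C q a)" using g' qD(1) a(1) by (auto simp: Hom_iff)
    also have "\<dots> = Nul C W (Cod C g)" using g'(1) a by (simp add: Hom_iff)
    finally show "\<exists>u\<in>Hom C W X. Cmp C m u = a" using is_kernel_lift[OF g gH a(1)] by blast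
  qed
qed

text \<open>The kernel of the difference of \<open>f p1\<close> and \<open>g p2\<close> on a biproduct.\<close>

lemma pullback_exists:
  assumes f: "f \<in> Hom C X Z" and g: "g \<in> Hom C Y Z"
  obtains P a b where "a \<in> Hom C P X" "b \<in> Hom C P Y" "Cmp C f a = Cmp C g b"
    "\<And>W x y. x \<in> Hom C W X \<Longrightarrow> y \<in> Hom C W Y \<Longrightarrow> Cmp C f x = Cmp C g y \<Longrightarrow>
       \<exists>t \<in> Hom C W P. Cmp C a t = x \<and> Cmp C b t = y"
    "\<And>W t. t \<in> Hom C W P \<Longrightarrow> Cmp C a t = Nul C W X \<Longrightarrow> Cmp C b t = Nul C W Y \<Longrightarrow> t = Nul C W P"
proof -
  obtain S i1 i2 p1 p2 where B: "is_biproduct C X Y S i1 i2 p1 p2"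
    using has_biproducts[of X Y] f g by (auto simp: Hom_iff)
  note B' = B[unfolded is_biproduct_def]
  have i: "i1 \<in> Hom C X S" "i2 \<in> Hom C Y S" and p: "p1 \<in> Hom C S X" "p2 \<in> Hom C S Y"
    using B' by auto
  note fp = Cmp_Hom[OF p(1) f] and gp = Cmp_Hom[OF p(2) g]
  obtain d where d: "d \<in> Hom C S Z" "Cmp C f p1 = Pls C d (Cmp C g p2)" using ex_diff[OF fp gp] .
  obtain P k where k: "is_kernel C d P k" using obtain_kernel[OF d(1)] .
  note kD = is_kernelD[OF k d(1)]
  have dt: "Cmp C f (Cmp C p1 t) = Pls C (Cmp C d t) (Cmp C g (Cmp C p2 t))" if "t \<in> Hom C W S" for t W
    using Cmp_Pls_left[OF that d(1) gp] d(2) that p f g by (simp add: Hom_iff flip: Cmp_Cmp)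
  have split: "t = Nul C W S"
    if t: "t \<in> Hom C W S" and z: "Cmp C p1 t = Nul C W X" "Cmp C p2 t = Nul C W Y" for t W
  proof -
    have "t = Cmp C (Pls C (Cmp C i1 p1) (Cmp C i2 p2)) t" using B' t by (simp add: Hom_iff)
    also have "\<dots> = Pls C (Cmp C i1 (Cmp C p1 t)) (Cmp C i2 (Cmp C p2 t))"
      using Cmp_Pls_left[OF t Cmp_Hom[OF p(1) i(1)] Cmp_Hom[OF p(2) i(2)]] t i p by (simp add: Hom_iff)
    also have "\<dots> = Nul C W S" using i t by (simp add: z Hom_iff)
    finally show ?thesis .
  qed
  show ?thesis
  proof (rule that[of "Cmp C p1 k" P "Cmp C p2 k"])
    show "Cmp C p1 k \<in> Hom C P X" "Cmp C p2 k \<in> Hom C P Y" using p kD(1) Cmp_Hom by blast+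
    show "Cmp C f (Cmp C p1 k) = Cmp C g (Cmp C p2 k)"
      using dt[OF kD(1)] kD(1,2) gp p g by (simp add: Hom_iff)
  next
    fix W x y assume x: "x \<in> Hom C W X" and y: "y \<in> Hom C W Y" and eq: "Cmp C f x = Cmp C g y"
    let ?s = "Pls C (Cmp C i1 x) (Cmp C i2 y)"
    have s: "?s \<in> Hom C W S" using i x y by (blast intro: Pls_Hom Cmp_Hom)
    have "Cmp C p1 ?s = Pls C (Cmp C p1 (Cmp C i1 x)) (Cmp C p1 (Cmp C i2 y))"
      using Cmp_Pls_right[OF Cmp_Hom[OF x i(1)] Cmp_Hom[OF y i(2)] p(1)] .
    also have "\<dots> = Pls C (Cmp C (Idn C X) x) (Cmp C (Nul C Y X) y)"
      using B' Cmp_assoc[OF x i(1) p(1)] Cmp_assoc[OF y i(2) p(1)] by simp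
    also have "\<dots> = x" using x y by (simp add: Hom_iff)
    finally have s1: "Cmp C p1 ?s = x" .
    have "Cmp C p2 ?s = Pls C (Cmp C p2 (Cmp C i1 x)) (Cmp C p2 (Cmp C i2 y))"
      using Cmp_Pls_right[OF Cmp_Hom[OF x i(1)] Cmp_Hom[OF y i(2)] p(2)] .
    also have "\<dots> = Pls C (Cmp C (Nul C X Y) x) (Cmp C (Idn C Y) y)"
      using B' Cmp_assoc[OF x i(1) p(2)] Cmp_assoc[OF y i(2) p(2)] by simp
    also have "\<dots> = y" using x y by (simp add: Hom_iff)
    finally have s2: "Cmp C p2 ?s = y" .
    have "Pls C (Cmp C d ?s) (Cmp C g y) = Cmp C g y" using dt[OF s] s1 s2 eq by simp
    then have "Cmp C d ?s = Nul C W Z"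
      using Pls_eq_right_iff[OF Cmp_Hom[OF s d(1)] Cmp_Hom[OF y g]] by simp
    then obtain t where t: "t \<in> Hom C W P" "Cmp C k t = ?s" using is_kernel_lift[OF k d(1) s] by blast
    have "Cmp C (Cmp C p1 k) t = x" "Cmp C (Cmp C p2 k) t = y"
      using t s1 s2 kD(1) p by (simp_all add: Hom_iff)
    then show "\<exists>t\<in>Hom C W P. Cmp C (Cmp C p1 k) t = x \<and> Cmp C (Cmp C p2 k) t = y" using t(1) by blast
  next
    fix W t assume t: "t \<in> Hom C W P" and z: "Cmp C (Cmp C p1 k) t = Nul C W X" "Cmp C (Cmp C p2 k) t = Nul C W Y"
    have "Cmp C k t = Nul C W S" using split[OF Cmp_Hom[OF t kD(1)]] z t kD(1) p by (simp add: Hom_iff)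
    then show "t = Nul C W P" using mono_Nul[OF kD(3,1) t] by blast
  qed
qed

text \<open>Both the resolution by a syzygy that is projective and the resolution of a stable representable by
  representables have this shape; the former has \<open>P2 = 0\<close>.\<close>

lemma projective_resolution_of_length_two:
  assumes pr: "projective C P0" "projective C P1" "projective C P2" and Z: "is_zero C Z"
    and \<epsilon>: "\<epsilon> \<in> Hom C P0 X" "epi_arr C \<epsilon>" and d0: "d0 \<in> Hom C P1 P0" "exact_at C d0 \<epsilon>"
    and d1: "is_kernel C d0 P2 d1"
  shows "projective_resolution C X
    (\<lambda>n. if n = 0 then P0 else if n = 1 then P1 else if n = 2 then P2 else Z)
    (\<lambda>n. if n = 0 then d0 else if n = 1 then d1 else if n = 2 then Nul C Z P2 else Nul C Z Z) \<epsilon>"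
proof -
  have o: "P0 \<in> Obj C" "P1 \<in> Obj C" "P2 \<in> Obj C" "Z \<in> Obj C" using pr Z by (auto simp: projective_def is_zero_def)
  note d1D = is_kernelD[OF d1 d0(1)]
  have Zp: "projective C Z" using projective_zero[OF Z] .
  have id_epi: "epi_arr C (Idn C V)" if "V \<in> Obj C" for V
    using iso_epi[OF is_iso_Idn[OF that]] .
  have e1: "exact_at C d1 d0"
    unfolding exact_at_def
    using d1 d1D(1) d0(1) o id_epi[OF o(3)]
    by (intro conjI exI[of _ P2] exI[of _ d1] exI[of _ "Idn C P2"]) (auto simp: Hom_iff)
  have k2: "is_kernel C d1 Z (Nul C Z P2)" using kernel_of_mono[OF d1D(3,1) Z] .
  have e2: "exact_at C (Nul C Z P2) d1"
    unfolding exact_at_def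
    using d1D(1) o id_epi[OF o(4)] k2
    by (intro conjI exI[of _ Z] exI[of _ "Nul C Z P2"] exI[of _ "Idn C Z"]) (auto simp: Hom_iff)
  have k3: "is_kernel C (Nul C Z V) Z (Idn C Z)" if "V \<in> Obj C" for V
    using is_kernel_Nul[OF o(4) that] .
  have e3: "exact_at C (Nul C Z Z) (Nul C Z V)" if "V \<in> Obj C" for V
    unfolding exact_at_def
    using that o id_epi[OF o(4)] k3[OF that] zero_Idn[OF Z]
    by (intro conjI exI[of _ Z] exI[of _ "Idn C Z"]) (auto simp: Hom_iff)
  show ?thesis
    unfolding projective_resolution_def
    using pr Zp d0 d1D(1) o \<epsilon> e1 e2 e3 by auto
qed

lemma exact_at_cokernel:
  assumes q: "is_cokernel C f Q q" and f: "f \<in> Hom C X Y"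
  shows "exact_at C f q"
proof -
  note qD = is_cokernelD[OF q f]
  obtain K k where k: "is_kernel C q K k" using obtain_kernel[OF qD(1)] .
  obtain e where e: "e \<in> Hom C X K" "Cmp C k e = f" using is_kernel_lift[OF k qD(1) f qD(2)] .
  show ?thesis unfolding exact_at_def
    using f qD(1) k e epi_onto_kernel_of_cokernel[OF q f k e] by (auto simp: Hom_iff)
qed

lemma hereditaryI:
  assumes enough: "enough_projectives C"
    and syzygy: "\<And>P X e K k. projective C P \<Longrightarrow> e \<in> Hom C P X \<Longrightarrow> epi_arr C e \<Longrightarrow> is_kernel C e K k \<Longrightarrow> projective C K"
  shows "hereditary C"
  unfolding hereditary_def
proof
  fix X assume "X \<in> Obj C"
  then obtain P e where P: "projective C P" and e: "e \<in> Hom C P X" "epi_arr C e"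
    using enough by (auto simp: enough_projectives_def)
  obtain K k where k: "is_kernel C e K k" using obtain_kernel[OF e(1)] .
  note kD = is_kernelD[OF k e(1)]
  obtain Z where Z: "is_zero C Z" using has_zero by blast
  have ex: "exact_at C k e" using exact_at_cokernel[OF epi_is_cokernel_of_kernel[OF e(2,1) k] kD(1)] .
  show "proj_dim_le C 1 X"
    unfolding proj_dim_le_def
    using projective_resolution_of_length_two[OF P syzygy[OF P e k] projective_zero[OF Z] Z e kD(1) ex
      kernel_of_mono[OF kD(3,1) Z]]
    by (intro exI conjI) (use Z in auto)
qed

lemma exact_at_lift:
  assumes ex: "exact_at C f g" and f: "f \<in> Hom C X Y" and g: "g \<in> Hom C Y Z" and P: "projective C P"
    and t: "t \<in> Hom C P Y" "Cmp C g t = Nul C P Z"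
  obtains s where "s \<in> Hom C P X" "Cmp C f s = t"
proof -
  obtain K k e where k: "is_kernel C g K k" and e: "e \<in> Hom C X K" "Cmp C k e = f" "epi_arr C e"
    using ex f by (auto simp: exact_at_def Hom_iff)
  note kD = is_kernelD[OF k g]
  obtain t' where t': "t' \<in> Hom C P K" "Cmp C k t' = t" using is_kernel_lift[OF k g t] .
  obtain s where s: "s \<in> Hom C P X" "Cmp C e s = t'" using projectiveD[OF P e(3,1) t'(1)] .
  have "Cmp C f s = t" using Cmp_push[OF e(2,1) kD(1) s(1)] s(2) t'(2) by simp
  then show ?thesis using that s by blast
qed

text \<open>Replacing \<open>h\<close> by its coimage \<open>e\<close>, one may compare \<open>K \<rightarrow> P \<rightarrow> I\<close> with a projective resolution \<open>Q 1 \<rightarrow> Q 0 \<rightarrow> I\<close> of length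
  one, as in Schanuel's lemma. The comparison arrows \<open>s\<close> and \<open>t\<close> between \<open>P\<close> and \<open>Q 0\<close> show that the identity of \<open>K\<close>
  factors through \<open>P \<oplus> Q 1\<close>.\<close>

lemma hereditaryD:
  assumes her: "hereditary C" and P: "projective C P" and h: "h \<in> Hom C P X" and k: "is_kernel C h K k"
  shows "projective C K"
proof -
  note kD = is_kernelD[OF k h]
  obtain I e where e: "is_cokernel C k I e" using obtain_cokernel[OF kD(1)] .
  note eD = is_cokernelD[OF e kD(1)]
  have ke: "is_kernel C e K k" using mono_is_kernel_of_cokernel[OF kD(3,1) e] .
  have "proj_dim_le C 1 I" using her eD(1) by (simp add: hereditary_def Hom_iff)
  then obtain Q d \<epsilon> where res: "projective_resolution C I Q d \<epsilon>" and Qz: "\<forall>n>1. is_zero C (Q n)"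
    by (auto simp: proj_dim_le_def)
  have Qp: "projective C (Q n)" and d: "d n \<in> Hom C (Q (Suc n)) (Q n)" for n
    using res by (auto simp: projective_resolution_def)
  have \<epsilon>: "\<epsilon> \<in> Hom C (Q 0) I" "epi_arr C \<epsilon>" and ex0: "exact_at C (d 0) \<epsilon>" and ex1: "exact_at C (d 1) (d 0)"
    using res by (auto simp: projective_resolution_def)
  have d0: "d 0 \<in> Hom C (Q 1) (Q 0)" and d1: "d 1 \<in> Hom C (Q 2) (Q 1)"
    using d[of 0] d[of 1] by (auto simp: numeral_2_eq_2)
  \<comment> \<open>\<open>e0\<close> identifies \<open>Q 1\<close> with the kernel of \<open>\<epsilon>\<close>; below, its monicity comes from \<open>Q 2 = 0\<close>.\<close>
  obtain K0 k0 e0 where k0: "is_kernel C \<epsilon> K0 k0" and e0: "e0 \<in> Hom C (Q 1) K0" "Cmp C k0 e0 = d 0" "epi_arr C e0"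
    using ex0 d0 by (auto simp: exact_at_def Hom_iff)
  note k0D = is_kernelD[OF k0 \<epsilon>(1)]
  obtain s where s: "s \<in> Hom C P (Q 0)" "Cmp C \<epsilon> s = e" using projectiveD[OF P \<epsilon>(2,1) eD(1)] .
  obtain t where t: "t \<in> Hom C (Q 0) P" "Cmp C e t = \<epsilon>" using projectiveD[OF Qp eD(3,1) \<epsilon>(1)] .
  have Po: "P \<in> Obj C" using P projective_Obj by blast
  obtain a0 where a0: "a0 \<in> Hom C P P" "Idn C P = Pls C a0 (Cmp C t s)"
    using ex_diff[OF Idn_Hom[OF Po] Cmp_Hom[OF s(1) t(1)]] .
  have "Cmp C e (Cmp C t s) = e" using Cmp_push[OF t(2,1) eD(1) s(1)] s(2) by simp
  then have "Pls C (Cmp C e a0) e = e"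
    using Cmp_Pls_right[OF a0(1) Cmp_Hom[OF s(1) t(1)] eD(1)] eD(1) by (simp add: Hom_iff flip: a0(2))
  then have "Cmp C e a0 = Nul C P I" using Pls_eq_right_iff[OF Cmp_Hom[OF a0(1) eD(1)] eD(1)] by simp
  then obtain a where a: "a \<in> Hom C P K" "Cmp C k a = a0" using is_kernel_lift[OF ke eD(1) a0(1)] by blast
  have "Cmp C \<epsilon> (Cmp C s k) = Nul C K I" using Cmp_push[OF s(2,1) \<epsilon>(1) kD(1)] eD(2) by simp
  then obtain s0 where s0: "s0 \<in> Hom C K K0" "Cmp C k0 s0 = Cmp C s k"
    using is_kernel_lift[OF k0 \<epsilon>(1) Cmp_Hom[OF kD(1) s(1)]] by blast
  \<comment> \<open>An arrow killed by \<open>e0\<close> is killed by \<open>d 0\<close>, so it comes from the image of \<open>Q 2\<close>, which is zero.\<close>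
  have "mono_arr C e0"
  proof (rule mono_arrI[OF e0(1)])
    fix W x assume x: "x \<in> Hom C W (Q 1)" "Cmp C e0 x = Nul C W K0"
    have "Cmp C (d 0) x = Nul C W (Q 0)" using Cmp_push[OF e0(2,1) k0D(1) x(1)] x k0D(1) by (simp add: Hom_iff)
    moreover obtain L l m where l: "is_kernel C (d 0) L l" "m \<in> Hom C (Q 2) L" "Cmp C l m = d 1" "epi_arr C m"
      using ex1 d1 by (auto simp: exact_at_def Hom_iff)
    moreover note lD = is_kernelD[OF l(1) d0]
    moreover obtain y where y: "y \<in> Hom C W L" "Cmp C l y = x"
      using is_kernel_lift[OF l(1) d0 x(1)] calculation by blast
    moreover have Q2: "is_zero C (Q 2)" using Qz by simp
    have "Idn C L = Nul C L L"
      using epi_Nul[OF l(4,2) Idn_Hom] from_zero[OF Q2 l(2)] l(2) by (simp add: Hom_iff)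
    then have "y = Nul C W L" using to_zero is_zeroI y(1) l(2) by (metis Hom_iff)
    then show "x = Nul C W (Q 1)" using y x(1) lD(1) by (auto simp: Hom_iff)
  qed
  then obtain g where g: "is_kernel C g (Q 1) e0" using mono_normal[of e0] e0(1) by (auto simp: Hom_iff)
  have gH: "g \<in> Hom C K0 (Cod C g)" using g HomD[OF e0(1)] by (auto simp: is_kernel_def Hom_def)
  have "g = Nul C K0 (Cod C g)" using epi_Nul[OF e0(3,1) gH is_kernelD(2)[OF g gH]] .
  then have "Cmp C g (Idn C K0) = Nul C K0 (Cod C g)" using gH by (simp add: Hom_iff)
  then obtain i where i: "i \<in> Hom C K0 (Q 1)" "Cmp C e0 i = Idn C K0"
    using is_kernel_lift[OF g gH, of "Idn C K0" K0] gH Idn_Hom by (metis Hom_iff)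
  have "Cmp C e (Cmp C t k0) = Nul C K0 I" using Cmp_push[OF t(2,1) eD(1) k0D(1)] k0D(2) by simp
  then obtain t0 where t0: "t0 \<in> Hom C K0 K" "Cmp C k t0 = Cmp C t k0"
    using is_kernel_lift[OF ke eD(1) Cmp_Hom[OF k0D(1) t(1)]] by blast
  \<comment> \<open>The identity of \<open>K\<close> is \<open>a k + t0 s0\<close>, whose two summands factor through the projectives
    \<open>P\<close> and \<open>Q 1\<close>.\<close>
  have ak: "Cmp C a k \<in> Hom C K K" and ts: "Cmp C t0 s0 \<in> Hom C K K"
    using a t0 s0 kD(1) Cmp_Hom by blast+
  have "Cmp C k (Cmp C t0 s0) = Cmp C t (Cmp C s k)"
    using Cmp_swap[OF t0(2,1) kD(1) k0D(1) t(1) s0(1)] s0(2) by simp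
  moreover have "Cmp C k (Cmp C a k) = Cmp C a0 k" using Cmp_push[OF a(2,1) kD(1) kD(1)] .
  moreover have "k = Cmp C (Pls C a0 (Cmp C t s)) k" using kD(1) by (simp add: Hom_iff flip: a0(2))
  moreover have "\<dots> = Pls C (Cmp C a0 k) (Cmp C t (Cmp C s k))"
    using Cmp_Pls_left[OF kD(1) a0(1) Cmp_Hom[OF s(1) t(1)]] kD(1) s(1) t(1) by (simp add: Hom_iff)
  ultimately have "Cmp C k (Pls C (Cmp C a k) (Cmp C t0 s0)) = Cmp C k (Idn C K)"
    using Cmp_Pls_right[OF ak ts kD(1)] kD(1) by (simp add: Hom_iff)
  then have id: "Pls C (Cmp C a k) (Cmp C t0 s0) = Idn C K"
    using mono_arrD[OF kD(3,1) Pls_Hom[OF ak ts]] kD(1) Idn_Hom by (simp add: Hom_iff)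
  show ?thesis
    unfolding projective_def
  proof (intro conjI allI impI ballI)
    show "K \<in> Obj C" using kD(1) by (simp add: Hom_iff)
    fix m f assume m: "epi_arr C m" and f: "f \<in> Hom C K (Cod C m)"
    have mH: "m \<in> Hom C (Dom C m) (Cod C m)" using m by (simp add: Hom_def epi_arr_def)
    obtain u where u: "u \<in> Hom C P (Dom C m)" "Cmp C m u = Cmp C f a"
      using projectiveD[OF P m mH Cmp_Hom[OF a(1) f]] .
    obtain v where v: "v \<in> Hom C (Q 1) (Dom C m)" "Cmp C m v = Cmp C f (Cmp C t0 e0)"
      using projectiveD[OF Qp m mH Cmp_Hom[OF Cmp_Hom[OF e0(1) t0(1)] f]] .
    have is0: "Cmp C i s0 \<in> Hom C K (Q 1)" using i(1) s0(1) Cmp_Hom by blast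
    have uk: "Cmp C u k \<in> Hom C K (Dom C m)" and vs: "Cmp C v (Cmp C i s0) \<in> Hom C K (Dom C m)"
      using u(1) v(1) kD(1) is0 Cmp_Hom by blast+
    have "Cmp C m (Cmp C u k) = Cmp C f (Cmp C a k)" using Cmp_swap[OF u(2,1) mH a(1) f kD(1)] .
    moreover have "Cmp C m (Cmp C v (Cmp C i s0)) = Cmp C f (Cmp C t0 (Cmp C e0 (Cmp C i s0)))"
      using Cmp_push[OF v(2,1) mH is0] e0(1) t0(1) f is0 i(1) s0(1) by (simp add: Hom_iff)
    moreover have "Cmp C e0 (Cmp C i s0) = s0" using Cmp_push[OF i(2,1) e0(1) s0(1)] s0(1) by (simp add: Hom_iff)
    ultimately have "Cmp C m (Pls C (Cmp C u k) (Cmp C v (Cmp C i s0))) = Cmp C f (Pls C (Cmp C a k) (Cmp C t0 s0))"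
      using Cmp_Pls_right[OF uk vs mH] Cmp_Pls_right[OF ak ts f] by simp
    also have "\<dots> = f" using id f by (simp add: Hom_iff)
    finally show "\<exists>u\<in>Hom C K (Dom C m). Cmp C m u = f" using Pls_Hom[OF uk vs] by blast
  qed
qed

end

section \<open>Functors and adjunctions\<close>

lemma functor_Obj: "is_functor C D F \<Longrightarrow> X \<in> Obj C \<Longrightarrow> FO F X \<in> Obj D"
  by (simp add: is_functor_def)

lemma functor_Idn: "is_functor C D F \<Longrightarrow> X \<in> Obj C \<Longrightarrow> FA F (Idn C X) = Idn D (FO F X)"
  by (simp add: is_functor_def)

lemma functor_Hom: "is_functor C D F \<Longrightarrow> f \<in> Hom C X Y \<Longrightarrow> FA F f \<in> Hom D (FO F X) (FO F Y)"
  by (auto simp: is_functor_def Hom_def)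

lemma functor_Cmp:
  "is_functor C D F \<Longrightarrow> f \<in> Hom C X Y \<Longrightarrow> g \<in> Hom C Y Z \<Longrightarrow> FA F (Cmp C g f) = Cmp D (FA F g) (FA F f)"
  by (auto simp: is_functor_def Hom_def)

lemma additive_Pls:
  "additive_functor C D F \<Longrightarrow> category C \<Longrightarrow> f \<in> Hom C X Y \<Longrightarrow> g \<in> Hom C X Y \<Longrightarrow>
    FA F (Pls C f g) = Pls D (FA F f) (FA F g)"
  unfolding additive_functor_def by (meson category.HomD(4,5))

lemma additive_Nul:
  assumes F: "additive_functor C D F" and C: "preadditive C" and D: "preadditive D"
    and XY: "X \<in> Obj C" "Y \<in> Obj C"
  shows "FA F (Nul C X Y) = Nul D (FO F X) (FO F Y)"
proof -
  interpret C: preadditive C by fact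
  interpret D: preadditive D by fact
  have f: "is_functor C D F" using F by (simp add: additive_functor_def)
  have "Pls D (FA F (Nul C X Y)) (FA F (Nul C X Y)) = FA F (Pls C (Nul C X Y) (Nul C X Y))"
    using additive_Pls[OF F C.category_axioms C.Nul_Hom C.Nul_Hom] XY by simp
  also have "\<dots> = FA F (Nul C X Y)" using XY by simp
  finally show ?thesis
    using D.Pls_eq_right_iff[OF functor_Hom[OF f] functor_Hom[OF f]] C.Nul_Hom XY by blast
qed

definition is_unit :: "('o, 'm) cat \<Rightarrow> ('p, 'n) cat \<Rightarrow> ('o, 'm, 'p, 'n) fctr \<Rightarrow>
    ('p, 'n, 'o, 'm) fctr \<Rightarrow> ('o \<Rightarrow> 'm) \<Rightarrow> bool" where
  "is_unit C D F G \<eta> \<longleftrightarrow> nat_trans C C id_functor (G \<circ>\<^sub>F F) \<eta> \<and>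
     (\<forall>X \<in> Obj C. \<forall>Y \<in> Obj D. \<forall>a \<in> Hom C X (FO G Y).
        \<exists>!u. u \<in> Hom D (FO F X) Y \<and> Cmp C (FA G u) (\<eta> X) = a)"

definition is_counit :: "('o, 'm) cat \<Rightarrow> ('p, 'n) cat \<Rightarrow> ('o, 'm, 'p, 'n) fctr \<Rightarrow>
    ('p, 'n, 'o, 'm) fctr \<Rightarrow> ('p \<Rightarrow> 'n) \<Rightarrow> bool" where
  "is_counit C D F G \<epsilon> \<longleftrightarrow> nat_trans D D (F \<circ>\<^sub>F G) id_functor \<epsilon> \<and>
     (\<forall>X \<in> Obj C. \<forall>Y \<in> Obj D. \<forall>a \<in> Hom D (FO F X) Y.
        \<exists>!u. u \<in> Hom C X (FO G Y) \<and> Cmp D (\<epsilon> Y) (FA F u) = a)"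

context category
begin

lemma unit_Hom: "is_unit C D F G \<eta> \<Longrightarrow> X \<in> Obj C \<Longrightarrow> \<eta> X \<in> Hom C X (FO G (FO F X))"
  by (simp add: is_unit_def nat_trans_def id_functor_def comp_functor_def)

lemma unit_nat: "is_unit C D F G \<eta> \<Longrightarrow> f \<in> Hom C X X' \<Longrightarrow> Cmp C (FA G (FA F f)) (\<eta> X) = Cmp C (\<eta> X') f"
  by (auto simp: is_unit_def nat_trans_def id_functor_def comp_functor_def Hom_def)

lemma unit_lift:
  assumes "is_unit C D F G \<eta>" "Y \<in> Obj D" "a \<in> Hom C X (FO G Y)"
  obtains u where "u \<in> Hom D (FO F X) Y" "Cmp C (FA G u) (\<eta> X) = a"
  using assms HomD(4)[OF assms(3)] unfolding is_unit_def by metis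

lemma counit_lift:
  assumes "is_counit D C F G \<epsilon>" "X \<in> Obj D" "a \<in> Hom C (FO F X) Y"
  obtains u where "u \<in> Hom D X (FO G Y)" "Cmp C (\<epsilon> Y) (FA F u) = a"
  using assms HomD(5)[OF assms(3)] unfolding is_counit_def by metis

lemma counit_Hom: "is_counit D C F G \<epsilon> \<Longrightarrow> Y \<in> Obj C \<Longrightarrow> \<epsilon> Y \<in> Hom C (FO F (FO G Y)) Y"
  by (simp add: is_counit_def nat_trans_def id_functor_def comp_functor_def)

lemma counit_nat: "is_counit D C F G \<epsilon> \<Longrightarrow> f \<in> Hom C Y Y' \<Longrightarrow> Cmp C (\<epsilon> Y') (FA F (FA G f)) = Cmp C f (\<epsilon> Y)"
  by (auto simp: is_counit_def nat_trans_def id_functor_def comp_functor_def Hom_def)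

end

lemma unit_unique:
  assumes "category C" "category D" "is_functor D C G" "is_unit C D F G \<eta>" "X \<in> Obj C"
    "u \<in> Hom D (FO F X) Y" "v \<in> Hom D (FO F X) Y"
    "Cmp C (FA G u) (\<eta> X) = Cmp C (FA G v) (\<eta> X)"
  shows "u = v"
proof -
  have "Y \<in> Obj D" "Cmp C (FA G u) (\<eta> X) \<in> Hom C X (FO G Y)"
    using assms category.HomD(5) category.Cmp_Hom[OF assms(1) category.unit_Hom[OF assms(1,4,5)] functor_Hom[OF assms(3,6)]]
    by auto
  then show ?thesis using assms unfolding is_unit_def by metis
qed

lemma counit_unique:
  assumes "category C" "category D" "is_functor D C F" "is_counit D C F G \<epsilon>" "Y \<in> Obj C"
    "u \<in> Hom D X (FO G Y)" "v \<in> Hom D X (FO G Y)"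
    "Cmp C (\<epsilon> Y) (FA F u) = Cmp C (\<epsilon> Y) (FA F v)"
  shows "u = v"
proof -
  have "X \<in> Obj D" "Cmp C (\<epsilon> Y) (FA F u) \<in> Hom C (FO F X) Y"
    using assms category.HomD(4) category.Cmp_Hom[OF assms(1) functor_Hom[OF assms(3,6)] category.counit_Hom[OF assms(1,4,5)]]
    by auto
  then show ?thesis using assms unfolding is_counit_def by metis
qed

lemma left_adjoint_unit:
  assumes adj: "left_adjoint C D F G" and C: "category C" and D: "category D"
  shows "\<exists>\<eta>. is_unit C D F G \<eta>"
proof -
  interpret C: category C by fact
  interpret D: category D by fact
  have F: "is_functor C D F" and G: "is_functor D C G" using adj by (auto simp: left_adjoint_def)
  obtain \<phi> where bij: "\<And>X Y. X \<in> Obj C \<Longrightarrow> Y \<in> Obj D \<Longrightarrow>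
        bij_betw (\<phi> X Y) (Hom D (FO F X) Y) (Hom C X (FO G Y))"
    and nat: "\<And>u v f. u \<in> Arr C \<Longrightarrow> v \<in> Arr D \<Longrightarrow> f \<in> Hom D (FO F (Cod C u)) (Dom D v) \<Longrightarrow>
        \<phi> (Dom C u) (Cod D v) (Cmp D v (Cmp D f (FA F u))) =
        Cmp C (FA G v) (Cmp C (\<phi> (Cod C u) (Dom D v) f) u)"
    using adj unfolding left_adjoint_def by blast
  define \<eta> where "\<eta> X = \<phi> X (FO F X) (Idn D (FO F X))" for X
  have FX: "FO F X \<in> Obj D" if "X \<in> Obj C" for X using functor_Obj[OF F that] .
  have \<eta>: "\<eta> X \<in> Hom C X (FO G (FO F X))" if "X \<in> Obj C" for X
    unfolding \<eta>_def using bij_betwE[OF bij[OF that FX[OF that]]] D.Idn_Hom[OF FX[OF that]] by blast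
  have \<phi>: "\<phi> X Y u = Cmp C (FA G u) (\<eta> X)" if X: "X \<in> Obj C" and u: "u \<in> Hom D (FO F X) Y" for X Y u
  proof -
    have "\<phi> X Y (Cmp D u (Cmp D (Idn D (FO F X)) (FA F (Idn C X)))) = Cmp C (FA G u) (Cmp C (\<eta> X) (Idn C X))"
      using nat[of "Idn C X" u "Idn D (FO F X)"] X D.HomD(1-3)[OF u] D.Idn_Hom[OF FX[OF X]]
      by (simp add: \<eta>_def)
    then show ?thesis
      using X FX[OF X] u functor_Idn[OF F X] \<eta>[OF X] by (simp add: D.Hom_iff C.Hom_iff)
  qed
  have "\<exists>!u. u \<in> Hom D (FO F X) Y \<and> Cmp C (FA G u) (\<eta> X) = a"
    if X: "X \<in> Obj C" and Y: "Y \<in> Obj D" and a: "a \<in> Hom C X (FO G Y)" for X Y a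
  proof -
    have "a \<in> \<phi> X Y ` Hom D (FO F X) Y" using bij_betw_imp_surj_on[OF bij[OF X Y]] a by simp
    then obtain u where u: "u \<in> Hom D (FO F X) Y" "\<phi> X Y u = a" by blast
    show ?thesis
    proof (intro ex1I[of _ u] conjI)
      show "u \<in> Hom D (FO F X) Y" by fact
      show "Cmp C (FA G u) (\<eta> X) = a" using \<phi>[OF X u(1)] u(2) by simp
      fix v assume v: "v \<in> Hom D (FO F X) Y \<and> Cmp C (FA G v) (\<eta> X) = a"
      then have "\<phi> X Y v = \<phi> X Y u" using \<phi>[OF X conjunct1[OF v]] u(2) by simp
      then show "v = u" using bij_betw_imp_inj_on[OF bij[OF X Y]] u v by (blast dest: inj_onD)
    qed
  qed
  moreover have "Cmp C (FA G (FA F f)) (\<eta> X) = Cmp C (\<eta> X') f" if f: "f \<in> Hom C X X'" for X X' f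
  proof -
    have X: "X \<in> Obj C" "X' \<in> Obj C" using f by (auto simp: C.Hom_iff)
    have Ff: "FA F f \<in> Hom D (FO F X) (FO F X')" using functor_Hom[OF F f] .
    have "\<phi> X (FO F X') (Cmp D (Idn D (FO F X')) (Cmp D (Idn D (FO F X')) (FA F f))) =
        Cmp C (FA G (Idn D (FO F X'))) (Cmp C (\<eta> X') f)"
      using nat[of f "Idn D (FO F X')" "Idn D (FO F X')"] X FX f D.Idn_Hom[OF FX[OF X(2)]] C.HomD[OF f]
      by (simp add: \<eta>_def)
    moreover have "Cmp D (Idn D (FO F X')) (Cmp D (Idn D (FO F X')) (FA F f)) = FA F f"
      using Ff by (simp add: D.Hom_iff)
    moreover have "Cmp C (FA G (Idn D (FO F X'))) (Cmp C (\<eta> X') f) = Cmp C (\<eta> X') f"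
      using functor_Idn[OF G FX[OF X(2)]] \<eta>[OF X(2)] f by (simp add: C.Hom_iff)
    ultimately show ?thesis using \<phi>[OF X(1) Ff] by simp
  qed
  from this[OF C.Arr_Hom] have "nat_trans C C id_functor (G \<circ>\<^sub>F F) \<eta>"
    using \<eta> by (simp add: nat_trans_def id_functor_def comp_functor_def)
  ultimately show ?thesis unfolding is_unit_def by blast
qed

lemma left_adjoint_counit:
  assumes adj: "left_adjoint C D F G" and C: "category C" and D: "category D"
  shows "\<exists>\<epsilon>. is_counit C D F G \<epsilon>"
proof -
  interpret C: category C by fact
  interpret D: category D by fact
  have F: "is_functor C D F" and G: "is_functor D C G" using adj by (auto simp: left_adjoint_def)
  obtain \<eta> where unit: "is_unit C D F G \<eta>" using left_adjoint_unit[OF adj C D] by blast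
  note \<eta> = C.unit_Hom[OF unit] and un = unit_unique[OF C D G unit] and nat = C.unit_nat[OF unit]
  have GY: "FO G Y \<in> Obj C" if "Y \<in> Obj D" for Y using functor_Obj[OF G that] .
  have "\<exists>e. e \<in> Hom D (FO F (FO G Y)) Y \<and> Cmp C (FA G e) (\<eta> (FO G Y)) = Idn C (FO G Y)"
    if "Y \<in> Obj D" for Y using C.unit_lift[OF unit that C.Idn_Hom[OF GY[OF that]]] by metis
  then obtain \<epsilon> where \<epsilon>: "\<And>Y. Y \<in> Obj D \<Longrightarrow> \<epsilon> Y \<in> Hom D (FO F (FO G Y)) Y"
    and tri: "\<And>Y. Y \<in> Obj D \<Longrightarrow> Cmp C (FA G (\<epsilon> Y)) (\<eta> (FO G Y)) = Idn C (FO G Y)"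
    by metis
  have key: "Cmp C (FA G (Cmp D (\<epsilon> Y) (FA F u))) (\<eta> X) = u" if Y: "Y \<in> Obj D" and u: "u \<in> Hom C X (FO G Y)" for X Y u
  proof -
    have X: "X \<in> Obj C" using u by (simp add: C.Hom_iff)
    have Fu: "FA F u \<in> Hom D (FO F X) (FO F (FO G Y))" using functor_Hom[OF F u] .
    have "Cmp C (FA G (Cmp D (\<epsilon> Y) (FA F u))) (\<eta> X) = Cmp C (FA G (\<epsilon> Y)) (Cmp C (FA G (FA F u)) (\<eta> X))"
      using functor_Cmp[OF G Fu \<epsilon>[OF Y]] functor_Hom[OF G Fu] functor_Hom[OF G \<epsilon>[OF Y]] \<eta>[OF X]
      by (simp add: C.Hom_iff)
    also have "\<dots> = Cmp C (FA G (\<epsilon> Y)) (Cmp C (\<eta> (FO G Y)) u)" using nat[OF u] by simp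
    also have "\<dots> = Cmp C (Idn C (FO G Y)) u"
      using C.Cmp_push[OF tri[OF Y] \<eta>[OF GY[OF Y]] functor_Hom[OF G \<epsilon>[OF Y]] u] .
    also have "\<dots> = u" using u by (simp add: C.Hom_iff)
    finally show ?thesis .
  qed
  have "\<exists>!u. u \<in> Hom C X (FO G Y) \<and> Cmp D (\<epsilon> Y) (FA F u) = a"
    if X: "X \<in> Obj C" and Y: "Y \<in> Obj D" and a: "a \<in> Hom D (FO F X) Y" for X Y a
  proof -
    let ?u = "Cmp C (FA G a) (\<eta> X)"
    have u: "?u \<in> Hom C X (FO G Y)" using C.Cmp_Hom[OF \<eta>[OF X] functor_Hom[OF G a]] .
    have "Cmp D (\<epsilon> Y) (FA F ?u) \<in> Hom D (FO F X) Y" using D.Cmp_Hom[OF functor_Hom[OF F u] \<epsilon>[OF Y]] .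
    from un[OF X this a key[OF Y u]] show ?thesis using u key[OF Y] by metis
  qed
  moreover have "Cmp D (\<epsilon> Y') (FA F (FA G f)) = Cmp D f (\<epsilon> Y)" if f: "f \<in> Hom D Y Y'" for Y Y' f
  proof -
    have Y: "Y \<in> Obj D" "Y' \<in> Obj D" using f by (auto simp: D.Hom_iff)
    have Gf: "FA G f \<in> Hom C (FO G Y) (FO G Y')" using functor_Hom[OF G f] .
    have "Cmp C (FA G (Cmp D f (\<epsilon> Y))) (\<eta> (FO G Y)) = Cmp C (FA G f) (Cmp C (FA G (\<epsilon> Y)) (\<eta> (FO G Y)))"
      using functor_Cmp[OF G \<epsilon>[OF Y(1)] f] functor_Hom[OF G \<epsilon>[OF Y(1)]] Gf \<eta>[OF GY[OF Y(1)]]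
      by (simp add: C.Hom_iff)
    also have "\<dots> = FA G f" using tri[OF Y(1)] Gf by (simp add: C.Hom_iff)
    finally have "Cmp C (FA G (Cmp D (\<epsilon> Y') (FA F (FA G f)))) (\<eta> (FO G Y)) = Cmp C (FA G (Cmp D f (\<epsilon> Y))) (\<eta> (FO G Y))"
      using key[OF Y(2) Gf] by simp
    then show ?thesis
      using un[OF GY[OF Y(1)] D.Cmp_Hom[OF functor_Hom[OF F Gf] \<epsilon>[OF Y(2)]] D.Cmp_Hom[OF \<epsilon>[OF Y(1)] f]] by blast
  qed
  from this[OF D.Arr_Hom] have "nat_trans D D (F \<circ>\<^sub>F G) id_functor \<epsilon>"
    using \<epsilon> by (simp add: nat_trans_def id_functor_def comp_functor_def)
  ultimately show ?thesis unfolding is_counit_def by blast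
qed

lemma full_sub_simps [simp]:
  "Obj (full_sub C S) = Obj C \<inter> S"
  "Cmp (full_sub C S) = Cmp C" "Idn (full_sub C S) = Idn C" "Pls (full_sub C S) = Pls C"
  "Nul (full_sub C S) = Nul C" "Dom (full_sub C S) = Dom C" "Cod (full_sub C S) = Cod C"
  by (simp_all add: full_sub_def)

lemma Hom_full_sub: "X \<in> S \<Longrightarrow> Y \<in> S \<Longrightarrow> Hom (full_sub C S) X Y = Hom C X Y"
  by (auto simp: Hom_def full_sub_def)

section \<open>Projective generators coming from a fully faithful functor\<close>

text \<open>The category of finitely presented functors enters the argument through these properties of the Yoneda embedding
  \<open>Y\<close>. The arrows from \<open>Y U\<close> to \<open>F\<close> play the role of the elements of \<open>F\<close> at \<open>U\<close>.\<close>

locale representables = A: abelian A + C: abelian C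
  for A :: "('o, 'm) cat" and C :: "('p, 'n) cat" +
  fixes Y :: "('o, 'm, 'p, 'n) fctr"
  assumes Y_additive: "additive_functor A C Y"
    and Y_fully_faithful: "fully_faithful A C Y"
    and presentation: "F \<in> Obj C \<Longrightarrow> \<exists>f \<in> Arr A. \<exists>q. is_cokernel C (FA Y f) F q"
    and Y_projective: "U \<in> Obj A \<Longrightarrow> projective C (FO Y U)"
begin

abbreviation cmpA (infixr "\<cdot>" 70) where "g \<cdot> f \<equiv> Cmp A g f"
abbreviation cmpC (infixr "\<bullet>" 70) where "g \<bullet> f \<equiv> Cmp C g f"
abbreviation "Yo \<equiv> FO Y"
abbreviation "Ya \<equiv> FA Y"

lemmas Hom_iffs = A.Hom_iff C.Hom_iff

lemma Y_functor: "is_functor A C Y"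
  using Y_additive by (simp add: additive_functor_def)

lemmas Y_Hom = functor_Hom[OF Y_functor]

lemma Yo_Obj [simp]: "X \<in> Obj A \<Longrightarrow> Yo X \<in> Obj C"
  using functor_Obj[OF Y_functor] .

lemma Ya_Arr [simp]: "f \<in> Arr A \<Longrightarrow> Ya f \<in> Arr C"
  and Dom_Ya [simp]: "f \<in> Arr A \<Longrightarrow> Dom C (Ya f) = Yo (Dom A f)"
  and Cod_Ya [simp]: "f \<in> Arr A \<Longrightarrow> Cod C (Ya f) = Yo (Cod A f)"
  using Y_Hom[OF A.Arr_Hom] by (auto simp: C.Hom_iff)

lemma Ya_Cmp [simp]: "f \<in> Arr A \<Longrightarrow> g \<in> Arr A \<Longrightarrow> Dom A g = Cod A f \<Longrightarrow> Ya (g \<cdot> f) = Ya g \<bullet> Ya f"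
  using functor_Cmp[OF Y_functor A.Arr_Hom, of f g "Cod A g"] by (simp add: Hom_def)

lemma Ya_Idn [simp]: "X \<in> Obj A \<Longrightarrow> Ya (Idn A X) = Idn C (Yo X)"
  using functor_Idn[OF Y_functor] .

lemma Ya_Nul [simp]: "X \<in> Obj A \<Longrightarrow> X' \<in> Obj A \<Longrightarrow> Ya (Nul A X X') = Nul C (Yo X) (Yo X')"
  using additive_Nul[OF Y_additive A.preadditive_axioms C.preadditive_axioms] .

lemmas Ya_Pls = additive_Pls[OF Y_additive A.category_axioms]

lemma Y_full:
  assumes "a \<in> Hom C (Yo U) (Yo V)" "U \<in> Obj A" "V \<in> Obj A"
  obtains c where "c \<in> Hom A U V" "Ya c = a"
proof -
  have "a \<in> Ya ` Hom A U V"
    using Y_fully_faithful assms unfolding fully_faithful_def bij_betw_def by blast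
  then show ?thesis using that by blast
qed

lemma Y_faithful: "c \<in> Hom A U V \<Longrightarrow> d \<in> Hom A U V \<Longrightarrow> Ya c = Ya d \<Longrightarrow> c = d"
  using Y_fully_faithful A.HomD(4,5) unfolding fully_faithful_def bij_betw_def inj_on_def by metis

lemma Y_faithful_Nul: "c \<in> Hom A U V \<Longrightarrow> Ya c = Nul C (Yo U) (Yo V) \<Longrightarrow> c = Nul A U V"
  using Y_faithful[of c U V "Nul A U V"] by (simp add: A.Hom_iff)

lemma obtain_presentation:
  assumes "F \<in> Obj C"
  obtains f B D q where "f \<in> Hom A B D" "is_cokernel C (Ya f) F q" "q \<in> Hom C (Yo D) F" "epi_arr C q"
proof -
  obtain f q where f: "f \<in> Arr A" "is_cokernel C (Ya f) F q" using presentation[OF assms] by blast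
  show ?thesis using that[OF A.Arr_Hom[OF f(1)] f(2)] C.is_cokernelD[OF f(2) Y_Hom[OF A.Arr_Hom[OF f(1)]]] by blast
qed

lemma mono_test:
  assumes m: "m \<in> Hom C M N"
    and z: "\<And>U a. U \<in> Obj A \<Longrightarrow> a \<in> Hom C (Yo U) M \<Longrightarrow> m \<bullet> a = Nul C (Yo U) N \<Longrightarrow> a = Nul C (Yo U) M"
  shows "mono_arr C m"
proof (rule C.mono_arrI[OF m])
  fix W a assume a: "a \<in> Hom C W M" "m \<bullet> a = Nul C W N"
  obtain f B D q where f: "f \<in> Hom A B D" and q: "q \<in> Hom C (Yo D) W" "epi_arr C q"
    using obtain_presentation a(1) C.HomD(4) by metis
  have D: "D \<in> Obj A" using A.HomD[OF f] by simp
  have "m \<bullet> a \<bullet> q = Nul C (Yo D) N" using C.Cmp_push[OF a(2,1) m q(1)] m q(1) by (simp add: C.Hom_iff)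
  then have "a \<bullet> q = Nul C (Yo D) M" using z[OF D C.Cmp_Hom[OF q(1) a(1)]] by simp
  then show "a = Nul C W M" using C.epi_Nul[OF q(2,1) a(1)] by simp
qed

lemma epi_test:
  assumes m: "m \<in> Hom C M N"
    and l: "\<And>U a. U \<in> Obj A \<Longrightarrow> a \<in> Hom C (Yo U) N \<Longrightarrow> \<exists>b \<in> Hom C (Yo U) M. m \<bullet> b = a"
  shows "epi_arr C m"
proof -
  obtain f B D q where f: "f \<in> Hom A B D" and q: "q \<in> Hom C (Yo D) N" "epi_arr C q"
    using obtain_presentation m C.HomD(5) by metis
  have D: "D \<in> Obj A" using A.HomD[OF f] by simp
  obtain b where b: "b \<in> Hom C (Yo D) M" "m \<bullet> b = q" using l[OF D q(1)] by blast
  show ?thesis using C.epi_of_epi_Cmp[of m b, OF _ b(1) m] b(2) q(2) by simp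
qed

text \<open>Present \<open>W\<close> by \<open>f: B \<rightarrow> D\<close>. The lift exists on the generator \<open>Y D\<close>; it vanishes on the relations \<open>Y B\<close>, because \<open>m\<close>
  and \<open>m'\<close> are jointly monic there, and so it descends to \<open>W\<close>.\<close>

lemma joint_lift_test:
  assumes m: "m \<in> Hom C M N" and m': "m' \<in> Hom C M N'"
    and a: "a \<in> Hom C W N" and a': "a' \<in> Hom C W N'"
    and joint_mono: "\<And>U t. U \<in> Obj A \<Longrightarrow> t \<in> Hom C (Yo U) M \<Longrightarrow> m \<bullet> t = Nul C (Yo U) N \<Longrightarrow>
        m' \<bullet> t = Nul C (Yo U) N' \<Longrightarrow> t = Nul C (Yo U) M"
    and lift: "\<And>U y. U \<in> Obj A \<Longrightarrow> y \<in> Hom C (Yo U) W \<Longrightarrow>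
        \<exists>t \<in> Hom C (Yo U) M. m \<bullet> t = a \<bullet> y \<and> m' \<bullet> t = a' \<bullet> y"
  shows "\<exists>t \<in> Hom C W M. m \<bullet> t = a \<and> m' \<bullet> t = a'"
proof -
  obtain f B D q where f: "f \<in> Hom A B D" and cok: "is_cokernel C (Ya f) W q"
    and q: "q \<in> Hom C (Yo D) W" "epi_arr C q"
    using obtain_presentation a C.HomD(4) by metis
  have BD: "B \<in> Obj A" "D \<in> Obj A" using A.HomD[OF f] by simp_all
  note Yf = Y_Hom[OF f] and qf = C.is_cokernelD(2)[OF cok Y_Hom[OF f]]
  obtain t where t: "t \<in> Hom C (Yo D) M" "m \<bullet> t = a \<bullet> q" "m' \<bullet> t = a' \<bullet> q"
    using lift[OF BD(2) q(1)] by blast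
  have "m \<bullet> t \<bullet> Ya f = a \<bullet> q \<bullet> Ya f" using C.Cmp_swap[OF t(2) t(1) m q(1) a Yf] .
  then have 1: "m \<bullet> t \<bullet> Ya f = Nul C (Yo B) N" using qf a BD by (simp add: C.Hom_iff)
  have "m' \<bullet> t \<bullet> Ya f = a' \<bullet> q \<bullet> Ya f" using C.Cmp_swap[OF t(3) t(1) m' q(1) a' Yf] .
  then have 2: "m' \<bullet> t \<bullet> Ya f = Nul C (Yo B) N'" using qf a' BD by (simp add: C.Hom_iff)
  have "t \<bullet> Ya f = Nul C (Yo B) M" using joint_mono[OF BD(1) C.Cmp_Hom[OF Yf t(1)] 1 2] .
  then obtain s where s: "s \<in> Hom C W M" "s \<bullet> q = t" using C.is_cokernel_desc[OF cok Yf t(1)] by blast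
  have "(m \<bullet> s) \<bullet> q = a \<bullet> q" "(m' \<bullet> s) \<bullet> q = a' \<bullet> q"
    using s t m m' q(1) by (auto simp: C.Hom_iff)
  then have "m \<bullet> s = a" "m' \<bullet> s = a'"
    using C.epi_arrD[OF q(2,1) C.Cmp_Hom[OF s(1) m] a] C.epi_arrD[OF q(2,1) C.Cmp_Hom[OF s(1) m'] a'] by blast+
  then show ?thesis using s(1) by blast
qed

lemma kernel_test:
  assumes n: "n \<in> Hom C M N" and m: "m \<in> Hom C K M" "n \<bullet> m = Nul C K N"
    and mono: "\<And>U a. U \<in> Obj A \<Longrightarrow> a \<in> Hom C (Yo U) K \<Longrightarrow> m \<bullet> a = Nul C (Yo U) M \<Longrightarrow> a = Nul C (Yo U) K"
    and lift: "\<And>U a. U \<in> Obj A \<Longrightarrow> a \<in> Hom C (Yo U) M \<Longrightarrow> n \<bullet> a = Nul C (Yo U) N \<Longrightarrow>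
      \<exists>u \<in> Hom C (Yo U) K. m \<bullet> u = a"
  shows "is_kernel C n K m"
proof (rule C.is_kernelI[OF n m mono_test[OF m(1) mono]])
  fix W a assume a: "a \<in> Hom C W M" "n \<bullet> a = Nul C W N"
  have "\<exists>t \<in> Hom C W K. m \<bullet> t = a \<and> m \<bullet> t = a"
  proof (rule joint_lift_test[OF m(1) m(1) a(1) a(1)])
    fix U y assume U: "U \<in> Obj A" and y: "y \<in> Hom C (Yo U) W"
    have "n \<bullet> a \<bullet> y = Nul C (Yo U) N" using C.Cmp_push[OF a(2,1) n y] y n by (simp add: C.Hom_iff)
    then show "\<exists>t\<in>Hom C (Yo U) K. m \<bullet> t = a \<bullet> y \<and> m \<bullet> t = a \<bullet> y"
      using lift[OF U C.Cmp_Hom[OF y a(1)]] by blast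
  qed (use mono in blast)
  then show "\<exists>u\<in>Hom C W K. m \<bullet> u = a" by blast
qed auto

end

section \<open>The defect and its adjoints\<close>

text \<open>The defect recollement: \<open>w\<close> is the defect \<open>j_upper\<close>, with left adjoint \<open>l\<close> (that is, \<open>j_lshriek\<close>) and right adjoint
  \<open>Y\<close>; \<open>D\<close> is its kernel, and \<open>R\<close> and \<open>S\<close> are the reflection \<open>i_upper\<close> and the coreflection \<open>i_ushriek\<close>. The
  adjunctions are given by units \<open>\<eta>: F \<rightarrow> Y (w F)\<close>, \<open>\<theta>: X \<rightarrow> w (l X)\<close>, \<open>r: F \<rightarrow> R F\<close> and by the counit \<open>s: S F \<rightarrow> F\<close>. The
  stable Yoneda functor \<open>T\<close> comes with the projection \<open>p: Y \<rightarrow> T\<close>, and \<open>p_cokernel\<close> says that \<open>T X\<close> is \<open>Y X\<close> modulo the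
  arrows through a projective.\<close>

locale defect = representables A C Y
  for A :: "('o, 'm) cat" and C :: "('p, 'n) cat" and Y :: "('o, 'm, 'p, 'n) fctr" +
  fixes w :: "('p, 'n, 'o, 'm) fctr" and l :: "('o, 'm, 'p, 'n) fctr"
    and R S :: "('p, 'n, 'p, 'n) fctr" and T :: "('o, 'm, 'p, 'n) fctr"
    and D :: "('p, 'n) cat"
    and \<eta> :: "'p \<Rightarrow> 'n" and \<theta> :: "'o \<Rightarrow> 'm" and r s :: "'p \<Rightarrow> 'n" and p :: "'o \<Rightarrow> 'n"
  assumes D_def: "D = full_sub C {F. is_zero A (FO w F)}"
    and enough: "enough_projectives A"
    and D_abelian: "abelian D"
    and w_functor: "is_functor C A w" and l_functor: "is_functor A C l"
    and R_functor: "is_functor C D R" and S_functor: "is_functor C D S"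
    and unit_w: "is_unit C A w Y \<eta>" and unit_l: "is_unit A C l w \<theta>"
    and unit_R: "is_unit C D R id_functor r" and counit_S: "is_counit D C id_functor S s"
    and l_right_exact: "right_exact A C l"
    and l_fully_faithful: "fully_faithful A C l"
    and l_Y: "nat_isomorphic (full_sub A {P. projective A P}) C l Y"
    and T_Hom: "a \<in> Hom A X X' \<Longrightarrow> FA T a \<in> Hom C (FO T X) (FO T X')"
    and p_Hom: "X \<in> Obj A \<Longrightarrow> p X \<in> Hom C (FO Y X) (FO T X)"
    and p_nat: "a \<in> Hom A X X' \<Longrightarrow> Cmp C (FA T a) (p X) = Cmp C (p X') (FA Y a)"
    and p_cokernel: "projective A P \<Longrightarrow> e \<in> Hom A P X \<Longrightarrow> epi_arr A e \<Longrightarrow>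
      is_cokernel C (FA Y e) (FO T X) (p X)"
begin

abbreviation "wo \<equiv> FO w"
abbreviation "wa \<equiv> FA w"
abbreviation "Ro \<equiv> FO R"
abbreviation "Ra \<equiv> FA R"
abbreviation "So \<equiv> FO S"
abbreviation "Sa \<equiv> FA S"
abbreviation "lo \<equiv> FO l"
abbreviation "la \<equiv> FA l"
abbreviation "To \<equiv> FO T"
abbreviation "Ta \<equiv> FA T"

lemma D_simps [simp]:
  "Cmp D = Cmp C" "Idn D = Idn C" "Pls D = Pls C" "Nul D = Nul C" "Dom D = Dom C" "Cod D = Cod C"
  by (simp_all add: D_def)

lemma D_iff: "F \<in> Obj D \<longleftrightarrow> F \<in> Obj C \<and> is_zero A (wo F)"
  by (auto simp: D_def)

lemma D_Obj: "F \<in> Obj D \<Longrightarrow> F \<in> Obj C"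
  by (simp add: D_iff)

lemma Hom_D: "V \<in> Obj D \<Longrightarrow> V' \<in> Obj D \<Longrightarrow> Hom D V V' = Hom C V V'"
  by (auto simp: D_iff Hom_def D_def full_sub_def)

lemma Hom_D_subset: "f \<in> Hom D V V' \<Longrightarrow> f \<in> Hom C V V'"
  by (auto simp: Hom_def D_def full_sub_def)

lemma D_category: "category D"
  using D_abelian by (simp add: abelian_def preadditive_def)

lemma D_preadditive: "preadditive D"
  using D_abelian by (simp add: abelian_def)

lemma wo_Obj: "F \<in> Obj C \<Longrightarrow> wo F \<in> Obj A"
  using functor_Obj[OF w_functor] .

lemmas wa_Hom = functor_Hom[OF w_functor]
lemmas \<eta>_Hom = C.unit_Hom[OF unit_w]
lemmas \<eta>_lift = C.unit_lift[OF unit_w]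
lemmas \<eta>_nat = C.unit_nat[OF unit_w]
lemmas \<eta>_unique = unit_unique[OF C.category_axioms A.category_axioms Y_functor unit_w]

lemma Ro_D: "F \<in> Obj C \<Longrightarrow> Ro F \<in> Obj D"
  using functor_Obj[OF R_functor] .

lemma Ro_Obj: "F \<in> Obj C \<Longrightarrow> Ro F \<in> Obj C"
  using Ro_D D_Obj by blast

lemma Ra_Hom: "f \<in> Hom C F F' \<Longrightarrow> Ra f \<in> Hom C (Ro F) (Ro F')"
  using functor_Hom[OF R_functor] Hom_D_subset by blast

lemma r_Hom: "F \<in> Obj C \<Longrightarrow> r F \<in> Hom C F (Ro F)"
  using C.unit_Hom[OF unit_R] by (simp add: id_functor_def)

lemma r_nat: "f \<in> Hom C F F' \<Longrightarrow> Ra f \<bullet> r F = r F' \<bullet> f"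
  using C.unit_nat[OF unit_R] by (simp add: id_functor_def)

lemma r_lift:
  assumes "V \<in> Obj D" "a \<in> Hom C F V"
  obtains u where "u \<in> Hom C (Ro F) V" "u \<bullet> r F = a"
proof -
  obtain u where "u \<in> Hom D (Ro F) V" "FA id_functor u \<bullet> r F = a"
    using C.unit_lift[OF unit_R assms(1), of a F] assms(2) by (auto simp: id_functor_def)
  then show ?thesis using that[OF Hom_D_subset] by (simp add: id_functor_def)
qed

lemma r_unique:
  assumes F: "F \<in> Obj C" and V: "V \<in> Obj D" and u: "u \<in> Hom C (Ro F) V" and v: "v \<in> Hom C (Ro F) V"
    and eq: "u \<bullet> r F = v \<bullet> r F"
  shows "u = v"
proof -
  have "is_functor D C id_functor" by (auto simp: is_functor_def id_functor_def D_iff D_def full_sub_def Hom_def)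
  from unit_unique[OF C.category_axioms D_category this unit_R F, of u V v] show ?thesis
    using u v eq Hom_D[OF Ro_D[OF F] V] by (simp add: id_functor_def)
qed

lemma So_D: "F \<in> Obj C \<Longrightarrow> So F \<in> Obj D"
  using functor_Obj[OF S_functor] .

lemma Sa_Hom: "f \<in> Hom C F F' \<Longrightarrow> Sa f \<in> Hom C (So F) (So F')"
  using functor_Hom[OF S_functor] Hom_D_subset by blast

lemma s_Hom: "F \<in> Obj C \<Longrightarrow> s F \<in> Hom C (So F) F"
  using C.counit_Hom[OF counit_S] by (simp add: id_functor_def)

lemma s_nat: "f \<in> Hom C F F' \<Longrightarrow> s F' \<bullet> Sa f = f \<bullet> s F"
  using C.counit_nat[OF counit_S] by (simp add: id_functor_def)

lemma s_lift:
  assumes "V \<in> Obj D" "a \<in> Hom C V F"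
  obtains u where "u \<in> Hom C V (So F)" "s F \<bullet> u = a"
proof -
  obtain u where "u \<in> Hom D V (So F)" "s F \<bullet> FA id_functor u = a"
    using C.counit_lift[OF counit_S assms(1), of a F] assms(2) by (auto simp: id_functor_def)
  then show ?thesis using that[OF Hom_D_subset] by (simp add: id_functor_def)
qed

lemma s_unique:
  assumes F: "F \<in> Obj C" and V: "V \<in> Obj D" and u: "u \<in> Hom C V (So F)" and v: "v \<in> Hom C V (So F)"
    and eq: "s F \<bullet> u = s F \<bullet> v"
  shows "u = v"
proof -
  have "is_functor D C id_functor" by (auto simp: is_functor_def id_functor_def D_iff D_def full_sub_def Hom_def)
  from counit_unique[OF C.category_axioms D_category this counit_S F, of u V v] show ?thesis
    using u v eq Hom_D[OF V So_D[OF F]] by (simp add: id_functor_def)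
qed

text \<open>By adjunction, arrows from \<open>F\<close> to \<open>Y X\<close> correspond to arrows from \<open>w F\<close> to \<open>X\<close>. So membership in \<open>D\<close> can be tested
  on arrows to representables.\<close>

lemma D_to_Y:
  assumes V: "V \<in> Obj D" and a: "a \<in> Hom C V (Yo X)" and X: "X \<in> Obj A"
  shows "a = Nul C V (Yo X)"
proof -
  obtain u where u: "u \<in> Hom A (wo V) X" "Ya u \<bullet> \<eta> V = a" using \<eta>_lift[OF X a] .
  have "u = Nul A (wo V) X" using A.from_zero[OF _ u(1)] V by (simp add: D_iff)
  then show ?thesis using u \<eta>_Hom[OF D_Obj[OF V]] X by (auto simp: Hom_iffs)
qed

lemma D_I:
  assumes F: "F \<in> Obj C" and z: "\<And>X a. X \<in> Obj A \<Longrightarrow> a \<in> Hom C F (Yo X) \<Longrightarrow> a = Nul C F (Yo X)"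
  shows "F \<in> Obj D"
proof -
  note wF = wo_Obj[OF F] and \<eta>F = \<eta>_Hom[OF F]
  have "Ya (Idn A (wo F)) \<bullet> \<eta> F = Ya (Nul A (wo F) (wo F)) \<bullet> \<eta> F"
    using z[OF wF \<eta>F] wF \<eta>F by (simp add: Hom_iffs)
  then have "Idn A (wo F) = Nul A (wo F) (wo F)"
    using \<eta>_unique[OF F A.Idn_Hom[OF wF] A.Nul_Hom[OF wF wF]] by simp
  then show ?thesis using A.is_zeroI[OF wF] F by (simp add: D_iff)
qed

text \<open>If \<open>V\<close> in \<open>D\<close> is presented by \<open>f\<close>, then \<open>f\<close> is an epimorphism of \<open>A\<close>, since \<open>V\<close> has no nonzero arrows to representables.
  So an element of \<open>V\<close> at a projective lifts first to the generator and then along \<open>f\<close> to the relations.\<close>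

lemma Y_projective_to_D:
  assumes P: "projective A P" and V: "V \<in> Obj D" and a: "a \<in> Hom C (Yo P) V"
  shows "a = Nul C (Yo P) V"
proof -
  have Po: "P \<in> Obj A" using A.projective_Obj[OF P] .
  obtain f B D0 q where f: "f \<in> Hom A B D0" and cok: "is_cokernel C (Ya f) V q"
    and q: "q \<in> Hom C (Yo D0) V" "epi_arr C q"
    using obtain_presentation[OF D_Obj[OF V]] .
  have BD: "B \<in> Obj A" "D0 \<in> Obj A" using A.HomD[OF f] by auto
  have "epi_arr A f"
  proof (rule A.epi_arrI[OF f])
    fix W x assume x: "x \<in> Hom A D0 W" "x \<cdot> f = Nul A B W"
    have W: "W \<in> Obj A" using x by (simp add: A.Hom_iff)
    have "Ya x \<bullet> Ya f = Nul C (Yo B) (Yo W)" using x f W BD by (simp add: Hom_iffs flip: Ya_Cmp)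
    then obtain u where u: "u \<in> Hom C V (Yo W)" "u \<bullet> q = Ya x"
      using C.is_cokernel_desc[OF cok Y_Hom[OF f] Y_Hom[OF x(1)]] by blast
    have "u = Nul C V (Yo W)" using D_to_Y[OF V u(1) W] .
    then have "Ya x = Nul C (Yo D0) (Yo W)" using u q by (auto simp: Hom_iffs)
    then show "x = Nul A D0 W" using Y_faithful_Nul x by blast
  qed
  obtain b where b: "b \<in> Hom C (Yo P) (Yo D0)" "q \<bullet> b = a"
    using C.projectiveD[OF Y_projective[OF Po] q(2,1) a] .
  obtain b' where b': "b' \<in> Hom A P D0" "Ya b' = b" using Y_full[OF b(1) Po BD(2)] .
  obtain b'' where b'': "b'' \<in> Hom A P B" "f \<cdot> b'' = b'" using A.projectiveD[OF P \<open>epi_arr A f\<close> f b'(1)] .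
  have "Ya b' = Ya f \<bullet> Ya b''" using b'' f by (auto simp: A.Hom_iff)
  then have "a = q \<bullet> Ya f \<bullet> Ya b''" using b(2) b'(2) by simp
  also have "\<dots> = Nul C (Yo P) V"
    using C.Cmp_push[OF C.is_cokernelD(2)[OF cok Y_Hom[OF f]] Y_Hom[OF f] q(1) Y_Hom[OF b''(1)]] b'' BD V
    by (simp add: Hom_iffs D_Obj)
  finally show ?thesis .
qed

lemma obtain_projective_cover:
  assumes "X \<in> Obj A"
  obtains P e where "projective A P" "e \<in> Hom A P X" "epi_arr A e"
  using enough assms unfolding enough_projectives_def by blast

lemma p_epi: assumes "X \<in> Obj A" shows "epi_arr C (p X)"
proof -
  obtain P e where "projective A P" "e \<in> Hom A P X" "epi_arr A e" using obtain_projective_cover[OF assms] .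
  then show ?thesis using C.is_cokernelD(3)[OF p_cokernel Y_Hom] by blast
qed

lemma To_D: assumes X: "X \<in> Obj A" shows "To X \<in> Obj D"
proof (rule D_I)
  note pX = p_Hom[OF X]
  show "To X \<in> Obj C" using pX by (simp add: C.Hom_iff)
  fix Z a assume Z: "Z \<in> Obj A" and a: "a \<in> Hom C (To X) (Yo Z)"
  obtain P e where P: "projective A P" and e: "e \<in> Hom A P X" "epi_arr A e"
    using obtain_projective_cover[OF X] .
  obtain x where x: "x \<in> Hom A X Z" "Ya x = a \<bullet> p X" using Y_full[OF C.Cmp_Hom[OF pX a] X Z] .
  have "p X \<bullet> Ya e = Nul C (Yo P) (To X)" using C.is_cokernelD(2)[OF p_cokernel[OF P e] Y_Hom[OF e(1)]] .
  then have "Ya (x \<cdot> e) = Nul C (Yo P) (Yo Z)"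
    using x e a pX by (simp add: Hom_iffs)
  then have "x \<cdot> e = Nul A P Z" using Y_faithful_Nul A.Cmp_Hom[OF e(1) x(1)] by blast
  then have "x = Nul A X Z" using A.epi_Nul[OF e(2,1) x(1)] by blast
  then have "a \<bullet> p X = Nul C (Yo X) (Yo Z)" using x(2) X Z by simp
  then show "a = Nul C (To X) (Yo Z)" using C.epi_Nul[OF p_epi[OF X] pX a] by blast
qed

lemma To_Obj: "X \<in> Obj A \<Longrightarrow> To X \<in> Obj C"
  using To_D D_Obj by blast

lemma p_lift:
  assumes V: "V \<in> Obj D" and a: "a \<in> Hom C (Yo X) V" and X: "X \<in> Obj A"
  obtains u where "u \<in> Hom C (To X) V" "u \<bullet> p X = a"
proof -
  obtain P e where P: "projective A P" and e: "e \<in> Hom A P X" "epi_arr A e"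
    using obtain_projective_cover[OF X] .
  have "a \<bullet> Ya e = Nul C (Yo P) V" using Y_projective_to_D[OF P V C.Cmp_Hom[OF Y_Hom[OF e(1)] a]] .
  then show ?thesis using C.is_cokernel_desc[OF p_cokernel[OF P e] Y_Hom[OF e(1)] a] that by blast
qed

text \<open>Arrows from \<open>Y P\<close> to \<open>T X\<close> vanish for projective \<open>P\<close>. Conversely, an element in the kernel of \<open>p X\<close> lifts along a projective
  cover of \<open>X\<close>.\<close>

lemma p_zero_iff:
  assumes g: "g \<in> Hom A U X"
  shows "p X \<bullet> Ya g = Nul C (Yo U) (To X) \<longleftrightarrow> (\<exists>P y h. projective A P \<and> h \<in> Hom A U P \<and> y \<in> Hom A P X \<and> g = y \<cdot> h)"
proof
  have UX: "U \<in> Obj A" "X \<in> Obj A" using A.HomD[OF g] by auto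
  note pX = p_Hom[OF UX(2)]
  assume z: "p X \<bullet> Ya g = Nul C (Yo U) (To X)"
  obtain P e where P: "projective A P" and e: "e \<in> Hom A P X" "epi_arr A e"
    using obtain_projective_cover[OF UX(2)] .
  obtain k where k: "k \<in> Hom C (Yo U) (Yo P)" "Ya e \<bullet> k = Ya g"
    using C.projective_lift_cokernel[OF p_cokernel[OF P e] Y_Hom[OF e(1)] Y_projective[OF UX(1)] Y_Hom[OF g] z] .
  obtain h where h: "h \<in> Hom A U P" "Ya h = k" using Y_full[OF k(1) UX(1) A.projective_Obj[OF P]] .
  have "Ya (e \<cdot> h) = Ya g" using e h k by (simp add: Hom_iffs)
  then have "g = e \<cdot> h" using Y_faithful[OF A.Cmp_Hom[OF h(1) e(1)] g] by simp
  then show "\<exists>P y h. projective A P \<and> h \<in> Hom A U P \<and> y \<in> Hom A P X \<and> g = y \<cdot> h" using P e h by blast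
next
  have UX: "U \<in> Obj A" "X \<in> Obj A" using A.HomD[OF g] by auto
  note pX = p_Hom[OF UX(2)]
  assume "\<exists>P y h. projective A P \<and> h \<in> Hom A U P \<and> y \<in> Hom A P X \<and> g = y \<cdot> h"
  then obtain P y h where P: "projective A P" and h: "h \<in> Hom A U P" and y: "y \<in> Hom A P X" and gy: "g = y \<cdot> h" by blast
  have "p X \<bullet> Ya y = Nul C (Yo P) (To X)" using Y_projective_to_D[OF P To_D[OF UX(2)] C.Cmp_Hom[OF Y_Hom[OF y] pX]] .
  then show "p X \<bullet> Ya g = Nul C (Yo U) (To X)"
    using C.Cmp_push[OF _ Y_Hom[OF y] pX Y_Hom[OF h]] gy y h pX by (simp add: Hom_iffs)
qed

lemma p_zero_iff_projective:
  assumes K: "K \<in> Obj A"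
  shows "p K = Nul C (Yo K) (To K) \<longleftrightarrow> projective A K"
proof
  assume "p K = Nul C (Yo K) (To K)"
  then have "p K \<bullet> Ya (Idn A K) = Nul C (Yo K) (To K)" using p_Hom[OF K] K by (simp add: C.Hom_iff)
  then obtain P y h where "projective A P" "h \<in> Hom A K P" "y \<in> Hom A P K" "Idn A K = y \<cdot> h"
    using p_zero_iff[OF A.Idn_Hom[OF K]] by blast
  then show "projective A K" using A.projective_retract by metis
next
  assume "projective A K"
  then show "p K = Nul C (Yo K) (To K)" using Y_projective_to_D To_D p_Hom K by blast
qed

text \<open>Let \<open>Y X\<close> be a generator of \<open>F\<close> and \<open>P\<close> a projective cover of \<open>X\<close>. An arrow from \<open>F\<close> to a representable that kills
  \<open>Y P\<close> is given by an arrow of \<open>A\<close> on \<open>X\<close> that kills the epimorphism \<open>P \<rightarrow> X\<close>. Hence \<open>F\<close> modulo the image of \<open>Y P\<close> lies in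
  \<open>D\<close>. This quotient is the reflection of \<open>F\<close>, which explains the next lemmas: \<open>r F\<close> is an epimorphism, and it kills
  only elements that factor through \<open>Y P\<close>.\<close>

lemma cokernel_of_cover_in_D:
  assumes q: "q \<in> Hom C (Yo X) F" "epi_arr C q" and e: "e \<in> Hom A P X" "epi_arr A e"
    and Q: "is_cokernel C (q \<bullet> Ya e) Q \<kappa>"
  shows "Q \<in> Obj D"
proof (rule D_I)
  have qe: "q \<bullet> Ya e \<in> Hom C (Yo P) F" using C.Cmp_Hom[OF Y_Hom[OF e(1)] q(1)] .
  note \<kappa> = C.is_cokernelD[OF Q qe]
  show "Q \<in> Obj C" using \<kappa>(1) by (simp add: C.Hom_iff)
  fix Z a assume Z: "Z \<in> Obj A" and a: "a \<in> Hom C Q (Yo Z)"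
  have X: "X \<in> Obj A" using A.HomD[OF e(1)] by simp
  have \<kappa>q: "\<kappa> \<bullet> q \<in> Hom C (Yo X) Q" using C.Cmp_Hom[OF q(1) \<kappa>(1)] .
  obtain x where x: "x \<in> Hom A X Z" "Ya x = a \<bullet> \<kappa> \<bullet> q" using Y_full[OF C.Cmp_Hom[OF \<kappa>q a] X Z] .
  have "Ya (x \<cdot> e) = a \<bullet> \<kappa> \<bullet> q \<bullet> Ya e" using x e a \<kappa>(1) q(1) by (simp add: Hom_iffs)
  also have "\<dots> = Nul C (Yo P) (Yo Z)" using \<kappa>(2) a qe by (simp add: C.Hom_iff)
  finally have "x \<cdot> e = Nul A P Z" using Y_faithful_Nul A.Cmp_Hom[OF e(1) x(1)] by blast
  then have "x = Nul A X Z" using A.epi_Nul[OF e(2,1) x(1)] by blast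
  then have "a \<bullet> \<kappa> \<bullet> q = Nul C (Yo X) (Yo Z)" using x(2) X Z by simp
  then have "(a \<bullet> \<kappa>) \<bullet> q = Nul C (Yo X) (Yo Z)" using a \<kappa>(1) q(1) by (simp add: C.Hom_iff)
  then have "a \<bullet> \<kappa> = Nul C F (Yo Z)" using C.epi_Nul[OF q(2,1) C.Cmp_Hom[OF \<kappa>(1) a]] by blast
  then show "a = Nul C Q (Yo Z)" using C.epi_Nul[OF \<kappa>(3,1) a] by blast
qed

lemma r_kernel:
  assumes q: "q \<in> Hom C (Yo X) F" "epi_arr C q" and P: "projective A P" and e: "e \<in> Hom A P X" "epi_arr A e"
    and U: "U \<in> Obj A" and t: "t \<in> Hom C (Yo U) F" "r F \<bullet> t = Nul C (Yo U) (Ro F)"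
  obtains h where "h \<in> Hom A U P" "t = q \<bullet> Ya (e \<cdot> h)"
proof -
  have F: "F \<in> Obj C" using q by (simp add: C.Hom_iff)
  have qe: "q \<bullet> Ya e \<in> Hom C (Yo P) F" using C.Cmp_Hom[OF Y_Hom[OF e(1)] q(1)] .
  obtain Q \<kappa> where Q: "is_cokernel C (q \<bullet> Ya e) Q \<kappa>" using C.obtain_cokernel[OF qe] .
  note \<kappa> = C.is_cokernelD[OF Q qe]
  obtain u where u: "u \<in> Hom C (Ro F) Q" "u \<bullet> r F = \<kappa>"
    using r_lift[OF cokernel_of_cover_in_D[OF q e Q] \<kappa>(1)] .
  have "\<kappa> \<bullet> t = u \<bullet> r F \<bullet> t" using C.Cmp_push[OF u(2) r_Hom[OF F] u(1) t(1)] by simp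
  then have "\<kappa> \<bullet> t = Nul C (Yo U) Q" using t u(1) by (simp add: C.Hom_iff)
  then obtain k where k: "k \<in> Hom C (Yo U) (Yo P)" "(q \<bullet> Ya e) \<bullet> k = t"
    using C.projective_lift_cokernel[OF Q qe Y_projective[OF U] t(1)] by blast
  obtain h where h: "h \<in> Hom A U P" "Ya h = k" using Y_full[OF k(1) U A.projective_Obj[OF P]] .
  have "t = q \<bullet> Ya (e \<cdot> h)" using k h e q by (auto simp: Hom_iffs)
  then show ?thesis using that h by blast
qed

lemma r_projective:
  assumes P: "projective A P" and \<sigma>: "\<sigma> \<in> Hom C (Yo P) F" and h: "h \<in> Hom C W (Yo P)"
  shows "r F \<bullet> \<sigma> \<bullet> h = Nul C W (Ro F)"
proof -
  have F: "F \<in> Obj C" using \<sigma> by (simp add: C.Hom_iff)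
  have "r F \<bullet> \<sigma> = Nul C (Yo P) (Ro F)"
    using Y_projective_to_D[OF P Ro_D[OF F] C.Cmp_Hom[OF \<sigma> r_Hom[OF F]]] .
  from C.Cmp_push[OF this \<sigma> r_Hom[OF F] h] show ?thesis using h Ro_Obj[OF F] by (simp add: C.Hom_iff)
qed

lemma r_epi: assumes F: "F \<in> Obj C" shows "epi_arr C (r F)"
proof -
  obtain f B X q where f: "f \<in> Hom A B X" and q: "q \<in> Hom C (Yo X) F" "epi_arr C q"
    using obtain_presentation[OF F] .
  have X: "X \<in> Obj A" using A.HomD[OF f] by simp
  obtain P e where P: "projective A P" and e: "e \<in> Hom A P X" "epi_arr A e" using obtain_projective_cover[OF X] .
  have qe: "q \<bullet> Ya e \<in> Hom C (Yo P) F" using C.Cmp_Hom[OF Y_Hom[OF e(1)] q(1)] .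
  obtain Q \<kappa> where Q: "is_cokernel C (q \<bullet> Ya e) Q \<kappa>" using C.obtain_cokernel[OF qe] .
  note \<kappa> = C.is_cokernelD[OF Q qe] and rF = r_Hom[OF F]
  have QD: "Q \<in> Obj D" using cokernel_of_cover_in_D[OF q e Q] .
  obtain u where u: "u \<in> Hom C (Ro F) Q" "u \<bullet> r F = \<kappa>" using r_lift[OF QD \<kappa>(1)] .
  have "r F \<bullet> q \<bullet> Ya e = Nul C (Yo P) (Ro F)"
    using Y_projective_to_D[OF P Ro_D[OF F] C.Cmp_Hom[OF qe rF]] .
  then obtain v where v: "v \<in> Hom C Q (Ro F)" "v \<bullet> \<kappa> = r F" using C.is_cokernel_desc[OF Q qe rF] by blast
  have "(v \<bullet> u) \<bullet> r F = Idn C (Ro F) \<bullet> r F"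
    using u v rF \<kappa>(1) by (simp add: C.Hom_iff)
  then have "v \<bullet> u = Idn C (Ro F)"
    using r_unique[OF F Ro_D[OF F] C.Cmp_Hom[OF u(1) v(1)] C.Idn_Hom[OF Ro_Obj[OF F]]] by blast
  then have "epi_arr C v" using C.epi_of_epi_Cmp[OF _ u(1) v(1)] C.iso_epi[OF C.is_iso_Idn[OF Ro_Obj[OF F]]] by simp
  then show ?thesis using C.epi_Cmp[OF \<kappa>(3) _ \<kappa>(1) v(1)] v(2) by simp
qed

text \<open>As a left adjoint, \<open>w\<close> preserves cokernels, and \<open>w (Y X)\<close> may be replaced by \<open>X\<close>; the projection from \<open>X\<close> is then
  the arrow corresponding to \<open>\<eta> F q\<close>.\<close>

lemma obtain_w_cokernel:
  assumes f: "f \<in> Hom A B X" and q: "is_cokernel C (Ya f) F q"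
  obtains c where "is_cokernel A f (wo F) c" "c \<in> Hom A X (wo F)" "Ya c = \<eta> F \<bullet> q"
proof -
  note qD = C.is_cokernelD[OF q Y_Hom[OF f]]
  have F: "F \<in> Obj C" using qD(1) by (simp add: C.Hom_iff)
  have BX: "B \<in> Obj A" "X \<in> Obj A" using A.HomD[OF f] by auto
  note \<eta>F = \<eta>_Hom[OF F] and wF = wo_Obj[OF F]
  obtain c where c: "c \<in> Hom A X (wo F)" "Ya c = \<eta> F \<bullet> q" using Y_full[OF C.Cmp_Hom[OF qD(1) \<eta>F] BX(2) wF] .
  have "Ya (c \<cdot> f) = \<eta> F \<bullet> q \<bullet> Ya f" using c f qD(1) \<eta>F by (simp add: Hom_iffs)
  also have "\<dots> = Nul C (Yo B) (Yo (wo F))" using qD(2) \<eta>F BX by (simp add: Hom_iffs)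
  finally have cf: "c \<cdot> f = Nul A B (wo F)" using Y_faithful_Nul[OF A.Cmp_Hom[OF f c(1)]] by blast
  have desc: "\<exists>u \<in> Hom A (wo F) W. u \<cdot> c = a" if a: "a \<in> Hom A X W" "a \<cdot> f = Nul A B W" for W a
  proof -
    have W: "W \<in> Obj A" using A.HomD[OF a(1)] by simp
    have "Ya a \<bullet> Ya f = Nul C (Yo B) (Yo W)" using a f W BX by (simp add: Hom_iffs flip: Ya_Cmp)
    then obtain v where v: "v \<in> Hom C F (Yo W)" "v \<bullet> q = Ya a"
      using C.is_cokernel_desc[OF q Y_Hom[OF f] Y_Hom[OF a(1)]] by blast
    obtain u where u: "u \<in> Hom A (wo F) W" "Ya u \<bullet> \<eta> F = v" using \<eta>_lift[OF W v(1)] .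
    have "Ya (u \<cdot> c) = Ya u \<bullet> \<eta> F \<bullet> q" using u c by (simp add: Hom_iffs)
    also have "\<dots> = Ya a" using C.Cmp_push[OF u(2) \<eta>F Y_Hom[OF u(1)] qD(1)] v(2) by simp
    finally have "u \<cdot> c = a" using Y_faithful[OF A.Cmp_Hom[OF c(1) u(1)] a(1)] by blast
    then show ?thesis using u(1) by blast
  qed
  have "epi_arr A c"
  proof (rule A.epi_arrI[OF c(1)])
    fix W a assume a: "a \<in> Hom A (wo F) W" "a \<cdot> c = Nul A X W"
    have W: "W \<in> Obj A" using A.HomD[OF a(1)] by simp
    have "(Ya a \<bullet> \<eta> F) \<bullet> q = Ya (a \<cdot> c)" using a(1) c \<eta>F qD(1) by (simp add: Hom_iffs)
    then have "Ya a \<bullet> \<eta> F = Nul C F (Yo W)"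
      using C.epi_Nul[OF qD(3,1) C.Cmp_Hom[OF \<eta>F Y_Hom[OF a(1)]]] a(2) BX W by simp
    then have "Ya a \<bullet> \<eta> F = Ya (Nul A (wo F) W) \<bullet> \<eta> F" using \<eta>F W wF by (simp add: C.Hom_iff)
    then show "a = Nul A (wo F) W" using \<eta>_unique[OF F a(1) A.Nul_Hom[OF wF W]] by blast
  qed
  then show ?thesis using that A.is_cokernelI[OF f c(1) cf _ desc] c by blast
qed

text \<open>\<open>w\<close> is also a right adjoint, namely of \<open>l\<close>.\<close>

lemma w_mono:
  assumes m: "m \<in> Hom C F F'" "mono_arr C m"
  shows "mono_arr A (wa m)"
proof -
  note wm = wa_Hom[OF m(1)]
  have "a = b" if a: "a \<in> Hom A X (wo F)" and b: "b \<in> Hom A X (wo F)" and eq: "wa m \<cdot> a = wa m \<cdot> b" for X a b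
  proof -
    have X: "X \<in> Obj A" and F: "F \<in> Obj C" using A.HomD[OF a] C.HomD[OF m(1)] by auto
    have \<theta>X: "\<theta> X \<in> Hom A X (wo (lo X))" using A.unit_Hom[OF unit_l X] .
    obtain a' where a': "a' \<in> Hom C (lo X) F" "wa a' \<cdot> \<theta> X = a" using A.unit_lift[OF unit_l F a] .
    obtain b' where b': "b' \<in> Hom C (lo X) F" "wa b' \<cdot> \<theta> X = b" using A.unit_lift[OF unit_l F b] .
    have "wa (m \<bullet> a') \<cdot> \<theta> X = wa (m \<bullet> b') \<cdot> \<theta> X"
      using functor_Cmp[OF w_functor a'(1) m(1)] functor_Cmp[OF w_functor b'(1) m(1)]
        wa_Hom[OF a'(1)] wa_Hom[OF b'(1)] wm \<theta>X a'(2) b'(2) eq by (simp add: A.Hom_iff)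
    then have "m \<bullet> a' = m \<bullet> b'"
      using unit_unique[OF A.category_axioms C.category_axioms w_functor unit_l X C.Cmp_Hom[OF a'(1) m(1)] C.Cmp_Hom[OF b'(1) m(1)]]
      by blast
    then have "a' = b'" using C.mono_arrD[OF m(2,1) a'(1) b'(1)] by blast
    then show ?thesis using a'(2) b'(2) by simp
  qed
  then show ?thesis using wm by (auto simp: mono_arr_def A.Hom_iff)
qed

text \<open>The arrow \<open>g F\<close> glues the two halves \<open>R F\<close> and \<open>w F\<close> of \<open>F\<close>: it is the unit \<open>\<eta> F\<close>, reflected
  in \<open>D\<close>.\<close>

definition g :: "'p \<Rightarrow> 'n" where
  "g F = (SOME u. u \<in> Hom C (Ro F) (To (wo F)) \<and> u \<bullet> r F = p (wo F) \<bullet> \<eta> F)"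

lemma g:
  assumes F: "F \<in> Obj C"
  shows g_Hom: "g F \<in> Hom C (Ro F) (To (wo F))" and g_r: "g F \<bullet> r F = p (wo F) \<bullet> \<eta> F"
proof -
  obtain u where "u \<in> Hom C (Ro F) (To (wo F))" "u \<bullet> r F = p (wo F) \<bullet> \<eta> F"
    using r_lift[OF To_D[OF wo_Obj[OF F]] C.Cmp_Hom[OF \<eta>_Hom[OF F] p_Hom[OF wo_Obj[OF F]]]] .
  then have "g F \<in> Hom C (Ro F) (To (wo F)) \<and> g F \<bullet> r F = p (wo F) \<bullet> \<eta> F"
    unfolding g_def by (intro someI) blast
  then show "g F \<in> Hom C (Ro F) (To (wo F))" "g F \<bullet> r F = p (wo F) \<bullet> \<eta> F" by blast+
qed

lemma g_nat:
  assumes a: "a \<in> Hom C F F'"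
  shows "Ta (wa a) \<bullet> g F = g F' \<bullet> Ra a"
proof -
  have F: "F \<in> Obj C" "F' \<in> Obj C" using C.HomD[OF a] by auto
  note wF = wo_Obj[OF F(1)] wo_Obj[OF F(2)]
  have "Ta (wa a) \<bullet> g F \<bullet> r F = Ta (wa a) \<bullet> p (wo F) \<bullet> \<eta> F" using g_r[OF F(1)] by simp
  also have "\<dots> = p (wo F') \<bullet> Ya (wa a) \<bullet> \<eta> F"
    using C.Cmp_swap[OF p_nat[OF wa_Hom[OF a]] p_Hom[OF wF(1)] T_Hom[OF wa_Hom[OF a]]
      Y_Hom[OF wa_Hom[OF a]] p_Hom[OF wF(2)] \<eta>_Hom[OF F(1)]] .
  also have "\<dots> = p (wo F') \<bullet> \<eta> F' \<bullet> a" using \<eta>_nat[OF a] by simp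
  also have "\<dots> = g F' \<bullet> r F' \<bullet> a"
    using C.Cmp_swap[OF g_r[OF F(2)] r_Hom[OF F(2)] g_Hom[OF F(2)] \<eta>_Hom[OF F(2)] p_Hom[OF wF(2)] a] by simp
  also have "\<dots> = g F' \<bullet> Ra a \<bullet> r F" using r_nat[OF a] by simp
  finally have "(Ta (wa a) \<bullet> g F) \<bullet> r F = (g F' \<bullet> Ra a) \<bullet> r F"
    using T_Hom[OF wa_Hom[OF a]] g_Hom[OF F(1)] g_Hom[OF F(2)] Ra_Hom[OF a] r_Hom[OF F(1)]
    by (simp add: C.Hom_iff)
  then show ?thesis
    using r_unique[OF F(1) To_D[OF wF(2)] C.Cmp_Hom[OF g_Hom[OF F(1)] T_Hom[OF wa_Hom[OF a]]]
      C.Cmp_Hom[OF Ra_Hom[OF a] g_Hom[OF F(2)]]] by blast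
qed

text \<open>The generator \<open>X\<close> of \<open>F\<close> maps onto \<open>w F\<close>, so \<open>P \<rightarrow> w F\<close> lifts to \<open>X\<close>. The lift of \<open>Y P\<close> to \<open>F\<close> is killed by \<open>r F\<close>,
  since \<open>D\<close> vanishes on projectives.\<close>

lemma projective_element_lift:
  assumes F: "F \<in> Obj C" and x: "x \<in> Hom C W (Yo P)" and P: "projective A P" and y: "y \<in> Hom A P (wo F)"
  obtains t where "t \<in> Hom C W F" "\<eta> F \<bullet> t = Ya y \<bullet> x" "r F \<bullet> t = Nul C W (Ro F)"
proof -
  obtain f B X q where f: "f \<in> Hom A B X" and cok: "is_cokernel C (Ya f) F q" and q: "q \<in> Hom C (Yo X) F"
    using obtain_presentation[OF F] by metis
  obtain c where c: "is_cokernel A f (wo F) c" "c \<in> Hom A X (wo F)" "Ya c = \<eta> F \<bullet> q"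
    using obtain_w_cokernel[OF f cok] .
  obtain y' where y': "y' \<in> Hom A P X" "c \<cdot> y' = y"
    using A.projectiveD[OF P A.is_cokernelD(3)[OF c(1) f] c(2) y] .
  note qy = C.Cmp_Hom[OF Y_Hom[OF y'(1)] q]
  show ?thesis
  proof (rule that[of "(q \<bullet> Ya y') \<bullet> x"])
    show "(q \<bullet> Ya y') \<bullet> x \<in> Hom C W F" using C.Cmp_Hom[OF x qy] .
    have "\<eta> F \<bullet> (q \<bullet> Ya y') \<bullet> x = (\<eta> F \<bullet> q) \<bullet> Ya y' \<bullet> x"
      using \<eta>_Hom[OF F] q x Y_Hom[OF y'(1)] by (simp add: C.Hom_iff)
    also have "\<dots> = Ya (c \<cdot> y') \<bullet> x" using c y'(1) x by (simp add: Hom_iffs flip: c(3))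
    finally show "\<eta> F \<bullet> (q \<bullet> Ya y') \<bullet> x = Ya y \<bullet> x" using y'(2) by simp
    show "r F \<bullet> (q \<bullet> Ya y') \<bullet> x = Nul C W (Ro F)" using r_projective[OF P qy x] .
  qed
qed

section \<open>Gluing over a hereditary category\<close>

text \<open>Heredity enters through the kernel of an arrow from a projective. An element of \<open>F\<close> killed by \<open>r F\<close> comes from a projective \<open>P\<close>. If \<open>\<eta> F\<close> kills it too, it
  comes from the part \<open>K\<close> of \<open>P\<close> that dies in \<open>w F\<close>. This \<open>K\<close> is projective, so it lifts to the relations of \<open>F\<close>. Equivalently, the canonical arrow from \<open>l (w F)\<close> to \<open>Y (w F)\<close> is a monomorphism.\<close>

lemma joint_mono_element:
  assumes her: "hereditary A" and F: "F \<in> Obj C" and U: "U \<in> Obj A" and t: "t \<in> Hom C (Yo U) F"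
    and rt: "r F \<bullet> t = Nul C (Yo U) (Ro F)" and \<eta>t: "\<eta> F \<bullet> t = Nul C (Yo U) (Yo (wo F))"
  shows "t = Nul C (Yo U) F"
proof -
  obtain f B X q where f: "f \<in> Hom A B X" and cok: "is_cokernel C (Ya f) F q"
    and q: "q \<in> Hom C (Yo X) F" "epi_arr C q"
    using obtain_presentation[OF F] .
  have X: "X \<in> Obj A" using A.HomD[OF f] by simp
  obtain P e where P: "projective A P" and e: "e \<in> Hom A P X" "epi_arr A e" using obtain_projective_cover[OF X] .
  obtain c where c: "is_cokernel A f (wo F) c" "c \<in> Hom A X (wo F)" "Ya c = \<eta> F \<bullet> q"
    using obtain_w_cokernel[OF f cok] .
  obtain h where h: "h \<in> Hom A U P" "t = q \<bullet> Ya (e \<cdot> h)" using r_kernel[OF q P e U t rt] .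
  have eh: "e \<cdot> h \<in> Hom A U X" using A.Cmp_Hom[OF h(1) e(1)] .
  have "Ya (c \<cdot> e \<cdot> h) = Ya c \<bullet> Ya (e \<cdot> h)" using c(2) eh by (simp add: Hom_iffs)
  also have "\<dots> = \<eta> F \<bullet> t" using c(3) h(2) \<eta>_Hom[OF F] q(1) Y_Hom[OF eh] by (simp add: C.Hom_iff)
  finally have "c \<cdot> e \<cdot> h = Nul A U (wo F)" using \<eta>t Y_faithful_Nul[OF A.Cmp_Hom[OF eh c(2)]] by simp
  then have ceh: "(c \<cdot> e) \<cdot> h = Nul A U (wo F)" using c(2) e(1) h(1) by (simp add: A.Hom_iff)
  note ce = A.Cmp_Hom[OF e(1) c(2)]
  obtain K k where k: "is_kernel A (c \<cdot> e) K k" using A.obtain_kernel[OF ce] .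
  note kD = A.is_kernelD[OF k ce]
  have K: "projective A K" using A.hereditaryD[OF her P ce k] .
  obtain h' where h': "h' \<in> Hom A U K" "k \<cdot> h' = h" using A.is_kernel_lift[OF k ce h(1) ceh] .
  have "c \<cdot> e \<cdot> k = Nul A K (wo F)" using kD(1,2) c(2) e(1) by (simp add: A.Hom_iff)
  then obtain b where b: "b \<in> Hom A K B" "f \<cdot> b = e \<cdot> k"
    using A.projective_lift_cokernel[OF c(1) f K A.Cmp_Hom[OF kD(1) e(1)]] by blast
  have bh: "b \<cdot> h' \<in> Hom A U B" using A.Cmp_Hom[OF h'(1) b(1)] .
  have "e \<cdot> h = f \<cdot> b \<cdot> h'"
    using A.Cmp_swap[OF b(2,1) f kD(1) e(1) h'(1)] h'(2) by simp
  then have "t = q \<bullet> Ya f \<bullet> Ya (b \<cdot> h')" using h(2) f bh by (simp add: A.Hom_iff)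
  also have "\<dots> = Nul C (Yo U) F"
    using C.Cmp_push[OF C.is_cokernelD(2)[OF cok Y_Hom[OF f]] Y_Hom[OF f] q(1) Y_Hom[OF bh]] Y_Hom[OF bh] F
    by (simp add: C.Hom_iff)
  finally show ?thesis .
qed

lemma joint_mono:
  assumes her: "hereditary A" and F: "F \<in> Obj C" and t: "t \<in> Hom C W F" "t' \<in> Hom C W F"
    and rt: "r F \<bullet> t = r F \<bullet> t'" and \<eta>t: "\<eta> F \<bullet> t = \<eta> F \<bullet> t'"
  shows "t = t'"
proof -
  note rF = r_Hom[OF F] and \<eta>F = \<eta>_Hom[OF F]
  obtain d where d: "d \<in> Hom C W F" "t = Pls C d t'" using C.ex_diff[OF t] .
  have "Pls C (r F \<bullet> d) (r F \<bullet> t') = r F \<bullet> t'" "Pls C (\<eta> F \<bullet> d) (\<eta> F \<bullet> t') = \<eta> F \<bullet> t'"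
    using C.Cmp_Pls_right[OF d(1) t(2) rF] C.Cmp_Pls_right[OF d(1) t(2) \<eta>F] rt \<eta>t d(2) by simp_all
  then have z: "r F \<bullet> d = Nul C W (Ro F)" "\<eta> F \<bullet> d = Nul C W (Yo (wo F))"
    using C.Pls_eq_right_iff[OF C.Cmp_Hom[OF d(1) rF] C.Cmp_Hom[OF t(2) rF]]
      C.Pls_eq_right_iff[OF C.Cmp_Hom[OF d(1) \<eta>F] C.Cmp_Hom[OF t(2) \<eta>F]] by simp_all
  have W: "W \<in> Obj C" using C.HomD[OF d(1)] by simp
  obtain f B X q where f: "f \<in> Hom A B X" and q: "q \<in> Hom C (Yo X) W" "epi_arr C q"
    using obtain_presentation[OF W] .
  have X: "X \<in> Obj A" using A.HomD[OF f] by simp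
  have "r F \<bullet> d \<bullet> q = Nul C (Yo X) (Ro F)" "\<eta> F \<bullet> d \<bullet> q = Nul C (Yo X) (Yo (wo F))"
    using C.Cmp_push[OF z(1) d(1) rF q(1)] C.Cmp_push[OF z(2) d(1) \<eta>F q(1)] q(1) rF \<eta>F by (simp_all add: C.Hom_iff)
  then have "d \<bullet> q = Nul C (Yo X) F" using joint_mono_element[OF her F X C.Cmp_Hom[OF q(1) d(1)]] by blast
  then have "d = Nul C W F" using C.epi_Nul[OF q(2,1) d(1)] by blast
  then show ?thesis using d(2) t(2) by (simp add: C.Hom_iff)
qed

text \<open>Lift \<open>b\<close> to an element \<open>t0\<close> of \<open>F\<close>. The discrepancy between \<open>\<eta> F t0\<close> and \<open>c\<close> vanishes in \<open>T (w F)\<close>, so it factors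
  through a projective and can be corrected without changing the image in \<open>R F\<close>.\<close>

lemma gluing_element:
  assumes F: "F \<in> Obj C" and U: "U \<in> Obj A" and b: "b \<in> Hom C (Yo U) (Ro F)" and c: "c \<in> Hom C (Yo U) (Yo (wo F))"
    and eq: "g F \<bullet> b = p (wo F) \<bullet> c"
  shows "\<exists>t \<in> Hom C (Yo U) F. r F \<bullet> t = b \<and> \<eta> F \<bullet> t = c"
proof -
  note rF = r_Hom[OF F] and \<eta>F = \<eta>_Hom[OF F] and gF = g_Hom[OF F] and wF = wo_Obj[OF F]
  note pF = p_Hom[OF wF]
  obtain t0 where t0: "t0 \<in> Hom C (Yo U) F" "r F \<bullet> t0 = b"
    using C.projectiveD[OF Y_projective[OF U] r_epi[OF F] rF b] .
  obtain d where d: "d \<in> Hom C (Yo U) (Yo (wo F))" "c = Pls C d (\<eta> F \<bullet> t0)"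
    using C.ex_diff[OF c C.Cmp_Hom[OF t0(1) \<eta>F]] .
  have "p (wo F) \<bullet> \<eta> F \<bullet> t0 = g F \<bullet> b" using C.Cmp_swap[OF g_r[OF F] rF gF \<eta>F pF t0(1)] t0(2) by simp
  then have "Pls C (p (wo F) \<bullet> d) (g F \<bullet> b) = g F \<bullet> b"
    using C.Cmp_Pls_right[OF d(1) C.Cmp_Hom[OF t0(1) \<eta>F] pF] d(2) eq by simp
  then have pd: "p (wo F) \<bullet> d = Nul C (Yo U) (To (wo F))"
    using C.Pls_eq_right_iff[OF C.Cmp_Hom[OF d(1) pF] C.Cmp_Hom[OF b gF]] by simp
  obtain x where x: "x \<in> Hom A U (wo F)" "Ya x = d" using Y_full[OF d(1) U wF] .
  obtain P y h where P: "projective A P" and h: "h \<in> Hom A U P" and y: "y \<in> Hom A P (wo F)" and xy: "x = y \<cdot> h"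
    using p_zero_iff[OF x(1)] pd x(2) by blast
  obtain t1 where t1: "t1 \<in> Hom C (Yo U) F" "\<eta> F \<bullet> t1 = Ya y \<bullet> Ya h" "r F \<bullet> t1 = Nul C (Yo U) (Ro F)"
    using projective_element_lift[OF F Y_Hom[OF h] P y] .
  have "r F \<bullet> Pls C t1 t0 = b" using C.Cmp_Pls_right[OF t1(1) t0(1) rF] t1(3) t0(2) b by (simp add: C.Hom_iff)
  moreover have "\<eta> F \<bullet> Pls C t1 t0 = c"
    using C.Cmp_Pls_right[OF t1(1) t0(1) \<eta>F] t1(2) d(2) x(2) xy y h by (simp add: A.Hom_iff)
  ultimately show ?thesis using C.Pls_Hom[OF t1(1) t0(1)] by blast
qed

text \<open>Together with \<open>joint_mono\<close>, this exhibits \<open>F\<close> as the pullback of \<open>R F\<close> and \<open>Y (w F)\<close> over \<open>T (w F)\<close>.\<close>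

lemma gluing:
  assumes her: "hereditary A" and F: "F \<in> Obj C" and b: "b \<in> Hom C W (Ro F)" and c: "c \<in> Hom C W (Yo (wo F))"
    and eq: "g F \<bullet> b = p (wo F) \<bullet> c"
  obtains t where "t \<in> Hom C W F" "r F \<bullet> t = b" "\<eta> F \<bullet> t = c"
proof -
  note rF = r_Hom[OF F] and \<eta>F = \<eta>_Hom[OF F] and gF = g_Hom[OF F] and wF = wo_Obj[OF F]
  note pF = p_Hom[OF wF]
  have "\<exists>t \<in> Hom C W F. r F \<bullet> t = b \<and> \<eta> F \<bullet> t = c"
  proof (rule joint_lift_test[OF rF \<eta>F b c])
    show "t = Nul C (Yo U) F"
      if "U \<in> Obj A" "t \<in> Hom C (Yo U) F" "r F \<bullet> t = Nul C (Yo U) (Ro F)" "\<eta> F \<bullet> t = Nul C (Yo U) (Yo (wo F))" for U t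
      using joint_mono_element[OF her F that] .
    show "\<exists>t\<in>Hom C (Yo U) F. r F \<bullet> t = b \<bullet> y \<and> \<eta> F \<bullet> t = c \<bullet> y"
      if U: "U \<in> Obj A" and y: "y \<in> Hom C (Yo U) W" for U y
      using gluing_element[OF F U C.Cmp_Hom[OF y b] C.Cmp_Hom[OF y c]] C.Cmp_swap[OF eq b gF c pF y] by blast
  qed
  then show ?thesis using that by blast
qed

text \<open>Suppose \<open>k x\<close> factors through a projective \<open>P\<close>. The part of \<open>P\<close> killed by \<open>f\<close> is projective and maps to \<open>K\<close>, and \<open>x\<close>
  factors through it. Now suppose \<open>f x\<close> factors through \<open>P\<close>. The part of \<open>P\<close> that maps into the image of \<open>f\<close> is
  projective, so it lifts along \<open>f\<close>; subtracting the lift changes \<open>x\<close> into an arrow to \<open>K\<close>.\<close>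

lemma T_kernel:
  assumes her: "hereditary A" and f: "f \<in> Hom A X X'" and k: "is_kernel A f K k"
  shows "is_kernel C (Ta f) (To K) (Ta k)"
proof (rule kernel_test[OF T_Hom[OF f]])
  note kD = A.is_kernelD[OF k f]
  have o: "X \<in> Obj A" "X' \<in> Obj A" "K \<in> Obj A" using A.HomD[OF f] A.HomD[OF kD(1)] by auto
  note pX = p_Hom[OF o(1)] and pX' = p_Hom[OF o(2)] and pK = p_Hom[OF o(3)]
  note Tf = T_Hom[OF f] and Tk = T_Hom[OF kD(1)]
  show "Ta k \<in> Hom C (To K) (To X)" by fact
  have "(Ta f \<bullet> Ta k) \<bullet> p K = Ta f \<bullet> p X \<bullet> Ya k" using Tf Tk pK p_nat[OF kD(1)] by (simp add: C.Hom_iff)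
  also have "\<dots> = p X' \<bullet> Ya f \<bullet> Ya k"
    using C.Cmp_swap[OF p_nat[OF f] pX Tf Y_Hom[OF f] pX' Y_Hom[OF kD(1)]] .
  also have "\<dots> = p X' \<bullet> Ya (f \<cdot> k)" using f kD(1) by (simp add: A.Hom_iff)
  also have "\<dots> = Nul C (Yo K) (To X')" using kD(2) o pX' by (simp add: C.Hom_iff)
  finally show "Ta f \<bullet> Ta k = Nul C (To K) (To X')"
    using C.epi_Nul[OF p_epi[OF o(3)] pK C.Cmp_Hom[OF Tk Tf]] by blast
next
  note kD = A.is_kernelD[OF k f]
  have o: "X \<in> Obj A" "X' \<in> Obj A" "K \<in> Obj A" using A.HomD[OF f] A.HomD[OF kD(1)] by auto
  note pX = p_Hom[OF o(1)] and pX' = p_Hom[OF o(2)] and pK = p_Hom[OF o(3)]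
  note Tf = T_Hom[OF f] and Tk = T_Hom[OF kD(1)]
  fix U a assume U: "U \<in> Obj A" and a: "a \<in> Hom C (Yo U) (To K)" "Ta k \<bullet> a = Nul C (Yo U) (To X)"
  obtain a1 where a1: "a1 \<in> Hom C (Yo U) (Yo K)" "p K \<bullet> a1 = a"
    using C.projectiveD[OF Y_projective[OF U] p_epi[OF o(3)] pK a(1)] .
  obtain x where x: "x \<in> Hom A U K" "Ya x = a1" using Y_full[OF a1(1) U o(3)] .
  note kx = A.Cmp_Hom[OF x(1) kD(1)]
  have "p X \<bullet> Ya (k \<cdot> x) = p X \<bullet> Ya k \<bullet> a1" using x kD(1) by (auto simp: A.Hom_iff)
  also have "\<dots> = Ta k \<bullet> a"
    using C.Cmp_swap[OF p_nat[OF kD(1)] pK Tk Y_Hom[OF kD(1)] pX a1(1)] a1(2) by simp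
  finally have "p X \<bullet> Ya (k \<cdot> x) = Nul C (Yo U) (To X)" using a(2) by simp
  then obtain P y h where P: "projective A P" and h: "h \<in> Hom A U P" and y: "y \<in> Hom A P X" and xy: "k \<cdot> x = y \<cdot> h"
    using p_zero_iff[OF kx] by blast
  note fy = A.Cmp_Hom[OF y f]
  obtain L m where m: "is_kernel A (f \<cdot> y) L m" using A.obtain_kernel[OF fy] .
  note mD = A.is_kernelD[OF m fy]
  have L: "projective A L" using A.hereditaryD[OF her P fy m] .
  have "(f \<cdot> y) \<cdot> h = f \<cdot> k \<cdot> x" using xy f y h by (simp add: A.Hom_iff)
  also have "\<dots> = Nul A U X'" using A.Cmp_push[OF kD(2,1) f x(1)] x(1) o by (simp add: A.Hom_iff)
  finally obtain h' where h': "h' \<in> Hom A U L" "m \<cdot> h' = h" using A.is_kernel_lift[OF m fy h] by blast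
  have "f \<cdot> y \<cdot> m = Nul A L X'" using mD(1,2) f y by (simp add: A.Hom_iff)
  then obtain y' where y': "y' \<in> Hom A L K" "k \<cdot> y' = y \<cdot> m"
    using A.is_kernel_lift[OF k f A.Cmp_Hom[OF mD(1) y]] by blast
  have "k \<cdot> y' \<cdot> h' = k \<cdot> x" using A.Cmp_swap[OF y'(2,1) kD(1) mD(1) y h'(1)] h'(2) xy by simp
  then have "y' \<cdot> h' = x" using A.mono_arrD[OF kD(3,1) A.Cmp_Hom[OF h'(1) y'(1)] x(1)] by blast
  then show "a = Nul C (Yo U) (To K)" using p_zero_iff[OF x(1)] L h'(1) y'(1) a1(2) x(2) by auto
next
  note kD = A.is_kernelD[OF k f]
  have o: "X \<in> Obj A" "X' \<in> Obj A" "K \<in> Obj A" using A.HomD[OF f] A.HomD[OF kD(1)] by auto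
  note pX = p_Hom[OF o(1)] and pX' = p_Hom[OF o(2)] and pK = p_Hom[OF o(3)]
  note Tf = T_Hom[OF f] and Tk = T_Hom[OF kD(1)]
  fix U a assume U: "U \<in> Obj A" and a: "a \<in> Hom C (Yo U) (To X)" "Ta f \<bullet> a = Nul C (Yo U) (To X')"
  obtain a1 where a1: "a1 \<in> Hom C (Yo U) (Yo X)" "p X \<bullet> a1 = a"
    using C.projectiveD[OF Y_projective[OF U] p_epi[OF o(1)] pX a(1)] .
  obtain x where x: "x \<in> Hom A U X" "Ya x = a1" using Y_full[OF a1(1) U o(1)] .
  note fx = A.Cmp_Hom[OF x(1) f]
  have "p X' \<bullet> Ya (f \<cdot> x) = p X' \<bullet> Ya f \<bullet> a1" using x f by (auto simp: A.Hom_iff)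
  also have "\<dots> = Ta f \<bullet> a"
    using C.Cmp_swap[OF p_nat[OF f] pX Tf Y_Hom[OF f] pX' a1(1)] a1(2) by simp
  finally have "p X' \<bullet> Ya (f \<cdot> x) = Nul C (Yo U) (To X')" using a(2) by simp
  then obtain P z h where P: "projective A P" and h: "h \<in> Hom A U P" and z: "z \<in> Hom A P X'" and fz: "f \<cdot> x = z \<cdot> h"
    using p_zero_iff[OF fx] by blast
  obtain Q c where c: "is_cokernel A f Q c" using A.obtain_cokernel[OF f] .
  note cD = A.is_cokernelD[OF c f]
  note cz = A.Cmp_Hom[OF z cD(1)]
  obtain L m where m: "is_kernel A (c \<cdot> z) L m" using A.obtain_kernel[OF cz] .
  note mD = A.is_kernelD[OF m cz]
  have L: "projective A L" using A.hereditaryD[OF her P cz m] .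
  have "(c \<cdot> z) \<cdot> h = c \<cdot> f \<cdot> x" using fz cD(1) z h by (simp add: A.Hom_iff)
  also have "\<dots> = Nul A U Q" using A.Cmp_push[OF cD(2) f cD(1) x(1)] x(1) cD(1) by (simp add: A.Hom_iff)
  finally obtain h' where h': "h' \<in> Hom A U L" "m \<cdot> h' = h" using A.is_kernel_lift[OF m cz h] by blast
  have "c \<cdot> z \<cdot> m = Nul A L Q" using mD(1,2) cD(1) z by (simp add: A.Hom_iff)
  then obtain y where y: "y \<in> Hom A L X" "f \<cdot> y = z \<cdot> m"
    using A.projective_lift_cokernel[OF c f L A.Cmp_Hom[OF mD(1) z]] by blast
  note yh = A.Cmp_Hom[OF h'(1) y(1)]
  have fyh: "f \<cdot> y \<cdot> h' = f \<cdot> x" using A.Cmp_swap[OF y(2,1) f mD(1) z h'(1)] h'(2) fz by simp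
  obtain d where d: "d \<in> Hom A U X" "x = Pls A d (y \<cdot> h')" using A.ex_diff[OF x(1) yh] .
  have "Pls A (f \<cdot> d) (f \<cdot> x) = f \<cdot> x" using A.Cmp_Pls_right[OF d(1) yh f] d(2) fyh by simp
  then have "f \<cdot> d = Nul A U X'" using A.Pls_eq_right_iff[OF A.Cmp_Hom[OF d(1) f] fx] by simp
  then obtain u where u: "u \<in> Hom A U K" "k \<cdot> u = d" using A.is_kernel_lift[OF k f d(1)] by blast
  have "Ta k \<bullet> p K \<bullet> Ya u = p X \<bullet> Ya k \<bullet> Ya u"
    using C.Cmp_swap[OF p_nat[OF kD(1)] pK Tk Y_Hom[OF kD(1)] pX Y_Hom[OF u(1)]] .
  also have "\<dots> = p X \<bullet> Ya d" using u kD(1) by (auto simp: A.Hom_iff)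
  also have "\<dots> = a"
  proof -
    have "p X \<bullet> Ya (y \<cdot> h') = Nul C (Yo U) (To X)" using p_zero_iff[OF yh] L h'(1) y(1) by blast
    then have "p X \<bullet> Ya x = p X \<bullet> Ya d"
      using C.Cmp_Pls_right[OF Y_Hom[OF d(1)] Y_Hom[OF yh] pX] Ya_Pls[OF d(1) yh] d(2) Y_Hom[OF d(1)] pX
      by (simp add: C.Hom_iff)
    then show ?thesis using a1(2) x(2) by simp
  qed
  finally show "\<exists>u\<in>Hom C (Yo U) (To K). Ta k \<bullet> u = a" using C.Cmp_Hom[OF Y_Hom[OF u(1)] pK] by blast
qed

lemma T_mono:
  assumes her: "hereditary A" and m: "m \<in> Hom A X X'" "mono_arr A m"
  shows "mono_arr C (Ta m)"
proof -
  obtain n where n: "is_kernel A n X m" using A.mono_normal[OF m(2)] m(1) by (auto simp: A.Hom_iff)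
  have nH: "n \<in> Hom A X' (Cod A n)" using n A.HomD[OF m(1)] by (auto simp: is_kernel_def Hom_def)
  show ?thesis using C.is_kernelD(3)[OF T_kernel[OF her nH n] T_Hom[OF nH]] .
qed

end

section \<open>Pre-hereditary recollements\<close>

lemma left_derived_value_2:
  "left_derived_value C D F 2 X H \<longleftrightarrow>
    (\<exists>P d \<epsilon>. projective_resolution C X P d \<epsilon> \<and> is_homology D (FA F (d 2)) (FA F (d 1)) H)"
  by (simp add: left_derived_value_def numeral_2_eq_2)

lemma left_derived_value_2I:
  "projective_resolution C X P d \<epsilon> \<Longrightarrow> is_homology D (FA F (d 2)) (FA F (d 1)) H \<Longrightarrow>
    left_derived_value C D F 2 X H"
  unfolding left_derived_value_2 by blast

context defect
begin

text \<open>The inclusion of \<open>D\<close> has the right adjoint \<open>S\<close>, so it preserves epimorphisms.\<close>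

lemma epi_D:
  assumes e: "e \<in> Hom C V V'" "epi_arr D e" and V: "V \<in> Obj D" "V' \<in> Obj D"
  shows "epi_arr C e"
proof -
  have "a = b" if a: "a \<in> Hom C V' F" and b: "b \<in> Hom C V' F" and eq: "a \<bullet> e = b \<bullet> e" for a b F
  proof -
    have F: "F \<in> Obj C" using C.HomD[OF a] by simp
    obtain a' where a': "a' \<in> Hom C V' (So F)" "s F \<bullet> a' = a" using s_lift[OF V(2) a] .
    obtain b' where b': "b' \<in> Hom C V' (So F)" "s F \<bullet> b' = b" using s_lift[OF V(2) b] .
    have "s F \<bullet> a' \<bullet> e = s F \<bullet> b' \<bullet> e"
      using C.Cmp_push[OF a'(2,1) s_Hom[OF F] e(1)] C.Cmp_push[OF b'(2,1) s_Hom[OF F] e(1)] eq by simp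
    then have "a' \<bullet> e = b' \<bullet> e"
      using s_unique[OF F V(1) C.Cmp_Hom[OF e(1) a'(1)] C.Cmp_Hom[OF e(1) b'(1)]] by blast
    moreover have "a' \<in> Hom D V' (So F)" "b' \<in> Hom D V' (So F)" "e \<in> Hom D V V'"
      using a' b' e V So_D[OF F] by (simp_all add: Hom_D)
    ultimately have "a' = b'" using category.epi_arrD[OF D_category e(2)] by simp
    then show ?thesis using a'(2) b'(2) by simp
  qed
  then show ?thesis using e(1) by (auto simp: epi_arr_def C.Hom_iff)
qed

lemma D_epi:
  assumes e: "e \<in> Hom C V V'" "epi_arr C e" and V: "V \<in> Obj D" "V' \<in> Obj D"
  shows "epi_arr D e"
proof -
  have "e \<in> Hom D V V'" using e V by (simp add: Hom_D)
  moreover have "a = b" if "a \<in> Hom D V' F" "b \<in> Hom D V' F" "a \<bullet> e = b \<bullet> e" for a b F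
    using that C.epi_arrD[OF e(2,1)] Hom_D_subset by blast
  ultimately show ?thesis using category.HomD[OF D_category] unfolding epi_arr_def by simp
qed

text \<open>\<open>T X\<close> is the reflection of the projective object \<open>Y X\<close>.\<close>

lemma T_projective: assumes X: "X \<in> Obj A" shows "projective D (To X)"
  unfolding projective_def
proof (intro conjI allI impI ballI)
  interpret D: abelian D by (rule D_abelian)
  show "To X \<in> Obj D" using To_D[OF X] .
  fix e f assume e: "epi_arr D e" and f: "f \<in> Hom D (To X) (Cod D e)"
  have eH: "e \<in> Hom D (Dom D e) (Cod D e)" using e by (intro D.Arr_Hom) (simp add: epi_arr_def)
  have V: "Dom D e \<in> Obj D" "Cod D e \<in> Obj D" using D.HomD[OF eH] by blast+
  have eC: "e \<in> Hom C (Dom D e) (Cod D e)" and fC: "f \<in> Hom C (To X) (Cod D e)"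
    using eH f Hom_D_subset by blast+
  note pX = p_Hom[OF X]
  obtain u where u: "u \<in> Hom C (Yo X) (Dom D e)" "e \<bullet> u = f \<bullet> p X"
    using C.projectiveD[OF Y_projective[OF X] epi_D[OF eC e V] eC C.Cmp_Hom[OF pX fC]] .
  obtain v where v: "v \<in> Hom C (To X) (Dom D e)" "v \<bullet> p X = u" using p_lift[OF V(1) u(1) X] .
  have "(e \<bullet> v) \<bullet> p X = f \<bullet> p X" using v u(2) eC pX by (simp add: C.Hom_iff)
  then have "e \<bullet> v = f" using C.epi_arrD[OF p_epi[OF X] pX C.Cmp_Hom[OF v(1) eC] fC] by simp
  then show "\<exists>u\<in>Hom D (To X) (Dom D e). Cmp D e u = f"
    using v(1) Hom_D[OF To_D[OF X] V(1)] by auto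
qed

lemma enough_projectives_C: "enough_projectives C"
  unfolding enough_projectives_def
proof
  fix F assume "F \<in> Obj C"
  then obtain f B X q where "f \<in> Hom A B X" "q \<in> Hom C (Yo X) F" "epi_arr C q" using obtain_presentation by metis
  then show "\<exists>P e. projective C P \<and> e \<in> Hom C P F \<and> epi_arr C e"
    using Y_projective A.HomD(5) by blast
qed

lemma enough_projectives_D: "enough_projectives D"
  unfolding enough_projectives_def
proof
  fix V assume V: "V \<in> Obj D"
  obtain f B X q where f: "f \<in> Hom A B X" and q: "q \<in> Hom C (Yo X) V" "epi_arr C q"
    using obtain_presentation[OF D_Obj[OF V]] .
  have X: "X \<in> Obj A" using A.HomD[OF f] by simp
  obtain u where u: "u \<in> Hom C (To X) V" "u \<bullet> p X = q" using p_lift[OF V q(1) X] .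
  have "epi_arr C u" using C.epi_of_epi_Cmp[OF _ p_Hom[OF X] u(1)] u(2) q(2) by simp
  then show "\<exists>P e. projective D P \<and> e \<in> Hom D P V \<and> epi_arr D e"
    using T_projective[OF X] D_epi[OF u(1) _ To_D[OF X] V] u(1) Hom_D[OF To_D[OF X] V] by blast
qed

text \<open>In other words, \<open>R\<close> preserves monomorphisms. Both \<open>w\<close> and \<open>T\<close> do, so the image of \<open>a\<close> in \<open>T (w F)\<close> vanishes. Hence \<open>\<eta> F a\<close>
  agrees with \<open>\<eta> F t\<close> for some \<open>t\<close> killed by \<open>r F\<close>, and \<open>a = t\<close> because \<open>m a\<close> and \<open>m t\<close> agree in the pullback \<open>F'\<close>.\<close>

lemma r_mono:
  assumes her: "hereditary A" and m: "m \<in> Hom C F F'" "mono_arr C m" and U: "U \<in> Obj A"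
    and a: "a \<in> Hom C (Yo U) F" and z: "r F' \<bullet> m \<bullet> a = Nul C (Yo U) (Ro F')"
  shows "r F \<bullet> a = Nul C (Yo U) (Ro F)"
proof -
  have F: "F \<in> Obj C" "F' \<in> Obj C" using C.HomD[OF m(1)] by auto
  note wF = wo_Obj[OF F(1)] and wF' = wo_Obj[OF F(2)]
  note rF = r_Hom[OF F(1)] and rF' = r_Hom[OF F(2)] and \<eta>F = \<eta>_Hom[OF F(1)] and \<eta>F' = \<eta>_Hom[OF F(2)]
  note gF = g_Hom[OF F(1)] and gF' = g_Hom[OF F(2)] and pF = p_Hom[OF wF]
  note wm = wa_Hom[OF m(1)] and Rm = Ra_Hom[OF m(1)]
  note Twm = T_Hom[OF wm]
  have ra: "r F \<bullet> a \<in> Hom C (Yo U) (Ro F)" using C.Cmp_Hom[OF a rF] .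
  have "Ta (wa m) \<bullet> g F \<bullet> r F \<bullet> a = g F' \<bullet> Ra m \<bullet> r F \<bullet> a"
    using C.Cmp_swap[OF g_nat[OF m(1)] gF Twm Rm gF' ra] .
  also have "Ra m \<bullet> r F \<bullet> a = r F' \<bullet> m \<bullet> a" using C.Cmp_swap[OF r_nat[OF m(1)] rF Rm m(1) rF' a] .
  also have "g F' \<bullet> \<dots> = Nul C (Yo U) (To (wo F'))" using z gF' U by (simp add: C.Hom_iff)
  finally have "g F \<bullet> r F \<bullet> a = Nul C (Yo U) (To (wo F))"
    using C.mono_Nul[OF T_mono[OF her wm w_mono[OF m]] Twm C.Cmp_Hom[OF ra gF]] by blast
  then have pz: "p (wo F) \<bullet> \<eta> F \<bullet> a = Nul C (Yo U) (To (wo F))"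
    using C.Cmp_swap[OF g_r[OF F(1)] rF gF \<eta>F pF a] by simp
  obtain x where x: "x \<in> Hom A U (wo F)" "Ya x = \<eta> F \<bullet> a" using Y_full[OF C.Cmp_Hom[OF a \<eta>F] U wF] .
  obtain P y h where P: "projective A P" and h: "h \<in> Hom A U P" and y: "y \<in> Hom A P (wo F)" and xy: "x = y \<cdot> h"
    using p_zero_iff[OF x(1)] pz x(2) by auto
  obtain t where t: "t \<in> Hom C (Yo U) F" "\<eta> F \<bullet> t = Ya y \<bullet> Ya h" "r F \<bullet> t = Nul C (Yo U) (Ro F)"
    using projective_element_lift[OF F(1) Y_Hom[OF h] P y] .
  have \<eta>t: "\<eta> F \<bullet> t = \<eta> F \<bullet> a" using t(2) x(2) xy y h by (simp add: A.Hom_iff)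
  have "m \<bullet> t = m \<bullet> a"
  proof (rule joint_mono[OF her F(2) C.Cmp_Hom[OF t(1) m(1)] C.Cmp_Hom[OF a m(1)]])
    have "r F' \<bullet> m \<bullet> t = Ra m \<bullet> r F \<bullet> t" using C.Cmp_swap[OF r_nat[OF m(1)] rF Rm m(1) rF' t(1)] by simp
    then show "r F' \<bullet> m \<bullet> t = r F' \<bullet> m \<bullet> a" using t(3) z Rm U by (simp add: C.Hom_iff)
    show "\<eta> F' \<bullet> m \<bullet> t = \<eta> F' \<bullet> m \<bullet> a"
      using C.Cmp_swap[OF \<eta>_nat[OF m(1)] \<eta>F Y_Hom[OF wm] m(1) \<eta>F' t(1)]
        C.Cmp_swap[OF \<eta>_nat[OF m(1)] \<eta>F Y_Hom[OF wm] m(1) \<eta>F' a] \<eta>t by simp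
  qed
  then have "t = a" using C.mono_arrD[OF m(2,1) t(1) a] by blast
  then show ?thesis using t(3) by simp
qed

text \<open>Since \<open>R\<close> is right exact and preserves monomorphisms, it preserves the exactness of \<open>d2\<close>, \<open>d1\<close>. An element of the
  kernel of \<open>R d1\<close> is represented by some \<open>a\<close> in \<open>P2\<close> whose image in the kernel \<open>L\<close> of \<open>d0\<close> is killed by the
  reflection.\<close>

lemma derived_vanish:
  assumes her: "hereditary A"
    and d2: "d2 \<in> Hom C P3 P2" and d1: "d1 \<in> Hom C P2 P1" and d0: "d0 \<in> Hom C P1 P0"
    and ex2: "exact_at C d2 d1" and ex1: "exact_at C d1 d0"
    and H: "is_homology D (Ra d2) (Ra d1) H"
  shows "is_zero D H"
proof -
  interpret D: abelian D by (rule D_abelian)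
  have o: "P3 \<in> Obj C" "P2 \<in> Obj C" "P1 \<in> Obj C" using C.HomD[OF d2] C.HomD[OF d1] by auto
  note r3 = r_Hom[OF o(1)] and r2 = r_Hom[OF o(2)] and r1 = r_Hom[OF o(3)]
  have R2: "Ra d2 \<in> Hom D (Ro P3) (Ro P2)" and R1: "Ra d1 \<in> Hom D (Ro P2) (Ro P1)"
    using functor_Hom[OF R_functor] d2 d1 by blast+
  note R2C = Hom_D_subset[OF R2] and R1C = Hom_D_subset[OF R1]
  obtain K k e q where k: "is_kernel D (Ra d1) K k" and e: "e \<in> Hom D (Ro P3) K" "k \<bullet> e = Ra d2"
    and q: "is_cokernel D e H q"
    using H D.HomD[OF R2] unfolding is_homology_def by auto
  note kD = D.is_kernelD[OF k R1] and qD = D.is_cokernelD[OF q e(1)]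
  have KD: "K \<in> Obj D" using D.HomD[OF kD(1)] by simp
  note kC = Hom_D_subset[OF kD(1)] and eC = Hom_D_subset[OF e(1)]
  obtain L z e' where z: "is_kernel C d0 L z" and e': "e' \<in> Hom C P2 L" "z \<bullet> e' = d1" "epi_arr C e'"
    using ex1 C.HomD[OF d1] by (auto simp: exact_at_def)
  note zD = C.is_kernelD[OF z d0]
  have "epi_arr C e"
  proof (rule epi_test[OF eC])
    fix U u assume U: "U \<in> Obj A" and u: "u \<in> Hom C (Yo U) K"
    obtain a where a: "a \<in> Hom C (Yo U) P2" "r P2 \<bullet> a = k \<bullet> u"
      using C.projectiveD[OF Y_projective[OF U] r_epi[OF o(2)] r2 C.Cmp_Hom[OF u kC]] .
    have e'a: "e' \<bullet> a \<in> Hom C (Yo U) L" using C.Cmp_Hom[OF a(1) e'(1)] .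
    have "r P1 \<bullet> z \<bullet> e' \<bullet> a = r P1 \<bullet> d1 \<bullet> a" using C.Cmp_push[OF e'(2,1) zD(1) a(1)] by simp
    also have "\<dots> = Ra d1 \<bullet> r P2 \<bullet> a" using C.Cmp_swap[OF r_nat[OF d1] r2 R1C d1 r1 a(1)] by simp
    also have "\<dots> = Ra d1 \<bullet> k \<bullet> u" using a(2) by simp
    also have "\<dots> = Nul C (Yo U) (Ro P1)"
      using C.Cmp_push[of "Ra d1" k "Nul C K (Ro P1)" K "Ro P2" "Ro P1" u "Yo U", OF _ kC R1C u] kD(2) R1C u
      by (simp add: C.Hom_iff)
    finally have re': "r L \<bullet> e' \<bullet> a = Nul C (Yo U) (Ro L)" using r_mono[OF her zD(1,3) U e'a] by blast
    \<comment> \<open>So \<open>e' a\<close> comes from a projective \<open>P\<close>. Lifting \<open>P\<close> along \<open>e'\<close> and subtracting, one may assume that \<open>d1\<close> kills \<open>a\<close>;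
      this does not change \<open>r P2 a\<close>.\<close>
    have Lo: "L \<in> Obj C" using C.HomD[OF zD(1)] by simp
    obtain f B X c where f: "f \<in> Hom A B X" and c: "c \<in> Hom C (Yo X) L" "epi_arr C c"
      using obtain_presentation[OF Lo] .
    have X: "X \<in> Obj A" using A.HomD[OF f] by simp
    obtain P \<pi> where P: "projective A P" and \<pi>: "\<pi> \<in> Hom A P X" "epi_arr A \<pi>" using obtain_projective_cover[OF X] .
    obtain h where h: "h \<in> Hom A U P" "e' \<bullet> a = c \<bullet> Ya (\<pi> \<cdot> h)" using r_kernel[OF c P \<pi> U e'a re'] .
    obtain \<sigma> where \<sigma>: "\<sigma> \<in> Hom C (Yo P) P2" "e' \<bullet> \<sigma> = c \<bullet> Ya \<pi>"
      using C.projectiveD[OF Y_projective[OF A.projective_Obj[OF P]] e'(3,1) C.Cmp_Hom[OF Y_Hom[OF \<pi>(1)] c(1)]] .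
    note \<sigma>h = C.Cmp_Hom[OF Y_Hom[OF h(1)] \<sigma>(1)]
    have "e' \<bullet> \<sigma> \<bullet> Ya h = e' \<bullet> a"
      using C.Cmp_push[OF \<sigma>(2,1) e'(1) Y_Hom[OF h(1)]] h \<pi>(1) c(1) by (simp add: Hom_iffs)
    then have "d1 \<bullet> \<sigma> \<bullet> Ya h = d1 \<bullet> a"
      using C.Cmp_push[OF e'(2,1) zD(1) \<sigma>h] C.Cmp_push[OF e'(2,1) zD(1) a(1)] by simp
    moreover obtain b where b: "b \<in> Hom C (Yo U) P2" "a = Pls C b (\<sigma> \<bullet> Ya h)" using C.ex_diff[OF a(1) \<sigma>h] .
    ultimately have "Pls C (d1 \<bullet> b) (d1 \<bullet> a) = d1 \<bullet> a" using C.Cmp_Pls_right[OF b(1) \<sigma>h d1] by simp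
    then have "d1 \<bullet> b = Nul C (Yo U) P1" using C.Pls_eq_right_iff[OF C.Cmp_Hom[OF b(1) d1] C.Cmp_Hom[OF a(1) d1]] by simp
    then obtain y where y: "y \<in> Hom C (Yo U) P3" "d2 \<bullet> y = b"
      using C.exact_at_lift[OF ex2 d2 d1 Y_projective[OF U] b(1)] by blast
    have "k \<bullet> u = r P2 \<bullet> b"
      using a(2) b(2) C.Cmp_Pls_right[OF b(1) \<sigma>h r2] r_projective[OF P \<sigma>(1) Y_Hom[OF h(1)]]
        C.Cmp_Hom[OF b(1) r2] by (simp add: C.Hom_iff)
    also have "\<dots> = Ra d2 \<bullet> r P3 \<bullet> y" using C.Cmp_swap[OF r_nat[OF d2] r3 R2C d2 r2 y(1)] y(2) by simp
    also have "\<dots> = k \<bullet> e \<bullet> r P3 \<bullet> y" using C.Cmp_push[OF e(2) eC kC C.Cmp_Hom[OF y(1) r3]] by simp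
    finally have ku: "k \<bullet> u = k \<bullet> e \<bullet> r P3 \<bullet> y" .
    have ery: "e \<bullet> r P3 \<bullet> y \<in> Hom C (Yo U) K" using C.Cmp_Hom[OF C.Cmp_Hom[OF y(1) r3] eC] .
    have kmono: "mono_arr C k"
    proof (rule C.mono_arrI[OF kC])
      fix W v assume v: "v \<in> Hom C W K" "k \<bullet> v = Nul C W (Ro P2)"
      have W: "W \<in> Obj C" using C.HomD[OF v(1)] by simp
      obtain v' where v': "v' \<in> Hom C (Ro W) K" "v' \<bullet> r W = v" using r_lift[OF KD v(1)] .
      have "(k \<bullet> v') \<bullet> r W = Nul C (Ro W) (Ro P2) \<bullet> r W"
        using v v' kC r_Hom[OF W] by (simp add: C.Hom_iff)
      then have "k \<bullet> v' = Nul C (Ro W) (Ro P2)"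
        using r_unique[OF W Ro_D[OF o(2)] C.Cmp_Hom[OF v'(1) kC] C.Nul_Hom[OF Ro_Obj[OF W] Ro_Obj[OF o(2)]]] by blast
      then have "v' = Nul C (Ro W) K"
        using D.mono_Nul[OF kD(3,1), of v' "Ro W"] v'(1) Hom_D[OF Ro_D[OF W] KD] by simp
      then show "v = Nul C W K" using v' r_Hom[OF W] KD D_Obj by (auto simp: C.Hom_iff)
    qed
    have "u = e \<bullet> r P3 \<bullet> y" using C.mono_arrD[OF kmono kC u ery ku] .
    then show "\<exists>b\<in>Hom C (Yo U) (Ro P3). e \<bullet> b = u" using C.Cmp_Hom[OF y(1) r3] by blast
  qed
  then have "epi_arr D e" using D_epi[OF eC _ Ro_D[OF o(1)] KD] by blast
  then have "q = Nul D K H" using D.epi_Nul[OF _ e(1) qD(1)] qD(2) by simp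
  moreover have "H \<in> Obj D" using D.HomD[OF qD(1)] by simp
  ultimately have "Idn D H = Nul D H H"
    using D.epi_Nul[OF qD(3,1) D.Idn_Hom[of H]] KD D_Obj by (simp add: C.Hom_iff)
  then show ?thesis using D.is_zeroI \<open>H \<in> Obj D\<close> by blast
qed

text \<open>A syzygy \<open>K \<rightarrow> P \<rightarrow> X\<close> yields the projective resolution \<open>0 \<rightarrow> Y K \<rightarrow> Y P \<rightarrow> Y X \<rightarrow> T X\<close>. As \<open>R (Y P) = 0\<close>, the second derived
  functor of \<open>R\<close> at \<open>T X\<close> is \<open>R (Y K)\<close>. If that vanishes then so does \<open>p K\<close>, which means that \<open>K\<close> is projective.\<close>

lemma hereditary_of_derived_vanish:
  assumes vanish: "\<And>P H. projective D P \<Longrightarrow> left_derived_value C D R 2 P H \<Longrightarrow> is_zero D H"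
  shows "hereditary A"
proof (rule A.hereditaryI[OF enough])
  interpret D: abelian D by (rule D_abelian)
  fix P X e K k
  assume P: "projective A P" and e: "e \<in> Hom A P X" "epi_arr A e" and k: "is_kernel A e K k"
  note kD = A.is_kernelD[OF k e(1)]
  have o: "P \<in> Obj A" "X \<in> Obj A" "K \<in> Obj A" using A.HomD[OF e(1)] A.HomD[OF kD(1)] by auto
  note Yk = Y_Hom[OF kD(1)]
  have Ykerm: "is_kernel C (Ya e) (Yo K) (Ya k)"
  proof (rule kernel_test[OF Y_Hom[OF e(1)] Yk])
    show "Ya e \<bullet> Ya k = Nul C (Yo K) (Yo X)" using kD(1,2) e(1) o by (simp add: A.Hom_iff flip: Ya_Cmp)
    fix U a assume U: "U \<in> Obj A"
    { assume a: "a \<in> Hom C (Yo U) (Yo K)" "Ya k \<bullet> a = Nul C (Yo U) (Yo P)"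
      obtain x where x: "x \<in> Hom A U K" "Ya x = a" using Y_full[OF a(1) U o(3)] .
      have "Ya (k \<cdot> x) = Nul C (Yo U) (Yo P)" using x a kD(1) by (simp add: A.Hom_iff)
      then have "k \<cdot> x = Nul A U P" using Y_faithful_Nul[OF A.Cmp_Hom[OF x(1) kD(1)]] by blast
      then have "x = Nul A U K" using A.mono_Nul[OF kD(3,1) x(1)] by blast
      then show "a = Nul C (Yo U) (Yo K)" using x U o by simp }
    { assume a: "a \<in> Hom C (Yo U) (Yo P)" "Ya e \<bullet> a = Nul C (Yo U) (Yo X)"
      obtain x where x: "x \<in> Hom A U P" "Ya x = a" using Y_full[OF a(1) U o(1)] .
      have "Ya (e \<cdot> x) = Nul C (Yo U) (Yo X)" using x a e(1) by (simp add: A.Hom_iff)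
      then have "e \<cdot> x = Nul A U X" using Y_faithful_Nul[OF A.Cmp_Hom[OF x(1) e(1)]] by blast
      then obtain u where u: "u \<in> Hom A U K" "k \<cdot> u = x" using A.is_kernel_lift[OF k e(1) x(1)] by blast
      have "Ya k \<bullet> Ya u = a" using u x kD(1) by (auto simp: A.Hom_iff simp flip: Ya_Cmp)
      then show "\<exists>u\<in>Hom C (Yo U) (Yo K). Ya k \<bullet> u = a" using Y_Hom[OF u(1)] by blast }
  qed
  obtain Z where Z: "is_zero C Z" using C.has_zero by blast
  have Zo: "Z \<in> Obj C" using C.is_zero_Obj[OF Z] .
  note res = C.projective_resolution_of_length_two[OF Y_projective[OF o(2)] Y_projective[OF o(1)] Y_projective[OF o(3)]
      Z p_Hom[OF o(2)] p_epi[OF o(2)] Y_Hom[OF e(1)] C.exact_at_cokernel[OF p_cokernel[OF P e] Y_Hom[OF e(1)]] Ykerm]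
  have YK: "Yo K \<in> Obj C" and YP: "Yo P \<in> Obj C" using o by auto
  have "Ra (Nul C Z (Yo K)) \<bullet> r Z = Nul C (Ro Z) (Ro (Yo K)) \<bullet> r Z"
    using r_nat[OF C.Nul_Hom[OF Zo YK]] r_Hom[OF Zo] r_Hom[OF YK] Zo Ro_Obj[OF YK] by (simp add: C.Hom_iff)
  then have R2: "Ra (Nul C Z (Yo K)) = Nul C (Ro Z) (Ro (Yo K))"
    using r_unique[OF Zo Ro_D[OF YK] Ra_Hom[OF C.Nul_Hom[OF Zo YK]] C.Nul_Hom[OF Ro_Obj[OF Zo] Ro_Obj[OF YK]]] by blast
  have "Ra (Ya k) \<bullet> r (Yo K) = r (Yo P) \<bullet> Ya k" using r_nat[OF Yk] .
  also have "r (Yo P) = Nul C (Yo P) (Ro (Yo P))" using Y_projective_to_D[OF P Ro_D[OF YP] r_Hom[OF YP]] .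
  also have "\<dots> \<bullet> Ya k = Nul C (Ro (Yo K)) (Ro (Yo P)) \<bullet> r (Yo K)"
    using Yk r_Hom[OF YK] Ro_Obj[OF YP] by (simp add: C.Hom_iff)
  finally have R1: "Ra (Ya k) = Nul C (Ro (Yo K)) (Ro (Yo P))"
    using r_unique[OF YK Ro_D[OF YP] Ra_Hom[OF Yk] C.Nul_Hom[OF Ro_Obj[OF YK] Ro_Obj[OF YP]]] by blast
  have "is_homology D (Ra (Nul C Z (Yo K))) (Ra (Ya k)) (Ro (Yo K))"
    using D.is_homology_Nul[OF Ro_D[OF Zo] Ro_D[OF YK] Ro_D[OF YP]] R1 R2 by simp
  then have "left_derived_value C D R 2 (To X) (Ro (Yo K))"
    using left_derived_value_2I[OF res, of D R] by simp
  then have "is_zero D (Ro (Yo K))" using vanish[OF T_projective[OF o(2)]] by blast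
  then have Rz: "Idn C (Ro (Yo K)) = Nul C (Ro (Yo K)) (Ro (Yo K))" using D.zero_Idn by simp
  obtain u where u: "u \<in> Hom C (Ro (Yo K)) (To K)" "u \<bullet> r (Yo K) = p K" using r_lift[OF To_D[OF o(3)] p_Hom[OF o(3)]] .
  have "is_zero C (Ro (Yo K))" using C.is_zeroI[OF Ro_Obj[OF YK] Rz] .
  from C.factor_through_zero[OF this r_Hom[OF YK] u(1)] have "p K = Nul C (Yo K) (To K)" using u(2) by simp
  then show "projective A K" using p_zero_iff_projective[OF o(3)] by blast
qed

theorem derived_vanish_iff_hereditary:
  "(\<forall>P. projective D P \<longrightarrow> (\<forall>H. left_derived_value C D R 2 P H \<longrightarrow> is_zero D H)) \<longleftrightarrow> hereditary A"
proof
  assume her: "hereditary A"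
  show "\<forall>P. projective D P \<longrightarrow> (\<forall>H. left_derived_value C D R 2 P H \<longrightarrow> is_zero D H)"
  proof (intro allI impI)
    fix Q H assume "left_derived_value C D R 2 Q H"
    then obtain P d \<epsilon> where res: "projective_resolution C Q P d \<epsilon>" and H: "is_homology D (Ra (d 2)) (Ra (d 1)) H"
      unfolding left_derived_value_2 by blast
    have d: "d n \<in> Hom C (P (Suc n)) (P n)" and ex: "exact_at C (d (Suc n)) (d n)" for n
      using res by (auto simp: projective_resolution_def)
    show "is_zero D H"
      using derived_vanish[OF her d d d ex ex, of 0 H] H by (simp add: numeral_2_eq_2)
  qed
qed (use hereditary_of_derived_vanish in blast)

text \<open>If \<open>l X\<close> has no nonzero subobjects in \<open>D\<close>, the kernel of \<open>l P \<rightarrow> l X\<close> (which is \<open>Y K\<close> modulo the image of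
  \<open>Y P1\<close>) vanishes, where \<open>K\<close> is a syzygy of \<open>X\<close> covered by \<open>P1\<close>. Hence \<open>P1 \<rightarrow> K\<close> splits.\<close>

lemma hereditary_of_torsion_free:
  assumes free: "\<And>X V a. X \<in> Obj A \<Longrightarrow> V \<in> Obj D \<Longrightarrow> a \<in> Hom C V (lo X) \<Longrightarrow> a = Nul C V (lo X)"
  shows "hereditary A"
proof (rule A.hereditaryI[OF enough])
  fix P X e K k
  assume P: "projective A P" and e: "e \<in> Hom A P X" "epi_arr A e" and k: "is_kernel A e K k"
  note kD = A.is_kernelD[OF k e(1)]
  have o: "P \<in> Obj A" "X \<in> Obj A" "K \<in> Obj A" using A.HomD[OF e(1)] A.HomD[OF kD(1)] by auto
  obtain P1 d1 where P1: "projective A P1" and d1: "d1 \<in> Hom A P1 K" "epi_arr A d1"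
    using obtain_projective_cover[OF o(3)] .
  have P1o: "P1 \<in> Obj A" using A.projective_Obj[OF P1] .
  have d: "k \<cdot> d1 \<in> Hom A P1 P" using A.Cmp_Hom[OF d1(1) kD(1)] .
  have "is_cokernel A (k \<cdot> d1) X e"
    using A.is_cokernel_Cmp_epi[OF A.epi_is_cokernel_of_kernel[OF e(2,1) k] kD(1) d1(2,1)] .
  then have cok: "is_cokernel C (la (k \<cdot> d1)) (lo X) (la e)" using l_right_exact by (simp add: right_exact_def)
  note ld = functor_Hom[OF l_functor d] and le = functor_Hom[OF l_functor e(1)]
  let ?A = "full_sub A {P. projective A P}"
  obtain \<phi> where \<phi>: "nat_trans ?A C l Y \<phi>" and iso: "\<And>X. X \<in> Obj ?A \<Longrightarrow> is_iso C (lo X) (Yo X) (\<phi> X)"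
    using l_Y unfolding nat_isomorphic_def by blast
  obtain \<psi> where \<psi>: "\<psi> \<in> Hom C (Yo P) (lo P)" "\<psi> \<bullet> \<phi> P = Idn C (lo P)" "\<phi> P \<bullet> \<psi> = Idn C (Yo P)"
    and \<phi>P: "\<phi> P \<in> Hom C (lo P) (Yo P)"
    using C.is_isoD[OF iso[of P]] P o by auto
  obtain \<psi>1 where \<psi>1: "\<psi>1 \<in> Hom C (Yo P1) (lo P1)" "\<phi> P1 \<bullet> \<psi>1 = Idn C (Yo P1)"
    and \<phi>P1: "\<phi> P1 \<in> Hom C (lo P1) (Yo P1)"
    using C.is_isoD[OF iso[of P1]] P1 P1o by auto
  have nat: "\<phi> P \<bullet> la (k \<cdot> d1) = Ya (k \<cdot> d1) \<bullet> \<phi> P1"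
    using \<phi> P P1 A.HomD[OF d] unfolding nat_trans_def by (auto simp: full_sub_def)
  \<comment> \<open>The arrow \<open>Y K \<rightarrow> l X\<close> kills the image of \<open>Y P1\<close>, so it factors through \<open>T K\<close> and vanishes.\<close>
  let ?b = "la e \<bullet> \<psi> \<bullet> Ya k"
  note Yk = Y_Hom[OF kD(1)] and Yd1 = Y_Hom[OF d1(1)] and Yd = Y_Hom[OF d]
  have \<psi>k: "\<psi> \<bullet> Ya k \<in> Hom C (Yo K) (lo P)" using C.Cmp_Hom[OF Yk \<psi>(1)] .
  have b: "?b \<in> Hom C (Yo K) (lo X)" using C.Cmp_Hom[OF \<psi>k le] .
  have "Ya (k \<cdot> d1) = Ya (k \<cdot> d1) \<bullet> \<phi> P1 \<bullet> \<psi>1" using \<psi>1(2) Yd by (simp add: C.Hom_iff)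
  also have "\<dots> = \<phi> P \<bullet> la (k \<cdot> d1) \<bullet> \<psi>1" using C.Cmp_swap[OF nat ld \<phi>P \<phi>P1 Yd \<psi>1(1)] by simp
  finally have "\<psi> \<bullet> Ya (k \<cdot> d1) = \<psi> \<bullet> \<phi> P \<bullet> la (k \<cdot> d1) \<bullet> \<psi>1" by simp
  also have "\<dots> = la (k \<cdot> d1) \<bullet> \<psi>1"
    using C.Cmp_push[OF \<psi>(2) \<phi>P \<psi>(1) C.Cmp_Hom[OF \<psi>1(1) ld]] ld \<psi>1(1) by (simp add: C.Hom_iff)
  finally have "la e \<bullet> \<psi> \<bullet> Ya (k \<cdot> d1) = la e \<bullet> la (k \<cdot> d1) \<bullet> \<psi>1" by simp
  also have "\<dots> = Nul C (Yo P1) (lo X)"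
    using C.Cmp_push[OF C.is_cokernelD(2)[OF cok ld] ld le \<psi>1(1)] \<psi>1(1) le by (simp add: C.Hom_iff)
  finally have "?b \<bullet> Ya d1 = Nul C (Yo P1) (lo X)"
    using le \<psi>(1) kD(1) d1(1) by (simp add: Hom_iffs)
  then obtain u where u: "u \<in> Hom C (To K) (lo X)" "u \<bullet> p K = ?b"
    using C.is_cokernel_desc[OF p_cokernel[OF P1 d1] Yd1 b] by blast
  have "?b = Nul C (Yo K) (lo X)"
    using free[OF o(2) To_D[OF o(3)] u(1)] u(2) p_Hom[OF o(3)] le by (auto simp: C.Hom_iff)
  then obtain t where t: "t \<in> Hom C (Yo K) (lo P1)" "la (k \<cdot> d1) \<bullet> t = \<psi> \<bullet> Ya k"
    using C.projective_lift_cokernel[OF cok ld Y_projective[OF o(3)] \<psi>k] by blast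
  obtain i where i: "i \<in> Hom A K P1" "Ya i = \<phi> P1 \<bullet> t" using Y_full[OF C.Cmp_Hom[OF t(1) \<phi>P1] o(3) P1o] .
  have "Ya ((k \<cdot> d1) \<cdot> i) = Ya (k \<cdot> d1) \<bullet> \<phi> P1 \<bullet> t" using d i by (simp add: A.Hom_iff)
  also have "\<dots> = \<phi> P \<bullet> la (k \<cdot> d1) \<bullet> t" using C.Cmp_swap[OF nat ld \<phi>P \<phi>P1 Yd t(1)] by simp
  also have "\<dots> = \<phi> P \<bullet> \<psi> \<bullet> Ya k" using t(2) by simp
  also have "\<dots> = Ya k" using C.Cmp_push[OF \<psi>(3,1) \<phi>P Yk] Yk by (simp add: C.Hom_iff)
  finally have "(k \<cdot> d1) \<cdot> i = k" using Y_faithful[OF A.Cmp_Hom[OF i(1) d] kD(1)] by blast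
  then have "k \<cdot> d1 \<cdot> i = k \<cdot> Idn A K" using i(1) d1(1) kD(1) by (simp add: A.Hom_iff)
  then have "d1 \<cdot> i = Idn A K"
    using A.mono_arrD[OF kD(3,1) A.Cmp_Hom[OF i(1) d1(1)] A.Idn_Hom[OF o(3)]] by blast
  then show "projective A K" using A.projective_retract[OF P1 i(1) d1(1)] by blast
qed

end

section \<open>Equivalences of categories\<close>

lemma id_functor_simps [simp]: "FO id_functor X = X" "FA id_functor f = f"
  by (simp_all add: id_functor_def)

lemma comp_functor_simps [simp]: "FO (G \<circ>\<^sub>F F) X = FO G (FO F X)" "FA (G \<circ>\<^sub>F F) f = FA G (FA F f)"
  by (simp_all add: comp_functor_def)

lemma nat_transD:
  assumes "nat_trans C D F G \<nu>"
  shows "X \<in> Obj C \<Longrightarrow> \<nu> X \<in> Hom D (FO F X) (FO G X)"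
    and "f \<in> Hom C X Y \<Longrightarrow> Cmp D (\<nu> Y) (FA F f) = Cmp D (FA G f) (\<nu> X)"
  using assms by (auto simp: nat_trans_def Hom_def)

lemma nat_isomorphicI:
  assumes "category C"
    and "\<And>X. X \<in> Obj C \<Longrightarrow> is_iso D (FO F X) (FO G X) (\<nu> X)"
    and "\<And>X Y f. f \<in> Hom C X Y \<Longrightarrow> Cmp D (\<nu> Y) (FA F f) = Cmp D (FA G f) (\<nu> X)"
  shows "nat_isomorphic C D F G"
  unfolding nat_isomorphic_def nat_trans_def
  using assms(2) assms(3)[OF category.Arr_Hom[OF assms(1)]]
  by (intro exI[of _ \<nu>]) (auto simp: is_iso_def)

lemma nat_isomorphicE:
  assumes "nat_isomorphic C D F G"
  obtains \<nu> where "nat_trans C D F G \<nu>" "\<forall>X \<in> Obj C. is_iso D (FO F X) (FO G X) (\<nu> X)"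
  using assms unfolding nat_isomorphic_def by auto

lemma equivalenceE:
  assumes "equivalence C D E"
  obtains G where "is_functor D C G" "nat_isomorphic C C (G \<circ>\<^sub>F E) id_functor"
    "nat_isomorphic D D (E \<circ>\<^sub>F G) id_functor"
  using assms unfolding equivalence_def by auto

lemma equivalence_id:
  assumes "category C" shows "equivalence C C id_functor"
proof -
  interpret category C by fact
  have f: "is_functor C C id_functor"
    using Arr_Hom by (auto simp: is_functor_def)
  have "nat_isomorphic C C (id_functor \<circ>\<^sub>F id_functor) id_functor"
    by (rule nat_isomorphicI[OF assms, of _ _ _ "Idn C"]) (auto simp: is_iso_Idn Hom_iff)
  then show ?thesis using f by (auto simp: equivalence_def)
qed

lemma equivalence_faithful:
  assumes E: "equivalence C D E" and C: "category C" and D: "category D"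
    and ab: "a \<in> Hom C X Y" "b \<in> Hom C X Y" "FA E a = FA E b"
  shows "a = b"
proof -
  interpret C: category C by fact
  obtain G where G: "nat_isomorphic C C (G \<circ>\<^sub>F E) id_functor" using equivalenceE[OF E] .
  obtain \<nu> where nt: "nat_trans C C (G \<circ>\<^sub>F E) id_functor \<nu>"
    and iso: "\<forall>X \<in> Obj C. is_iso C (FO G (FO E X)) X (\<nu> X)"
    using nat_isomorphicE[OF G] by auto
  have X: "X \<in> Obj C" using C.HomD[OF ab(1)] by simp
  have "Cmp C a (\<nu> X) = Cmp C b (\<nu> X)"
    using nat_transD(2)[OF nt ab(1)] nat_transD(2)[OF nt ab(2)] ab(3) by simp
  then show ?thesis using C.epi_arrD[OF C.iso_epi[OF bspec[OF iso X]] nat_transD(1)[OF nt X]] ab by simp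
qed

lemma equivalence_reflects_zero:
  assumes E: "equivalence C D E" and C: "preadditive C" and D: "preadditive D"
    and X: "X \<in> Obj C" and Z: "is_zero D (FO E X)"
  shows "is_zero C X"
proof -
  interpret C: preadditive C by fact
  interpret D: preadditive D by fact
  have F: "is_functor C D E" using E by (simp add: equivalence_def)
  have "FA E (Idn C X) = FA E (Nul C X X)"
    using D.from_zero[OF Z] functor_Hom[OF F C.Idn_Hom[OF X]] functor_Hom[OF F C.Nul_Hom[OF X X]] by metis
  then have "Idn C X = Nul C X X"
    using equivalence_faithful[OF E C.category_axioms D.category_axioms C.Idn_Hom[OF X] C.Nul_Hom[OF X X]] by simp
  then show ?thesis using C.is_zeroI[OF X] by simp
qed

text \<open>A pseudo-inverse \<open>G\<close> of \<open>E\<close> preserves epimorphisms because \<open>E\<close> is faithful, so lifting problems against \<open>e\<close> can be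
  solved in \<open>C\<close> after applying \<open>G\<close>.\<close>

lemma equivalence_projective:
  assumes E: "equivalence C D E" and C: "category C" and D: "category D" and Q: "projective C Q"
  shows "projective D (FO E Q)"
  unfolding projective_def
proof (intro conjI allI impI ballI)
  interpret C: category C by fact
  interpret D: category D by fact
  have F: "is_functor C D E" using E by (simp add: equivalence_def)
  have Qo: "Q \<in> Obj C" using C.projective_Obj[OF Q] .
  show EQ: "FO E Q \<in> Obj D" using functor_Obj[OF F Qo] .
  obtain G where G: "is_functor D C G" and GE: "nat_isomorphic C C (G \<circ>\<^sub>F E) id_functor"
    and EG: "nat_isomorphic D D (E \<circ>\<^sub>F G) id_functor"
    using equivalenceE[OF E] .
  obtain \<nu> where \<nu>iso: "\<forall>X \<in> Obj C. is_iso C (FO G (FO E X)) X (\<nu> X)"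
    using nat_isomorphicE[OF GE] by auto
  obtain \<epsilon> where \<epsilon>: "nat_trans D D (E \<circ>\<^sub>F G) id_functor \<epsilon>"
    and \<epsilon>iso: "\<forall>X \<in> Obj D. is_iso D (FO E (FO G X)) X (\<epsilon> X)"
    using nat_isomorphicE[OF EG] by auto
  fix e f assume e: "epi_arr D e" and f: "f \<in> Hom D (FO E Q) (Cod D e)"
  define T S where "T = Dom D e" and "S = Cod D e"
  have eH: "e \<in> Hom D T S" using e D.Arr_Hom by (simp add: T_def S_def epi_arr_def)
  have fH: "f \<in> Hom D (FO E Q) S" using f by (simp add: S_def)
  have TS: "T \<in> Obj D" "S \<in> Obj D" using D.HomD[OF eH] by auto
  have \<epsilon>T: "\<epsilon> T \<in> Hom D (FO E (FO G T)) T" and \<epsilon>S: "\<epsilon> S \<in> Hom D (FO E (FO G S)) S"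
    and \<epsilon>Q: "\<epsilon> (FO E Q) \<in> Hom D (FO E (FO G (FO E Q))) (FO E Q)"
    using nat_transD(1)[OF \<epsilon>] TS EQ by auto
  obtain iS where iS: "iS \<in> Hom D S (FO E (FO G S))" "Cmp D iS (\<epsilon> S) = Idn D (FO E (FO G S))"
    using D.is_isoD[OF bspec[OF \<epsilon>iso TS(2)]] by auto
  obtain iQ where iQ: "iQ \<in> Hom D (FO E Q) (FO E (FO G (FO E Q)))" "Cmp D iQ (\<epsilon> (FO E Q)) = Idn D (FO E (FO G (FO E Q)))"
    using D.is_isoD[OF bspec[OF \<epsilon>iso EQ]] by auto
  obtain jQ where jQ: "jQ \<in> Hom C Q (FO G (FO E Q))" "Cmp C (\<nu> Q) jQ = Idn C Q"
    and \<nu>Q: "\<nu> Q \<in> Hom C (FO G (FO E Q)) Q"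
    using C.is_isoD[OF bspec[OF \<nu>iso Qo]] by auto
  note Ge = functor_Hom[OF G eH]
  note EGe = functor_Hom[OF F Ge]
  have \<epsilon>e: "Cmp D (\<epsilon> S) (FA E (FA G e)) = Cmp D e (\<epsilon> T)" using nat_transD(2)[OF \<epsilon> eH] by simp
  have "epi_arr C (FA G e)"
  proof -
    have "a = b" if a: "a \<in> Hom C (FO G S) W" and b: "b \<in> Hom C (FO G S) W" and eq: "Cmp C a (FA G e) = Cmp C b (FA G e)" for a b W
    proof -
      note Ea = functor_Hom[OF F a] and Eb = functor_Hom[OF F b]
      note Ei = D.Cmp_Hom[OF iS(1) Ea] D.Cmp_Hom[OF iS(1) Eb]
      have "Cmp D (Cmp D (FA E c) iS) (Cmp D e (\<epsilon> T)) = FA E (Cmp C c (FA G e))" if c: "c \<in> Hom C (FO G S) W" for c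
      proof -
        note Ec = functor_Hom[OF F c]
        have "Cmp D (Cmp D (FA E c) iS) (Cmp D e (\<epsilon> T)) = Cmp D (FA E c) (Cmp D iS (Cmp D (\<epsilon> S) (FA E (FA G e))))"
          using \<epsilon>e Ec iS(1) eH \<epsilon>T by (simp add: D.Hom_iff)
        also have "\<dots> = Cmp D (FA E c) (FA E (FA G e))"
          using D.Cmp_push[OF iS(2) \<epsilon>S iS(1) EGe] EGe by (simp add: D.Hom_iff)
        finally show ?thesis using functor_Cmp[OF F Ge c] by simp
      qed
      from this[OF a] this[OF b] have "Cmp D (Cmp D (FA E a) iS) (Cmp D e (\<epsilon> T)) = Cmp D (Cmp D (FA E b) iS) (Cmp D e (\<epsilon> T))"
        using eq by simp
      then have ai: "Cmp D (FA E a) iS = Cmp D (FA E b) iS"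
        using D.epi_arrD[OF D.epi_Cmp[OF D.iso_epi[OF bspec[OF \<epsilon>iso TS(1)]] e _ eH] _ Ei] \<epsilon>T D.Cmp_Hom[OF \<epsilon>T eH] by simp
      have "FA E a = Cmp D (Cmp D (FA E a) iS) (\<epsilon> S)" "FA E b = Cmp D (Cmp D (FA E b) iS) (\<epsilon> S)"
        using iS Ea Eb \<epsilon>S by (simp_all add: D.Hom_iff)
      then have "FA E a = FA E b" using ai by simp
      then show ?thesis using equivalence_faithful[OF E C D a b] by simp
    qed
    then show ?thesis using Ge by (auto simp: epi_arr_def C.Hom_iff)
  qed
  \<comment> \<open>The chosen isomorphisms need not satisfy the triangle identities, so the lift is corrected by an
    automorphism of the source.\<close>
  define f1 where "f1 = Cmp D f (Cmp D (FA E (\<nu> Q)) iQ)"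
  have f1: "f1 \<in> Hom D (FO E Q) S"
    unfolding f1_def using D.Cmp_Hom[OF D.Cmp_Hom[OF iQ(1) functor_Hom[OF F \<nu>Q]] fH] .
  note Gf1 = functor_Hom[OF G f1]
  obtain u where u: "u \<in> Hom C Q (FO G T)" "Cmp C (FA G e) u = Cmp C (FA G f1) jQ"
    using C.projectiveD[OF Q \<open>epi_arr C (FA G e)\<close> Ge C.Cmp_Hom[OF jQ(1) Gf1]] .
  note Eu = functor_Hom[OF F u(1)] and EG = functor_Hom[OF F Gf1] and Ej = functor_Hom[OF F jQ(1)]
  have "Cmp D e (Cmp D (\<epsilon> T) (FA E u)) = Cmp D (\<epsilon> S) (Cmp D (FA E (FA G e)) (FA E u))"
    using D.Cmp_swap[OF \<epsilon>e EGe \<epsilon>S \<epsilon>T eH Eu] by simp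
  also have "\<dots> = Cmp D (\<epsilon> S) (Cmp D (FA E (FA G f1)) (FA E jQ))"
    using functor_Cmp[OF F u(1) Ge] functor_Cmp[OF F jQ(1) Gf1] u(2) by simp
  also have "\<dots> = Cmp D f1 (Cmp D (\<epsilon> (FO E Q)) (FA E jQ))"
    using D.Cmp_swap[OF _ EG \<epsilon>S \<epsilon>Q f1 Ej] nat_transD(2)[OF \<epsilon> f1] by simp
  also have "\<dots> = Cmp D f (Cmp D (FA E (\<nu> Q)) (Cmp D iQ (Cmp D (\<epsilon> (FO E Q)) (FA E jQ))))"
    using fH functor_Hom[OF F \<nu>Q] iQ(1) \<epsilon>Q Ej by (simp add: f1_def D.Hom_iff)
  also have "\<dots> = Cmp D f (Cmp D (FA E (\<nu> Q)) (FA E jQ))"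
    using D.Cmp_push[OF iQ(2) \<epsilon>Q iQ(1) Ej] Ej by (simp add: D.Hom_iff)
  also have "Cmp D (FA E (\<nu> Q)) (FA E jQ) = Idn D (FO E Q)"
    using functor_Cmp[OF F jQ(1) \<nu>Q] jQ(2) functor_Idn[OF F Qo] by simp
  also have "Cmp D f (Idn D (FO E Q)) = f" using fH by (simp add: D.Hom_iff)
  finally show "\<exists>u\<in>Hom D (FO E Q) (Dom D e). Cmp D e u = f"
    using D.Cmp_Hom[OF Eu \<epsilon>T] by (auto simp: T_def)
qed

lemma equivalenceI:
  assumes ff: "fully_faithful C D F" and C: "category C" and D: "category D"
    and surj: "\<And>N. N \<in> Obj D \<Longrightarrow> \<exists>X \<in> Obj C. \<exists>i. is_iso D (FO F X) N i"
  shows "equivalence C D F"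
proof -
  interpret C: category C by fact
  interpret D: category D by fact
  have F: "is_functor C D F" using ff by (simp add: fully_faithful_def)
  have full: "\<exists>a \<in> Hom C X Y. FA F a = b" if "b \<in> Hom D (FO F X) (FO F Y)" "X \<in> Obj C" "Y \<in> Obj C" for X Y b
  proof -
    have "b \<in> FA F ` Hom C X Y" using ff that unfolding fully_faithful_def bij_betw_def by blast
    then show ?thesis by blast
  qed
  have faithful: "a = b" if "a \<in> Hom C X Y" "b \<in> Hom C X Y" "FA F a = FA F b" for X Y a b
    using ff that C.HomD(4,5)[OF that(1)] unfolding fully_faithful_def bij_betw_def inj_on_def by blast
  obtain o' i where o': "\<And>N. N \<in> Obj D \<Longrightarrow> o' N \<in> Obj C" and iso: "\<And>N. N \<in> Obj D \<Longrightarrow> is_iso D (FO F (o' N)) N (i N)"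
    using surj by metis
  then have iH: "\<And>N. N \<in> Obj D \<Longrightarrow> i N \<in> Hom D (FO F (o' N)) N" by (auto simp: is_iso_def)
  obtain j where jH: "\<And>N. N \<in> Obj D \<Longrightarrow> j N \<in> Hom D N (FO F (o' N))"
    and ji: "\<And>N. N \<in> Obj D \<Longrightarrow> Cmp D (j N) (i N) = Idn D (FO F (o' N))"
    and ij: "\<And>N. N \<in> Obj D \<Longrightarrow> Cmp D (i N) (j N) = Idn D N"
    using iso unfolding is_iso_def by metis
  have "\<exists>a \<in> Hom C (o' (Dom D f)) (o' (Cod D f)). FA F a = Cmp D (j (Cod D f)) (Cmp D f (i (Dom D f)))"
    if f: "f \<in> Arr D" for f
    using full[OF D.Cmp_Hom[OF D.Cmp_Hom[OF iH D.Arr_Hom[OF f]] jH] o' o'] D.Dom_Obj[OF f] D.Cod_Obj[OF f] by blast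
  then obtain m where m: "\<And>f. f \<in> Arr D \<Longrightarrow> m f \<in> Hom C (o' (Dom D f)) (o' (Cod D f))"
    and Fm': "\<And>f. f \<in> Arr D \<Longrightarrow> FA F (m f) = Cmp D (j (Cod D f)) (Cmp D f (i (Dom D f)))"
    by metis
  have mH: "m f \<in> Hom C (o' N) (o' N')" and Fm: "FA F (m f) = Cmp D (j N') (Cmp D f (i N))"
    if "f \<in> Hom D N N'" for f N N'
    using m Fm' D.HomD[OF that] by auto
  define G where "G = \<lparr>FO = o', FA = m\<rparr>"
  have ifm: "Cmp D (i N') (FA F (m f)) = Cmp D f (i N)" if f: "f \<in> Hom D N N'" for f N N'
  proof -
    have N: "N \<in> Obj D" "N' \<in> Obj D" using D.HomD[OF f] by auto
    have "Cmp D (i N') (FA F (m f)) = Cmp D (Idn D N') (Cmp D f (i N))"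
      unfolding Fm[OF f] using D.Cmp_push[OF ij[OF N(2)] jH[OF N(2)] iH[OF N(2)] D.Cmp_Hom[OF iH[OF N(1)] f]] .
    then show ?thesis using D.Cmp_Hom[OF iH[OF N(1)] f] by (simp add: D.Hom_iff)
  qed
  have mono: "a = b" if ab: "a \<in> Hom C X (o' N)" "b \<in> Hom C X (o' N)" and N: "N \<in> Obj D"
    and eq: "Cmp D (i N) (FA F a) = Cmp D (i N) (FA F b)" for a b X N
  proof -
    have "FA F c = Cmp D (j N) (Cmp D (i N) (FA F c))" if c: "c \<in> Hom C X (o' N)" for c
      using D.Cmp_push[OF ji[OF N] iH[OF N] jH[OF N] functor_Hom[OF F c]] functor_Hom[OF F c] by (simp add: D.Hom_iff)
    then show ?thesis using faithful[OF ab] ab eq by metis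
  qed
  have G: "is_functor D C G"
    unfolding is_functor_def
  proof (intro conjI ballI impI)
    fix N assume N: "N \<in> Obj D"
    show "FO G N \<in> Obj C" using o'[OF N] by (simp add: G_def)
    show "FA G (Idn D N) = Idn C (FO G N)"
      using mono[OF mH[OF D.Idn_Hom[OF N]] C.Idn_Hom[OF o'[OF N]] N] ifm[OF D.Idn_Hom[OF N]]
        functor_Idn[OF F o'[OF N]] iH[OF N] N by (simp add: G_def D.Hom_iff)
  next
    fix f assume "f \<in> Arr D"
    then show "FA G f \<in> Hom C (FO G (Dom D f)) (FO G (Cod D f))" using m by (simp add: G_def)
  next
    fix f h assume "f \<in> Arr D" "h \<in> Arr D" "Dom D h = Cod D f"
    then obtain N N' N'' where f: "f \<in> Hom D N N'" and h: "h \<in> Hom D N' N''" by (auto simp: Hom_def)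
    have N: "N \<in> Obj D" "N' \<in> Obj D" "N'' \<in> Obj D" using D.HomD[OF f] D.HomD[OF h] by auto
    note hf = D.Cmp_Hom[OF f h] and Fmf = functor_Hom[OF F mH[OF f]] and Fmh = functor_Hom[OF F mH[OF h]]
    have "Cmp D (i N'') (FA F (Cmp C (m h) (m f))) = Cmp D (i N'') (Cmp D (FA F (m h)) (FA F (m f)))"
      using functor_Cmp[OF F mH[OF f] mH[OF h]] by simp
    also have "\<dots> = Cmp D h (Cmp D (i N') (FA F (m f)))"
      using D.Cmp_swap[OF ifm[OF h] Fmh iH[OF N(3)] iH[OF N(2)] h Fmf] .
    also have "\<dots> = Cmp D (Cmp D h f) (i N)" using ifm[OF f] f h iH[OF N(1)] by (simp add: D.Hom_iff)
    also have "\<dots> = Cmp D (i N'') (FA F (m (Cmp D h f)))" using ifm[OF hf] by simp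
    finally show "FA G (Cmp D h f) = Cmp C (FA G h) (FA G f)"
      using mono[OF C.Cmp_Hom[OF mH[OF f] mH[OF h]] mH[OF hf] N(3)] by (simp add: G_def)
  qed
  have "nat_isomorphic D D (F \<circ>\<^sub>F G) id_functor"
    by (rule nat_isomorphicI[OF D, of _ _ _ i]) (use iso ifm in \<open>auto simp: G_def\<close>)
  moreover have "nat_isomorphic C C (G \<circ>\<^sub>F F) id_functor"
  proof -
    have FX: "FO F X \<in> Obj D" if "X \<in> Obj C" for X using functor_Obj[OF F that] .
    have "\<exists>a. a \<in> Hom C (o' (FO F X)) X \<and> FA F a = i (FO F X)" if X: "X \<in> Obj C" for X
      using full[OF iH[OF FX[OF X]] o'[OF FX[OF X]] X] by blast
    then obtain \<nu> where \<nu>: "\<And>X. X \<in> Obj C \<Longrightarrow> \<nu> X \<in> Hom C (o' (FO F X)) X"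
      and F\<nu>: "\<And>X. X \<in> Obj C \<Longrightarrow> FA F (\<nu> X) = i (FO F X)" by metis
    show ?thesis
    proof (rule nat_isomorphicI[OF C, of _ _ _ \<nu>])
      fix X assume X: "X \<in> Obj C"
      obtain \<mu> where \<mu>: "\<mu> \<in> Hom C X (o' (FO F X))" "FA F \<mu> = j (FO F X)"
        using full[OF jH[OF FX[OF X]] X o'[OF FX[OF X]]] by blast
      have "FA F (Cmp C \<mu> (\<nu> X)) = FA F (Idn C (o' (FO F X)))" "FA F (Cmp C (\<nu> X) \<mu>) = FA F (Idn C X)"
        using functor_Cmp[OF F \<nu>[OF X] \<mu>(1)] functor_Cmp[OF F \<mu>(1) \<nu>[OF X]] \<mu>(2) F\<nu>[OF X]
          ji[OF FX[OF X]] ij[OF FX[OF X]] functor_Idn[OF F X] functor_Idn[OF F o'[OF FX[OF X]]] by simp_all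
      then have "Cmp C \<mu> (\<nu> X) = Idn C (o' (FO F X))" "Cmp C (\<nu> X) \<mu> = Idn C X"
        using faithful[OF C.Cmp_Hom[OF \<nu>[OF X] \<mu>(1)] C.Idn_Hom[OF o'[OF FX[OF X]]]]
          faithful[OF C.Cmp_Hom[OF \<mu>(1) \<nu>[OF X]] C.Idn_Hom[OF X]] by blast+
      then show "is_iso C (FO (G \<circ>\<^sub>F F) X) (FO id_functor X) (\<nu> X)"
        using \<nu>[OF X] \<mu>(1) by (auto simp: is_iso_def G_def)
    next
      fix X X' f assume f: "f \<in> Hom C X X'"
      have X: "X \<in> Obj C" "X' \<in> Obj C" using C.HomD[OF f] by auto
      note Ff = functor_Hom[OF F f]
      have "FA F (Cmp C (\<nu> X') (m (FA F f))) = FA F (Cmp C f (\<nu> X))"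
        using functor_Cmp[OF F mH[OF Ff] \<nu>[OF X(2)]] functor_Cmp[OF F \<nu>[OF X(1)] f] ifm[OF Ff] F\<nu> X by simp
      then show "Cmp C (\<nu> X') (FA (G \<circ>\<^sub>F F) f) = Cmp C (FA id_functor f) (\<nu> X)"
        using faithful[OF C.Cmp_Hom[OF mH[OF Ff] \<nu>[OF X(2)]] C.Cmp_Hom[OF \<nu>[OF X(1)] f]] by (simp add: G_def)
    qed
  qed
  ultimately show ?thesis using F G by (auto simp: equivalence_def)
qed

section \<open>The MacPherson-Vilonen category\<close>

lemma mv_Obj:
  "(X, V, g, f) \<in> Obj (mv_cat D' D'' F G \<alpha>) \<longleftrightarrow>
    X \<in> Obj D'' \<and> V \<in> Obj D' \<and> f \<in> Hom D' (FO F X) V \<and> g \<in> Hom D' V (FO G X) \<and> Cmp D' g f = \<alpha> X"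
  by (simp add: mv_cat_def Let_def)

lemma mv_Hom:
  "h \<in> Hom (mv_cat D' D'' F G \<alpha>) (X, V, g, f) (X', V', g', f') \<longleftrightarrow>
    (X, V, g, f) \<in> Obj (mv_cat D' D'' F G \<alpha>) \<and> (X', V', g', f') \<in> Obj (mv_cat D' D'' F G \<alpha>) \<and>
    (\<exists>x v. h = ((X, V, g, f), (x, v), (X', V', g', f')) \<and> x \<in> Hom D'' X X' \<and> v \<in> Hom D' V V' \<and>
      Cmp D' v f = Cmp D' f' (FA F x) \<and> Cmp D' (FA G x) g = Cmp D' g' v)"
  by (auto simp: mv_cat_def Let_def Hom_def)

lemma mv_Cmp [simp]:
  "Cmp (mv_cat D' D'' F G \<alpha>) (T', (x', v'), U) (S, (x, v), T) = (S, (Cmp D'' x' x, Cmp D' v' v), U)"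
  by (simp add: mv_cat_def Let_def)

lemma mv_Idn [simp]:
  "Idn (mv_cat D' D'' F G \<alpha>) (X, V, g, f) = ((X, V, g, f), (Idn D'' X, Idn D' V), (X, V, g, f))"
  by (simp add: mv_cat_def Let_def)

lemma mv_Arr:
  assumes "h \<in> Arr (mv_cat D' D'' F G \<alpha>)"
  shows "Dom (mv_cat D' D'' F G \<alpha>) h \<in> Obj (mv_cat D' D'' F G \<alpha>) \<and> Cod (mv_cat D' D'' F G \<alpha>) h \<in> Obj (mv_cat D' D'' F G \<alpha>)"
  using assms by (auto simp: mv_cat_def Let_def)

lemma mv_category:
  fixes D' :: "('p1, 'n1) cat" and D'' :: "('p2, 'n2) cat"
  assumes D': "category D'" and D'': "category D''" and F: "is_functor D'' D' F" and G: "is_functor D'' D' G"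
  shows "category (mv_cat D' D'' F G \<alpha>)" (is "category ?M")
proof
  interpret D': category D' by fact
  interpret D'': category D'' by fact
  show "Dom ?M f \<in> Obj ?M" "Cod ?M f \<in> Obj ?M" if "f \<in> Arr ?M" for f using mv_Arr[OF that] by auto
  fix S T U W :: "('p1, 'n1, 'p2) mv_obj"
  obtain X V g f where S: "S = (X, V, g, f)" by (metis prod_cases4)
  obtain X1 V1 g1 f1 where T: "T = (X1, V1, g1, f1)" by (metis prod_cases4)
  obtain X2 V2 g2 f2 where U: "U = (X2, V2, g2, f2)" by (metis prod_cases4)
  obtain X3 V3 g3 f3 where W: "W = (X3, V3, g3, f3)" by (metis prod_cases4)
  show "Idn ?M S \<in> Hom ?M S S" if "S \<in> Obj ?M"
  proof -
    have o: "X \<in> Obj D''" "V \<in> Obj D'" "f \<in> Hom D' (FO F X) V" "g \<in> Hom D' V (FO G X)"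
      using that by (simp_all add: S mv_Obj)
    then show ?thesis using that functor_Idn[OF F o(1)] functor_Idn[OF G o(1)]
      by (simp add: S mv_Hom D'.Hom_iff D''.Hom_iff)
  qed
  fix h h' h''
  show "Cmp ?M h' h \<in> Hom ?M S U" if h: "h \<in> Hom ?M S T" and h': "h' \<in> Hom ?M T U"
  proof -
    obtain x v where xv: "h = (S, (x, v), T)" "x \<in> Hom D'' X X1" "v \<in> Hom D' V V1"
      "Cmp D' v f = Cmp D' f1 (FA F x)" "Cmp D' (FA G x) g = Cmp D' g1 v"
      using h unfolding S T mv_Hom by blast
    obtain x' v' where xv': "h' = (T, (x', v'), U)" "x' \<in> Hom D'' X1 X2" "v' \<in> Hom D' V1 V2"
      "Cmp D' v' f1 = Cmp D' f2 (FA F x')" "Cmp D' (FA G x') g1 = Cmp D' g2 v'"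
      using h' unfolding U T mv_Hom by blast
    have o: "S \<in> Obj ?M" "T \<in> Obj ?M" "U \<in> Obj ?M" using h h' by (auto simp: S T U mv_Hom)
    have ob: "f \<in> Hom D' (FO F X) V" "g \<in> Hom D' V (FO G X)" "f1 \<in> Hom D' (FO F X1) V1" "g1 \<in> Hom D' V1 (FO G X1)"
      "f2 \<in> Hom D' (FO F X2) V2" "g2 \<in> Hom D' V2 (FO G X2)"
      using o by (auto simp: S T U mv_Obj)
    note Fx = functor_Hom[OF F xv(2)] functor_Hom[OF F xv'(2)] functor_Hom[OF G xv(2)] functor_Hom[OF G xv'(2)]
    have "Cmp D' (Cmp D' v' v) f = Cmp D' v' (Cmp D' f1 (FA F x))" using xv xv' ob by (simp add: D'.Hom_iff)
    also have "\<dots> = Cmp D' f2 (Cmp D' (FA F x') (FA F x))"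
      using D'.Cmp_swap[OF xv'(4) ob(3) xv'(3) Fx(2) ob(5) Fx(1)] .
    finally have 1: "Cmp D' (Cmp D' v' v) f = Cmp D' f2 (FA F (Cmp D'' x' x))"
      using functor_Cmp[OF F xv(2) xv'(2)] by simp
    have "Cmp D' (FA G (Cmp D'' x' x)) g = Cmp D' (FA G x') (Cmp D' g1 v)"
      using functor_Cmp[OF G xv(2) xv'(2)] xv(5) ob(2) Fx by (simp add: D'.Hom_iff)
    also have "\<dots> = Cmp D' g2 (Cmp D' v' v)" using D'.Cmp_swap[OF xv'(5) ob(4) Fx(4) xv'(3) ob(6) xv(3)] .
    finally have "\<exists>x v. Cmp ?M h' h = (S, (x, v), U) \<and> x \<in> Hom D'' X X2 \<and> v \<in> Hom D' V V2 \<and>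
       Cmp D' v f = Cmp D' f2 (FA F x) \<and> Cmp D' (FA G x) g = Cmp D' g2 v"
      using 1 xv xv' by (auto simp: intro: D'.Cmp_Hom D''.Cmp_Hom)
    then show ?thesis using o by (simp add: S U mv_Hom)
  qed
  show "Cmp ?M h (Idn ?M S) = h" "Cmp ?M (Idn ?M T) h = h" if h: "h \<in> Hom ?M S T"
    using h by (auto simp: S T mv_Hom D'.Hom_iff D''.Hom_iff)
  show "Cmp ?M (Cmp ?M h'' h') h = Cmp ?M h'' (Cmp ?M h' h)"
    if "h \<in> Hom ?M S T" "h' \<in> Hom ?M T U" "h'' \<in> Hom ?M U W"
    using that by (auto simp: S T U W mv_Hom D'.Hom_iff D''.Hom_iff)
qed

lemma mv_iso:
  assumes D': "category D'" and D'': "category D''" and F: "is_functor D'' D' F" and G: "is_functor D'' D' G"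
    and h: "(S, (x, v), T) \<in> Hom (mv_cat D' D'' F G \<alpha>) S T" and S: "S = (X, V, g, f)" and T: "T = (X', V', g', f')"
    and x: "is_iso D'' X X' x" and v: "is_iso D' V V' v"
  shows "is_iso (mv_cat D' D'' F G \<alpha>) S T (S, (x, v), T)" (is "is_iso ?M S T ?h")
proof -
  interpret D': category D' by fact
  interpret D'': category D'' by fact
  obtain x' where x': "x \<in> Hom D'' X X'" "x' \<in> Hom D'' X' X" "Cmp D'' x' x = Idn D'' X" "Cmp D'' x x' = Idn D'' X'"
    using D''.is_isoD[OF x] .
  obtain v' where v': "v \<in> Hom D' V V'" "v' \<in> Hom D' V' V" "Cmp D' v' v = Idn D' V" "Cmp D' v v' = Idn D' V'"
    using D'.is_isoD[OF v] .
  have o: "S \<in> Obj ?M" "T \<in> Obj ?M" and eq: "Cmp D' v f = Cmp D' f' (FA F x)" "Cmp D' (FA G x) g = Cmp D' g' v"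
    using h by (auto simp: S T mv_Hom)
  have ob: "f \<in> Hom D' (FO F X) V" "g \<in> Hom D' V (FO G X)" "f' \<in> Hom D' (FO F X') V'" "g' \<in> Hom D' V' (FO G X')"
    "X \<in> Obj D''" "X' \<in> Obj D''"
    using o by (auto simp: S T mv_Obj)
  note Fx = functor_Hom[OF F x'(1)] functor_Hom[OF F x'(2)] functor_Hom[OF G x'(1)] functor_Hom[OF G x'(2)]
  have inv: "Cmp D' (FA F x) (FA F x') = Idn D' (FO F X')" "Cmp D' (FA G x') (FA G x) = Idn D' (FO G X)"
    using functor_Cmp[OF F x'(2,1)] functor_Cmp[OF G x'(1,2)] x'(3,4) functor_Idn[OF F ob(6)] functor_Idn[OF G ob(5)] by simp_all
  have "Cmp D' v' f' = Cmp D' v' (Cmp D' f' (Cmp D' (FA F x) (FA F x')))" using inv ob by (simp add: D'.Hom_iff)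
  also have "\<dots> = Cmp D' v' (Cmp D' v (Cmp D' f (FA F x')))"
    using D'.Cmp_swap[OF eq(1) ob(1) v'(1) Fx(1) ob(3) Fx(2)] by simp
  also have "\<dots> = Cmp D' f (FA F x')"
    using D'.Cmp_push[OF v'(3,1,2) D'.Cmp_Hom[OF Fx(2) ob(1)]] D'.Cmp_Hom[OF Fx(2) ob(1)] by (simp add: D'.Hom_iff)
  finally have 1: "Cmp D' v' f' = Cmp D' f (FA F x')" .
  have "Cmp D' (FA G x') g' = Cmp D' (FA G x') (Cmp D' g' (Cmp D' v v'))" using v' ob by (simp add: D'.Hom_iff)
  also have "\<dots> = Cmp D' (FA G x') (Cmp D' (FA G x) (Cmp D' g v'))"
    using D'.Cmp_swap[OF eq(2) ob(2) Fx(3) v'(1) ob(4) v'(2)] by simp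
  also have "\<dots> = Cmp D' g v'"
    using D'.Cmp_push[OF inv(2) Fx(3,4) D'.Cmp_Hom[OF v'(2) ob(2)]] D'.Cmp_Hom[OF v'(2) ob(2)] by (simp add: D'.Hom_iff)
  finally have "(T, (x', v'), S) \<in> Hom ?M T S" using 1 o x' v' by (auto simp: S T mv_Hom)
  then show ?thesis
    using h x'(3,4) v'(3,4) unfolding is_iso_def by (intro conjI bexI[of _ "(T, (x', v'), S)"]) (auto simp: S T)
qed

lemma (in preadditive) is_zero_of_iso:
  assumes "is_iso C X Z f" "is_zero C Z" shows "is_zero C X"
proof -
  obtain g where g: "f \<in> Hom C X Z" "g \<in> Hom C Z X" "Cmp C g f = Idn C X" using is_isoD[OF assms(1)] .
  then show ?thesis using factor_through_zero[OF assms(2) g(1,2)] is_zeroI[of X] by (simp add: Hom_iff)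
qed

text \<open>The arrow \<open>\<gamma> = (\<alpha>, 1)\<close> from \<open>F X \<oplus> G X\<close> to \<open>G X\<close> defines an epimorphism onto \<open>(X, G X, 1, \<alpha>)\<close>. By projectivity it has a
  section, whose second component \<open>v\<close> satisfies \<open>v \<alpha> = i1\<close>. Hence \<open>p1 v\<close> is a left inverse of \<open>\<alpha>\<close>.\<close>

lemma mv_projective_split:
  assumes D': "abelian D'" and D'': "category D''" and F: "is_functor D'' D' F" and G: "is_functor D'' D' G"
    and \<alpha>: "\<alpha> X \<in> Hom D' (FO F X) (FO G X)" and X: "X \<in> Obj D''"
    and proj: "projective (mv_cat D' D'' F G \<alpha>) (X, FO G X, Idn D' (FO G X), \<alpha> X)"
  obtains \<beta> where "\<beta> \<in> Hom D' (FO G X) (FO F X)" "Cmp D' \<beta> (\<alpha> X) = Idn D' (FO F X)"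
proof -
  interpret D': abelian D' by fact
  interpret D'': category D'' by fact
  let ?M = "mv_cat D' D'' F G \<alpha>"
  interpret M: category ?M using mv_category[OF D'.category_axioms D'' F G] .
  note FX = functor_Obj[OF F X] and GX = functor_Obj[OF G X]
  obtain B i1 i2 p1 p2 where bip: "is_biproduct D' (FO F X) (FO G X) B i1 i2 p1 p2"
    using D'.has_biproducts[OF FX GX] by blast
  have B: "i1 \<in> Hom D' (FO F X) B" "i2 \<in> Hom D' (FO G X) B" "p1 \<in> Hom D' B (FO F X)" "p2 \<in> Hom D' B (FO G X)"
    "Cmp D' p1 i1 = Idn D' (FO F X)" "Cmp D' p2 i2 = Idn D' (FO G X)"
    "Cmp D' p1 i2 = Nul D' (FO G X) (FO F X)" "Cmp D' p2 i1 = Nul D' (FO F X) (FO G X)"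
    using bip by (auto simp: is_biproduct_def)
  define \<gamma> where "\<gamma> = Pls D' (Cmp D' (\<alpha> X) p1) p2"
  note ap = D'.Cmp_Hom[OF B(3) \<alpha>]
  have \<gamma>: "\<gamma> \<in> Hom D' B (FO G X)" unfolding \<gamma>_def using D'.Pls_Hom[OF ap B(4)] .
  have \<gamma>1: "Cmp D' \<gamma> i1 = \<alpha> X" and \<gamma>2: "Cmp D' \<gamma> i2 = Idn D' (FO G X)"
    unfolding \<gamma>_def using D'.Cmp_Pls_left[OF B(1) ap B(4)] D'.Cmp_Pls_left[OF B(2) ap B(4)] B \<alpha>
    by (simp_all add: D'.Hom_iff)
  let ?T = "(X, B, \<gamma>, i1)" and ?J = "(X, FO G X, Idn D' (FO G X), \<alpha> X)"
  let ?e = "(?T, (Idn D'' X, \<gamma>), ?J)"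
  have Jo: "?J \<in> Obj ?M" and To: "?T \<in> Obj ?M" using \<alpha> X GX \<gamma> B(1) \<gamma>1 by (simp_all add: mv_Obj D'.Hom_iff)
  have e: "?e \<in> Hom ?M ?T ?J"
    using Jo To \<gamma> \<gamma>1 X functor_Idn[OF F X] functor_Idn[OF G X] \<alpha> by (auto simp: mv_Hom D'.Hom_iff D''.Hom_iff)
  have "a = b" if a: "a \<in> Hom ?M ?J W" and b: "b \<in> Hom ?M ?J W" and eq: "Cmp ?M a ?e = Cmp ?M b ?e" for a b W
  proof -
    obtain X' V' g' f' where W: "W = (X', V', g', f')" by (metis prod_cases4)
    obtain x v where xv: "a = (?J, (x, v), W)" "x \<in> Hom D'' X X'" "v \<in> Hom D' (FO G X) V'" using a unfolding W mv_Hom by blast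
    obtain x' v' where xv': "b = (?J, (x', v'), W)" "x' \<in> Hom D'' X X'" "v' \<in> Hom D' (FO G X) V'" using b unfolding W mv_Hom by blast
    have "Cmp D'' x (Idn D'' X) = Cmp D'' x' (Idn D'' X)" and vg: "Cmp D' v \<gamma> = Cmp D' v' \<gamma>"
      using eq by (simp_all add: xv xv')
    then have "x = x'" using xv(2) xv'(2) by (simp add: D''.Hom_iff)
    moreover have "Cmp D' (Cmp D' v \<gamma>) i2 = v" "Cmp D' (Cmp D' v' \<gamma>) i2 = v'"
      using xv(3) xv'(3) \<gamma> B(2) \<gamma>2 by (simp_all add: D'.Hom_iff)
    moreover have "v = v'" using calculation(2,3) vg by metis
    ultimately show ?thesis using xv(1) xv'(1) by simp
  qed
  then have "epi_arr ?M ?e" using e M.HomD[OF e] by (auto simp: epi_arr_def)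
  then obtain u where u: "u \<in> Hom ?M ?J ?T" "Cmp ?M ?e u = Idn ?M ?J"
    using M.projectiveD[OF proj _ e M.Idn_Hom[OF Jo]] by blast
  obtain x v where xv: "u = (?J, (x, v), ?T)" "x \<in> Hom D'' X X" "v \<in> Hom D' (FO G X) B"
    "Cmp D' v (\<alpha> X) = Cmp D' i1 (FA F x)"
    using u(1) unfolding mv_Hom by blast
  have "Cmp D'' (Idn D'' X) x = Idn D'' X" using u(2) by (simp add: xv)
  then have "x = Idn D'' X" using xv(2) by (simp add: D''.Hom_iff)
  then have va: "Cmp D' v (\<alpha> X) = i1" using xv(4) functor_Idn[OF F X] B(1) by (simp add: D'.Hom_iff)
  have "Cmp D' (Cmp D' p1 v) (\<alpha> X) = Idn D' (FO F X)" using va B xv(3) \<alpha> by (simp add: D'.Hom_iff)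
  then show ?thesis using that D'.Cmp_Hom[OF xv(3) B(3)] by blast
qed

text \<open>In a MacPherson-Vilonen recollement, \<open>i_ushriek j_lshriek\<close> is the kernel of \<open>\<alpha>\<close>, which is a split monomorphism by the
  preceding lemma when \<open>j_lower\<close> takes a projective value. For the defect recollement \<open>j_lower\<close> is the Yoneda embedding,
  and all of its values are projective.\<close>

lemma mv_torsion_free:
  assumes mv: "is_mv_for Q D' D'' F G \<alpha>" and mid: "category (mid Q)" and sub: "preadditive (sub Q)"
    and X: "X \<in> Obj (quo Q)" and j: "is_functor (quo Q) (mid Q) (j_lshriek Q)"
    and i: "is_functor (mid Q) (sub Q) (i_ushriek Q)"
    and proj: "projective (mid Q) (FO (j_lower Q) X)"
  shows "is_zero (sub Q) (FO (i_ushriek Q) (FO (j_lshriek Q) X))"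
proof -
  have D': "abelian D'" and D'': "abelian D''" and F: "is_functor D'' D' F" and G: "is_functor D'' D' G"
    and \<alpha>: "nat_trans D'' D' F G \<alpha>"
    using mv by (auto simp: is_mv_for_def mv_data_def right_exact_def left_exact_def additive_functor_def)
  interpret D': abelian D' by fact
  interpret D'': abelian D'' by fact
  let ?M = "mv_cat D' D'' F G \<alpha>"
  let ?S = "mv_recoll D' D'' F G \<alpha>"
  interpret M: category ?M using mv_category[OF D'.category_axioms D''.category_axioms F G] .
  have S: "sub ?S = D'" "mid ?S = ?M" "quo ?S = D''" by (simp_all add: mv_recoll_def Let_def)
  obtain E' E E'' where E': "equivalence (sub Q) D' E'" and E: "equivalence (mid Q) ?M E" and E'': "equivalence (quo Q) D'' E''"
    and ni: "nat_isomorphic (mid Q) D' (E' \<circ>\<^sub>F i_ushriek Q) (i_ushriek ?S \<circ>\<^sub>F E)"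
    and nl: "nat_isomorphic (quo Q) ?M (E \<circ>\<^sub>F j_lshriek Q) (j_lshriek ?S \<circ>\<^sub>F E'')"
    and nr: "nat_isomorphic (quo Q) ?M (E \<circ>\<^sub>F j_lower Q) (j_lower ?S \<circ>\<^sub>F E'')"
    using mv unfolding is_mv_for_def recoll_equiv_def S by blast
  define X1 where "X1 = FO E'' X"
  have X1: "X1 \<in> Obj D''" using E'' functor_Obj X by (auto simp: X1_def equivalence_def)
  note \<alpha>1 = nat_transD(1)[OF \<alpha> X1]
  let ?J = "(X1, FO G X1, Idn D' (FO G X1), \<alpha> X1)" and ?L = "(X1, FO F X1, \<alpha> X1, Idn D' (FO F X1))"
  obtain \<nu> where "\<forall>X \<in> Obj (quo Q).
      is_iso ?M (FO (E \<circ>\<^sub>F j_lower Q) X) (FO (j_lower ?S \<circ>\<^sub>F E'') X) (\<nu> X)"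
    using nat_isomorphicE[OF nr] by metis
  then have \<nu>: "is_iso ?M (FO E (FO (j_lower Q) X)) ?J (\<nu> X)"
    using X by (simp add: mv_recoll_def Let_def X1_def)
  obtain \<kappa> where "\<forall>X \<in> Obj (quo Q).
      is_iso ?M (FO (E \<circ>\<^sub>F j_lshriek Q) X) (FO (j_lshriek ?S \<circ>\<^sub>F E'') X) (\<kappa> X)"
    using nat_isomorphicE[OF nl] by metis
  then obtain \<mu> where \<mu>: "is_iso ?M (FO E (FO (j_lshriek Q) X)) ?L \<mu>"
    using X by (simp add: mv_recoll_def Let_def X1_def) metis
  have "projective ?M ?J"
    using M.is_isoD[OF \<nu>] M.projective_retract[OF equivalence_projective[OF E mid M.category_axioms proj]] by metis
  then obtain \<beta> where \<beta>: "\<beta> \<in> Hom D' (FO G X1) (FO F X1)" "Cmp D' \<beta> (\<alpha> X1) = Idn D' (FO F X1)"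
    using mv_projective_split[where \<alpha> = \<alpha> and X = X1, OF D' D''.category_axioms F G \<alpha>1 X1] by blast
  obtain X2 V2 g2 f2 where EL: "FO E (FO (j_lshriek Q) X) = (X2, V2, g2, f2)" by (metis prod_cases4)
  obtain \<mu>' where \<mu>': "\<mu> \<in> Hom ?M (X2, V2, g2, f2) ?L" "\<mu>' \<in> Hom ?M ?L (X2, V2, g2, f2)" "Cmp ?M \<mu>' \<mu> = Idn ?M (X2, V2, g2, f2)"
    using M.is_isoD[OF \<mu>] EL by metis
  obtain x v where xv: "\<mu> = ((X2, V2, g2, f2), (x, v), ?L)" "x \<in> Hom D'' X2 X1" "v \<in> Hom D' V2 (FO F X1)"
      "Cmp D' (FA G x) g2 = Cmp D' (\<alpha> X1) v" and g2: "g2 \<in> Hom D' V2 (FO G X2)"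
    using \<mu>'(1) unfolding mv_Hom mv_Obj by blast
  obtain x' v' where xv': "\<mu>' = (?L, (x', v'), (X2, V2, g2, f2))" "v' \<in> Hom D' (FO F X1) V2"
    using \<mu>'(2) unfolding mv_Hom mv_Obj by blast
  have vv: "Cmp D' v' v = Idn D' V2" using \<mu>'(3) by (simp add: xv(1) xv'(1))
  note Gx = functor_Hom[OF G xv(2)]
  have k: "is_kernel D' g2 (ker_obj D' g2) (ker_arr D' g2)" using D'.is_kernel_ker D'.has_kernels D'.HomD[OF g2] by blast
  note kD = D'.is_kernelD[OF k g2]
  define K where "K = ker_obj D' g2"
  define a where "a = ker_arr D' g2"
  have a: "a \<in> Hom D' K V2" "Cmp D' g2 a = Nul D' K (FO G X2)" "mono_arr D' a" using kD by (auto simp: K_def a_def)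
  have Ko: "K \<in> Obj D'" using D'.HomD[OF a(1)] by simp
  have va: "Cmp D' v a \<in> Hom D' K (FO F X1)" using D'.Cmp_Hom[OF a(1) xv(3)] .
  have "Cmp D' (\<alpha> X1) (Cmp D' v a) = Cmp D' (FA G x) (Cmp D' g2 a)" using D'.Cmp_swap[OF xv(4) g2 Gx xv(3) \<alpha>1 a(1)] by simp
  also have "\<dots> = Nul D' K (FO G X1)" using a Gx Ko by (simp add: D'.Hom_iff)
  finally have "Cmp D' \<beta> (Cmp D' (\<alpha> X1) (Cmp D' v a)) = Nul D' K (FO F X1)" using \<beta> Ko by (simp add: D'.Hom_iff)
  then have "Cmp D' v a = Nul D' K (FO F X1)" using D'.Cmp_push[OF \<beta>(2) \<alpha>1 \<beta>(1) va] va by (simp add: D'.Hom_iff)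
  then have "Cmp D' v' (Cmp D' v a) = Nul D' K V2" using xv'(2) Ko by (simp add: D'.Hom_iff)
  then have "a = Nul D' K V2" using D'.Cmp_push[OF vv xv(3) xv'(2) a(1)] a(1) by (simp add: D'.Hom_iff)
  then have "Cmp D' a (Idn D' K) = Nul D' K V2" using a(1) by (simp add: D'.Hom_iff)
  then have "is_zero D' K" using D'.mono_Nul[OF a(3,1) D'.Idn_Hom[OF Ko]] D'.is_zeroI[OF Ko] by blast
  moreover note lX = functor_Obj[OF j X]
  obtain \<zeta> where "\<forall>X \<in> Obj (mid Q).
      is_iso D' (FO (E' \<circ>\<^sub>F i_ushriek Q) X) (FO (i_ushriek ?S \<circ>\<^sub>F E) X) (\<zeta> X)"
    using nat_isomorphicE[OF ni] by metis
  from bspec[OF this lX]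
  have "is_iso D' (FO E' (FO (i_ushriek Q) (FO (j_lshriek Q) X))) K (\<zeta> (FO (j_lshriek Q) X))"
    by (simp add: mv_recoll_def Let_def K_def EL)
  ultimately have "is_zero D' (FO E' (FO (i_ushriek Q) (FO (j_lshriek Q) X)))" using D'.is_zero_of_iso by blast
  then show ?thesis
    using equivalence_reflects_zero[OF E' sub D'.preadditive_axioms functor_Obj[OF i lX]] by blast
qed

section \<open>The defect recollement of a hereditary category\<close>

context defect
begin

abbreviation "Z0 \<equiv> zero_obj D"
abbreviation "M \<equiv> mv_cat D A (zero_functor D) T (zero_trans D T)"

lemma Z0: "is_zero D Z0"
  using preadditive.zero_obj_zero[OF D_preadditive abelian.has_zero[OF D_abelian]] .

lemma Z0_D: "Z0 \<in> Obj D"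
  using Z0 by (simp add: is_zero_def)

lemma Z0_Obj: "Z0 \<in> Obj C"
  using Z0_D D_Obj by blast

lemma from_Z0: "f \<in> Hom D Z0 V \<Longrightarrow> f = Nul C Z0 V"
  using preadditive.from_zero[OF D_preadditive Z0] by simp

lemma Idn_Z0: "Idn C Z0 = Nul C Z0 Z0"
  using preadditive.zero_Idn[OF D_preadditive Z0] by simp

lemma zero_functor_D: "right_exact A D (zero_functor D)"
proof -
  interpret D: preadditive D by (rule D_preadditive)
  have "is_functor A D (zero_functor D)"
    using Z0_D D.Idn_Hom[OF Z0_D] Z0_Obj by (auto simp: is_functor_def zero_functor_def)
  moreover have "is_cokernel D (Idn C Z0) Z0 (Idn C Z0)"
    using D.is_cokernel_Nul[OF Z0_D Z0_D] by (simp add: Idn_Z0)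
  moreover have "Idn C Z0 = Pls C (Idn C Z0) (Idn C Z0)" using Z0_Obj by (simp add: Idn_Z0)
  ultimately show ?thesis by (simp add: right_exact_def additive_functor_def zero_functor_def)
qed

lemma T_functor: "is_functor A D T"
  unfolding is_functor_def
proof (intro conjI ballI impI)
  fix X assume X: "X \<in> Obj A"
  show "To X \<in> Obj D" using To_D[OF X] .
  have "Ta (Idn A X) \<bullet> p X = Idn C (To X) \<bullet> p X"
    using p_nat[OF A.Idn_Hom[OF X]] p_Hom[OF X] X by (simp add: C.Hom_iff)
  then show "Ta (Idn A X) = Idn D (To X)"
    using C.epi_arrD[OF p_epi[OF X] p_Hom[OF X] T_Hom[OF A.Idn_Hom[OF X]] C.Idn_Hom[OF To_Obj[OF X]]] by simp
next
  fix f assume "f \<in> Arr A"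
  then show "Ta f \<in> Hom D (To (Dom A f)) (To (Cod A f))"
    using T_Hom[OF A.Arr_Hom] Hom_D[OF To_D To_D] A.Dom_Obj A.Cod_Obj by blast
next
  fix f h assume "f \<in> Arr A" "h \<in> Arr A" "Dom A h = Cod A f"
  then obtain X X' X'' where f: "f \<in> Hom A X X'" and h: "h \<in> Hom A X' X''" by (auto simp: Hom_def)
  have X: "X \<in> Obj A" "X' \<in> Obj A" "X'' \<in> Obj A" using A.HomD[OF f] A.HomD[OF h] by auto
  note hf = A.Cmp_Hom[OF f h]
  have "Ta (h \<cdot> f) \<bullet> p X = p X'' \<bullet> Ya h \<bullet> Ya f" using p_nat[OF hf] f h by (simp add: A.Hom_iff)
  also have "\<dots> = Ta h \<bullet> p X' \<bullet> Ya f"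
    using C.Cmp_swap[OF p_nat[OF h] p_Hom[OF X(2)] T_Hom[OF h] Y_Hom[OF h] p_Hom[OF X(3)] Y_Hom[OF f]] by simp
  also have "\<dots> = (Ta h \<bullet> Ta f) \<bullet> p X" using p_nat[OF f] T_Hom[OF f] T_Hom[OF h] p_Hom[OF X(1)] by (simp add: C.Hom_iff)
  finally show "Ta (h \<cdot> f) = Cmp D (Ta h) (Ta f)"
    using C.epi_arrD[OF p_epi[OF X(1)] p_Hom[OF X(1)] T_Hom[OF hf] C.Cmp_Hom[OF T_Hom[OF f] T_Hom[OF h]]] by simp
qed

lemma T_additive: "additive_functor A D T"
  unfolding additive_functor_def
proof (intro conjI ballI)
  fix X X' f h assume X: "X \<in> Obj A" "X' \<in> Obj A" and f: "f \<in> Hom A X X'" and h: "h \<in> Hom A X X'"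
  note fh = A.Pls_Hom[OF f h] and pX = p_Hom[OF X(1)]
  have "Ta (Pls A f h) \<bullet> p X = p X' \<bullet> Pls C (Ya f) (Ya h)" using p_nat[OF fh] Ya_Pls[OF f h] by simp
  also have "\<dots> = Pls C (Ta f \<bullet> p X) (Ta h \<bullet> p X)"
    using C.Cmp_Pls_right[OF Y_Hom[OF f] Y_Hom[OF h] p_Hom[OF X(2)]] p_nat[OF f] p_nat[OF h] by simp
  also have "\<dots> = Pls C (Ta f) (Ta h) \<bullet> p X" using C.Cmp_Pls_left[OF pX T_Hom[OF f] T_Hom[OF h]] by simp
  finally show "Ta (Pls A f h) = Pls D (Ta f) (Ta h)"
    using C.epi_arrD[OF p_epi[OF X(1)] pX T_Hom[OF fh] C.Pls_Hom[OF T_Hom[OF f] T_Hom[OF h]]] by simp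
qed (rule T_functor)

lemma T_Nul: "X \<in> Obj A \<Longrightarrow> X' \<in> Obj A \<Longrightarrow> Ta (Nul A X X') = Nul C (To X) (To X')"
  using additive_Nul[OF T_additive A.preadditive_axioms D_preadditive] by simp

lemma T_left_exact: assumes her: "hereditary A" shows "left_exact A D T"
  unfolding left_exact_def
proof (intro conjI allI impI)
  interpret D: preadditive D by (rule D_preadditive)
  fix f K k assume k: "is_kernel A f K k"
  then obtain X X' where f: "f \<in> Hom A X X'" by (auto simp: is_kernel_def Hom_def)
  note kD = A.is_kernelD[OF k f]
  have o: "X \<in> Obj A" "X' \<in> Obj A" "K \<in> Obj A" using A.HomD[OF f] A.HomD[OF kD(1)] by auto
  have kC: "is_kernel C (Ta f) (To K) (Ta k)" using T_kernel[OF her f k] .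
  note kCD = C.is_kernelD[OF kC T_Hom[OF f]]
  have fD: "Ta f \<in> Hom D (To X) (To X')" "Ta k \<in> Hom D (To K) (To X)"
    using functor_Hom[OF T_functor f] functor_Hom[OF T_functor kD(1)] .
  show "is_kernel D (Ta f) (To K) (Ta k)"
  proof (rule D.is_kernelI[OF fD])
    show "Cmp D (Ta f) (Ta k) = Nul D (To K) (To X')" using kCD(2) by simp
    show "mono_arr D (Ta k)"
    proof (rule D.mono_arrI[OF fD(2)])
      fix W a assume "a \<in> Hom D W (To K)" "Cmp D (Ta k) a = Nul D W (To X)"
      then show "a = Nul D W (To K)" using C.mono_Nul[OF kCD(3,1), of a W] Hom_D_subset by simp
    qed
    fix W a assume a: "a \<in> Hom D W (To X)" "Cmp D (Ta f) a = Nul D W (To X')"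
    have W: "W \<in> Obj D" using D.HomD[OF a(1)] by simp
    obtain u where "u \<in> Hom C W (To K)" "Ta k \<bullet> u = a"
      using C.is_kernel_lift[OF kC T_Hom[OF f] Hom_D_subset[OF a(1)]] a(2) by auto
    then show "\<exists>u\<in>Hom D W (To K). Cmp D (Ta k) u = a" using Hom_D[OF W To_D[OF o(3)]] by auto
  qed
qed (rule T_additive)

lemma zero_trans_nat: "nat_trans A D (zero_functor D) T (zero_trans D T)"
proof -
  interpret D: preadditive D by (rule D_preadditive)
  show ?thesis
    unfolding nat_trans_def
  proof (intro conjI ballI)
    fix X assume "X \<in> Obj A"
    then show "zero_trans D T X \<in> Hom D (FO (zero_functor D) X) (To X)"
      using D.Nul_Hom[OF Z0_D To_D] by (simp add: zero_trans_def zero_functor_def)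
  next
    fix f assume "f \<in> Arr A"
    note f = A.Arr_Hom[OF this]
    show "Cmp D (zero_trans D T (Cod A f)) (FA (zero_functor D) f) = Cmp D (FA T f) (zero_trans D T (Dom A f))"
      using T_Hom[OF f] Z0_Obj by (simp add: zero_trans_def zero_functor_def C.Hom_iff)
  qed
qed

lemma M_category: "category M"
  using mv_category[OF D_category A.category_axioms _ T_functor] zero_functor_D
  by (simp add: right_exact_def additive_functor_def)

lemma M_data [simp]:
  "FO (zero_functor D) X = Z0" "FA (zero_functor D) x = Idn C Z0" "zero_trans D T X = Nul C Z0 (To X)"
  by (simp_all add: zero_functor_def zero_trans_def)

lemma M_Obj:
  "(X, V, h, f) \<in> Obj M \<longleftrightarrow> X \<in> Obj A \<and> V \<in> Obj D \<and> h \<in> Hom C V (To X) \<and> f = Nul C Z0 V"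
proof (cases "X \<in> Obj A \<and> V \<in> Obj D")
  case True
  have "f \<in> Hom D Z0 V \<longleftrightarrow> f = Nul C Z0 V"
    using from_Z0 preadditive.Nul_Hom[OF D_preadditive Z0_D] True by auto
  moreover have "h \<bullet> Nul C Z0 V = Nul C Z0 (To X)" if "h \<in> Hom C V (To X)"
    using that Z0_Obj by (simp add: C.Hom_iff)
  moreover have "Hom D V (To X) = Hom C V (To X)" using True Hom_D[OF _ To_D] by blast
  ultimately show ?thesis using True by (auto simp: mv_Obj)
qed (auto simp: mv_Obj)

lemma M_Hom:
  "b \<in> Hom M (X, V, h, f) (X', V', h', f') \<longleftrightarrow>
    (X, V, h, f) \<in> Obj M \<and> (X', V', h', f') \<in> Obj M \<and>
    (\<exists>x v. b = ((X, V, h, f), (x, v), (X', V', h', f')) \<and> x \<in> Hom A X X' \<and> v \<in> Hom C V V' \<and>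
      Ta x \<bullet> h = h' \<bullet> v)"
proof (cases "(X, V, h, f) \<in> Obj M \<and> (X', V', h', f') \<in> Obj M")
  case True
  then have V: "V \<in> Obj D" "V' \<in> Obj D" "f = Nul C Z0 V" "f' = Nul C Z0 V'" by (simp_all add: M_Obj)
  have "v \<bullet> f = f' \<bullet> Idn C Z0" if "v \<in> Hom C V V'" for v
    using that Z0_Obj V by (simp add: C.Hom_iff)
  then show ?thesis using True unfolding mv_Hom Hom_D[OF V(1,2)] M_data D_simps by blast
qed (auto simp: mv_Hom)

lemma M_iso:
  assumes S: "(X, V, h, f) \<in> Obj M" and T: "(X', V', h', f') \<in> Obj M"
    and x: "is_iso A X X' x" and v: "is_iso C V V' v" and eq: "Ta x \<bullet> h = h' \<bullet> v"
  shows "is_iso M (X, V, h, f) (X', V', h', f') ((X, V, h, f), (x, v), (X', V', h', f'))"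
proof -
  have F: "is_functor A D (zero_functor D)" using zero_functor_D by (simp add: right_exact_def additive_functor_def)
  have "is_iso D V V' v" using v S T Hom_D unfolding is_iso_def by (auto simp: M_Obj)
  moreover have "((X, V, h, f), (x, v), (X', V', h', f')) \<in> Hom M (X, V, h, f) (X', V', h', f')"
    using S T x v eq by (auto simp: M_Hom is_iso_def)
  ultimately show ?thesis
    using mv_iso[OF D_category A.category_axioms F T_functor _ refl refl x] by blast
qed

text \<open>The comparison with the construction for \<open>0 \<rightarrow> T\<close>: an object \<open>F\<close> is taken apart into \<open>w F\<close>, \<open>R F\<close> and the arrow \<open>g F\<close>
  between \<open>R F\<close> and \<open>T (w F)\<close>.\<close>

definition glue :: "('p, 'n, ('p, 'n, 'o) mv_obj, ('p, 'n, 'o, 'm) mv_arr) fctr" where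
  "glue = (let ob = (\<lambda>F. (wo F, Ro F, g F, Nul C Z0 (Ro F)))
     in \<lparr>FO = ob, FA = (\<lambda>a. (ob (Dom C a), (wa a, Ra a), ob (Cod C a)))\<rparr>)"

lemma glue_FO: "FO glue F = (wo F, Ro F, g F, Nul C Z0 (Ro F))"
  by (simp add: glue_def Let_def)

lemma glue_FA: "a \<in> Hom C F F' \<Longrightarrow> FA glue a = (FO glue F, (wa a, Ra a), FO glue F')"
  by (auto simp: glue_def Let_def Hom_def)

lemma glue_Obj: "F \<in> Obj C \<Longrightarrow> FO glue F \<in> Obj M"
  using wo_Obj Ro_D g_Hom by (simp add: glue_FO M_Obj)

lemma glue_Hom: "a \<in> Hom C F F' \<Longrightarrow> FA glue a \<in> Hom M (FO glue F) (FO glue F')"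
  using glue_Obj[of F] glue_Obj[of F'] wa_Hom Ra_Hom g_nat C.HomD(4,5)[of a F F']
  by (simp add: glue_FA) (simp add: glue_FO M_Hom)

lemma glue_functor: "is_functor C M glue"
  unfolding is_functor_def
proof (intro conjI ballI impI)
  fix F assume F: "F \<in> Obj C"
  show "FO glue F \<in> Obj M" using glue_Obj[OF F] .
  show "FA glue (Idn C F) = Idn M (FO glue F)"
    using glue_FA[OF C.Idn_Hom[OF F]] functor_Idn[OF w_functor F] functor_Idn[OF R_functor F] by (simp add: glue_FO)
next
  fix f assume "f \<in> Arr C"
  then show "FA glue f \<in> Hom M (FO glue (Dom C f)) (FO glue (Cod C f))" using glue_Hom[OF C.Arr_Hom] by blast
next
  fix f h assume "f \<in> Arr C" "h \<in> Arr C" "Dom C h = Cod C f"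
  then obtain X X' X'' where f: "f \<in> Hom C X X'" and h: "h \<in> Hom C X' X''" by (auto simp: Hom_def)
  show "FA glue (h \<bullet> f) = Cmp M (FA glue h) (FA glue f)"
    using functor_Cmp[OF w_functor f h] functor_Cmp[OF R_functor f h]
    by (simp add: glue_FA[OF f] glue_FA[OF h] glue_FA[OF C.Cmp_Hom[OF f h]])
qed

text \<open>Arrows into the pullback \<open>F'\<close> of \<open>R F'\<close> and \<open>Y (w F')\<close> are compatible pairs; by the universal properties of \<open>r F\<close> and
  \<open>\<eta> F\<close> these are the same as arrows between the glued data.\<close>

lemma glue_fully_faithful: assumes her: "hereditary A" shows "fully_faithful C M glue"
  unfolding fully_faithful_def
proof (intro conjI ballI)
  fix F F' assume F: "F \<in> Obj C" and F': "F' \<in> Obj C"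
  note rF = r_Hom[OF F] and rF' = r_Hom[OF F'] and \<eta>F = \<eta>_Hom[OF F] and \<eta>F' = \<eta>_Hom[OF F']
  note gF = g_Hom[OF F] and gF' = g_Hom[OF F'] and wF = wo_Obj[OF F] and wF' = wo_Obj[OF F']
  show "bij_betw (FA glue) (Hom C F F') (Hom M (FO glue F) (FO glue F'))"
  proof (rule bij_betw_imageI)
    show "inj_on (FA glue) (Hom C F F')"
    proof (rule inj_onI)
      fix a b assume a: "a \<in> Hom C F F'" and b: "b \<in> Hom C F F'" and "FA glue a = FA glue b"
      then have "wa a = wa b" "Ra a = Ra b" by (simp_all add: glue_FA)
      then show "a = b"
        using joint_mono[OF her F' a b] r_nat[OF a] r_nat[OF b] \<eta>_nat[OF a] \<eta>_nat[OF b] by simp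
    qed
    show "FA glue ` Hom C F F' = Hom M (FO glue F) (FO glue F')"
    proof (intro equalityI subsetI)
      fix b assume "b \<in> FA glue ` Hom C F F'"
      then show "b \<in> Hom M (FO glue F) (FO glue F')" using glue_Hom by blast
    next
      fix b assume "b \<in> Hom M (FO glue F) (FO glue F')"
      then obtain x v where b: "b = (FO glue F, (x, v), FO glue F')" and x: "x \<in> Hom A (wo F) (wo F')"
        and v: "v \<in> Hom C (Ro F) (Ro F')" and eq: "Ta x \<bullet> g F = g F' \<bullet> v"
        unfolding glue_FO M_Hom by blast
      have "g F' \<bullet> v \<bullet> r F = Ta x \<bullet> g F \<bullet> r F" using C.Cmp_swap[OF eq gF T_Hom[OF x] v gF' rF] by simp
      also have "\<dots> = Ta x \<bullet> p (wo F) \<bullet> \<eta> F" using g_r[OF F] by simp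
      also have "\<dots> = p (wo F') \<bullet> Ya x \<bullet> \<eta> F"
        using C.Cmp_swap[OF p_nat[OF x] p_Hom[OF wF] T_Hom[OF x] Y_Hom[OF x] p_Hom[OF wF'] \<eta>F] .
      finally obtain t where t: "t \<in> Hom C F F'" "r F' \<bullet> t = v \<bullet> r F" "\<eta> F' \<bullet> t = Ya x \<bullet> \<eta> F"
        using gluing[OF her F' C.Cmp_Hom[OF rF v] C.Cmp_Hom[OF \<eta>F Y_Hom[OF x]]] by metis
      have "Ra t = v" using r_unique[OF F Ro_D[OF F'] Ra_Hom[OF t(1)] v] r_nat[OF t(1)] t(2) by simp
      moreover have "wa t = x" using \<eta>_unique[OF F wa_Hom[OF t(1)] x] \<eta>_nat[OF t(1)] t(3) by simp
      ultimately show "b \<in> FA glue ` Hom C F F'" using b glue_FA[OF t(1)] t(1) by force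
    qed
  qed
qed (rule glue_functor)

lemma iso_of_universal_r:
  assumes F: "F \<in> Obj C" and V: "V \<in> Obj D" and b: "b \<in> Hom C F V"
    and ex: "\<And>W a. W \<in> Obj D \<Longrightarrow> a \<in> Hom C F W \<Longrightarrow> \<exists>u \<in> Hom C V W. u \<bullet> b = a"
    and epi: "epi_arr C b"
  obtains v where "is_iso C (Ro F) V v" "v \<bullet> r F = b"
proof -
  note rF = r_Hom[OF F]
  obtain v where v: "v \<in> Hom C (Ro F) V" "v \<bullet> r F = b" using r_lift[OF V b] .
  obtain u where u: "u \<in> Hom C V (Ro F)" "u \<bullet> b = r F" using ex[OF Ro_D[OF F] rF] by blast
  have "(u \<bullet> v) \<bullet> r F = Idn C (Ro F) \<bullet> r F" using u v rF by (simp add: C.Hom_iff)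
  then have 1: "u \<bullet> v = Idn C (Ro F)"
    using r_unique[OF F Ro_D[OF F] C.Cmp_Hom[OF v(1) u(1)] C.Idn_Hom[OF Ro_Obj[OF F]]] by blast
  have "(v \<bullet> u) \<bullet> b = Idn C V \<bullet> b" using u v b by (simp add: C.Hom_iff)
  then have 2: "v \<bullet> u = Idn C V"
    using C.epi_arrD[OF epi b C.Cmp_Hom[OF u(1) v(1)] C.Idn_Hom[OF D_Obj[OF V]]] by blast
  show ?thesis using that[OF _ v(2)] u(1) v(1) 1 2 by (auto simp: is_iso_def)
qed

lemma iso_of_universal_\<eta>:
  assumes F: "F \<in> Obj C" and X: "X \<in> Obj A" and c: "c \<in> Hom C F (Yo X)"
    and ex: "\<And>W a. W \<in> Obj A \<Longrightarrow> a \<in> Hom C F (Yo W) \<Longrightarrow> \<exists>u \<in> Hom A X W. Ya u \<bullet> c = a"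
    and un: "\<And>W u v. u \<in> Hom A X W \<Longrightarrow> v \<in> Hom A X W \<Longrightarrow> Ya u \<bullet> c = Ya v \<bullet> c \<Longrightarrow> u = v"
  obtains x where "is_iso A (wo F) X x" "Ya x \<bullet> \<eta> F = c"
proof -
  note \<eta>F = \<eta>_Hom[OF F] and wF = wo_Obj[OF F]
  obtain x where x: "x \<in> Hom A (wo F) X" "Ya x \<bullet> \<eta> F = c" using \<eta>_lift[OF X c] .
  obtain u where u: "u \<in> Hom A X (wo F)" "Ya u \<bullet> c = \<eta> F" using ex[OF wF \<eta>F] by blast
  have "Ya (u \<cdot> x) \<bullet> \<eta> F = Ya (Idn A (wo F)) \<bullet> \<eta> F" using u x \<eta>F wF by (simp add: Hom_iffs)
  then have 1: "u \<cdot> x = Idn A (wo F)"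
    using \<eta>_unique[OF F A.Cmp_Hom[OF x(1) u(1)] A.Idn_Hom[OF wF]] by blast
  have "Ya (x \<cdot> u) \<bullet> c = Ya (Idn A X) \<bullet> c" using u x c X by (simp add: Hom_iffs)
  then have 2: "x \<cdot> u = Idn A X" using un[OF A.Cmp_Hom[OF u(1) x(1)] A.Idn_Hom[OF X]] by blast
  show ?thesis using that[OF _ x(2)] u(1) x(1) 1 2 by (auto simp: is_iso_def)
qed

text \<open>The object \<open>F\<close> is the pullback of \<open>h: V \<rightarrow> T X\<close> and \<open>p X: Y X \<rightarrow> T X\<close>, with legs \<open>b\<close> and \<open>c\<close>. A projective cover \<open>e: P \<rightarrow> X\<close>
  gives an arrow \<open>t: Y P \<rightarrow> F\<close> with \<open>b t = 0\<close> and \<open>c t = Y e\<close>, and \<open>b\<close> is its cokernel because \<open>p X\<close> is the cokernel of \<open>Y e\<close>.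
  Hence \<open>b\<close> is universal among arrows from \<open>F\<close> to \<open>D\<close>, and \<open>c\<close> is universal among arrows from \<open>F\<close> to representables.\<close>

lemma glue_surjective:
  assumes N: "(X, V, h, f) \<in> Obj M"
  shows "\<exists>F \<in> Obj C. \<exists>i. is_iso M (FO glue F) (X, V, h, f) i"
proof -
  have X: "X \<in> Obj A" and V: "V \<in> Obj D" and h: "h \<in> Hom C V (To X)" using N by (auto simp: M_Obj)
  note pX = p_Hom[OF X] and Vo = D_Obj[OF V]
  obtain F b c where b: "b \<in> Hom C F V" and c: "c \<in> Hom C F (Yo X)" and hb: "h \<bullet> b = p X \<bullet> c"
    and lift: "\<And>W x y. x \<in> Hom C W V \<Longrightarrow> y \<in> Hom C W (Yo X) \<Longrightarrow> h \<bullet> x = p X \<bullet> y \<Longrightarrow>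
       \<exists>t \<in> Hom C W F. b \<bullet> t = x \<and> c \<bullet> t = y"
    and mono: "\<And>W t. t \<in> Hom C W F \<Longrightarrow> b \<bullet> t = Nul C W V \<Longrightarrow> c \<bullet> t = Nul C W (Yo X) \<Longrightarrow> t = Nul C W F"
    using C.pullback_exists[OF h pX] by metis
  have F: "F \<in> Obj C" using C.HomD[OF b] by simp
  obtain P e where P: "projective A P" and e: "e \<in> Hom A P X" "epi_arr A e" using obtain_projective_cover[OF X] .
  have Po: "P \<in> Obj A" using A.projective_Obj[OF P] .
  note cok = p_cokernel[OF P e] and Ye = Y_Hom[OF e(1)]
  have "h \<bullet> Nul C (Yo P) V = p X \<bullet> Ya e" using C.is_cokernelD(2)[OF cok Ye] h Po by (simp add: C.Hom_iff)
  then obtain t where t: "t \<in> Hom C (Yo P) F" "b \<bullet> t = Nul C (Yo P) V" "c \<bullet> t = Ya e"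
    using lift[OF C.Nul_Hom[OF Yo_Obj[OF Po] Vo] Ye] by blast
  have b_epi: "epi_arr C b"
  proof (rule epi_test[OF b])
    fix U a assume U: "U \<in> Obj A" and a: "a \<in> Hom C (Yo U) V"
    obtain y where "y \<in> Hom C (Yo U) (Yo X)" "p X \<bullet> y = h \<bullet> a"
      using C.projectiveD[OF Y_projective[OF U] p_epi[OF X] pX C.Cmp_Hom[OF a h]] .
    then show "\<exists>d\<in>Hom C (Yo U) F. b \<bullet> d = a" using lift[OF a] by metis
  qed
  \<comment> \<open>\<open>b\<close> is a cokernel of its kernel \<open>K\<close>, and the elements of \<open>K\<close> come from \<open>Y P\<close> through \<open>t\<close>.\<close>
  have desc: "\<exists>u \<in> Hom C V W. u \<bullet> b = a" if a: "a \<in> Hom C F W" "a \<bullet> t = Nul C (Yo P) W" for W a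
  proof -
    obtain K k where k: "is_kernel C b K k" using C.obtain_kernel[OF b] .
    note kD = C.is_kernelD[OF k b]
    have Ko: "K \<in> Obj C" using C.HomD[OF kD(1)] by simp
    obtain f' B X' q where f': "f' \<in> Hom A B X'" and q: "q \<in> Hom C (Yo X') K" "epi_arr C q"
      using obtain_presentation[OF Ko] .
    have X': "X' \<in> Obj A" using A.HomD[OF f'] by simp
    note kq = C.Cmp_Hom[OF q(1) kD(1)]
    note ckq = C.Cmp_Hom[OF kq c]
    have bkq: "b \<bullet> k \<bullet> q = Nul C (Yo X') V" using C.Cmp_push[OF kD(2,1) b q(1)] q(1) Vo by (simp add: C.Hom_iff)
    have "p X \<bullet> c \<bullet> k \<bullet> q = h \<bullet> b \<bullet> k \<bullet> q" using C.Cmp_swap[OF hb b h c pX kq] by simp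
    then have "p X \<bullet> c \<bullet> k \<bullet> q = Nul C (Yo X') (To X)" using bkq h X' by (simp add: C.Hom_iff)
    then obtain y where y: "y \<in> Hom C (Yo X') (Yo P)" "Ya e \<bullet> y = c \<bullet> k \<bullet> q"
      using C.projective_lift_cokernel[OF cok Ye Y_projective[OF X'] ckq] by blast
    note ty = C.Cmp_Hom[OF y(1) t(1)]
    obtain d where d: "d \<in> Hom C (Yo X') F" "k \<bullet> q = Pls C d (t \<bullet> y)" using C.ex_diff[OF kq ty] .
    have bty: "b \<bullet> t \<bullet> y = Nul C (Yo X') V" using C.Cmp_push[OF t(2,1) b y(1)] y(1) Vo by (simp add: C.Hom_iff)
    have cty: "c \<bullet> t \<bullet> y = c \<bullet> k \<bullet> q" using C.Cmp_push[OF t(3,1) c y(1)] y(2) by simp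
    have "Pls C (b \<bullet> d) (Nul C (Yo X') V) = Nul C (Yo X') V"
      using C.Cmp_Pls_right[OF d(1) ty b] d(2) bkq bty by simp
    then have "b \<bullet> d = Nul C (Yo X') V" using C.Cmp_Hom[OF d(1) b] by (simp add: C.Hom_iff)
    moreover have "Pls C (c \<bullet> d) (c \<bullet> k \<bullet> q) = c \<bullet> k \<bullet> q"
      using C.Cmp_Pls_right[OF d(1) ty c] d(2) cty by simp
    then have "c \<bullet> d = Nul C (Yo X') (Yo X)" using C.Pls_eq_right_iff[OF C.Cmp_Hom[OF d(1) c] ckq] by simp
    ultimately have "d = Nul C (Yo X') F" using mono[OF d(1)] by blast
    then have kq': "k \<bullet> q = t \<bullet> y" using d(2) ty by (simp add: C.Hom_iff)
    have "(a \<bullet> k) \<bullet> q = a \<bullet> t \<bullet> y" using a(1) kD(1) q(1) kq' by (simp add: C.Hom_iff)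
    also have "\<dots> = Nul C (Yo X') W" using C.Cmp_push[OF a(2) t(1) a(1) y(1)] y(1) a(1) by (simp add: C.Hom_iff)
    finally have "a \<bullet> k = Nul C K W" using C.epi_Nul[OF q(2,1) C.Cmp_Hom[OF kD(1) a(1)]] by blast
    then show ?thesis
      using C.is_cokernel_desc[OF C.epi_is_cokernel_of_kernel[OF b_epi b k] kD(1) a(1)] by metis
  qed
  have r_univ: "\<exists>u \<in> Hom C V W. u \<bullet> b = a" if "W \<in> Obj D" "a \<in> Hom C F W" for W a
    using desc[OF that(2)] Y_projective_to_D[OF P that(1) C.Cmp_Hom[OF t(1) that(2)]] by blast
  have \<eta>_uniq: "u = v" if u: "u \<in> Hom A X W" and v: "v \<in> Hom A X W" and eq: "Ya u \<bullet> c = Ya v \<bullet> c" for W u v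
  proof -
    have "Ya u \<bullet> c \<bullet> t = Ya v \<bullet> c \<bullet> t" using C.Cmp_swap[OF eq c Y_Hom[OF u] c Y_Hom[OF v] t(1)] .
    then have "Ya (u \<cdot> e) = Ya (v \<cdot> e)" using t(3) u v e(1) by (simp add: A.Hom_iff)
    then have "u \<cdot> e = v \<cdot> e" using Y_faithful[OF A.Cmp_Hom[OF e(1) u] A.Cmp_Hom[OF e(1) v]] by blast
    then show ?thesis using A.epi_arrD[OF e(2,1) u v] by blast
  qed
  have \<eta>_univ: "\<exists>u \<in> Hom A X W. Ya u \<bullet> c = a" if W: "W \<in> Obj A" and a: "a \<in> Hom C F (Yo W)" for W a
  proof -
    note at' = C.Cmp_Hom[OF t(1) a]
    obtain K k where k: "is_kernel A e K k" using A.obtain_kernel[OF e(1)] .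
    note kD = A.is_kernelD[OF k e(1)]
    have Ko: "K \<in> Obj A" using A.HomD[OF kD(1)] by simp
    obtain a' where a': "a' \<in> Hom A P W" "Ya a' = a \<bullet> t" using Y_full[OF at' Po W] .
    note Yk = Y_Hom[OF kD(1)]
    note tk = C.Cmp_Hom[OF Yk t(1)]
    have "b \<bullet> t \<bullet> Ya k = Nul C (Yo K) V" using C.Cmp_push[OF t(2,1) b Yk] Yk Vo by (simp add: C.Hom_iff)
    moreover have "c \<bullet> t \<bullet> Ya k = Ya (e \<cdot> k)" using C.Cmp_push[OF t(3,1) c Yk] e(1) kD(1) by (simp add: A.Hom_iff)
    then have "c \<bullet> t \<bullet> Ya k = Nul C (Yo K) (Yo X)" using kD(2) Ko X by simp
    ultimately have "t \<bullet> Ya k = Nul C (Yo K) F" using mono[OF tk] by blast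
    then have "Ya (a' \<cdot> k) = Nul C (Yo K) (Yo W)" using a' kD(1) a t(1) by (simp add: Hom_iffs)
    then have "a' \<cdot> k = Nul A K W" using Y_faithful_Nul[OF A.Cmp_Hom[OF kD(1) a'(1)]] by blast
    then obtain u where u: "u \<in> Hom A X W" "u \<cdot> e = a'"
      using A.is_cokernel_desc[OF A.epi_is_cokernel_of_kernel[OF e(2,1) k] kD(1) a'(1)] by blast
    note uc = C.Cmp_Hom[OF c Y_Hom[OF u(1)]]
    have uct: "(Ya u \<bullet> c) \<bullet> t = a \<bullet> t" using u a'(2) t(1,3) c e(1) by (auto simp: Hom_iffs)
    obtain d where d: "d \<in> Hom C F (Yo W)" "a = Pls C d (Ya u \<bullet> c)" using C.ex_diff[OF a uc] .
    have "Pls C (d \<bullet> t) (a \<bullet> t) = a \<bullet> t" using C.Cmp_Pls_left[OF t(1) d(1) uc] d(2) uct by simp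
    then have "d \<bullet> t = Nul C (Yo P) (Yo W)" using C.Pls_eq_right_iff[OF C.Cmp_Hom[OF t(1) d(1)] at'] by simp
    then obtain z where z: "z \<in> Hom C V (Yo W)" "z \<bullet> b = d" using desc[OF d(1)] by blast
    have "d = Nul C F (Yo W)" using D_to_Y[OF V z(1) W] z(2) b W by (auto simp: C.Hom_iff)
    then have "Ya u \<bullet> c = a" using d(2) uc by (simp add: C.Hom_iff)
    then show ?thesis using u(1) by blast
  qed
  obtain v where v: "is_iso C (Ro F) V v" "v \<bullet> r F = b" using iso_of_universal_r[OF F V b r_univ b_epi] .
  obtain x where x: "is_iso A (wo F) X x" "Ya x \<bullet> \<eta> F = c" using iso_of_universal_\<eta>[OF F X c \<eta>_univ \<eta>_uniq] .
  have xH: "x \<in> Hom A (wo F) X" and vH: "v \<in> Hom C (Ro F) V" using v x by (auto simp: is_iso_def)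
  note wF = wo_Obj[OF F] and rF = r_Hom[OF F] and gF = g_Hom[OF F]
  have "(Ta x \<bullet> g F) \<bullet> r F = Ta x \<bullet> p (wo F) \<bullet> \<eta> F" using g_r[OF F] T_Hom[OF xH] gF rF by (simp add: C.Hom_iff)
  also have "\<dots> = p X \<bullet> c"
    using C.Cmp_swap[OF p_nat[OF xH] p_Hom[OF wF] T_Hom[OF xH] Y_Hom[OF xH] pX \<eta>_Hom[OF F]] x(2) by simp
  also have "\<dots> = (h \<bullet> v) \<bullet> r F" using hb v(2) vH h rF by (simp add: C.Hom_iff)
  finally have "Ta x \<bullet> g F = h \<bullet> v"
    using r_unique[OF F To_D[OF X] C.Cmp_Hom[OF gF T_Hom[OF xH]] C.Cmp_Hom[OF vH h]] by blast
  from M_iso[OF glue_Obj[OF F, unfolded glue_FO] N x(1) v(1) this]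
  show ?thesis using F unfolding glue_FO by blast
qed

lemma glue_equivalence: assumes her: "hereditary A" shows "equivalence C M glue"
proof (rule equivalenceI[OF glue_fully_faithful[OF her] C.category_axioms M_category])
  fix N assume "N \<in> Obj M"
  then show "\<exists>F\<in>Obj C. \<exists>i. is_iso M (FO glue F) N i" using glue_surjective by (cases N) blast
qed

section \<open>Compatibility of the gluing with the six functors\<close>

abbreviation "MV \<equiv> mv_recoll D A (zero_functor D) T (zero_trans D T)"
abbreviation "ZA \<equiv> zero_obj A"

lemma ZA: "is_zero A ZA" "ZA \<in> Obj A"
  using A.zero_obj_zero[OF A.has_zero] by (auto simp: is_zero_def)

lemma MV_simps:
  "FO (i_lower MV) V = (ZA, V, Nul C V (To ZA), Nul C Z0 V)"
  "FA (i_lower MV) v = ((ZA, Dom C v, Nul C (Dom C v) (To ZA), Nul C Z0 (Dom C v)), (Idn A ZA, v),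
     (ZA, Cod C v, Nul C (Cod C v) (To ZA), Nul C Z0 (Cod C v)))"
  "FO (i_upper MV) (X, V, h, f) = coker_obj D f"
  "FA (i_upper MV) ((X, V, h, f), (x, v), (X', V', h', f')) =
     (THE u. u \<in> Hom D (coker_obj D f) (coker_obj D f') \<and> Cmp C u (coker_arr D f) = Cmp C (coker_arr D f') v)"
  "FO (i_ushriek MV) (X, V, h, f) = ker_obj D h"
  "FA (i_ushriek MV) ((X, V, h, f), (x, v), (X', V', h', f')) =
     (THE u. u \<in> Hom D (ker_obj D h) (ker_obj D h') \<and> Cmp C (ker_arr D h') u = Cmp C v (ker_arr D h))"
  "FO (j_upper MV) (X, V, h, f) = X"
  "FA (j_upper MV) (S1, (x, v), S2) = x"
  "FO (j_lshriek MV) X = (X, Z0, Nul C Z0 (To X), Idn C Z0)"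
  "FA (j_lshriek MV) x = ((Dom A x, Z0, Nul C Z0 (To (Dom A x)), Idn C Z0), (x, Idn C Z0),
     (Cod A x, Z0, Nul C Z0 (To (Cod A x)), Idn C Z0))"
  "FO (j_lower MV) X = (X, To X, Idn C (To X), Nul C Z0 (To X))"
  "FA (j_lower MV) x = ((Dom A x, To (Dom A x), Idn C (To (Dom A x)), Nul C Z0 (To (Dom A x))), (x, Ta x),
     (Cod A x, To (Cod A x), Idn C (To (Cod A x)), Nul C Z0 (To (Cod A x))))"
  by (simp_all add: mv_recoll_def Let_def)

lemma r_iso:
  assumes V: "V \<in> Obj D" shows "is_iso C V (Ro V) (r V)"
proof -
  note Vo = D_Obj[OF V]
  note rV = r_Hom[OF Vo]
  obtain u where u: "u \<in> Hom C (Ro V) V" "u \<bullet> r V = Idn C V" using r_lift[OF V C.Idn_Hom[OF Vo]] .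
  have "(r V \<bullet> u) \<bullet> r V = Idn C (Ro V) \<bullet> r V" using u rV by (simp add: C.Hom_iff)
  then have "r V \<bullet> u = Idn C (Ro V)"
    using r_unique[OF Vo Ro_D[OF Vo] C.Cmp_Hom[OF u(1) rV] C.Idn_Hom[OF Ro_Obj[OF Vo]]] by blast
  then show ?thesis using u rV by (auto simp: is_iso_def)
qed

lemma glue_i_lower: "nat_isomorphic D M (glue \<circ>\<^sub>F id_functor) (i_lower MV \<circ>\<^sub>F id_functor)"
proof -
  have "\<exists>u. is_iso C (Ro V) V u \<and> u \<bullet> r V = Idn C V" if V: "V \<in> Obj D" for V
    using C.is_isoD[OF r_iso[OF V]] unfolding is_iso_def by metis
  then obtain \<rho> where \<rho>: "\<And>V. V \<in> Obj D \<Longrightarrow> is_iso C (Ro V) V (\<rho> V)"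
    and \<rho>r: "\<And>V. V \<in> Obj D \<Longrightarrow> \<rho> V \<bullet> r V = Idn C V" by metis
  have \<rho>H: "\<rho> V \<in> Hom C (Ro V) V" if "V \<in> Obj D" for V using \<rho>[OF that] by (auto simp: is_iso_def)
  define \<nu> where "\<nu> V = (FO glue V, (Nul A (wo V) ZA, \<rho> V), FO (i_lower MV) V)" for V
  show ?thesis
  proof (rule nat_isomorphicI[OF D_category, of _ _ _ \<nu>])
    fix V assume V: "V \<in> Obj D"
    note Vo = D_Obj[OF V]
    note wV = wo_Obj[OF Vo] and TZ = To_Obj[OF ZA(2)]
    have "FO (i_lower MV) V \<in> Obj M" using V Vo ZA TZ by (simp add: MV_simps M_Obj C.Hom_iff)
    moreover have "is_iso A (wo V) ZA (Nul A (wo V) ZA)"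
      using A.is_iso_zero[OF _ ZA(1)] V ZA(2) wV by (simp add: D_iff)
    moreover have "Ta (Nul A (wo V) ZA) \<bullet> g V = Nul C V (To ZA) \<bullet> \<rho> V"
      using T_Nul[OF wV ZA(2)] g_Hom[OF Vo] \<rho>H[OF V] TZ by (simp add: C.Hom_iff)
    ultimately show "is_iso M (FO (glue \<circ>\<^sub>F id_functor) V) (FO (i_lower MV \<circ>\<^sub>F id_functor) V) (\<nu> V)"
      using M_iso[OF glue_Obj[OF Vo, unfolded glue_FO] _ _ \<rho>[OF V]] by (simp add: \<nu>_def glue_FO MV_simps)
  next
    fix V V' v assume "v \<in> Hom D V V'"
    note v = Hom_D_subset[OF this] and V = category.HomD(4,5)[OF D_category this]
    note Vo = D_Obj[OF V(1)] D_Obj[OF V(2)]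
    have "(\<rho> V' \<bullet> Ra v) \<bullet> r V = \<rho> V' \<bullet> r V' \<bullet> v"
      using r_nat[OF v] \<rho>H[OF V(2)] Ra_Hom[OF v] r_Hom[OF Vo(1)] by (simp add: C.Hom_iff)
    also have "\<dots> = v" using C.Cmp_push[OF \<rho>r[OF V(2)] r_Hom[OF Vo(2)] \<rho>H[OF V(2)] v] v by (simp add: C.Hom_iff)
    also have "\<dots> = (v \<bullet> \<rho> V) \<bullet> r V" using \<rho>r[OF V(1)] v \<rho>H[OF V(1)] r_Hom[OF Vo(1)] by (simp add: C.Hom_iff)
    finally have "\<rho> V' \<bullet> Ra v = v \<bullet> \<rho> V"
      using r_unique[OF Vo(1) V(2) C.Cmp_Hom[OF Ra_Hom[OF v] \<rho>H[OF V(2)]] C.Cmp_Hom[OF \<rho>H[OF V(1)] v]] by blast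
    moreover have "Nul A (wo V') ZA \<cdot> wa v = Idn A ZA \<cdot> Nul A (wo V) ZA"
      using wa_Hom[OF v] ZA(2) by (simp add: A.Hom_iff)
    ultimately show "Cmp M (\<nu> V') (FA (glue \<circ>\<^sub>F id_functor) v) = Cmp M (FA (i_lower MV \<circ>\<^sub>F id_functor) v) (\<nu> V)"
      using C.HomD[OF v] by (simp add: \<nu>_def glue_FA[OF v] MV_simps)
  qed
qed

lemma coker_Z0:
  assumes V: "V \<in> Obj D"
  shows "is_iso D V (coker_obj D (Nul C Z0 V)) (coker_arr D (Nul C Z0 V))"
    and "is_cokernel D (Nul C Z0 V) (coker_obj D (Nul C Z0 V)) (coker_arr D (Nul C Z0 V))"
proof -
  interpret D: abelian D by (rule D_abelian)
  have f: "Nul C Z0 V \<in> Hom D Z0 V" using D.Nul_Hom[OF Z0_D V] by simp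
  show cok: "is_cokernel D (Nul C Z0 V) (coker_obj D (Nul C Z0 V)) (coker_arr D (Nul C Z0 V))"
    using D.is_cokernel_coker D.has_cokernels D.HomD(1)[OF f] by blast
  note q = D.is_cokernelD[OF cok f]
  have "Cmp D (Idn D V) (Nul C Z0 V) = Nul D Z0 V" using V Z0_Obj D_Obj by simp
  then obtain u where u: "u \<in> Hom D (coker_obj D (Nul C Z0 V)) V" "Cmp D u (coker_arr D (Nul C Z0 V)) = Idn D V"
    using D.is_cokernel_desc[OF cok f D.Idn_Hom[OF V]] by blast
  have Q: "coker_obj D (Nul C Z0 V) \<in> Obj D" using D.HomD[OF q(1)] by simp
  have "Cmp D (Cmp D (coker_arr D (Nul C Z0 V)) u) (coker_arr D (Nul C Z0 V)) =
      Cmp D (Idn D (coker_obj D (Nul C Z0 V))) (coker_arr D (Nul C Z0 V))"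
    using D.Cmp_assoc[OF q(1) u(1) q(1)] u(2) D.Cmp_Idn[OF q(1)] D.Idn_Cmp[OF q(1)] by simp
  then have "Cmp D (coker_arr D (Nul C Z0 V)) u = Idn D (coker_obj D (Nul C Z0 V))"
    using D.epi_arrD[OF q(3,1) D.Cmp_Hom[OF u(1) q(1)] D.Idn_Hom[OF Q]] by blast
  then show "is_iso D V (coker_obj D (Nul C Z0 V)) (coker_arr D (Nul C Z0 V))"
    using q(1) u by (auto simp: is_iso_def)
qed

lemma glue_i_upper: "nat_isomorphic C D (id_functor \<circ>\<^sub>F R) (i_upper MV \<circ>\<^sub>F glue)"
proof (rule nat_isomorphicI[OF C.category_axioms, of _ _ _ "\<lambda>F. coker_arr D (Nul C Z0 (Ro F))"])
  fix F assume "F \<in> Obj C"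
  then show "is_iso D (FO (id_functor \<circ>\<^sub>F R) F) (FO (i_upper MV \<circ>\<^sub>F glue) F) (coker_arr D (Nul C Z0 (Ro F)))"
    using coker_Z0(1)[OF Ro_D] by (simp add: glue_FO MV_simps)
next
  interpret D: abelian D by (rule D_abelian)
  fix F F' a assume a: "a \<in> Hom C F F'"
  have F: "F \<in> Obj C" "F' \<in> Obj C" using C.HomD[OF a] by auto
  let ?f = "Nul C Z0 (Ro F)" and ?f' = "Nul C Z0 (Ro F')"
  have Ra: "Ra a \<in> Hom D (Ro F) (Ro F')" using functor_Hom[OF R_functor a] .
  have f: "?f \<in> Hom D Z0 (Ro F)" "?f' \<in> Hom D Z0 (Ro F')"
    using D.Nul_Hom[OF Z0_D Ro_D[OF F(1)]] D.Nul_Hom[OF Z0_D Ro_D[OF F(2)]] by simp_all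
  note c = coker_Z0(2)[OF Ro_D[OF F(1)]] and c' = coker_Z0(2)[OF Ro_D[OF F(2)]]
  note q = D.is_cokernelD[OF c f(1)] and q' = D.is_cokernelD[OF c' f(2)]
  note cR = D.Cmp_Hom[OF Ra q'(1)]
  have "Cmp D (Cmp D (coker_arr D ?f') (Ra a)) ?f = Nul D Z0 (coker_obj D ?f')"
    using Hom_D_subset[OF cR] Z0_Obj by (simp add: C.Hom_iff)
  then obtain u where u: "u \<in> Hom D (coker_obj D ?f) (coker_obj D ?f')" "Cmp D u (coker_arr D ?f) = Cmp D (coker_arr D ?f') (Ra a)"
    using D.is_cokernel_desc[OF c f(1) cR] by blast
  have "(THE u. u \<in> Hom D (coker_obj D ?f) (coker_obj D ?f') \<and> Cmp C u (coker_arr D ?f) = Cmp C (coker_arr D ?f') (Ra a)) = u"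
    using u D.epi_arrD[OF q(3,1)] by (intro the_equality) auto
  then show "Cmp D (coker_arr D ?f') (FA (id_functor \<circ>\<^sub>F R) a) = Cmp D (FA (i_upper MV \<circ>\<^sub>F glue) a) (coker_arr D ?f)"
    using u(2) by (simp add: glue_FA[OF a] glue_FO MV_simps)
qed

text \<open>Both sides are the part of the pullback \<open>F\<close> that is killed by \<open>\<eta> F\<close>: this part is the kernel of \<open>g F\<close>, and it is the
  largest subobject of \<open>F\<close> in \<open>D\<close> because objects of \<open>D\<close> have no nonzero arrows to representables.\<close>

lemma glue_i_ushriek:
  assumes her: "hereditary A"
  shows "nat_isomorphic C D (id_functor \<circ>\<^sub>F S) (i_ushriek MV \<circ>\<^sub>F glue)"
proof -
  interpret D: abelian D by (rule D_abelian)
  define k where "k F = ker_arr D (g F)" for F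
  define K where "K F = ker_obj D (g F)" for F
  have gD: "g F \<in> Hom D (Ro F) (To (wo F))" if "F \<in> Obj C" for F
    using g_Hom[OF that] Hom_D[OF Ro_D[OF that] To_D[OF wo_Obj[OF that]]] by simp
  have ker: "is_kernel D (g F) (K F) (k F)" if "F \<in> Obj C" for F
    unfolding k_def K_def using D.is_kernel_ker D.has_kernels D.HomD(1)[OF gD[OF that]] by blast
  note kD = D.is_kernelD[OF ker gD]
  have KD: "K F \<in> Obj D" if "F \<in> Obj C" for F using D.HomD(4)[OF kD(1)[OF that that]] .
  note kC = Hom_D_subset[OF kD(1)]
  have z: "g F \<bullet> r F \<bullet> s F = Nul C (So F) (To (wo F))" "\<eta> F \<bullet> s F = Nul C (So F) (Yo (wo F))" if F: "F \<in> Obj C" for F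
  proof -
    note wF = wo_Obj[OF F] and sF = s_Hom[OF F]
    show \<eta>s: "\<eta> F \<bullet> s F = Nul C (So F) (Yo (wo F))"
      using D_to_Y[OF So_D[OF F] C.Cmp_Hom[OF sF \<eta>_Hom[OF F]] wF] .
    have "g F \<bullet> r F \<bullet> s F = p (wo F) \<bullet> \<eta> F \<bullet> s F"
      using C.Cmp_swap[OF g_r[OF F] r_Hom[OF F] g_Hom[OF F] \<eta>_Hom[OF F] p_Hom[OF wF] sF] .
    then show "g F \<bullet> r F \<bullet> s F = Nul C (So F) (To (wo F))" using \<eta>s p_Hom[OF wF] sF by (simp add: C.Hom_iff)
  qed
  have "\<exists>u. u \<in> Hom D (So F) (K F) \<and> k F \<bullet> u = r F \<bullet> s F" if F: "F \<in> Obj C" for F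
  proof -
    have "r F \<bullet> s F \<in> Hom D (So F) (Ro F)" using C.Cmp_Hom[OF s_Hom[OF F] r_Hom[OF F]] Hom_D[OF So_D[OF F] Ro_D[OF F]] by simp
    then show ?thesis using D.is_kernel_lift[OF ker[OF F] gD[OF F], of "r F \<bullet> s F" "So F"] z(1)[OF F] by auto
  qed
  then obtain \<mu> where \<mu>: "\<And>F. F \<in> Obj C \<Longrightarrow> \<mu> F \<in> Hom D (So F) (K F)"
    and k\<mu>: "\<And>F. F \<in> Obj C \<Longrightarrow> k F \<bullet> \<mu> F = r F \<bullet> s F" by metis
  show ?thesis
  proof (rule nat_isomorphicI[OF C.category_axioms, of _ _ _ \<mu>])
    fix F assume F: "F \<in> Obj C"
    note rF = r_Hom[OF F] and \<eta>F = \<eta>_Hom[OF F] and sF = s_Hom[OF F] and wF = wo_Obj[OF F]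
    have KF: "K F \<in> Obj C" using KD[OF F] D_Obj by blast
    have "g F \<bullet> k F = p (wo F) \<bullet> Nul C (K F) (Yo (wo F))"
      using kD(2)[OF F F] p_Hom[OF wF] KF by (simp add: C.Hom_iff)
    then obtain t where t: "t \<in> Hom C (K F) F" "r F \<bullet> t = k F" "\<eta> F \<bullet> t = Nul C (K F) (Yo (wo F))"
      using gluing[OF her F kC[OF F F] C.Nul_Hom[OF KF Yo_Obj[OF wF]]] by blast
    obtain u where u: "u \<in> Hom C (K F) (So F)" "s F \<bullet> u = t" using s_lift[OF KD[OF F] t(1)] .
    note \<mu>C = Hom_D_subset[OF \<mu>[OF F]]
    have uD: "u \<in> Hom D (K F) (So F)" using u(1) Hom_D[OF KD[OF F] So_D[OF F]] by simp
    have "k F \<bullet> \<mu> F \<bullet> u = r F \<bullet> s F \<bullet> u" using C.Cmp_swap[OF k\<mu>[OF F] \<mu>C kC[OF F F] sF rF u(1)] .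
    then have "k F \<bullet> \<mu> F \<bullet> u = k F \<bullet> Idn C (K F)" using u(2) t(2) kC[OF F F] by (simp add: C.Hom_iff)
    then have 1: "\<mu> F \<bullet> u = Idn C (K F)"
      using D.mono_arrD[OF kD(3)[OF F F] kD(1)[OF F F], of "\<mu> F \<bullet> u" "K F" "Idn C (K F)"]
        D.Cmp_Hom[OF uD \<mu>[OF F]] D.Idn_Hom[OF KD[OF F]] by simp
    have "t \<bullet> \<mu> F = s F"
    proof (rule joint_mono[OF her F C.Cmp_Hom[OF \<mu>C t(1)] sF])
      show "r F \<bullet> t \<bullet> \<mu> F = r F \<bullet> s F" using C.Cmp_push[OF t(2,1) rF \<mu>C] k\<mu>[OF F] by simp
      show "\<eta> F \<bullet> t \<bullet> \<mu> F = \<eta> F \<bullet> s F"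
        using C.Cmp_push[OF t(3,1) \<eta>F \<mu>C] z(2)[OF F] \<mu>C wF by (simp add: C.Hom_iff)
    qed
    then have "s F \<bullet> u \<bullet> \<mu> F = s F \<bullet> Idn C (So F)" using C.Cmp_push[OF u(2,1) sF \<mu>C] sF by (simp add: C.Hom_iff)
    then have 2: "u \<bullet> \<mu> F = Idn C (So F)"
      using s_unique[OF F So_D[OF F] C.Cmp_Hom[OF \<mu>C u(1)] C.Idn_Hom] D_Obj[OF So_D[OF F]] by blast
    show "is_iso D (FO (id_functor \<circ>\<^sub>F S) F) (FO (i_ushriek MV \<circ>\<^sub>F glue) F) (\<mu> F)"
      using \<mu>[OF F] uD 1 2 by (auto simp: is_iso_def glue_FO MV_simps K_def)
  next
    fix F F' a assume a: "a \<in> Hom C F F'"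
    have F: "F \<in> Obj C" "F' \<in> Obj C" using C.HomD[OF a] by auto
    note wF = wo_Obj[OF F(1)] wo_Obj[OF F(2)]
    have Ra: "Ra a \<in> Hom D (Ro F) (Ro F')" and Sa: "Sa a \<in> Hom D (So F) (So F')"
      using functor_Hom[OF R_functor a] functor_Hom[OF S_functor a] .
    note RaC = Ra_Hom[OF a] and SaC = Sa_Hom[OF a] and Twa = T_Hom[OF wa_Hom[OF a]]
    note k = kD(1)[OF F(1) F(1)] and k' = kD(1)[OF F(2) F(2)]
    note kCF = Hom_D_subset[OF k] and kCF' = Hom_D_subset[OF k']
    have "g F' \<bullet> Ra a \<bullet> k F = Ta (wa a) \<bullet> g F \<bullet> k F"
      using C.Cmp_swap[OF g_nat[OF a] g_Hom[OF F(1)] Twa RaC g_Hom[OF F(2)] kCF] by simp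
    also have "\<dots> = Nul C (K F) (To (wo F'))" using kD(2)[OF F(1) F(1)] Twa kCF by (simp add: C.Hom_iff)
    finally obtain u where u: "u \<in> Hom D (K F) (K F')" "k F' \<bullet> u = Ra a \<bullet> k F"
      using D.is_kernel_lift[OF ker[OF F(2)] gD[OF F(2)] D.Cmp_Hom[OF k Ra]] by auto
    note uC = Hom_D_subset[OF u(1)]
    have the: "(THE u. u \<in> Hom D (K F) (K F') \<and> Cmp C (k F') u = Cmp C (Ra a) (k F)) = u"
      using u D.mono_arrD[OF kD(3)[OF F(2) F(2)] k'] by (intro the_equality) auto
    note \<mu>C = Hom_D_subset[OF \<mu>[OF F(1)]] and \<mu>C' = Hom_D_subset[OF \<mu>[OF F(2)]]
    have "k F' \<bullet> u \<bullet> \<mu> F = Ra a \<bullet> r F \<bullet> s F"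
      using C.Cmp_swap[OF u(2) uC kCF' kCF RaC \<mu>C] k\<mu>[OF F(1)] by simp
    also have "\<dots> = r F' \<bullet> a \<bullet> s F" using C.Cmp_swap[OF r_nat[OF a] r_Hom[OF F(1)] RaC a r_Hom[OF F(2)] s_Hom[OF F(1)]] .
    also have "\<dots> = r F' \<bullet> s F' \<bullet> Sa a" using s_nat[OF a] by simp
    also have "\<dots> = k F' \<bullet> \<mu> F' \<bullet> Sa a"
      using C.Cmp_swap[OF k\<mu>[OF F(2)] \<mu>C' kCF' s_Hom[OF F(2)] r_Hom[OF F(2)] SaC] by simp
    finally have "k F' \<bullet> u \<bullet> \<mu> F = k F' \<bullet> \<mu> F' \<bullet> Sa a" .
    then have "u \<bullet> \<mu> F = \<mu> F' \<bullet> Sa a"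
      using D.mono_arrD[OF kD(3)[OF F(2) F(2)] k' D.Cmp_Hom[OF \<mu>[OF F(1)] u(1)] D.Cmp_Hom[OF Sa \<mu>[OF F(2)]]] by simp
    then show "Cmp D (\<mu> F') (FA (id_functor \<circ>\<^sub>F S) a) = Cmp D (FA (i_ushriek MV \<circ>\<^sub>F glue) a) (\<mu> F)"
      using the by (simp add: glue_FA[OF a] glue_FO MV_simps K_def k_def)
  qed
qed

lemma glue_j_upper: "nat_isomorphic C A (id_functor \<circ>\<^sub>F w) (j_upper MV \<circ>\<^sub>F glue)"
proof (rule nat_isomorphicI[OF C.category_axioms, of _ _ _ "\<lambda>F. Idn A (wo F)"])
  fix F assume "F \<in> Obj C"
  then show "is_iso A (FO (id_functor \<circ>\<^sub>F w) F) (FO (j_upper MV \<circ>\<^sub>F glue) F) (Idn A (wo F))"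
    using A.is_iso_Idn[OF wo_Obj] by (simp add: glue_FO MV_simps)
next
  fix F F' a assume a: "a \<in> Hom C F F'"
  show "Idn A (wo F') \<cdot> FA (id_functor \<circ>\<^sub>F w) a = FA (j_upper MV \<circ>\<^sub>F glue) a \<cdot> Idn A (wo F)"
    using wa_Hom[OF a] by (simp add: glue_FA[OF a] MV_simps A.Hom_iff)
qed

text \<open>The unit of an adjunction is invertible when the left adjoint is fully faithful.\<close>

lemma \<theta>_iso: assumes X: "X \<in> Obj A" shows "is_iso A X (wo (lo X)) (\<theta> X)"
proof -
  have lX: "lo X \<in> Obj C" using functor_Obj[OF l_functor X] .
  note wlX = wo_Obj[OF lX] and \<theta>X = A.unit_Hom[OF unit_l X]
  obtain b where b: "b \<in> Hom C (lo (wo (lo X))) (lo X)" "wa b \<cdot> \<theta> (wo (lo X)) = Idn A (wo (lo X))"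
    using A.unit_lift[OF unit_l lX A.Idn_Hom[OF wlX]] .
  have "b \<in> la ` Hom A (wo (lo X)) X"
    using b(1) l_fully_faithful wlX X unfolding fully_faithful_def bij_betw_def by blast
  then obtain x where x: "x \<in> Hom A (wo (lo X)) X" "la x = b" by blast
  have \<theta>x: "\<theta> X \<cdot> x = Idn A (wo (lo X))" using A.unit_nat[OF unit_l x(1)] b(2) x(2) by simp
  have x\<theta>: "x \<cdot> \<theta> X \<in> Hom A X X" using A.Cmp_Hom[OF \<theta>X x(1)] .
  have "wa (la (x \<cdot> \<theta> X)) \<cdot> \<theta> X = \<theta> X \<cdot> x \<cdot> \<theta> X" using A.unit_nat[OF unit_l x\<theta>] .
  also have "\<dots> = \<theta> X" using A.Cmp_push[OF \<theta>x x(1) \<theta>X \<theta>X] \<theta>X by (simp add: A.Hom_iff)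
  also have "\<dots> = wa (la (Idn A X)) \<cdot> \<theta> X" using A.unit_nat[OF unit_l A.Idn_Hom[OF X]] \<theta>X by (simp add: A.Hom_iff)
  finally have "la (x \<cdot> \<theta> X) = la (Idn A X)"
    using unit_unique[OF A.category_axioms C.category_axioms w_functor unit_l X functor_Hom[OF l_functor x\<theta>]
      functor_Hom[OF l_functor A.Idn_Hom[OF X]]] by blast
  then have "x \<cdot> \<theta> X = Idn A X"
    using l_fully_faithful X x\<theta> A.Idn_Hom[OF X] unfolding fully_faithful_def bij_betw_def inj_on_def by blast
  then show ?thesis using \<theta>X x(1) \<theta>x by (auto simp: is_iso_def)
qed

text \<open>Arrows from \<open>l X\<close> to an object \<open>V\<close> of \<open>D\<close> correspond to arrows from \<open>X\<close> to \<open>w V = 0\<close>.\<close>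

lemma R_l_zero: assumes X: "X \<in> Obj A" shows "is_zero D (Ro (lo X))"
proof -
  have lX: "lo X \<in> Obj C" using functor_Obj[OF l_functor X] .
  note Rl = Ro_D[OF lX] and rl = r_Hom[OF lX]
  note Rlo = D_Obj[OF Rl]
  have n: "Nul C (lo X) (Ro (lo X)) \<in> Hom C (lo X) (Ro (lo X))" using C.Nul_Hom[OF lX Rlo] .
  have "wa (r (lo X)) \<cdot> \<theta> X = wa (Nul C (lo X) (Ro (lo X))) \<cdot> \<theta> X"
    using A.to_zero[of "wo (Ro (lo X))"] Rl A.Cmp_Hom[OF A.unit_Hom[OF unit_l X] wa_Hom[OF rl]]
      A.Cmp_Hom[OF A.unit_Hom[OF unit_l X] wa_Hom[OF n]] unfolding D_iff by metis
  then have "r (lo X) = Nul C (lo X) (Ro (lo X))"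
    using unit_unique[OF A.category_axioms C.category_axioms w_functor unit_l X rl n] by blast
  then have "Idn C (Ro (lo X)) \<bullet> r (lo X) = Nul C (Ro (lo X)) (Ro (lo X)) \<bullet> r (lo X)"
    using rl Rlo n by (simp add: C.Hom_iff)
  then have "Idn C (Ro (lo X)) = Nul C (Ro (lo X)) (Ro (lo X))"
    using r_unique[OF lX Rl C.Idn_Hom[OF Rlo] C.Nul_Hom[OF Rlo Rlo]] by blast
  then show ?thesis using preadditive.is_zeroI[OF D_preadditive Rl] by simp
qed

lemma glue_j_lshriek: "nat_isomorphic A M (glue \<circ>\<^sub>F l) (j_lshriek MV \<circ>\<^sub>F id_functor)"
proof -
  have lX: "lo X \<in> Obj C" if "X \<in> Obj A" for X using functor_Obj[OF l_functor that] .
  have "\<exists>x. is_iso A (wo (lo X)) X x \<and> x \<cdot> \<theta> X = Idn A X" if "X \<in> Obj A" for X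
    using A.is_isoD[OF \<theta>_iso[OF that]] unfolding is_iso_def by metis
  then obtain \<iota> where \<iota>: "\<And>X. X \<in> Obj A \<Longrightarrow> is_iso A (wo (lo X)) X (\<iota> X)"
    and \<iota>\<theta>: "\<And>X. X \<in> Obj A \<Longrightarrow> \<iota> X \<cdot> \<theta> X = Idn A X" by metis
  have \<iota>H: "\<iota> X \<in> Hom A (wo (lo X)) X" if "X \<in> Obj A" for X using \<iota>[OF that] by (auto simp: is_iso_def)
  have zero: "is_zero C (Ro (lo X))" if X: "X \<in> Obj A" for X
    using preadditive.zero_Idn[OF D_preadditive R_l_zero[OF X]] C.is_zeroI[OF Ro_Obj[OF lX[OF X]]] by simp
  define \<nu> where "\<nu> X = (FO glue (lo X), (\<iota> X, Nul C (Ro (lo X)) Z0), FO (j_lshriek MV) X)" for X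
  show ?thesis
  proof (rule nat_isomorphicI[OF A.category_axioms, of _ _ _ \<nu>])
    fix X assume X: "X \<in> Obj A"
    note Rl = Ro_Obj[OF lX[OF X]]
    have "FO (j_lshriek MV) X \<in> Obj M" using X Z0_D Z0_Obj To_Obj[OF X] Idn_Z0 by (simp add: MV_simps M_Obj)
    moreover have "is_iso C (Ro (lo X)) Z0 (Nul C (Ro (lo X)) Z0)"
      using C.is_iso_zero[OF zero[OF X]] Z0_Obj Rl C.is_zeroI[OF Z0_Obj Idn_Z0] by simp
    moreover have "Ta (\<iota> X) \<bullet> g (lo X) = Nul C Z0 (To X) \<bullet> Nul C (Ro (lo X)) Z0"
      using C.from_zero[OF zero[OF X] C.Cmp_Hom[OF g_Hom[OF lX[OF X]] T_Hom[OF \<iota>H[OF X]]]]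
        Z0_Obj To_Obj[OF X] Rl by simp
    ultimately show "is_iso M (FO (glue \<circ>\<^sub>F l) X) (FO (j_lshriek MV \<circ>\<^sub>F id_functor) X) (\<nu> X)"
      using M_iso[OF glue_Obj[OF lX[OF X], unfolded glue_FO] _ \<iota>[OF X]] by (simp add: \<nu>_def glue_FO MV_simps)
  next
    fix X X' x assume x: "x \<in> Hom A X X'"
    have X: "X \<in> Obj A" "X' \<in> Obj A" using A.HomD[OF x] by auto
    note lx = functor_Hom[OF l_functor x]
    note wlx = wa_Hom[OF lx]
    note \<theta>X = A.unit_Hom[OF unit_l X(1)] and \<theta>X' = A.unit_Hom[OF unit_l X(2)]
    have "(\<iota> X' \<cdot> wa (la x)) \<cdot> \<theta> X = \<iota> X' \<cdot> \<theta> X' \<cdot> x"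
      using A.unit_nat[OF unit_l x] \<iota>H[OF X(2)] wlx \<theta>X by (simp add: A.Hom_iff)
    also have "\<dots> = x" using A.Cmp_push[OF \<iota>\<theta>[OF X(2)] \<theta>X' \<iota>H[OF X(2)] x] x by (simp add: A.Hom_iff)
    also have "\<dots> = (x \<cdot> \<iota> X) \<cdot> \<theta> X" using \<iota>\<theta>[OF X(1)] x \<iota>H[OF X(1)] \<theta>X by (simp add: A.Hom_iff)
    finally have "\<iota> X' \<cdot> wa (la x) = x \<cdot> \<iota> X"
      using A.epi_arrD[OF A.iso_epi[OF \<theta>_iso[OF X(1)]] \<theta>X A.Cmp_Hom[OF wlx \<iota>H[OF X(2)]] A.Cmp_Hom[OF \<iota>H[OF X(1)] x]] by blast
    moreover have "Nul C (Ro (lo X')) Z0 \<bullet> Ra (la x) = Idn C Z0 \<bullet> Nul C (Ro (lo X)) Z0"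
      using Ra_Hom[OF lx] Z0_Obj by (simp add: C.Hom_iff)
    ultimately show "Cmp M (\<nu> X') (FA (glue \<circ>\<^sub>F l) x) = Cmp M (FA (j_lshriek MV \<circ>\<^sub>F id_functor) x) (\<nu> X)"
      using A.HomD[OF x] by (simp add: \<nu>_def glue_FA[OF lx] MV_simps)
  qed
qed

lemma glue_j_lower: "nat_isomorphic A M (glue \<circ>\<^sub>F Y) (j_lower MV \<circ>\<^sub>F id_functor)"
proof -
  have "\<exists>x. is_iso A (wo (Yo X)) X x \<and> Ya x \<bullet> \<eta> (Yo X) = Idn C (Yo X)" if X: "X \<in> Obj A" for X
  proof -
    note YX = Yo_Obj[OF X]
    have 1: "\<exists>u\<in>Hom A X W. Ya u \<bullet> Idn C (Yo X) = a" if W: "W \<in> Obj A" and a: "a \<in> Hom C (Yo X) (Yo W)" for W a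
    proof -
      obtain u where "u \<in> Hom A X W" "Ya u = a" using Y_full[OF a X W] .
      then show ?thesis using a by (auto simp: C.Hom_iff intro!: bexI[of _ u])
    qed
    have 2: "u = v" if u: "u \<in> Hom A X W" and v: "v \<in> Hom A X W"
      and eq: "Ya u \<bullet> Idn C (Yo X) = Ya v \<bullet> Idn C (Yo X)" for W u v
    proof -
      have "Ya u = Ya v" using eq Y_Hom[OF u] Y_Hom[OF v] by (simp add: C.Hom_iff)
      then show ?thesis using Y_faithful[OF u v] by simp
    qed
    show ?thesis by (rule iso_of_universal_\<eta>[OF YX X C.Idn_Hom[OF YX]]) (use 1 2 in blast)+
  qed
  then obtain \<epsilon> where \<epsilon>: "\<And>X. X \<in> Obj A \<Longrightarrow> is_iso A (wo (Yo X)) X (\<epsilon> X)"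
    and \<epsilon>\<eta>: "\<And>X. X \<in> Obj A \<Longrightarrow> Ya (\<epsilon> X) \<bullet> \<eta> (Yo X) = Idn C (Yo X)" by metis
  have \<epsilon>H: "\<epsilon> X \<in> Hom A (wo (Yo X)) X" if "X \<in> Obj A" for X using \<epsilon>[OF that] by (auto simp: is_iso_def)
  have "\<exists>v. is_iso C (Ro (Yo X)) (To X) v \<and> v \<bullet> r (Yo X) = p X" if X: "X \<in> Obj A" for X
    using iso_of_universal_r[OF Yo_Obj[OF X] To_D[OF X] p_Hom[OF X] _ p_epi[OF X]] p_lift X by metis
  then obtain \<tau> where \<tau>: "\<And>X. X \<in> Obj A \<Longrightarrow> is_iso C (Ro (Yo X)) (To X) (\<tau> X)"
    and \<tau>r: "\<And>X. X \<in> Obj A \<Longrightarrow> \<tau> X \<bullet> r (Yo X) = p X" by metis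
  have \<tau>H: "\<tau> X \<in> Hom C (Ro (Yo X)) (To X)" if "X \<in> Obj A" for X using \<tau>[OF that] by (auto simp: is_iso_def)
  define \<nu> where "\<nu> X = (FO glue (Yo X), (\<epsilon> X, \<tau> X), FO (j_lower MV) X)" for X
  show ?thesis
  proof (rule nat_isomorphicI[OF A.category_axioms, of _ _ _ \<nu>])
    fix X assume X: "X \<in> Obj A"
    note YX = Yo_Obj[OF X] and pX = p_Hom[OF X]
    note wY = wo_Obj[OF YX] and rY = r_Hom[OF YX] and \<eta>Y = \<eta>_Hom[OF YX] and gY = g_Hom[OF YX]
    have "FO (j_lower MV) X \<in> Obj M" using X To_D[OF X] To_Obj[OF X] by (simp add: MV_simps M_Obj C.Idn_Hom)
    moreover have "Ta (\<epsilon> X) \<bullet> g (Yo X) = Idn C (To X) \<bullet> \<tau> X"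
    proof -
      have "(Ta (\<epsilon> X) \<bullet> g (Yo X)) \<bullet> r (Yo X) = Ta (\<epsilon> X) \<bullet> p (wo (Yo X)) \<bullet> \<eta> (Yo X)"
        using g_r[OF YX] T_Hom[OF \<epsilon>H[OF X]] gY rY by (simp add: C.Hom_iff)
      also have "\<dots> = p X \<bullet> Ya (\<epsilon> X) \<bullet> \<eta> (Yo X)"
        using C.Cmp_swap[OF p_nat[OF \<epsilon>H[OF X]] p_Hom[OF wY] T_Hom[OF \<epsilon>H[OF X]] Y_Hom[OF \<epsilon>H[OF X]] pX \<eta>Y] .
      also have "\<dots> = p X" using \<epsilon>\<eta>[OF X] pX by (simp add: C.Hom_iff)
      also have "\<dots> = \<tau> X \<bullet> r (Yo X)" using \<tau>r[OF X] by simp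
      finally have "Ta (\<epsilon> X) \<bullet> g (Yo X) = \<tau> X"
        using r_unique[OF YX To_D[OF X] C.Cmp_Hom[OF gY T_Hom[OF \<epsilon>H[OF X]]] \<tau>H[OF X]] by blast
      then show ?thesis using \<tau>H[OF X] by (simp add: C.Hom_iff)
    qed
    ultimately show "is_iso M (FO (glue \<circ>\<^sub>F Y) X) (FO (j_lower MV \<circ>\<^sub>F id_functor) X) (\<nu> X)"
      using M_iso[OF glue_Obj[OF YX, unfolded glue_FO] _ \<epsilon>[OF X] \<tau>[OF X]] by (simp add: \<nu>_def glue_FO MV_simps)
  next
    fix X X' x assume x: "x \<in> Hom A X X'"
    have X: "X \<in> Obj A" "X' \<in> Obj A" using A.HomD[OF x] by auto
    note YX = Yo_Obj[OF X(1)] and YX' = Yo_Obj[OF X(2)] and Yx = Y_Hom[OF x]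
    note \<eta>Y = \<eta>_Hom[OF YX] and \<eta>Y' = \<eta>_Hom[OF YX'] and rY = r_Hom[OF YX] and rY' = r_Hom[OF YX']
    note wYx = wa_Hom[OF Yx] and RYx = Ra_Hom[OF Yx] and Tx = T_Hom[OF x]
    note \<epsilon>X = \<epsilon>H[OF X(1)] and \<epsilon>X' = \<epsilon>H[OF X(2)] and \<tau>X = \<tau>H[OF X(1)] and \<tau>X' = \<tau>H[OF X(2)]
    have "Ya (\<epsilon> X' \<cdot> wa (Ya x)) \<bullet> \<eta> (Yo X) = Ya (\<epsilon> X') \<bullet> \<eta> (Yo X') \<bullet> Ya x"
      using \<eta>_nat[OF Yx] \<epsilon>X' wYx \<eta>Y by (simp add: Hom_iffs)
    also have "\<dots> = Ya x" using C.Cmp_push[OF \<epsilon>\<eta>[OF X(2)] \<eta>Y' Y_Hom[OF \<epsilon>X'] Yx] Yx by (simp add: C.Hom_iff)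
    also have "\<dots> = Ya (x \<cdot> \<epsilon> X) \<bullet> \<eta> (Yo X)" using \<epsilon>\<eta>[OF X(1)] x \<epsilon>X \<eta>Y by (simp add: Hom_iffs)
    finally have 1: "\<epsilon> X' \<cdot> wa (Ya x) = x \<cdot> \<epsilon> X"
      using \<eta>_unique[OF YX A.Cmp_Hom[OF wYx \<epsilon>X'] A.Cmp_Hom[OF \<epsilon>X x]] by blast
    have "(\<tau> X' \<bullet> Ra (Ya x)) \<bullet> r (Yo X) = \<tau> X' \<bullet> r (Yo X') \<bullet> Ya x"
      using r_nat[OF Yx] \<tau>X' RYx rY by (simp add: C.Hom_iff)
    also have "\<dots> = p X' \<bullet> Ya x" using C.Cmp_push[OF \<tau>r[OF X(2)] rY' \<tau>X' Yx] .
    also have "\<dots> = (Ta x \<bullet> \<tau> X) \<bullet> r (Yo X)" using p_nat[OF x] \<tau>r[OF X(1)] Tx \<tau>X rY by (simp add: C.Hom_iff)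
    finally have 2: "\<tau> X' \<bullet> Ra (Ya x) = Ta x \<bullet> \<tau> X"
      using r_unique[OF YX To_D[OF X(2)] C.Cmp_Hom[OF RYx \<tau>X'] C.Cmp_Hom[OF \<tau>X Tx]] by blast
    show "Cmp M (\<nu> X') (FA (glue \<circ>\<^sub>F Y) x) = Cmp M (FA (j_lower MV \<circ>\<^sub>F id_functor) x) (\<nu> X)"
      using A.HomD[OF x] 1 2 by (simp add: \<nu>_def glue_FA[OF Yx] MV_simps)
  qed
qed

theorem hereditary_mv:
  assumes her: "hereditary A"
    and Q: "sub Q = D" "mid Q = C" "quo Q = A" "i_lower Q = id_functor" "i_upper Q = R" "i_ushriek Q = S"
      "j_upper Q = w" "j_lshriek Q = l" "j_lower Q = Y"
  shows "is_mv_for Q D A (zero_functor D) T (zero_trans D T)"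
proof -
  have MV: "sub MV = D" "mid MV = M" "quo MV = A" by (simp_all add: mv_recoll_def Let_def)
  have "recoll_equiv Q MV"
    unfolding recoll_equiv_def Q MV
    using equivalence_id[OF D_category] glue_equivalence[OF her] equivalence_id[OF A.category_axioms]
      glue_i_lower glue_i_upper glue_i_ushriek[OF her] glue_j_upper glue_j_lshriek glue_j_lower by blast
  then show ?thesis
    using D_abelian A.abelian_axioms zero_functor_D T_left_exact[OF her] zero_trans_nat
    by (simp add: is_mv_for_def mv_data_def)
qed

theorem mv_hereditary:
  assumes mv: "is_mv_for Q D' D'' F G \<alpha>"
    and Q: "sub Q = D" "mid Q = C" "quo Q = A" "i_ushriek Q = S" "j_lshriek Q = l" "j_lower Q = Y"
  shows "hereditary A"
proof (rule hereditary_of_torsion_free)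
  fix X V a assume X: "X \<in> Obj A" and V: "V \<in> Obj D" and a: "a \<in> Hom C V (lo X)"
  have "is_zero D (So (lo X))"
    using mv_torsion_free[OF mv, of X] X C.category_axioms D_preadditive l_functor S_functor Y_projective[OF X]
    by (simp add: Q)
  then have Z: "is_zero D (So (lo X))" .
  have lX: "lo X \<in> Obj C" using C.HomD[OF a] by simp
  obtain u where u: "u \<in> Hom C V (So (lo X))" "s (lo X) \<bullet> u = a" using s_lift[OF V a] .
  have "u = Nul C V (So (lo X))"
    using preadditive.to_zero[OF D_preadditive Z, of u V] u(1) Hom_D[OF V So_D[OF lX]] by simp
  then show "a = Nul C V (lo X)" using u s_Hom[OF lX] V D_Obj by (auto simp: C.Hom_iff)
qed

end

section \<open>Presheaves of abelian groups\<close>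

lemma op_cat_simps [simp]:
  "Obj (op_cat A) = Obj A" "Arr (op_cat A) = Arr A" "Dom (op_cat A) = Cod A" "Cod (op_cat A) = Dom A"
  "Idn (op_cat A) = Idn A" "Cmp (op_cat A) g f = Cmp A f g"
  by (simp_all add: op_cat_def)

lemma ab_fun_simp [simp]: "ab_fun (G, h, H) = h"
  by (simp add: ab_fun_def)

lemma Ab_simps [simp]:
  "Obj Ab = {G. comm_group G}" "Dom Ab (G, h, H) = G" "Cod Ab (G, h, H) = H"
  "Idn Ab G = (G, \<lambda>x \<in> carrier G. x, G)"
  "Cmp Ab (H', k, K) (G, h, H) = (G, \<lambda>x \<in> carrier G. k (h x), K)"
  "Nul Ab G H = (G, \<lambda>x \<in> carrier G. \<one>\<^bsub>H\<^esub>, H)"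
  by (simp_all add: Ab_def)

lemma Hom_Ab:
  "a \<in> Hom Ab G H \<longleftrightarrow> (\<exists>h. a = (G, h, H) \<and> comm_group G \<and> comm_group H \<and> h \<in> hom G H \<and> h \<in> extensional (carrier G))"
  by (auto simp: Hom_def Ab_def)

lemma Cmp_Ab:
  "a \<in> Hom Ab G H \<Longrightarrow> b \<in> Hom Ab H K \<Longrightarrow> Cmp Ab b a = (G, \<lambda>x \<in> carrier G. ab_fun b (ab_fun a x), K)"
  by (auto simp: Hom_Ab)

text \<open>The elements of a presheaf are written as functions: \<open>el F X\<close> is the group at \<open>X\<close>, \<open>res F u\<close> the restriction
  along \<open>u\<close> and \<open>cp \<phi> X\<close> the component at \<open>X\<close> of a transformation.\<close>

abbreviation el :: "('o, 'm) psh \<Rightarrow> 'o \<Rightarrow> 'm set set" where "el F X \<equiv> carrier (FO F X)"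
abbreviation res :: "('o, 'm) psh \<Rightarrow> 'm \<Rightarrow> 'm set \<Rightarrow> 'm set" where "res F u \<equiv> ab_fun (FA F u)"
abbreviation cp :: "('o \<Rightarrow> 'm set ab_arr) \<Rightarrow> 'o \<Rightarrow> 'm set \<Rightarrow> 'm set" where "cp \<phi> X \<equiv> ab_fun (\<phi> X)"

lemma psh_cat_simps [simp]:
  "Dom (psh_cat A) (F, \<phi>, G) = F" "Cod (psh_cat A) (F, \<phi>, G) = G"
  "Cmp (psh_cat A) (G', \<psi>, H) (F, \<phi>, G) = (F, \<lambda>X \<in> Obj A. Cmp Ab (\<psi> X) (\<phi> X), H)"
  "Nul (psh_cat A) F G = (F, \<lambda>X \<in> Obj A. Nul Ab (FO F X) (FO G X), G)"
  by (simp_all add: psh_cat_def functor_cat_def Let_def)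

lemma psh_Obj:
  "F \<in> Obj (psh_cat A) \<longleftrightarrow> is_functor (op_cat A) Ab F \<and> FO F \<in> extensional (Obj A) \<and> FA F \<in> extensional (Arr A)"
  by (simp add: psh_cat_def functor_cat_def)

lemma psh_Arr:
  "(F, \<phi>, G) \<in> Arr (psh_cat A) \<longleftrightarrow> F \<in> Obj (psh_cat A) \<and> G \<in> Obj (psh_cat A) \<and>
    nat_trans (op_cat A) Ab F G \<phi> \<and> \<phi> \<in> extensional (Obj A)"
  by (auto simp: psh_cat_def functor_cat_def)

lemma psh_Hom: "a \<in> Hom (psh_cat A) F G \<longleftrightarrow> (\<exists>\<phi>. a = (F, \<phi>, G) \<and> (F, \<phi>, G) \<in> Arr (psh_cat A))"
  by (cases a) (auto simp: Hom_def)

locale presheaf = abelian A for A :: "('o, 'm) cat"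
begin

abbreviation cmpA (infixr "\<cdot>" 70) where "g \<cdot> f \<equiv> Cmp A g f"

lemma psh_group: "F \<in> Obj (psh_cat A) \<Longrightarrow> X \<in> Obj A \<Longrightarrow> comm_group (FO F X)"
  by (simp add: psh_Obj is_functor_def)

lemma res_Hom: "F \<in> Obj (psh_cat A) \<Longrightarrow> u \<in> Hom A X X' \<Longrightarrow> FA F u \<in> Hom Ab (FO F X') (FO F X)"
  by (auto simp: psh_Obj is_functor_def Hom_def)

lemma res_hom: "F \<in> Obj (psh_cat A) \<Longrightarrow> u \<in> Hom A X X' \<Longrightarrow> res F u \<in> hom (FO F X') (FO F X)"
  using res_Hom[of F u X X'] by (auto simp: Hom_Ab)

lemma res_closed: "F \<in> Obj (psh_cat A) \<Longrightarrow> u \<in> Hom A X X' \<Longrightarrow> x \<in> el F X' \<Longrightarrow> res F u x \<in> el F X"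
  by (rule hom_in_carrier[OF res_hom])

lemma cp_Hom: "(F, \<phi>, G) \<in> Arr (psh_cat A) \<Longrightarrow> X \<in> Obj A \<Longrightarrow> \<phi> X \<in> Hom Ab (FO F X) (FO G X)"
  by (simp add: psh_Arr nat_trans_def)

lemma cp_hom: "(F, \<phi>, G) \<in> Arr (psh_cat A) \<Longrightarrow> X \<in> Obj A \<Longrightarrow> cp \<phi> X \<in> hom (FO F X) (FO G X)"
  using cp_Hom[of F \<phi> G X] by (auto simp: Hom_Ab)

lemma cp_closed: "(F, \<phi>, G) \<in> Arr (psh_cat A) \<Longrightarrow> X \<in> Obj A \<Longrightarrow> x \<in> el F X \<Longrightarrow> cp \<phi> X x \<in> el G X"
  by (rule hom_in_carrier[OF cp_hom])

lemma cp_res: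
  assumes \<phi>: "(F, \<phi>, G) \<in> Arr (psh_cat A)" and u: "u \<in> Hom A X X'" and x: "x \<in> el F X'"
  shows "cp \<phi> X (res F u x) = res G u (cp \<phi> X' x)"
proof -
  have o: "F \<in> Obj (psh_cat A)" "G \<in> Obj (psh_cat A)" using \<phi> by (auto simp: psh_Arr)
  have X: "X \<in> Obj A" "X' \<in> Obj A" using HomD[OF u] by auto
  have "Cmp Ab (\<phi> X) (FA F u) = Cmp Ab (FA G u) (\<phi> X')"
    using \<phi> HomD[OF u] by (auto simp: psh_Arr nat_trans_def)
  then show ?thesis
    using x unfolding Cmp_Ab[OF res_Hom[OF o(1) u] cp_Hom[OF \<phi> X(1)]] Cmp_Ab[OF cp_Hom[OF \<phi> X(2)] res_Hom[OF o(2) u]]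
    by (auto dest: fun_cong[where x = x])
qed

lemma psh_arr_eqI:
  assumes \<phi>: "(F, \<phi>, G) \<in> Arr (psh_cat A)" and \<psi>: "(F, \<psi>, G) \<in> Arr (psh_cat A)"
    and eq: "\<And>X x. X \<in> Obj A \<Longrightarrow> x \<in> el F X \<Longrightarrow> cp \<phi> X x = cp \<psi> X x"
  shows "\<phi> = \<psi>"
proof (rule extensionalityI[of _ "Obj A"])
  show "\<phi> \<in> extensional (Obj A)" "\<psi> \<in> extensional (Obj A)" using \<phi> \<psi> by (auto simp: psh_Arr)
  fix X assume X: "X \<in> Obj A"
  obtain h where h: "\<phi> X = (FO F X, h, FO G X)" "h \<in> extensional (el F X)" using cp_Hom[OF \<phi> X] by (auto simp: Hom_Ab)
  obtain k where k: "\<psi> X = (FO F X, k, FO G X)" "k \<in> extensional (el F X)" using cp_Hom[OF \<psi> X] by (auto simp: Hom_Ab)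
  have "h = k" using extensionalityI[OF h(2) k(2)] eq[OF X] by (simp add: h(1) k(1))
  then show "\<phi> X = \<psi> X" using h(1) k(1) by simp
qed

text \<open>Components are restricted to the elements of the source, as extensionality requires.\<close>

definition mk_arr :: "('o, 'm) psh \<Rightarrow> ('o \<Rightarrow> 'm set \<Rightarrow> 'm set) \<Rightarrow> ('o, 'm) psh \<Rightarrow> 'o \<Rightarrow> 'm set ab_arr" where
  "mk_arr F h G = (\<lambda>X \<in> Obj A. (FO F X, restrict (h X) (el F X), FO G X))"

lemma cp_mk_arr [simp]: "X \<in> Obj A \<Longrightarrow> x \<in> el F X \<Longrightarrow> cp (mk_arr F h G) X x = h X x"
  by (simp add: mk_arr_def)

lemma mk_arr:
  assumes F: "F \<in> Obj (psh_cat A)" and G: "G \<in> Obj (psh_cat A)"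
    and h: "\<And>X. X \<in> Obj A \<Longrightarrow> h X \<in> hom (FO F X) (FO G X)"
    and nat: "\<And>X X' u x. u \<in> Hom A X X' \<Longrightarrow> x \<in> el F X' \<Longrightarrow> h X (res F u x) = res G u (h X' x)"
  shows "(F, mk_arr F h G, G) \<in> Arr (psh_cat A)"
proof -
  have c: "mk_arr F h G X \<in> Hom Ab (FO F X) (FO G X)" if X: "X \<in> Obj A" for X
    using h[OF X] psh_group[OF F X] psh_group[OF G X] X
    by (auto simp: Hom_Ab mk_arr_def hom_def group.is_monoid monoid.m_closed comm_group.axioms
        intro!: monoid.m_closed comm_monoid.axioms)
  have "Cmp Ab (mk_arr F h G (Dom A u)) (FA F u) = Cmp Ab (FA G u) (mk_arr F h G (Cod A u))" if "u \<in> Arr A" for u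
  proof -
    note u = Arr_Hom[OF that]
    have X: "Dom A u \<in> Obj A" "Cod A u \<in> Obj A" using HomD[OF u] by auto
    have "(\<lambda>x\<in>el F (Cod A u). cp (mk_arr F h G) (Dom A u) (res F u x)) =
        (\<lambda>x\<in>el F (Cod A u). res G u (cp (mk_arr F h G) (Cod A u) x))"
      using nat[OF u] res_closed[OF F u] X by (intro restrict_ext) simp
    then show ?thesis
      unfolding Cmp_Ab[OF res_Hom[OF F u] c[OF X(1)]] Cmp_Ab[OF c[OF X(2)] res_Hom[OF G u]] by simp
  qed
  then show ?thesis using F G c by (simp add: psh_Arr nat_trans_def) (simp add: mk_arr_def)
qed

lemma cp_Cmp:
  assumes "(F, \<phi>, G) \<in> Arr (psh_cat A)" "(G, \<psi>, H) \<in> Arr (psh_cat A)" "X \<in> Obj A" "x \<in> el F X"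
  shows "ab_fun (fst (snd (Cmp (psh_cat A) (G, \<psi>, H) (F, \<phi>, G))) X) x = cp \<psi> X (cp \<phi> X x)"
  using assms Cmp_Ab[OF cp_Hom[OF assms(1,3)] cp_Hom[OF assms(2,3)]] by simp

lemma psh_Cmp_iff:
  assumes \<phi>: "(F, \<phi>, G) \<in> Arr (psh_cat A)" and \<psi>: "(G, \<psi>, H) \<in> Arr (psh_cat A)"
    and \<chi>: "(F, \<chi>, H) \<in> Arr (psh_cat A)"
  shows "Cmp (psh_cat A) (G, \<psi>, H) (F, \<phi>, G) = (F, \<chi>, H) \<longleftrightarrow>
    (\<forall>X \<in> Obj A. \<forall>x \<in> el F X. cp \<psi> X (cp \<phi> X x) = cp \<chi> X x)"
proof
  assume "Cmp (psh_cat A) (G, \<psi>, H) (F, \<phi>, G) = (F, \<chi>, H)"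
  then have "fst (snd (Cmp (psh_cat A) (G, \<psi>, H) (F, \<phi>, G))) = \<chi>" by simp
  then show "\<forall>X \<in> Obj A. \<forall>x \<in> el F X. cp \<psi> X (cp \<phi> X x) = cp \<chi> X x" using cp_Cmp[OF \<phi> \<psi>] by auto
next
  assume eq: "\<forall>X \<in> Obj A. \<forall>x \<in> el F X. cp \<psi> X (cp \<phi> X x) = cp \<chi> X x"
  have "Cmp Ab (\<psi> X) (\<phi> X) = \<chi> X" if X: "X \<in> Obj A" for X
  proof -
    obtain k where k: "\<chi> X = (FO F X, k, FO H X)" "k \<in> extensional (el F X)" using cp_Hom[OF \<chi> X] by (auto simp: Hom_Ab)
    have "(\<lambda>x\<in>el F X. cp \<psi> X (cp \<phi> X x)) = k"
      using eq X k by (intro extensionalityI[OF restrict_extensional k(2)]) simp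
    then show ?thesis unfolding Cmp_Ab[OF cp_Hom[OF \<phi> X] cp_Hom[OF \<psi> X]] using k(1) by simp
  qed
  moreover have "\<chi> \<in> extensional (Obj A)" using \<chi> by (simp add: psh_Arr)
  ultimately have "(\<lambda>X\<in>Obj A. Cmp Ab (\<psi> X) (\<phi> X)) = \<chi>"
    by (intro extensionalityI[OF restrict_extensional]) simp_all
  then show "Cmp (psh_cat A) (G, \<psi>, H) (F, \<phi>, G) = (F, \<chi>, H)" by simp
qed

lemma fp_simps [simp]:
  "Cmp (fp_cat A) = Cmp (psh_cat A)" "Nul (fp_cat A) = Nul (psh_cat A)" "Dom (fp_cat A) = Dom (psh_cat A)"
  "Cod (fp_cat A) = Cod (psh_cat A)"
  by (simp_all add: fp_cat_def)

lemma fp_Obj: "F \<in> Obj (fp_cat A) \<longleftrightarrow> finitely_presented A F"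
  by (auto simp: fp_cat_def finitely_presented_def)

lemma fp_psh: "finitely_presented A F \<Longrightarrow> F \<in> Obj (psh_cat A)"
  by (simp add: finitely_presented_def)

lemma fp_Hom: "finitely_presented A F \<Longrightarrow> finitely_presented A G \<Longrightarrow> Hom (fp_cat A) F G = Hom (psh_cat A) F G"
  unfolding fp_cat_def by (rule Hom_full_sub) simp_all

definition objectwise_cokernel where
  "objectwise_cokernel E \<phi> G \<psi> F \<longleftrightarrow>
    (E, \<phi>, G) \<in> Arr (psh_cat A) \<and> (G, \<psi>, F) \<in> Arr (psh_cat A) \<and>
    (\<forall>X \<in> Obj A. cp \<phi> X ` el E X = kernel (FO G X) (FO F X) (cp \<psi> X) \<and> cp \<psi> X ` el G X = el F X)"

text \<open>An arrow \<open>\<chi>\<close> killing \<open>\<phi>\<close> is constant on the fibres of the surjection \<open>\<psi>\<close>, so it can be evaluated on arbitrary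
  preimages.\<close>

lemma objectwise_cokernel:
  assumes cok: "objectwise_cokernel E \<phi> G \<psi> F"
    and fp: "finitely_presented A E" "finitely_presented A G" "finitely_presented A F"
  shows "is_cokernel (fp_cat A) (E, \<phi>, G) F (G, \<psi>, F)"
proof -
  have \<phi>: "(E, \<phi>, G) \<in> Arr (psh_cat A)" and \<psi>: "(G, \<psi>, F) \<in> Arr (psh_cat A)"
    and ker: "\<And>X. X \<in> Obj A \<Longrightarrow> cp \<phi> X ` el E X = kernel (FO G X) (FO F X) (cp \<psi> X)"
    and onto: "\<And>X. X \<in> Obj A \<Longrightarrow> cp \<psi> X ` el G X = el F X"
    using cok by (auto simp: objectwise_cokernel_def)
  note EP = fp_psh[OF fp(1)] and GP = fp_psh[OF fp(2)] and FP = fp_psh[OF fp(3)]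
  have \<phi>H: "(E, \<phi>, G) \<in> Hom (fp_cat A) E G" and \<psi>H: "(G, \<psi>, F) \<in> Hom (fp_cat A) G F"
    using \<phi> \<psi> fp by (simp_all add: fp_Hom psh_Hom)
  have z: "Cmp (psh_cat A) (G, \<psi>, F) (E, \<phi>, G) = Nul (psh_cat A) E F"
  proof -
    have "Cmp Ab (\<psi> X) (\<phi> X) = Nul Ab (FO E X) (FO F X)" if X: "X \<in> Obj A" for X
    proof -
      have "cp \<psi> X (cp \<phi> X x) = \<one>\<^bsub>FO F X\<^esub>" if "x \<in> el E X" for x
        using ker[OF X] that by (auto simp: kernel_def)
      then show ?thesis unfolding Cmp_Ab[OF cp_Hom[OF \<phi> X] cp_Hom[OF \<psi> X]] by (auto intro!: restrict_ext)
    qed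
    then show ?thesis by (auto intro!: restrict_ext)
  qed
  have univ: "\<exists>!u. u \<in> Hom (fp_cat A) F W \<and> Cmp (psh_cat A) u (G, \<psi>, F) = a"
    if W: "finitely_presented A W" and a: "a \<in> Hom (fp_cat A) G W" and az: "Cmp (psh_cat A) a (E, \<phi>, G) = Nul (psh_cat A) E W" for W a
  proof -
    note WP = fp_psh[OF W]
    obtain \<chi> where a\<chi>: "a = (G, \<chi>, W)" and \<chi>: "(G, \<chi>, W) \<in> Arr (psh_cat A)"
      using a W fp by (auto simp: fp_Hom psh_Hom)
    have \<chi>\<phi>: "cp \<chi> X (cp \<phi> X x) = \<one>\<^bsub>FO W X\<^esub>" if "X \<in> Obj A" "x \<in> el E X" for X x
    proof -
      have "ab_fun (fst (snd (Cmp (psh_cat A) (G, \<chi>, W) (E, \<phi>, G))) X) x = ab_fun (fst (snd (Nul (psh_cat A) E W)) X) x"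
        using az a\<chi> by simp
      then show ?thesis using cp_Cmp[OF \<phi> \<chi> that] that by simp
    qed
    have wd: "cp \<chi> X y = cp \<chi> X y'"
      if X: "X \<in> Obj A" and y: "y \<in> el G X" "y' \<in> el G X" and eq: "cp \<psi> X y = cp \<psi> X y'" for X y y'
    proof -
      interpret G: comm_group "FO G X" using psh_group[OF GP X] .
      interpret F: comm_group "FO F X" using psh_group[OF FP X] .
      interpret W: comm_group "FO W X" using psh_group[OF WP X] .
      interpret p: group_hom "FO G X" "FO F X" "cp \<psi> X" by unfold_locales (rule cp_hom[OF \<psi> X])
      interpret c: group_hom "FO G X" "FO W X" "cp \<chi> X" by unfold_locales (rule cp_hom[OF \<chi> X])
      have "y \<otimes>\<^bsub>FO G X\<^esub> inv\<^bsub>FO G X\<^esub> y' \<in> kernel (FO G X) (FO F X) (cp \<psi> X)"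
        using y eq by (simp add: kernel_def)
      then obtain x where "x \<in> el E X" "y \<otimes>\<^bsub>FO G X\<^esub> inv\<^bsub>FO G X\<^esub> y' = cp \<phi> X x" using ker[OF X] by auto
      then have "cp \<chi> X (y \<otimes>\<^bsub>FO G X\<^esub> inv\<^bsub>FO G X\<^esub> y') = \<one>\<^bsub>FO W X\<^esub>" using \<chi>\<phi>[OF X] by simp
      then have "cp \<chi> X y \<otimes>\<^bsub>FO W X\<^esub> inv\<^bsub>FO W X\<^esub> (cp \<chi> X y') = \<one>\<^bsub>FO W X\<^esub>" using y by simp
      then show ?thesis using y c.hom_closed by (simp add: W.inv_solve_right')
    qed
    define h where "h X x = cp \<chi> X (inv_into (el G X) (cp \<psi> X) x)" for X x
    have h: "h X (cp \<psi> X y) = cp \<chi> X y" if X: "X \<in> Obj A" and y: "y \<in> el G X" for X y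
      unfolding h_def using y by (intro wd[OF X] inv_into_into f_inv_into_f) auto
    have hh: "h X \<in> hom (FO F X) (FO W X)" if X: "X \<in> Obj A" for X
    proof (rule homI)
      fix x assume "x \<in> el F X"
      then obtain y where "y \<in> el G X" "x = cp \<psi> X y" using onto[OF X] by blast
      then show "h X x \<in> el W X" using h[OF X] cp_closed[OF \<chi> X] by simp
    next
      interpret G: comm_group "FO G X" using psh_group[OF GP X] .
      fix x x' assume x: "x \<in> el F X" "x' \<in> el F X"
      obtain y y' where y: "y \<in> el G X" "x = cp \<psi> X y" "y' \<in> el G X" "x' = cp \<psi> X y'"
        using x unfolding onto[OF X, symmetric] by (elim imageE) simp
      have "x \<otimes>\<^bsub>FO F X\<^esub> x' = cp \<psi> X (y \<otimes>\<^bsub>FO G X\<^esub> y')" using y hom_mult[OF cp_hom[OF \<psi> X]] by simp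
      then show "h X (x \<otimes>\<^bsub>FO F X\<^esub> x') = h X x \<otimes>\<^bsub>FO W X\<^esub> h X x'"
        using y h[OF X] hom_mult[OF cp_hom[OF \<chi> X]] by simp
    qed
    have nat: "h X (res F u x) = res W u (h X' x)" if u: "u \<in> Hom A X X'" and x: "x \<in> el F X'" for X X' u x
    proof -
      have X: "X \<in> Obj A" "X' \<in> Obj A" using HomD[OF u] by auto
      obtain y where y: "y \<in> el G X'" "x = cp \<psi> X' y" using x onto[OF X(2)] by blast
      have "h X (res F u x) = h X (cp \<psi> X (res G u y))" using cp_res[OF \<psi> u y(1)] y(2) by simp
      also have "\<dots> = cp \<chi> X (res G u y)" using h[OF X(1) res_closed[OF GP u y(1)]] .
      also have "\<dots> = res W u (h X' x)" using cp_res[OF \<chi> u y(1)] h[OF X(2) y(1)] y(2) by simp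
      finally show ?thesis .
    qed
    have m: "(F, mk_arr F h W, W) \<in> Arr (psh_cat A)" using mk_arr[OF FP WP hh nat] .
    have cpm: "cp (mk_arr F h W) X (cp \<psi> X y) = cp \<chi> X y" if "X \<in> Obj A" "y \<in> el G X" for X y
      using h[OF that] cp_closed[OF \<psi> that] that by simp
    note Cmp_iff = psh_Cmp_iff[OF \<psi> _ \<chi>, folded a\<chi>]
    show ?thesis
    proof (intro ex1I[of _ "(F, mk_arr F h W, W)"] conjI)
      show "(F, mk_arr F h W, W) \<in> Hom (fp_cat A) F W" using m W fp by (simp add: fp_Hom psh_Hom)
      show "Cmp (psh_cat A) (F, mk_arr F h W, W) (G, \<psi>, F) = a" using Cmp_iff[OF m] cpm by blast
    next
      fix u assume u: "u \<in> Hom (fp_cat A) F W \<and> Cmp (psh_cat A) u (G, \<psi>, F) = a"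
      obtain \<mu> where \<mu>: "u = (F, \<mu>, W)" "(F, \<mu>, W) \<in> Arr (psh_cat A)" using u W fp by (auto simp: fp_Hom psh_Hom)
      have "\<mu> = mk_arr F h W"
      proof (rule psh_arr_eqI[OF \<mu>(2) m])
        fix X x assume X: "X \<in> Obj A" and "x \<in> el F X"
        then obtain y where "y \<in> el G X" "x = cp \<psi> X y" using onto[OF X] by blast
        then show "cp \<mu> X x = cp (mk_arr F h W) X x" using Cmp_iff[OF \<mu>(2)] u \<mu>(1) cpm[OF X] X by auto
      qed
      then show "u = (F, mk_arr F h W, W)" using \<mu>(1) by simp
    qed
  qed
  have "(E, \<phi>, G) \<in> Arr (fp_cat A)" using \<phi>H by (simp add: Hom_def)
  then show ?thesis
    unfolding is_cokernel_def using fp \<psi>H z univ by (simp add: fp_Obj)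
qed

section \<open>Quotients of representable presheaves\<close>

text \<open>The condition on \<open>N\<close> under which \<open>quot_rep A N Y\<close> is a presheaf; it concerns only the values \<open>N X Y\<close> at the fixed
  \<open>Y\<close>.\<close>

definition right_ideal :: "('o \<Rightarrow> 'o \<Rightarrow> 'm set) \<Rightarrow> 'o \<Rightarrow> bool" where
  "right_ideal N Y \<longleftrightarrow> Y \<in> Obj A \<and> (\<forall>X \<in> Obj A. subgroup (N X Y) (hom_group A X Y)) \<and>
     (\<forall>X X' u. \<forall>g \<in> N X' Y. u \<in> Hom A X X' \<longrightarrow> g \<cdot> u \<in> N X Y)"

definition cls :: "('o \<Rightarrow> 'o \<Rightarrow> 'm set) \<Rightarrow> 'o \<Rightarrow> 'o \<Rightarrow> 'm \<Rightarrow> 'm set" where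
  "cls N X Y g = N X Y #>\<^bsub>hom_group A X Y\<^esub> g"

lemma hom_group_simps [simp]:
  "carrier (hom_group A X Y) = Hom A X Y" "mult (hom_group A X Y) = Pls A" "one (hom_group A X Y) = Nul A X Y"
  by (simp_all add: hom_group_def)

context
  fixes N :: "'o \<Rightarrow> 'o \<Rightarrow> 'm set" and Y :: 'o
  assumes N: "right_ideal N Y"
begin

lemma N_subgroup: "X \<in> Obj A \<Longrightarrow> subgroup (N X Y) (hom_group A X Y)"
  and N_Cmp: "g \<in> N X' Y \<Longrightarrow> u \<in> Hom A X X' \<Longrightarrow> g \<cdot> u \<in> N X Y"
  and N_Obj: "Y \<in> Obj A"
  using N by (auto simp: right_ideal_def)

lemma N_Hom: "X \<in> Obj A \<Longrightarrow> g \<in> N X Y \<Longrightarrow> g \<in> Hom A X Y"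
  using subgroup.subset[OF N_subgroup] by auto

lemma cls_eq:
  assumes g: "g \<in> Hom A X Y" and g': "g' \<in> cls N X Y g"
  shows "cls N X Y g' = cls N X Y g"
proof -
  have X: "X \<in> Obj A" using HomD[OF g] by simp
  interpret G: comm_group "hom_group A X Y" using hom_comm_group[OF X N_Obj] .
  show ?thesis using G.repr_independence[of g' "N X Y" g] g g' N_subgroup[OF X] by (simp add: cls_def)
qed

lemma cls_self: assumes g: "g \<in> Hom A X Y" shows "g \<in> cls N X Y g"
proof -
  have X: "X \<in> Obj A" using HomD[OF g] by simp
  interpret G: comm_group "hom_group A X Y" using hom_comm_group[OF X N_Obj] .
  show ?thesis using G.rcos_self[of g "N X Y"] g N_subgroup[OF X] by (simp add: cls_def)
qed

lemma cls_mem: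
  assumes g: "g \<in> Hom A X Y" and g': "g' \<in> cls N X Y g"
  obtains n where "n \<in> N X Y" "g' = Pls A n g"
  using assms by (auto simp: cls_def r_coset_def)

lemma cls_Pls: "n \<in> N X Y \<Longrightarrow> Pls A n g \<in> cls N X Y g"
  by (auto simp: cls_def r_coset_def)

lemma cls_eq_one: assumes g: "g \<in> Hom A X Y" shows "cls N X Y g = N X Y \<longleftrightarrow> g \<in> N X Y"
proof -
  have X: "X \<in> Obj A" using HomD[OF g] by simp
  interpret G: comm_group "hom_group A X Y" using hom_comm_group[OF X N_Obj] .
  show ?thesis using G.coset_join1[of "N X Y" g] G.coset_join2[of g "N X Y"] N_subgroup[OF X] g
      subgroup.subset[OF N_subgroup[OF X]] cls_self[OF g] unfolding cls_def by auto
qed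

lemma quot_FO: "X \<in> Obj A \<Longrightarrow> FO (quot_rep A N Y) X = hom_group A X Y Mod N X Y"
  by (simp add: quot_rep_def Let_def)

lemma quot_el: "X \<in> Obj A \<Longrightarrow> el (quot_rep A N Y) X = cls N X Y ` Hom A X Y"
  by (auto simp: quot_FO FactGroup_def RCOSETS_def cls_def)

lemma quot_one: "X \<in> Obj A \<Longrightarrow> \<one>\<^bsub>FO (quot_rep A N Y) X\<^esub> = N X Y"
  by (simp add: quot_FO FactGroup_def)

lemma quot_mult:
  assumes "g \<in> Hom A X Y" "g' \<in> Hom A X Y"
  shows "cls N X Y g \<otimes>\<^bsub>FO (quot_rep A N Y) X\<^esub> cls N X Y g' = cls N X Y (Pls A g g')"
proof -
  have X: "X \<in> Obj A" using HomD[OF assms(1)] by simp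
  interpret G: comm_group "hom_group A X Y" using hom_comm_group[OF X N_Obj] .
  interpret n: normal "N X Y" "hom_group A X Y" using G.subgroup_imp_normal[OF N_subgroup[OF X]] .
  show ?thesis using n.rcos_sum[of g g'] assms X by (simp add: quot_FO FactGroup_def cls_def)
qed

lemma UN_cls:
  assumes g: "g \<in> Hom A X Y" and const: "\<And>g'. g' \<in> cls N X Y g \<Longrightarrow> f g' = f g"
  shows "(\<Union>g' \<in> cls N X Y g. f g') = f g"
  using const cls_self[OF g] by blast

lemma cls_Cmp:
  assumes g: "g \<in> Hom A X' Y" and g': "g' \<in> cls N X' Y g" and u: "u \<in> Hom A X X'"
  shows "cls N X Y (g' \<cdot> u) = cls N X Y (g \<cdot> u)"
proof -
  obtain n where n: "n \<in> N X' Y" "g' = Pls A n g" using cls_mem[OF g g'] .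
  have "X' \<in> Obj A" using HomD[OF u] by simp
  then have "g' \<cdot> u = Pls A (n \<cdot> u) (g \<cdot> u)" using n(2) Cmp_Pls_left[OF u N_Hom[OF _ n(1)] g] by simp
  then show ?thesis using cls_eq[OF Cmp_Hom[OF u g]] cls_Pls[OF N_Cmp[OF n(1) u]] by simp
qed

lemma quot_FA:
  assumes u: "u \<in> Hom A X X'"
  shows "FA (quot_rep A N Y) u = (FO (quot_rep A N Y) X',
    \<lambda>S \<in> el (quot_rep A N Y) X'. \<Union>g \<in> S. cls N X Y (g \<cdot> u), FO (quot_rep A N Y) X)"
  using HomD[OF u] by (simp add: quot_rep_def Let_def cls_def)

lemma quot_res:
  assumes u: "u \<in> Hom A X X'" and g: "g \<in> Hom A X' Y"
  shows "res (quot_rep A N Y) u (cls N X' Y g) = cls N X Y (g \<cdot> u)"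
proof -
  have "cls N X' Y g \<in> el (quot_rep A N Y) X'" using quot_el g HomD[OF u] by blast
  then show ?thesis using quot_FA[OF u] UN_cls[OF g, of "\<lambda>g. cls N X Y (g \<cdot> u)"] cls_Cmp[OF g _ u] by simp
qed

lemma quot_group: assumes "X \<in> Obj A" shows "comm_group (FO (quot_rep A N Y) X)"
  using comm_group.abelian_FactGroup[OF hom_comm_group[OF assms N_Obj] N_subgroup[OF assms]] quot_FO[OF assms] by simp

lemma quot_FA_Hom:
  assumes u: "u \<in> Hom A X X'"
  shows "FA (quot_rep A N Y) u \<in> Hom Ab (FO (quot_rep A N Y) X') (FO (quot_rep A N Y) X)"
proof -
  have X: "X \<in> Obj A" "X' \<in> Obj A" using HomD[OF u] by auto
  have "res (quot_rep A N Y) u \<in> hom (FO (quot_rep A N Y) X') (FO (quot_rep A N Y) X)"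
  proof (rule homI)
    fix S assume "S \<in> el (quot_rep A N Y) X'"
    then obtain g where "g \<in> Hom A X' Y" "S = cls N X' Y g" using quot_el[OF X(2)] by blast
    then show "res (quot_rep A N Y) u S \<in> el (quot_rep A N Y) X" using quot_res[OF u] quot_el[OF X(1)] Cmp_Hom[OF u] by auto
  next
    fix S S' assume S: "S \<in> el (quot_rep A N Y) X'" "S' \<in> el (quot_rep A N Y) X'"
    obtain g g' where g: "g \<in> Hom A X' Y" "S = cls N X' Y g" "g' \<in> Hom A X' Y" "S' = cls N X' Y g'"
      using S unfolding quot_el[OF X(2)] by (elim imageE) simp
    then show "res (quot_rep A N Y) u (S \<otimes>\<^bsub>FO (quot_rep A N Y) X'\<^esub> S') =
        res (quot_rep A N Y) u S \<otimes>\<^bsub>FO (quot_rep A N Y) X\<^esub> res (quot_rep A N Y) u S'"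
      using quot_mult[OF g(1,3)] quot_mult[OF Cmp_Hom[OF u g(1)] Cmp_Hom[OF u g(3)]]
        quot_res[OF u g(1)] quot_res[OF u g(3)] quot_res[OF u Pls_Hom[OF g(1,3)]] Cmp_Pls_left[OF u g(1,3)] by simp
  qed
  then show ?thesis using quot_FA[OF u] quot_group X by (simp add: Hom_Ab)
qed

lemma quot_psh: "quot_rep A N Y \<in> Obj (psh_cat A)"
  unfolding psh_Obj
proof (intro conjI)
  show "FO (quot_rep A N Y) \<in> extensional (Obj A)" "FA (quot_rep A N Y) \<in> extensional (Arr A)"
    by (simp_all add: quot_rep_def Let_def)
  show "is_functor (op_cat A) Ab (quot_rep A N Y)"
    unfolding is_functor_def
  proof (intro conjI ballI impI)
    fix X assume "X \<in> Obj (op_cat A)"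
    then have X: "X \<in> Obj A" by simp
    show "FO (quot_rep A N Y) X \<in> Obj Ab" using quot_group[OF X] by simp
    obtain h where h: "FA (quot_rep A N Y) (Idn A X) = (FO (quot_rep A N Y) X, h, FO (quot_rep A N Y) X)"
      "h \<in> extensional (el (quot_rep A N Y) X)"
      using quot_FA_Hom[OF Idn_Hom[OF X]] by (auto simp: Hom_Ab)
    have "h = (\<lambda>x \<in> el (quot_rep A N Y) X. x)"
    proof (rule extensionalityI[OF h(2) restrict_extensional])
      fix x assume x: "x \<in> el (quot_rep A N Y) X"
      then obtain g where g: "g \<in> Hom A X Y" "x = cls N X Y g" using quot_el[OF X] by blast
      then show "h x = (\<lambda>x \<in> el (quot_rep A N Y) X. x) x"
        using quot_res[OF Idn_Hom[OF X] g(1)] h(1) x g by (simp add: Hom_iff)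
    qed
    then show "FA (quot_rep A N Y) (Idn (op_cat A) X) = Idn Ab (FO (quot_rep A N Y) X)" using h(1) by simp
  next
    fix u assume "u \<in> Arr (op_cat A)"
    then have "u \<in> Hom A (Dom A u) (Cod A u)" using Arr_Hom by simp
    then show "FA (quot_rep A N Y) u \<in> Hom Ab (FO (quot_rep A N Y) (Dom (op_cat A) u)) (FO (quot_rep A N Y) (Cod (op_cat A) u))"
      using quot_FA_Hom by simp
  next
    fix f h assume "f \<in> Arr (op_cat A)" "h \<in> Arr (op_cat A)" "Dom (op_cat A) h = Cod (op_cat A) f"
    then obtain X X' X'' where f: "f \<in> Hom A X' X''" and h: "h \<in> Hom A X X'" by (auto simp: Hom_def)
    have X: "X \<in> Obj A" "X' \<in> Obj A" "X'' \<in> Obj A" using HomD[OF f] HomD[OF h] by auto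
    note fh = Cmp_Hom[OF h f]
    let ?Q = "quot_rep A N Y"
    obtain k where k: "FA ?Q (f \<cdot> h) = (FO ?Q X'', k, FO ?Q X)" "k \<in> extensional (el ?Q X'')"
      using quot_FA_Hom[OF fh] by (auto simp: Hom_Ab)
    have "k = (\<lambda>x \<in> el ?Q X''. res ?Q h (res ?Q f x))"
    proof (rule extensionalityI[OF k(2) restrict_extensional])
      fix x assume x: "x \<in> el ?Q X''"
      then obtain g where g: "g \<in> Hom A X'' Y" "x = cls N X'' Y g" using quot_el[OF X(3)] by blast
      have "k x = cls N X Y (g \<cdot> f \<cdot> h)" using quot_res[OF fh g(1)] k(1) g(2) by simp
      also have "\<dots> = res ?Q h (res ?Q f x)"
        using quot_res[OF f g(1)] quot_res[OF h Cmp_Hom[OF f g(1)]] g f h by (simp add: Hom_iff)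
      finally show "k x = (\<lambda>x \<in> el ?Q X''. res ?Q h (res ?Q f x)) x" using x by simp
    qed
    then show "FA ?Q (Cmp (op_cat A) h f) = Cmp Ab (FA ?Q h) (FA ?Q f)"
      using Cmp_Ab[OF quot_FA_Hom[OF f] quot_FA_Hom[OF h]] k(1) by simp
  qed
qed

end

end

context presheaf
begin

text \<open>The right ideal of arrows factoring through \<open>f\<close>. Representables themselves (with \<open>f\<close> zero), cokernels of arrows
  between representables, and stable representables (with \<open>f\<close> a projective cover) are all quotients by principal
  ideals.\<close>

definition principal :: "('o \<Rightarrow> 'o \<Rightarrow> 'm set) \<Rightarrow> 'o \<Rightarrow> 'm \<Rightarrow> 'o \<Rightarrow> bool" where
  "principal N B f Y \<longleftrightarrow> f \<in> Hom A B Y \<and> (\<forall>X \<in> Obj A. N X Y = (\<lambda>h. f \<cdot> h) ` Hom A X B)"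

lemma principalD:
  assumes "principal N B f Y"
  shows "f \<in> Hom A B Y" "X \<in> Obj A \<Longrightarrow> N X Y = (\<lambda>h. f \<cdot> h) ` Hom A X B"
  using assms by (auto simp: principal_def)

lemma principal_right_ideal:
  assumes pr: "principal N B f Y"
  shows "right_ideal N Y"
  unfolding right_ideal_def
proof (intro conjI ballI allI impI)
  note f = principalD(1)[OF pr] and N = principalD(2)[OF pr]
  have BY: "B \<in> Obj A" "Y \<in> Obj A" using HomD[OF f] by auto
  show "Y \<in> Obj A" by fact
  fix X assume X: "X \<in> Obj A"
  interpret G: comm_group "hom_group A X B" using hom_comm_group[OF X BY(1)] .
  interpret H: comm_group "hom_group A X Y" using hom_comm_group[OF X BY(2)] .
  have "(\<lambda>h. f \<cdot> h) \<in> hom (hom_group A X B) (hom_group A X Y)"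
    using Cmp_Hom[OF _ f] Cmp_Pls_right[OF _ _ f] by (intro homI) simp_all
  then interpret p: group_hom "hom_group A X B" "hom_group A X Y" "\<lambda>h. f \<cdot> h" by unfold_locales
  show "subgroup (N X Y) (hom_group A X Y)" using p.img_is_subgroup N[OF X] by simp
next
  note f = principalD(1)[OF pr] and N = principalD(2)[OF pr]
  fix X X' u g assume g: "g \<in> N X' Y" and u: "u \<in> Hom A X X'"
  obtain h where h: "h \<in> Hom A X' B" "g = f \<cdot> h" using g N HomD(5)[OF u] by blast
  then have "g \<cdot> u = f \<cdot> h \<cdot> u" using f u by (simp add: Hom_iff)
  then show "g \<cdot> u \<in> N X Y" using Cmp_Hom[OF u h(1)] N HomD(4)[OF u] by blast
qed

definition zero_ideal :: "'o \<Rightarrow> 'o \<Rightarrow> 'm set" where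
  "zero_ideal X Y = {Nul A X Y}"

lemma yoneda_eq: "yoneda A = quot_yoneda A zero_ideal"
  by (simp add: yoneda_def zero_ideal_def[abs_def])

lemma zero_principal:
  assumes Z: "is_zero A Z" and Y: "Y \<in> Obj A"
  shows "principal zero_ideal Z (Nul A Z Y) Y"
  unfolding principal_def
proof (intro conjI ballI)
  have Zo: "Z \<in> Obj A" using is_zero_Obj[OF Z] .
  show "Nul A Z Y \<in> Hom A Z Y" using Nul_Hom[OF Zo Y] .
  fix X assume X: "X \<in> Obj A"
  have "Nul A Z Y \<cdot> h = Nul A X Y" if "h \<in> Hom A X Z" for h using that Y by (simp add: Hom_iff)
  then show "zero_ideal X Y = (\<lambda>h. Nul A Z Y \<cdot> h) ` Hom A X Z"
    using Nul_Hom[OF X Zo] unfolding zero_ideal_def by force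
qed

lemma zero_right_ideal: "Y \<in> Obj A \<Longrightarrow> right_ideal zero_ideal Y"
  using has_zero zero_principal principal_right_ideal by blast

lemma cls_zero: "g \<in> Hom A X Y \<Longrightarrow> cls zero_ideal X Y g = {g}"
  by (simp add: cls_def zero_ideal_def r_coset_def Hom_iff)

abbreviation "Yo \<equiv> FO (yoneda A)"

lemma Yo_eq: "Yo Y = quot_rep A zero_ideal Y"
  by (simp add: yoneda_eq quot_yoneda_def)

lemma Yo_psh: "Y \<in> Obj A \<Longrightarrow> Yo Y \<in> Obj (psh_cat A)"
  unfolding Yo_eq by (rule quot_psh[OF zero_right_ideal])

lemma Yo_el: "Y \<in> Obj A \<Longrightarrow> X \<in> Obj A \<Longrightarrow> el (Yo Y) X = (\<lambda>g. {g}) ` Hom A X Y"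
  unfolding Yo_eq quot_el[OF zero_right_ideal] using cls_zero by (intro image_cong) auto

lemma Yo_res: "u \<in> Hom A X X' \<Longrightarrow> g \<in> Hom A X' Y \<Longrightarrow> res (Yo Y) u {g} = {g \<cdot> u}"
  using quot_res[OF zero_right_ideal, of Y u X X' g] cls_zero[of g X' Y] cls_zero[of "g \<cdot> u" X Y]
  by (simp add: Yo_eq HomD(5) Cmp_Hom)

lemma Yo_mult: "g \<in> Hom A X Y \<Longrightarrow> g' \<in> Hom A X Y \<Longrightarrow> {g} \<otimes>\<^bsub>FO (Yo Y) X\<^esub> {g'} = {Pls A g g'}"
  using quot_mult[OF zero_right_ideal, of Y g X g'] cls_zero[of g X Y] cls_zero[of g' X Y] cls_zero[of "Pls A g g'" X Y]
  by (simp add: Yo_eq HomD(5) Pls_Hom)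

lemma quot_yoneda_Arr:
  assumes N: "right_ideal N Y" and N': "right_ideal N Y'" and a: "a \<in> Hom A Y Y'"
    and left: "\<And>X g. X \<in> Obj A \<Longrightarrow> g \<in> N X Y \<Longrightarrow> a \<cdot> g \<in> N X Y'"
  shows "\<exists>\<phi>. FA (quot_yoneda A N) a = (quot_rep A N Y, \<phi>, quot_rep A N Y') \<and>
    (quot_rep A N Y, \<phi>, quot_rep A N Y') \<in> Arr (psh_cat A) \<and>
    (\<forall>X. \<forall>g \<in> Hom A X Y. cp \<phi> X (cls N X Y g) = cls N X Y' (a \<cdot> g))"
proof -
  let ?Q = "quot_rep A N Y" and ?Q' = "quot_rep A N Y'"
  define h where "h X S = (\<Union>g \<in> S. cls N X Y' (a \<cdot> g))" for X S
  have hc: "h X (cls N X Y g) = cls N X Y' (a \<cdot> g)" if g: "g \<in> Hom A X Y" for X g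
    unfolding h_def
  proof (rule UN_cls[OF N g])
    have X: "X \<in> Obj A" using HomD[OF g] by simp
    fix g' assume g': "g' \<in> cls N X Y g"
    obtain n where n: "n \<in> N X Y" "g' = Pls A n g" using cls_mem[OF N g g'] .
    have "a \<cdot> g' = Pls A (a \<cdot> n) (a \<cdot> g)" using Cmp_Pls_right[OF N_Hom[OF N X n(1)] g a] n(2) by simp
    then show "cls N X Y' (a \<cdot> g') = cls N X Y' (a \<cdot> g)"
      using cls_eq[OF N' Cmp_Hom[OF g a]] cls_Pls[OF N' left[OF X n(1)]] by simp
  qed
  have arr: "(?Q, mk_arr ?Q h ?Q', ?Q') \<in> Arr (psh_cat A)"
  proof (rule mk_arr[OF quot_psh[OF N] quot_psh[OF N']])
    fix X assume X: "X \<in> Obj A"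
    show "h X \<in> hom (FO ?Q X) (FO ?Q' X)"
    proof (rule homI)
      fix S assume "S \<in> el ?Q X"
      then obtain g where "g \<in> Hom A X Y" "S = cls N X Y g" using quot_el[OF N X] by blast
      then show "h X S \<in> el ?Q' X" using hc Cmp_Hom[OF _ a] quot_el[OF N' X] by auto
    next
      fix S S' assume S: "S \<in> el ?Q X" "S' \<in> el ?Q X"
      obtain g g' where g: "g \<in> Hom A X Y" "S = cls N X Y g" "g' \<in> Hom A X Y" "S' = cls N X Y g'"
        using S unfolding quot_el[OF N X] by (elim imageE) simp
      then show "h X (S \<otimes>\<^bsub>FO ?Q X\<^esub> S') = h X S \<otimes>\<^bsub>FO ?Q' X\<^esub> h X S'"
        using quot_mult[OF N g(1,3)] quot_mult[OF N' Cmp_Hom[OF g(1) a] Cmp_Hom[OF g(3) a]]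
          hc[OF g(1)] hc[OF g(3)] hc[OF Pls_Hom[OF g(1,3)]] Cmp_Pls_right[OF g(1,3) a] by simp
    qed
  next
    fix X X' u S assume u: "u \<in> Hom A X X'" and "S \<in> el ?Q X'"
    then obtain g where g: "g \<in> Hom A X' Y" "S = cls N X' Y g" using quot_el[OF N] HomD(5)[OF u] by blast
    have "h X (res ?Q u S) = cls N X Y' (a \<cdot> g \<cdot> u)" using quot_res[OF N u g(1)] hc[OF Cmp_Hom[OF u g(1)]] g(2) by simp
    also have "\<dots> = res ?Q' u (h X' S)" using quot_res[OF N' u Cmp_Hom[OF g(1) a]] hc[OF g(1)] g a u by (simp add: Hom_iff)
    finally show "h X (res ?Q u S) = res ?Q' u (h X' S)" .
  qed
  have "FA (quot_yoneda A N) a = (?Q, mk_arr ?Q h ?Q', ?Q')"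
    using HomD[OF a] by (auto simp: quot_yoneda_def mk_arr_def h_def cls_def restrict_def fun_eq_iff)
  moreover have "cp (mk_arr ?Q h ?Q') X (cls N X Y g) = cls N X Y' (a \<cdot> g)" if g: "g \<in> Hom A X Y" for X g
  proof -
    have X: "X \<in> Obj A" using HomD[OF g] by simp
    then have "cls N X Y g \<in> el ?Q X" using quot_el[OF N X] g by simp
    then show ?thesis using X hc[OF g] by simp
  qed
  ultimately show ?thesis using arr by blast
qed

lemma Ya_Arr:
  assumes a: "a \<in> Hom A Y Y'"
  shows "\<exists>\<phi>. FA (yoneda A) a = (Yo Y, \<phi>, Yo Y') \<and> (Yo Y, \<phi>, Yo Y') \<in> Arr (psh_cat A) \<and>
    (\<forall>X. \<forall>g \<in> Hom A X Y. cp \<phi> X {g} = {a \<cdot> g})"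
proof -
  have Y: "Y \<in> Obj A" "Y' \<in> Obj A" using HomD[OF a] by auto
  have "a \<cdot> g \<in> zero_ideal X Y'" if "X \<in> Obj A" "g \<in> zero_ideal X Y" for X g
    using that a by (simp add: zero_ideal_def Hom_iff)
  from quot_yoneda_Arr[OF zero_right_ideal[OF Y(1)] zero_right_ideal[OF Y(2)] a this]
  obtain \<phi> where \<phi>: "FA (yoneda A) a = (Yo Y, \<phi>, Yo Y')" "(Yo Y, \<phi>, Yo Y') \<in> Arr (psh_cat A)"
    and cp: "\<forall>X. \<forall>g \<in> Hom A X Y. cp \<phi> X (cls zero_ideal X Y g) = cls zero_ideal X Y' (a \<cdot> g)"
    unfolding yoneda_eq[symmetric] Yo_eq[symmetric] by blast
  have "cp \<phi> X {g} = {a \<cdot> g}" if g: "g \<in> Hom A X Y" for X g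
    using cp g cls_zero[OF g] cls_zero[OF Cmp_Hom[OF g a]] by metis
  then show ?thesis using \<phi> by blast
qed

text \<open>The projection from the representable of \<open>Y\<close>, whose elements are singletons.\<close>

definition quot_proj :: "('o \<Rightarrow> 'o \<Rightarrow> 'm set) \<Rightarrow> 'o \<Rightarrow> 'o \<Rightarrow> 'm set ab_arr" where
  "quot_proj N Y = mk_arr (Yo Y) (\<lambda>X S. cls N X Y (the_elem S)) (quot_rep A N Y)"

lemma cp_quot_proj:
  assumes g: "g \<in> Hom A X Y" shows "cp (quot_proj N Y) X {g} = cls N X Y g"
proof -
  have "X \<in> Obj A" "{g} \<in> el (Yo Y) X" using g Yo_el[of Y X] HomD[OF g] by auto
  then show ?thesis by (simp add: quot_proj_def)
qed

lemma quot_proj_Arr: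
  assumes N: "right_ideal N Y"
  shows "(Yo Y, quot_proj N Y, quot_rep A N Y) \<in> Arr (psh_cat A)"
  unfolding quot_proj_def
proof (rule mk_arr[OF Yo_psh quot_psh[OF N]])
  show Y: "Y \<in> Obj A" using N_Obj[OF N] .
  fix X assume X: "X \<in> Obj A"
  show "(\<lambda>S. cls N X Y (the_elem S)) \<in> hom (FO (Yo Y) X) (FO (quot_rep A N Y) X)"
  proof (rule homI)
    fix S assume "S \<in> el (Yo Y) X"
    then obtain g where "g \<in> Hom A X Y" "S = {g}" using Yo_el[OF Y X] by blast
    then show "cls N X Y (the_elem S) \<in> el (quot_rep A N Y) X" using quot_el[OF N X] by simp
  next
    fix S S' assume S: "S \<in> el (Yo Y) X" "S' \<in> el (Yo Y) X"
    obtain g g' where g: "g \<in> Hom A X Y" "S = {g}" "g' \<in> Hom A X Y" "S' = {g'}"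
      using S unfolding Yo_el[OF Y X] by (elim imageE) simp
    then show "cls N X Y (the_elem (S \<otimes>\<^bsub>FO (Yo Y) X\<^esub> S')) =
        cls N X Y (the_elem S) \<otimes>\<^bsub>FO (quot_rep A N Y) X\<^esub> cls N X Y (the_elem S')"
      using Yo_mult[OF g(1,3)] quot_mult[OF N g(1,3)] by simp
  qed
next
  have Y: "Y \<in> Obj A" using N_Obj[OF N] .
  fix X X' u S assume u: "u \<in> Hom A X X'" and "S \<in> el (Yo Y) X'"
  then obtain g where g: "g \<in> Hom A X' Y" "S = {g}" using Yo_el[OF Y HomD(5)[OF u]] by blast
  then show "cls N X Y (the_elem (res (Yo Y) u S)) = res (quot_rep A N Y) u (cls N X' Y (the_elem S))"
    using Yo_res[OF u g(1)] quot_res[OF N u g(1)] by simp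
qed

lemma quot_objectwise_cokernel:
  assumes pr: "principal N B f Y"
  shows "\<exists>\<phi>. FA (yoneda A) f = (Yo B, \<phi>, Yo Y) \<and>
    objectwise_cokernel (Yo B) \<phi> (Yo Y) (quot_proj N Y) (quot_rep A N Y)"
proof -
  note f = principalD(1)[OF pr] and N = principalD(2)[OF pr]
  have BY: "B \<in> Obj A" "Y \<in> Obj A" using HomD[OF f] by auto
  have ri: "right_ideal N Y" using principal_right_ideal[OF pr] .
  obtain \<phi> where \<phi>: "FA (yoneda A) f = (Yo B, \<phi>, Yo Y)" "(Yo B, \<phi>, Yo Y) \<in> Arr (psh_cat A)"
    "\<And>X g. g \<in> Hom A X B \<Longrightarrow> cp \<phi> X {g} = {f \<cdot> g}" using Ya_Arr[OF f] by blast
  have "cp \<phi> X ` el (Yo B) X = kernel (FO (Yo Y) X) (FO (quot_rep A N Y) X) (cp (quot_proj N Y) X)"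
    if X: "X \<in> Obj A" for X
  proof -
    have "cp \<phi> X ` el (Yo B) X = (\<lambda>g. {f \<cdot> g}) ` Hom A X B"
      unfolding Yo_el[OF BY(1) X] image_image using \<phi>(3) by (intro image_cong) auto
    also have "\<dots> = (\<lambda>g. {g}) ` N X Y" unfolding N[OF X] by (simp add: image_image)
    also have "\<dots> = {S \<in> (\<lambda>g. {g}) ` Hom A X Y. cp (quot_proj N Y) X S = N X Y}"
    proof -
      have "cp (quot_proj N Y) X {g} = N X Y \<longleftrightarrow> g \<in> N X Y" if "g \<in> Hom A X Y" for g
        using cp_quot_proj[OF that] cls_eq_one[OF ri that] by simp
      then show ?thesis using N_Hom[OF ri X] by auto
    qed
    finally show ?thesis unfolding kernel_def Yo_el[OF BY(2) X] quot_one[OF ri X] .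
  qed
  moreover have "cp (quot_proj N Y) X ` el (Yo Y) X = el (quot_rep A N Y) X" if X: "X \<in> Obj A" for X
    unfolding Yo_el[OF BY(2) X] quot_el[OF ri X] image_image using cp_quot_proj by (intro image_cong) auto
  ultimately show ?thesis
    using \<phi> quot_proj_Arr[OF ri] by (simp add: objectwise_cokernel_def)
qed

lemma finitely_presented_iff:
  "finitely_presented A F \<longleftrightarrow> F \<in> Obj (psh_cat A) \<and>
    (\<exists>B \<in> Obj A. \<exists>X \<in> Obj A. \<exists>\<phi> \<psi>. objectwise_cokernel (Yo B) \<phi> (Yo X) \<psi> F)"
  unfolding finitely_presented_def objectwise_cokernel_def by blast

lemma quot_finitely_presented:
  assumes pr: "principal N B f Y"
  shows "finitely_presented A (quot_rep A N Y)"
  unfolding finitely_presented_iff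
  using quot_objectwise_cokernel[OF pr] quot_psh[OF principal_right_ideal[OF pr]] HomD(4,5)[OF principalD(1)[OF pr]]
  by blast

lemma Yo_fp: "Y \<in> Obj A \<Longrightarrow> finitely_presented A (Yo Y)"
  unfolding Yo_eq using has_zero zero_principal quot_finitely_presented by blast

text \<open>By the Yoneda lemma an arrow from \<open>Yo U\<close> is determined by the image of the identity of \<open>U\<close>; a preimage of it in
  \<open>Yo V\<close> is an arrow \<open>c\<close>.\<close>

lemma yoneda_lift:
  assumes \<psi>: "(Yo V, \<psi>, F) \<in> Arr (psh_cat A)" and onto: "cp \<psi> U ` el (Yo V) U = el F U"
    and \<alpha>: "(Yo U, \<alpha>, F) \<in> Arr (psh_cat A)" and UV: "U \<in> Obj A" "V \<in> Obj A"
  obtains c where "c \<in> Hom A U V" "Cmp (psh_cat A) (Yo V, \<psi>, F) (FA (yoneda A) c) = (Yo U, \<alpha>, F)"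
proof -
  have id: "{Idn A U} \<in> el (Yo U) U" using Yo_el[OF UV(1) UV(1)] Idn_Hom[OF UV(1)] by blast
  then have "cp \<alpha> U {Idn A U} \<in> cp \<psi> U ` el (Yo V) U" using cp_closed[OF \<alpha> UV(1)] onto by blast
  then obtain c where c: "c \<in> Hom A U V" "cp \<alpha> U {Idn A U} = cp \<psi> U {c}" using Yo_el[OF UV(2,1)] by auto
  obtain \<phi> where \<phi>: "FA (yoneda A) c = (Yo U, \<phi>, Yo V)" "(Yo U, \<phi>, Yo V) \<in> Arr (psh_cat A)"
    "\<And>X g. g \<in> Hom A X U \<Longrightarrow> cp \<phi> X {g} = {c \<cdot> g}" using Ya_Arr[OF c(1)] by blast
  have "cp \<psi> X (cp \<phi> X S) = cp \<alpha> X S" if X: "X \<in> Obj A" and S: "S \<in> el (Yo U) X" for X S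
  proof -
    obtain g where g: "g \<in> Hom A X U" "S = {g}" using S Yo_el[OF UV(1) X] by blast
    have cU: "{c} \<in> el (Yo V) U" using Yo_el[OF UV(2,1)] c(1) by blast
    have "cp \<psi> X (cp \<phi> X S) = cp \<psi> X (res (Yo V) g {c})" using \<phi>(3)[OF g(1)] Yo_res[OF g(1) c(1)] g(2) by simp
    also have "\<dots> = res F g (cp \<alpha> U {Idn A U})" using cp_res[OF \<psi> g(1) cU] c(2) by simp
    also have "\<dots> = cp \<alpha> X (res (Yo U) g {Idn A U})" using cp_res[OF \<alpha> g(1) id] by simp
    also have "\<dots> = cp \<alpha> X S" using Yo_res[OF g(1) Idn_Hom[OF UV(1)]] g by (simp add: Hom_iff)
    finally show ?thesis .
  qed
  then show ?thesis using that[OF c(1)] psh_Cmp_iff[OF \<phi>(2) \<psi> \<alpha>] \<phi>(1) by simp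
qed

lemma quot_cokernel:
  assumes pr: "principal N B f Y"
  shows "is_cokernel (fp_cat A) (FA (yoneda A) f) (quot_rep A N Y) (Yo Y, quot_proj N Y, quot_rep A N Y)"
  using quot_objectwise_cokernel[OF pr] objectwise_cokernel[OF _ Yo_fp Yo_fp quot_finitely_presented[OF pr]]
    HomD(4,5)[OF principalD(1)[OF pr]] by auto

text \<open>The only point that is not immediate is that \<open>Yo U\<close> is projective, since epimorphisms of finitely presented presheaves
  are not surjective by definition. An epimorphism \<open>e: F \<rightarrow> G\<close> yields a presentation of \<open>G\<close> whose generator maps to \<open>G\<close>
  through \<open>F\<close>, and \<open>G\<close> is isomorphic to the objectwise cokernel of this presentation, to which the Yoneda lemma
  applies.\<close>

lemma representables_fp:
  assumes fp: "abelian (fp_cat A)" and add: "additive_functor A (fp_cat A) (yoneda A)"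
    and ff: "fully_faithful A (fp_cat A) (yoneda A)"
  shows "representables A (fp_cat A) (yoneda A)"
proof -
  interpret C: abelian "fp_cat A" by fact
  let ?Y = "FA (yoneda A)"
  have Y: "is_functor A (fp_cat A) (yoneda A)" using add by (simp add: additive_functor_def)
  note Y_Hom = functor_Hom[OF Y]
  have pres: "\<exists>f \<in> Arr A. \<exists>q. is_cokernel (fp_cat A) (?Y f) F q" if "F \<in> Obj (fp_cat A)" for F
  proof -
    have F: "finitely_presented A F" using that by (simp add: fp_Obj)
    then obtain B X \<phi> \<psi> where BX: "B \<in> Obj A" "X \<in> Obj A" and cok: "objectwise_cokernel (Yo B) \<phi> (Yo X) \<psi> F"
      unfolding finitely_presented_iff by blast
    have "(Yo B, \<phi>, Yo X) \<in> Hom (fp_cat A) (Yo B) (Yo X)"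
      using cok BX by (simp add: fp_Hom Yo_fp psh_Hom objectwise_cokernel_def)
    then have "(Yo B, \<phi>, Yo X) \<in> ?Y ` Hom A B X"
      using ff BX unfolding fully_faithful_def bij_betw_def by blast
    then obtain f where f: "f \<in> Hom A B X" "?Y f = (Yo B, \<phi>, Yo X)" by force
    have "f \<in> Arr A" using HomD[OF f(1)] by simp
    moreover have "is_cokernel (fp_cat A) (?Y f) F (Yo X, \<psi>, F)"
      using objectwise_cokernel[OF cok Yo_fp[OF BX(1)] Yo_fp[OF BX(2)] F] f(2) by simp
    ultimately show ?thesis by blast
  qed
  have "projective (fp_cat A) (Yo U)" if U: "U \<in> Obj A" for U
    unfolding projective_def
  proof (intro conjI allI impI ballI)
    show "Yo U \<in> Obj (fp_cat A)" using functor_Obj[OF Y U] .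
    fix e a assume e: "epi_arr (fp_cat A) e" and a: "a \<in> Hom (fp_cat A) (Yo U) (Cod (fp_cat A) e)"
    define F G where "F = Dom (fp_cat A) e" and "G = Cod (fp_cat A) e"
    have eH: "e \<in> Hom (fp_cat A) F G" using e C.Arr_Hom by (simp add: F_def G_def epi_arr_def)
    have aH: "a \<in> Hom (fp_cat A) (Yo U) G" using a by (simp add: G_def)
    have FG: "F \<in> Obj (fp_cat A)" "G \<in> Obj (fp_cat A)" using C.HomD[OF eH] by auto
    obtain f0 q where f0: "f0 \<in> Arr A" "is_cokernel (fp_cat A) (?Y f0) F q" using pres[OF FG(1)] by blast
    define V where "V = Cod A f0"
    have V: "V \<in> Obj A" using Cod_Obj[OF f0(1)] by (simp add: V_def)
    have q: "q \<in> Hom (fp_cat A) (Yo V) F" "epi_arr (fp_cat A) q"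
      using C.is_cokernelD[OF f0(2) Y_Hom[OF Arr_Hom[OF f0(1)]]] by (auto simp: V_def)
    have eq: "Cmp (fp_cat A) e q \<in> Hom (fp_cat A) (Yo V) G" "epi_arr (fp_cat A) (Cmp (fp_cat A) e q)"
      using C.Cmp_Hom[OF q(1) eH] C.epi_Cmp[OF q(2) e q(1) eH] .
    obtain K k where k: "is_kernel (fp_cat A) (Cmp (fp_cat A) e q) K k" using C.obtain_kernel[OF eq(1)] .
    note kD = C.is_kernelD[OF k eq(1)]
    obtain f1 q1 where f1: "f1 \<in> Arr A" "is_cokernel (fp_cat A) (?Y f1) K q1" using pres C.HomD(4)[OF kD(1)] by blast
    define B where "B = Cod A f1"
    have B: "B \<in> Obj A" using Cod_Obj[OF f1(1)] by (simp add: B_def)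
    have q1: "q1 \<in> Hom (fp_cat A) (Yo B) K" "epi_arr (fp_cat A) q1"
      using C.is_cokernelD[OF f1(2) Y_Hom[OF Arr_Hom[OF f1(1)]]] by (auto simp: B_def)
    have "Cmp (fp_cat A) k q1 \<in> ?Y ` Hom A B V"
      using C.Cmp_Hom[OF q1(1) kD(1)] ff B V unfolding fully_faithful_def bij_betw_def by blast
    then obtain f where f: "f \<in> Hom A B V" "?Y f = Cmp (fp_cat A) k q1" by force
    have cok: "is_cokernel (fp_cat A) (?Y f) G (Cmp (fp_cat A) e q)"
      using C.is_cokernel_Cmp_epi[OF C.epi_is_cokernel_of_kernel[OF eq(2,1) k] kD(1) q1(2,1)] f(2) by simp
    \<comment> \<open>\<open>Q\<close> is the objectwise cokernel of the same arrow \<open>f\<close>.\<close>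
    define N where "N X (Y' :: 'o) = (\<lambda>h. f \<cdot> h) ` Hom A X B" for X Y'
    have pr: "principal N B f V" using f(1) by (simp add: principal_def N_def)
    define Q where "Q = quot_rep A N V"
    define \<psi> where "\<psi> = (Yo V, quot_proj N V, Q)"
    have cok': "is_cokernel (fp_cat A) (?Y f) Q \<psi>"
      using quot_cokernel[OF pr] by (simp add: Q_def \<psi>_def)
    note Yf = Y_Hom[OF f(1)]
    note D = C.is_cokernelD[OF cok Yf] and D' = C.is_cokernelD[OF cok' Yf]
    obtain i where i: "i \<in> Hom (fp_cat A) G Q" "Cmp (fp_cat A) i (Cmp (fp_cat A) e q) = \<psi>"
      using C.is_cokernel_desc[OF cok Yf D'(1,2)] .
    obtain j where j: "j \<in> Hom (fp_cat A) Q G" "Cmp (fp_cat A) j \<psi> = Cmp (fp_cat A) e q"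
      using C.is_cokernel_desc[OF cok' Yf D(1,2)] .
    have "Cmp (fp_cat A) (Cmp (fp_cat A) j i) (Cmp (fp_cat A) e q) = Cmp (fp_cat A) (Idn (fp_cat A) G) (Cmp (fp_cat A) e q)"
      using C.Cmp_assoc[OF D(1) i(1) j(1)] i(2) j(2) C.Idn_Cmp[OF D(1)] by metis
    then have ji: "Cmp (fp_cat A) j i = Idn (fp_cat A) G"
      using C.epi_arrD[OF eq(2,1) C.Cmp_Hom[OF i(1) j(1)] C.Idn_Hom[OF FG(2)]] by blast
    have Qfp: "finitely_presented A Q" using C.HomD(5)[OF i(1)] by (simp add: fp_Obj)
    obtain \<phi> where "objectwise_cokernel (Yo B) \<phi> (Yo V) (quot_proj N V) Q"
      using quot_objectwise_cokernel[OF pr] unfolding Q_def by blast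
    then have \<psi>: "(Yo V, quot_proj N V, Q) \<in> Arr (psh_cat A)" and onto: "cp (quot_proj N V) U ` el (Yo V) U = el Q U"
      using U by (auto simp: objectwise_cokernel_def)
    note ia = C.Cmp_Hom[OF aH i(1)]
    obtain \<alpha> where \<alpha>: "Cmp (fp_cat A) i a = (Yo U, \<alpha>, Q)" "(Yo U, \<alpha>, Q) \<in> Arr (psh_cat A)"
      using ia fp_Hom[OF Yo_fp[OF U] Qfp] psh_Hom by blast
    obtain c where c: "c \<in> Hom A U V" "Cmp (fp_cat A) \<psi> (?Y c) = Cmp (fp_cat A) i a"
      using yoneda_lift[OF \<psi> onto \<alpha>(2) U V] \<alpha>(1) unfolding \<psi>_def fp_simps by metis
    note Yc = Y_Hom[OF c(1)]
    have "Cmp (fp_cat A) e (Cmp (fp_cat A) q (?Y c)) = Cmp (fp_cat A) (Cmp (fp_cat A) j \<psi>) (?Y c)"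
      using C.Cmp_assoc[OF Yc q(1) eH] j(2) by simp
    also have "\<dots> = Cmp (fp_cat A) j (Cmp (fp_cat A) i a)" using C.Cmp_assoc[OF Yc D'(1) j(1)] c(2) by simp
    also have "\<dots> = a" using C.Cmp_assoc[OF aH i(1) j(1)] ji C.Idn_Cmp[OF aH] by simp
    finally show "\<exists>u\<in>Hom (fp_cat A) (Yo U) (Dom (fp_cat A) e). Cmp (fp_cat A) e u = a"
      using C.Cmp_Hom[OF Yc q(1)] by (auto simp: F_def)
  qed
  then show ?thesis
    using abelian_axioms fp add ff pres by (simp add: representables_def representables_axioms_def)
qed

section \<open>The stable Yoneda functor\<close>

text \<open>Arrows from a projective object to \<open>Y\<close> lift along the epimorphism \<open>e\<close>.\<close>

lemma proj_factoring_principal: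
  assumes P: "projective A P" and e: "e \<in> Hom A P Y" "epi_arr A e"
  shows "principal (proj_factoring A) P e Y"
  unfolding principal_def
proof (intro conjI ballI equalityI subsetI)
  show "e \<in> Hom A P Y" by fact
  fix X x assume "x \<in> proj_factoring A X Y"
  then obtain Q g h where Q: "projective A Q" and g: "g \<in> Hom A X Q" and h: "h \<in> Hom A Q Y" and x: "x = h \<cdot> g"
    unfolding proj_factoring_def by blast
  obtain h' where h': "h' \<in> Hom A Q P" "e \<cdot> h' = h" using projectiveD[OF Q e(2,1) h] .
  have "x = e \<cdot> h' \<cdot> g" using Cmp_push[OF h'(2,1) e(1) g] x by simp
  then show "x \<in> (\<lambda>h. e \<cdot> h) ` Hom A X P" using Cmp_Hom[OF g h'(1)] by blast
qed (use P e in \<open>auto simp: proj_factoring_def\<close>)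

abbreviation "T \<equiv> stable_yoneda A"
abbreviation "I \<equiv> proj_factoring A"

definition stable_proj :: "'o \<Rightarrow> ('o, 'm) psh_arr" where
  "stable_proj X = (Yo X, quot_proj I X, FO T X)"

lemma T_FO: "FO T X = quot_rep A I X"
  by (simp add: stable_yoneda_def quot_yoneda_def)

lemma stable_proj_cokernel:
  assumes P: "projective A P" and e: "e \<in> Hom A P X" "epi_arr A e"
  shows "is_cokernel (fp_cat A) (FA (yoneda A) e) (FO T X) (stable_proj X)"
  unfolding T_FO stable_proj_def using quot_cokernel[OF proj_factoring_principal[OF P e]] .

context
  assumes enough: "enough_projectives A"
begin

lemma I_right_ideal: assumes "X \<in> Obj A" shows "right_ideal I X" and "finitely_presented A (FO T X)"
proof -
  obtain P e where P: "projective A P" and e: "e \<in> Hom A P X" "epi_arr A e"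
    using enough assms by (auto simp: enough_projectives_def)
  note pr = proj_factoring_principal[OF P e]
  show "right_ideal I X" using principal_right_ideal[OF pr] .
  show "finitely_presented A (FO T X)" unfolding T_FO using quot_finitely_presented[OF pr] .
qed

lemma stable_proj_Hom: assumes X: "X \<in> Obj A" shows "stable_proj X \<in> Hom (fp_cat A) (Yo X) (FO T X)"
  unfolding fp_Hom[OF Yo_fp[OF X] I_right_ideal(2)[OF X]] psh_Hom stable_proj_def
  using quot_proj_Arr[OF I_right_ideal(1)[OF X]] by (simp add: T_FO)

lemma T_Arr:
  assumes a: "a \<in> Hom A X X'"
  shows "\<exists>\<phi>. FA T a = (FO T X, \<phi>, FO T X') \<and> (FO T X, \<phi>, FO T X') \<in> Arr (psh_cat A) \<and>
    (\<forall>U. \<forall>g \<in> Hom A U X. cp \<phi> U (cls I U X g) = cls I U X' (a \<cdot> g))"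
proof -
  have X: "X \<in> Obj A" "X' \<in> Obj A" using HomD[OF a] by auto
  have "a \<cdot> g \<in> I U X'" if "U \<in> Obj A" and gI: "g \<in> I U X" for U g
  proof -
    obtain P h y where P: "projective A P" and h: "h \<in> Hom A U P" and y: "y \<in> Hom A P X" and g: "g = y \<cdot> h"
      using gI unfolding proj_factoring_def by blast
    have "a \<cdot> g = (a \<cdot> y) \<cdot> h" using a h y g by (simp add: Hom_iff)
    then show ?thesis unfolding proj_factoring_def using P h Cmp_Hom[OF y a] by blast
  qed
  from quot_yoneda_Arr[OF I_right_ideal(1)[OF X(1)] I_right_ideal(1)[OF X(2)] a this]
  show ?thesis unfolding T_FO unfolding stable_yoneda_def .
qed

lemma T_Hom:
  assumes a: "a \<in> Hom A X X'" shows "FA T a \<in> Hom (fp_cat A) (FO T X) (FO T X')"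
proof -
  have X: "X \<in> Obj A" "X' \<in> Obj A" using HomD[OF a] by auto
  show ?thesis
    unfolding fp_Hom[OF I_right_ideal(2)[OF X(1)] I_right_ideal(2)[OF X(2)]] psh_Hom using T_Arr[OF a] by blast
qed

lemma stable_proj_nat:
  assumes fp: "category (fp_cat A)" and a: "a \<in> Hom A X X'"
  shows "Cmp (fp_cat A) (FA T a) (stable_proj X) = Cmp (fp_cat A) (stable_proj X') (FA (yoneda A) a)"
proof -
  interpret C: category "fp_cat A" by fact
  have X: "X \<in> Obj A" "X' \<in> Obj A" using HomD[OF a] by auto
  obtain \<tau> where \<tau>: "FA T a = (FO T X, \<tau>, FO T X')" "(FO T X, \<tau>, FO T X') \<in> Arr (psh_cat A)"
    "\<And>U g. g \<in> Hom A U X \<Longrightarrow> cp \<tau> U (cls I U X g) = cls I U X' (a \<cdot> g)" using T_Arr[OF a] by blast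
  obtain \<phi> where \<phi>: "FA (yoneda A) a = (Yo X, \<phi>, Yo X')" "(Yo X, \<phi>, Yo X') \<in> Arr (psh_cat A)"
    "\<And>U g. g \<in> Hom A U X \<Longrightarrow> cp \<phi> U {g} = {a \<cdot> g}" using Ya_Arr[OF a] by blast
  obtain \<chi> where \<chi>: "Cmp (fp_cat A) (stable_proj X') (FA (yoneda A) a) = (Yo X, \<chi>, FO T X')" "(Yo X, \<chi>, FO T X') \<in> Arr (psh_cat A)"
  proof -
    have "FA (yoneda A) a \<in> Hom (fp_cat A) (Yo X) (Yo X')"
      unfolding fp_Hom[OF Yo_fp[OF X(1)] Yo_fp[OF X(2)]] psh_Hom using \<phi> by blast
    from C.Cmp_Hom[OF this stable_proj_Hom[OF X(2)]] show ?thesis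
      unfolding fp_Hom[OF Yo_fp[OF X(1)] I_right_ideal(2)[OF X(2)]] psh_Hom using that by blast
  qed
  have pX: "(Yo X, quot_proj I X, FO T X) \<in> Arr (psh_cat A)" and pX': "(Yo X', quot_proj I X', FO T X') \<in> Arr (psh_cat A)"
    using quot_proj_Arr[OF I_right_ideal(1)] X by (simp_all add: T_FO)
  have "cp \<tau> U (cp (quot_proj I X) U S) = cp (quot_proj I X') U (cp \<phi> U S)" if U: "U \<in> Obj A" and S: "S \<in> el (Yo X) U" for U S
  proof -
    obtain g where g: "g \<in> Hom A U X" "S = {g}" using S Yo_el[OF X(1) U] by blast
    then show ?thesis using cp_quot_proj[OF g(1)] cp_quot_proj[OF Cmp_Hom[OF g(1) a]] \<phi>(3)[OF g(1)] \<tau>(3)[OF g(1)] by simp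
  qed
  moreover have "\<forall>U \<in> Obj A. \<forall>S \<in> el (Yo X) U. cp (quot_proj I X') U (cp \<phi> U S) = cp \<chi> U S"
    using \<chi>(1) psh_Cmp_iff[OF \<phi>(2) pX' \<chi>(2)] unfolding stable_proj_def \<phi>(1) fp_simps by blast
  ultimately have "Cmp (psh_cat A) (FO T X, \<tau>, FO T X') (Yo X, quot_proj I X, FO T X) = (Yo X, \<chi>, FO T X')"
    using psh_Cmp_iff[OF pX \<tau>(2) \<chi>(2)] by simp
  then show ?thesis unfolding \<chi>(1) \<tau>(1) by (simp add: stable_proj_def)
qed

end

end

section \<open>Heredity in terms of the defect recollement\<close>

text \<open>The frame of the abstract argument: the units come from the adjunctions of the recollement, and \<open>representables_fp\<close> and
  the projection \<open>stable_proj\<close> provide the properties of finitely presented presheaves.\<close>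

lemma defect_of_recollement:
  assumes A: "abelian A" and enough: "enough_projectives A" and R: "defect_recollement A R"
  shows "\<exists>\<eta> \<theta> r s. defect A (fp_cat A) (yoneda A) (j_upper R) (j_lshriek R) (i_upper R) (i_ushriek R)
    (stable_yoneda A) (sub R) \<eta> \<theta> r s (presheaf.stable_proj A)"
proof -
  interpret presheaf A using A by (simp add: presheaf_def)
  have rec: "recollement R" and Q: "quo R = A" "mid R = fp_cat A" "i_lower R = id_functor" "j_lower R = yoneda A"
    and sub: "sub R = full_sub (fp_cat A) {F. is_zero A (FO (j_upper R) F)}"
    using R by (auto simp: defect_recollement_def)
  have ab: "abelian (sub R)" "abelian (fp_cat A)" and add: "additive_functor A (fp_cat A) (yoneda A)"
    and ff: "fully_faithful A (fp_cat A) (yoneda A)" "fully_faithful A (fp_cat A) (j_lshriek R)"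
    and adj: "left_adjoint (fp_cat A) A (j_upper R) (yoneda A)" "left_adjoint A (fp_cat A) (j_lshriek R) (j_upper R)"
      "left_adjoint (fp_cat A) (sub R) (i_upper R) id_functor" "left_adjoint (sub R) (fp_cat A) id_functor (i_ushriek R)"
    using rec by (auto simp: recollement_def Q)
  have l: "right_exact A (fp_cat A) (j_lshriek R)"
    "nat_isomorphic (full_sub A {P. projective A P}) (fp_cat A) (j_lshriek R) (yoneda A)"
    using R by (auto simp: defect_recollement_def Q)
  have cat: "category A" "category (fp_cat A)" "category (sub R)"
    using A ab by (auto simp: abelian_def preadditive_def)
  obtain \<eta> where \<eta>: "is_unit (fp_cat A) A (j_upper R) (yoneda A) \<eta>" using left_adjoint_unit[OF adj(1) cat(2,1)] by blast
  obtain \<theta> where \<theta>: "is_unit A (fp_cat A) (j_lshriek R) (j_upper R) \<theta>" using left_adjoint_unit[OF adj(2) cat(1,2)] by blast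
  obtain r where r: "is_unit (fp_cat A) (sub R) (i_upper R) id_functor r" using left_adjoint_unit[OF adj(3) cat(2,3)] by blast
  obtain s where s: "is_counit (sub R) (fp_cat A) id_functor (i_ushriek R) s"
    using left_adjoint_counit[OF adj(4) cat(3,2)] by blast
  have "defect A (fp_cat A) (yoneda A) (j_upper R) (j_lshriek R) (i_upper R) (i_ushriek R)
    (stable_yoneda A) (sub R) \<eta> \<theta> r s stable_proj"
    unfolding defect_def defect_axioms_def
    using representables_fp[OF ab(2) add ff(1)] sub enough ab(1) adj \<eta> \<theta> r s l ff(2)
      T_Hom[OF enough] stable_proj_Hom[OF enough] stable_proj_nat[OF enough cat(2)] stable_proj_cokernel
    by (auto simp: left_adjoint_def)
  then show ?thesis by blast
qed

theorem theorem2p9: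
  fixes A :: "('o, 'm) cat"
    and R :: "(('o, 'm) psh, ('o, 'm) psh_arr, ('o, 'm) psh, ('o, 'm) psh_arr, 'o, 'm) recoll"
  assumes "abelian A"
    and "enough_projectives A"
    and "defect_recollement A R"
  shows "(pre_hereditary R \<longleftrightarrow> mv_instance R) \<and>
         (mv_instance R \<longleftrightarrow> hereditary A) \<and>
         (mv_instance_over TYPE(('p1, 'n1) cat) TYPE(('p2, 'n2) cat) R \<longrightarrow> mv_instance R) \<and>
         (mv_instance R \<longrightarrow>
            is_mv_for R (sub R) A (zero_functor (sub R)) (stable_yoneda A)
              (zero_trans (sub R) (stable_yoneda A)))"
proof -
  obtain \<eta> \<theta> r s where "defect A (fp_cat A) (yoneda A) (j_upper R) (j_lshriek R) (i_upper R) (i_ushriek R)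
    (stable_yoneda A) (sub R) \<eta> \<theta> r s (presheaf.stable_proj A)"
    using defect_of_recollement[OF assms] by blast
  then interpret defect A "fp_cat A" "yoneda A" "j_upper R" "j_lshriek R" "i_upper R" "i_ushriek R"
    "stable_yoneda A" "sub R" \<eta> \<theta> r s "presheaf.stable_proj A" .
  have Q: "quo R = A" "mid R = fp_cat A" "i_lower R = id_functor" "j_lower R = yoneda A"
    using assms(3) by (auto simp: defect_recollement_def)
  have pre: "pre_hereditary R \<longleftrightarrow> hereditary A"
    using derived_vanish_iff_hereditary enough_projectives_C enough_projectives_D enough
    by (simp add: pre_hereditary_def Q)
  have mv: "is_mv_for R (sub R) A (zero_functor (sub R)) (stable_yoneda A) (zero_trans (sub R) (stable_yoneda A))"
    if "hereditary A"
    using hereditary_mv[OF that, of R] Q by simp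
  then have inst: "mv_instance R" if "hereditary A"
    using that unfolding mv_instance_def mv_instance_over_def by blast
  have over: "hereditary A" if "mv_instance_over TYPE(('q1, 'l1) cat) TYPE(('q2, 'l2) cat) R"
    using that mv_hereditary[of R] Q unfolding mv_instance_over_def by auto
  have "hereditary A" if "mv_instance R" using over that unfolding mv_instance_def .
  then show ?thesis using pre mv inst over by blast
qed

end
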